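(* Let $\mathscr{R}$ be a $\mathbb{Z}_p$-algebra such that every finitely generated and $p$-torsion free $\mathscr{R}$-module is projective, and let $\mathfrak{M}$ be an object of $\mathrm{Mod}^{\varphi}_{/\mathfrak{S}_{\mathscr{R}}}$. Then $\mathfrak{M}$ is projective as an $(\mathscr{R}\otimes_{\mathbb{Z}_p}W(\kappa))[\![u]\!]$-module.
   Context: Fix a prime $p$, a finite extension $K$ of $\mathbb{Q}_p$ with ring of integers $\mathscr{O}_K$, uniformizer $\pi$ and residue field $\kappa$. Let $W(\kappa)$ be the ring of Witt vectors of $\kappa$, $E(u)$ the minimal (Eisenstein) polynomial of $\pi$ over $W(\kappa)$, $\mathfrak{S}:=W(\kappa)[\![u]\!]$, and $\varphi_{\mathfrak{S}}:\mathfrak{S}\to\mathfrak{S}$ the ring endomorphism extending the Frobenius on $W(\kappa)$ with $\varphi_{\mathfrak{S}}(u)=u^p$. A Breuil-Kisin module of height $h$ (a positive integer) is a finitely generated free $\mathfrak{S}$-module $\mathfrak{M}$ with a $\varphi_{\mathfrak{S}}$-semilinear endomorphism $\varphi_{\mathfrak{M}}:\mathfrak{M}\to\mathfrak{M}$ such that $E(u)^h$ kills the cokernel of the linearization $1\otimes\varphi_{\mathfrak{M}}:\varphi_{\mathfrak{S}}^{*}(\mathfrak{M}):=\mathfrak{S}\otimes_{\varphi_{\mathfrak{S}},\mathfrak{S}}\mathfrak{M}\to\mathfrak{M}$ (in particular $\varphi_{\mathfrak{M}}$ is injective). The category of such modules is $\mathrm{Mod}^{\varphi}_{/\mathfrak{S}}$.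 For a (commutative) $\mathbb{Z}_p$-algebra $\mathscr{R}$, put $\mathfrak{S}_{\mathscr{R}}:=(\mathscr{R}\otimes_{\mathbb{Z}_p}W(\kappa))[\![u]\!]$. $\mathrm{Mod}^{\varphi}_{/\mathfrak{S}_{\mathscr{R}}}$ is the category of objects of $\mathrm{Mod}^{\varphi}_{/\mathfrak{S}}$ equipped with an $\mathscr{R}$-action (compatible with $\varphi_{\mathfrak{M}}$), so that each such $\mathfrak{M}$ is an $\mathfrak{S}_{\mathscr{R}}$-module. *)

theory Defs
  imports "HOL-Algebra.Free_Abelian_Groups" "HOL-Algebra.Finite_Extensions"
    "HOL-Computational_Algebra.Primes"
begin

section \<open>Modules, projectivity, tensor products, power series\<close>

text \<open>The additive group (and ring data) of \<open>A\<close> with a new scalar multiplication. This is used for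
  modules carrying several actions and for restriction of scalars.\<close>

definition with_smult :: "('m, 'x) ring_scheme \<Rightarrow> ('a \<Rightarrow> 'm \<Rightarrow> 'm) \<Rightarrow> ('a, 'm) module" where
  "with_smult A act = \<lparr>carrier = carrier A, monoid.mult = monoid.mult A, one = one A, ring.zero = ring.zero A,
     ring.add = ring.add A, smult = act\<rparr>"

definition linear_maps ::
  "('a, 'x) ring_scheme \<Rightarrow> ('a, 'm, 'y) module_scheme \<Rightarrow> ('a, 'n, 'z) module_scheme \<Rightarrow> ('m \<Rightarrow> 'n) set" where
  "linear_maps R M N = {f \<in> carrier M \<rightarrow> carrier N.
     (\<forall>x\<in>carrier M. \<forall>y\<in>carrier M. f (x \<oplus>\<^bsub>M\<^esub> y) = f x \<oplus>\<^bsub>N\<^esub> f y) \<and>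
     (\<forall>a\<in>carrier R. \<forall>x\<in>carrier M. f (a \<odot>\<^bsub>M\<^esub> x) = a \<odot>\<^bsub>N\<^esub> f x)}"

text \<open>Every finitely generated module over \<open>R\<close>, with elements of type \<open>'r\<close>, is isomorphic to a
  quotient of some \<open>R\<^sup>n\<close>, hence to one with carrier in the type \<open>(nat \<Rightarrow> 'r) set\<close> (cosets of
  finite tuples). Quantifying over module structures on that type therefore covers all of them.\<close>

definition finitely_generated :: "('a, 'x) ring_scheme \<Rightarrow> ('a, 'm) module \<Rightarrow> bool" where
  "finitely_generated R M \<longleftrightarrow> (\<exists>B. finite B \<and> B \<subseteq> carrier M \<and>
     (\<forall>H. submodule H R M \<and> B \<subseteq> H \<longrightarrow> H = carrier M))"

definition finite_free :: "('a, 'x) ring_scheme \<Rightarrow> ('a, 'm) module \<Rightarrow> bool" where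
  "finite_free R M \<longleftrightarrow> (\<exists>B. finite B \<and> B \<subseteq> carrier M \<and>
     (\<forall>x\<in>carrier M. \<exists>!c. c \<in> B \<rightarrow>\<^sub>E carrier R \<and> x = (\<Oplus>\<^bsub>M\<^esub>b\<in>B. c b \<odot>\<^bsub>M\<^esub> b)))"

definition torsion_free_wrt :: "nat \<Rightarrow> ('m, 'x) ring_scheme \<Rightarrow> bool" where
  "torsion_free_wrt p M \<longleftrightarrow> (\<forall>x\<in>carrier M. [p] \<cdot>\<^bsub>M\<^esub> x = \<zero>\<^bsub>M\<^esub> \<longrightarrow> x = \<zero>\<^bsub>M\<^esub>)"

text \<open>The free module on a set \<open>I\<close>: finitely supported functions. A module is only an additive
  group with scalars, so the fields \<open>mult\<close> and \<open>one\<close> of the record are irrelevant.\<close>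

definition free_module :: "('a, 'x) ring_scheme \<Rightarrow> 'i set \<Rightarrow> ('a, 'i \<Rightarrow> 'a) module" where
  "free_module R I = \<lparr>
     carrier = {f \<in> I \<rightarrow>\<^sub>E carrier R. finite {i \<in> I. f i \<noteq> \<zero>\<^bsub>R\<^esub>}},
     monoid.mult = undefined, one = undefined,
     ring.zero = (\<lambda>i\<in>I. \<zero>\<^bsub>R\<^esub>),
     ring.add = (\<lambda>f g. \<lambda>i\<in>I. f i \<oplus>\<^bsub>R\<^esub> g i),
     smult = (\<lambda>a f. \<lambda>i\<in>I. a \<otimes>\<^bsub>R\<^esub> f i)\<rparr>"

text \<open>Projective means direct summand of a free module. It is no restriction to take the index set
  in the type of the elements of the module: a projective module is a direct summand of the free
  module on its own carrier.\<close>

definition projective_module :: "('a, 'x) ring_scheme \<Rightarrow> ('a, 'm) module \<Rightarrow> bool" where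
  "projective_module R M \<longleftrightarrow> module R M \<and>
     (\<exists>(I :: 'm set) s q. s \<in> linear_maps R M (free_module R I) \<and>
        q \<in> linear_maps R (free_module R I) M \<and> (\<forall>x\<in>carrier M. q (s x) = x))"

text \<open>The tensor product over \<open>k\<close>: the free abelian group on pairs modulo the bilinearity
  relations.\<close>

definition tensor_rels ::
  "('k, 'x) ring_scheme \<Rightarrow> ('k, 'a) module \<Rightarrow> ('k, 'b) module \<Rightarrow> ('a \<times> 'b \<Rightarrow>\<^sub>0 int) set" where
  "tensor_rels k A B = generate (free_Abelian_group (carrier A \<times> carrier B))
     ({frag_of (a \<oplus>\<^bsub>A\<^esub> a', b) - frag_of (a, b) - frag_of (a', b) | a a' b.
         a \<in> carrier A \<and> a' \<in> carrier A \<and> b \<in> carrier B} \<union>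
      {frag_of (a, b \<oplus>\<^bsub>B\<^esub> b') - frag_of (a, b) - frag_of (a, b') | a b b'.
         a \<in> carrier A \<and> b \<in> carrier B \<and> b' \<in> carrier B} \<union>
      {frag_of (c \<odot>\<^bsub>A\<^esub> a, b) - frag_of (a, c \<odot>\<^bsub>B\<^esub> b) | c a b.
         c \<in> carrier k \<and> a \<in> carrier A \<and> b \<in> carrier B})"

definition tensor_group ::
  "('k, 'x) ring_scheme \<Rightarrow> ('k, 'a) module \<Rightarrow> ('k, 'b) module \<Rightarrow> ('a \<times> 'b \<Rightarrow>\<^sub>0 int) set monoid" where
  "tensor_group k A B = free_Abelian_group (carrier A \<times> carrier B) Mod tensor_rels k A B"

definition tensor_class ::
  "('k, 'x) ring_scheme \<Rightarrow> ('k, 'a) module \<Rightarrow> ('k, 'b) module \<Rightarrow> ('a \<times> 'b \<Rightarrow>\<^sub>0 int)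
     \<Rightarrow> ('a \<times> 'b \<Rightarrow>\<^sub>0 int) set" where
  "tensor_class k A B x =
     tensor_rels k A B #>\<^bsub>free_Abelian_group (carrier A \<times> carrier B)\<^esub> x"

text \<open>The biadditive product with \<open>(a, b) (a', b') = (a a', b b')\<close> on representatives.\<close>

definition pair_mult ::
  "('a, 'x) ring_scheme \<Rightarrow> ('b, 'y) ring_scheme \<Rightarrow> ('a \<times> 'b \<Rightarrow>\<^sub>0 int) \<Rightarrow> ('a \<times> 'b \<Rightarrow>\<^sub>0 int)
     \<Rightarrow> ('a \<times> 'b \<Rightarrow>\<^sub>0 int)" where
  "pair_mult A B x y = frag_extend (\<lambda>(a, b). frag_extend (\<lambda>(a', b').
     frag_of (a \<otimes>\<^bsub>A\<^esub> a', b \<otimes>\<^bsub>B\<^esub> b')) y) x"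

definition tensor_algebra ::
  "('k, 'x) ring_scheme \<Rightarrow> ('k, 'a) module \<Rightarrow> ('k, 'b) module \<Rightarrow> ('a \<times> 'b \<Rightarrow>\<^sub>0 int) set ring" where
  "tensor_algebra k A B = \<lparr>
     carrier = carrier (tensor_group k A B),
     monoid.mult = (\<lambda>S T. \<Union>x\<in>S. \<Union>y\<in>T. tensor_class k A B (pair_mult A B x y)),
     one = tensor_class k A B (frag_of (\<one>\<^bsub>A\<^esub>, \<one>\<^bsub>B\<^esub>)),
     ring.zero = monoid.one (tensor_group k A B),
     ring.add = monoid.mult (tensor_group k A B)\<rparr>"

text \<open>The map from a tensor product to the additive group of \<open>G\<close> induced by a bilinear map
  \<open>f\<close>, that is \<open>a \<otimes> b \<mapsto> f a b\<close>.\<close>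

definition tensor_lift ::
  "('g, 'x) ring_scheme \<Rightarrow> ('a \<Rightarrow> 'b \<Rightarrow> 'g) \<Rightarrow> ('a \<times> 'b \<Rightarrow>\<^sub>0 int) set \<Rightarrow> 'g" where
  "tensor_lift G f T = (THE y. \<forall>x\<in>T. y =
     (\<Oplus>\<^bsub>G\<^esub>t\<in>Poly_Mapping.keys x. [Poly_Mapping.lookup x t] \<cdot>\<^bsub>G\<^esub> f (fst t) (snd t)))"

definition powser_ring :: "('a, 'x) ring_scheme \<Rightarrow> (nat \<Rightarrow> 'a) ring" where
  "powser_ring R = \<lparr>
     carrier = UNIV \<rightarrow> carrier R,
     monoid.mult = (\<lambda>f g n. \<Oplus>\<^bsub>R\<^esub>i\<in>{..n}. f i \<otimes>\<^bsub>R\<^esub> g (n - i)),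
     one = (\<lambda>n. if n = 0 then \<one>\<^bsub>R\<^esub> else \<zero>\<^bsub>R\<^esub>),
     ring.zero = (\<lambda>n. \<zero>\<^bsub>R\<^esub>),
     ring.add = (\<lambda>f g n. f n \<oplus>\<^bsub>R\<^esub> g n)\<rparr>"

definition powser_const :: "('a, 'x) ring_scheme \<Rightarrow> 'a \<Rightarrow> nat \<Rightarrow> 'a" where
  "powser_const R a = (\<lambda>n. if n = 0 then a else \<zero>\<^bsub>R\<^esub>)"

definition powser_var :: "('a, 'x) ring_scheme \<Rightarrow> nat \<Rightarrow> 'a" where
  "powser_var R = (\<lambda>n. if n = 1 then \<one>\<^bsub>R\<^esub> else \<zero>\<^bsub>R\<^esub>)"


section \<open>Finite extensions of the p-adic numbers\<close>

text \<open>The ring of p-adic integers as the inverse limit of the rings of integers modulo \<open>p ^ n\<close>,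
  with residues represented in \<open>{0..<p ^ n}\<close>.\<close>

definition padic_ints :: "nat \<Rightarrow> (nat \<Rightarrow> int) ring" where
  "padic_ints p = \<lparr>
     carrier = {x. \<forall>n. 0 \<le> x n \<and> x n < int p ^ n \<and> x (Suc n) mod int p ^ n = x n},
     monoid.mult = (\<lambda>x y n. (x n * y n) mod int p ^ n),
     one = (\<lambda>n. 1 mod int p ^ n),
     ring.zero = (\<lambda>n. 0),
     ring.add = (\<lambda>x y n. (x n + y n) mod int p ^ n)\<rparr>"

text \<open>The field of fractions, inside the field \<open>K\<close>, of a subring \<open>A\<close>.\<close>

definition fractions_in :: "('k, 'x) ring_scheme \<Rightarrow> 'k set \<Rightarrow> 'k set" where
  "fractions_in K A = {a \<otimes>\<^bsub>K\<^esub> inv\<^bsub>K\<^esub> b | a b. a \<in> A \<and> b \<in> A \<and> b \<noteq> \<zero>\<^bsub>K\<^esub>}"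

text \<open>A field extension of the fraction field of the p-adic integers is the same as a field \<open>K\<close> with an
  injective ring homomorphism \<open>\<iota>\<close> from the p-adic integers to \<open>K\<close>; the copy of the p-adic numbers
  in \<open>K\<close> is then the set of fractions of elements in the image of \<open>\<iota>\<close>.\<close>

definition finite_extension_of_Qp :: "nat \<Rightarrow> 'k ring \<Rightarrow> ((nat \<Rightarrow> int) \<Rightarrow> 'k) \<Rightarrow> bool" where
  "finite_extension_of_Qp p K \<iota> \<longleftrightarrow> field K \<and> \<iota> \<in> ring_hom (padic_ints p) K \<and>
     inj_on \<iota> (carrier (padic_ints p)) \<and>
     ring.finite_dimension K (fractions_in K (\<iota> ` carrier (padic_ints p))) (carrier K)"

text \<open>The integral closure of the p-adic integers in \<open>K\<close>.\<close>

definition ring_of_integers :: "nat \<Rightarrow> 'k ring \<Rightarrow> ((nat \<Rightarrow> int) \<Rightarrow> 'k) \<Rightarrow> 'k ring" where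
  "ring_of_integers p K \<iota> = K\<lparr>carrier := {x \<in> carrier K.
     \<exists>f \<in> carrier (univ_poly K (\<iota> ` carrier (padic_ints p))).
       f \<noteq> [] \<and> lead_coeff f = \<one>\<^bsub>K\<^esub> \<and> ring.eval K f x = \<zero>\<^bsub>K\<^esub>}\<rparr>"

text \<open>A uniformizer is a generator of the maximal ideal, which consists of the nonunits.\<close>

definition uniformizer :: "nat \<Rightarrow> 'k ring \<Rightarrow> ((nat \<Rightarrow> int) \<Rightarrow> 'k) \<Rightarrow> 'k \<Rightarrow> bool" where
  "uniformizer p K \<iota> \<pi> \<longleftrightarrow> \<pi> \<in> carrier (ring_of_integers p K \<iota>) \<and>
     PIdl\<^bsub>ring_of_integers p K \<iota>\<^esub> \<pi> =
       carrier (ring_of_integers p K \<iota>) - Units (ring_of_integers p K \<iota>)"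

definition residue_field :: "nat \<Rightarrow> 'k ring \<Rightarrow> ((nat \<Rightarrow> int) \<Rightarrow> 'k) \<Rightarrow> 'k \<Rightarrow> 'k set ring" where
  "residue_field p K \<iota> \<pi> =
     ring_of_integers p K \<iota> Quot (PIdl\<^bsub>ring_of_integers p K \<iota>\<^esub> \<pi>)"


section \<open>Witt vectors\<close>

text \<open>Integer polynomials in the variables \<open>X\<^sub>0, X\<^sub>1, \<dots>\<close> (indices \<open>Inl i\<close>) and
  \<open>Y\<^sub>0, Y\<^sub>1, \<dots>\<close> (indices \<open>Inr i\<close>).\<close>

type_synonym xy_poly = "((nat + nat) \<Rightarrow>\<^sub>0 nat) \<Rightarrow>\<^sub>0 int"

definition xy_var :: "nat + nat \<Rightarrow> xy_poly" where
  "xy_var v = Poly_Mapping.single (Poly_Mapping.single v 1) 1"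

definition xy_eval :: "('a, 'x) ring_scheme \<Rightarrow> (nat + nat \<Rightarrow> 'a) \<Rightarrow> xy_poly \<Rightarrow> 'a" where
  "xy_eval R v P = (\<Oplus>\<^bsub>R\<^esub>m\<in>Poly_Mapping.keys P. [Poly_Mapping.lookup P m] \<cdot>\<^bsub>R\<^esub>
     (\<Otimes>\<^bsub>R\<^esub>i\<in>Poly_Mapping.keys m. v i [^]\<^bsub>R\<^esub> Poly_Mapping.lookup m i))"

definition ghost :: "nat \<Rightarrow> nat \<Rightarrow> (nat \<Rightarrow> 'a::comm_ring_1) \<Rightarrow> 'a" where
  "ghost p n x = (\<Sum>i\<le>n. of_nat p ^ i * x i ^ (p ^ (n - i)))"

text \<open>The universal polynomials of Witt's theorem: the unique sequences of integer polynomials for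
  which the ghost components are additive, respectively multiplicative.\<close>

definition witt_add_poly :: "nat \<Rightarrow> nat \<Rightarrow> xy_poly" where
  "witt_add_poly p = (THE S. \<forall>n. ghost p n S =
     ghost p n (\<lambda>i. xy_var (Inl i)) + ghost p n (\<lambda>i. xy_var (Inr i)))"

definition witt_mult_poly :: "nat \<Rightarrow> nat \<Rightarrow> xy_poly" where
  "witt_mult_poly p = (THE S. \<forall>n. ghost p n S =
     ghost p n (\<lambda>i. xy_var (Inl i)) * ghost p n (\<lambda>i. xy_var (Inr i)))"

definition witt_ring :: "nat \<Rightarrow> ('a, 'x) ring_scheme \<Rightarrow> (nat \<Rightarrow> 'a) ring" where
  "witt_ring p R = \<lparr>
     carrier = UNIV \<rightarrow> carrier R,
     monoid.mult = (\<lambda>x y n. xy_eval R (case_sum x y) (witt_mult_poly p n)),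
     one = (\<lambda>n. if n = 0 then \<one>\<^bsub>R\<^esub> else \<zero>\<^bsub>R\<^esub>),
     ring.zero = (\<lambda>n. \<zero>\<^bsub>R\<^esub>),
     ring.add = (\<lambda>x y n. xy_eval R (case_sum x y) (witt_add_poly p n))\<rparr>"

text \<open>The Frobenius of \<open>W(R)\<close> for \<open>R\<close> of characteristic \<open>p\<close>.\<close>

definition witt_frob :: "nat \<Rightarrow> ('a, 'x) ring_scheme \<Rightarrow> (nat \<Rightarrow> 'a) \<Rightarrow> nat \<Rightarrow> 'a" where
  "witt_frob p R x = (\<lambda>n. x n [^]\<^bsub>R\<^esub> p)"

text \<open>The canonical map from the p-adic integers to \<open>W(R)\<close>, for \<open>R\<close> a perfect field of
  characteristic \<open>p\<close>: the p-adic limit of the multiples of \<open>1\<close> by the residues \<open>z n\<close>.\<close>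

definition padic_to_witt :: "nat \<Rightarrow> ('a, 'x) ring_scheme \<Rightarrow> (nat \<Rightarrow> int) \<Rightarrow> nat \<Rightarrow> 'a" where
  "padic_to_witt p R z = (THE w. w \<in> carrier (witt_ring p R) \<and>
     (\<forall>n. \<exists>v\<in>carrier (witt_ring p R). w =
        [z n] \<cdot>\<^bsub>witt_ring p R\<^esub> \<one>\<^bsub>witt_ring p R\<^esub> \<oplus>\<^bsub>witt_ring p R\<^esub> [(p ^ n)] \<cdot>\<^bsub>witt_ring p R\<^esub> v))"

definition witt_algebra :: "nat \<Rightarrow> ('a, 'x) ring_scheme \<Rightarrow> (nat \<Rightarrow> int, nat \<Rightarrow> 'a) module" where
  "witt_algebra p R = with_smult (witt_ring p R)
     (\<lambda>z w. padic_to_witt p R z \<otimes>\<^bsub>witt_ring p R\<^esub> w)"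

text \<open>The canonical embedding of \<open>W(\<kappa>)\<close> in \<open>K\<close>: the unique ring homomorphism to the ring of
  integers that induces the identity on the residue field (the residue of a Witt vector \<open>w\<close> being
  its component \<open>w 0\<close>).\<close>

definition witt_embed ::
  "nat \<Rightarrow> 'k ring \<Rightarrow> ((nat \<Rightarrow> int) \<Rightarrow> 'k) \<Rightarrow> 'k \<Rightarrow> (nat \<Rightarrow> 'k set) \<Rightarrow> 'k" where
  "witt_embed p K \<iota> \<pi> = (let OK = ring_of_integers p K \<iota>; W = witt_ring p (residue_field p K \<iota> \<pi>) in
     (THE j. j \<in> ring_hom W OK \<and> j \<in> extensional (carrier W) \<and>
       (\<forall>w\<in>carrier W. PIdl\<^bsub>OK\<^esub> \<pi> +>\<^bsub>OK\<^esub> j w = w 0)))"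

text \<open>The minimal polynomial of \<open>\<pi>\<close> over the fraction field of \<open>W(\<kappa>)\<close>. Its coefficients lie in
  \<open>W(\<kappa>)\<close>, and it is regarded as an element of \<open>W(\<kappa>)[[u]]\<close>.\<close>

definition eisenstein_poly ::
  "nat \<Rightarrow> 'k ring \<Rightarrow> ((nat \<Rightarrow> int) \<Rightarrow> 'k) \<Rightarrow> 'k \<Rightarrow> nat \<Rightarrow> nat \<Rightarrow> 'k set" where
  "eisenstein_poly p K \<iota> \<pi> = (let W = witt_ring p (residue_field p K \<iota> \<pi>); j = witt_embed p K \<iota> \<pi> in
     (\<lambda>n. the_inv_into (carrier W) j
       (ring.coeff K (ring.Irr K (fractions_in K (j ` carrier W)) \<pi>) n)))"


section \<open>Breuil-Kisin modules\<close>

definition kisin_ring :: "nat \<Rightarrow> ('a, 'x) ring_scheme \<Rightarrow> (nat \<Rightarrow> nat \<Rightarrow> 'a) ring" where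
  "kisin_ring p \<kappa> = powser_ring (witt_ring p \<kappa>)"

text \<open>The endomorphism of \<open>W(\<kappa>)[[u]]\<close> sending \<open>\<Sum> a\<^sub>n u\<^sup>n\<close> to \<open>\<Sum> F(a\<^sub>n) u\<^bsup>p n\<^esup>\<close>.\<close>

definition kisin_frob :: "nat \<Rightarrow> ('a, 'x) ring_scheme \<Rightarrow> (nat \<Rightarrow> nat \<Rightarrow> 'a) \<Rightarrow> nat \<Rightarrow> nat \<Rightarrow> 'a" where
  "kisin_frob p \<kappa> f = (\<lambda>n. if p dvd n then witt_frob p \<kappa> (f (n div p)) else \<zero>\<^bsub>witt_ring p \<kappa>\<^esub>)"

text \<open>The Frobenius pullback of \<open>M\<close>: the tensor product over \<open>S = W(\<kappa>)[[u]]\<close> of \<open>M\<close> with \<open>S\<close>, the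
  latter regarded as an \<open>S\<close>-module through the Frobenius.\<close>

definition frobenius_pullback ::
  "nat \<Rightarrow> ('a, 'x) ring_scheme \<Rightarrow> (nat \<Rightarrow> nat \<Rightarrow> 'a, 'm) module
     \<Rightarrow> ((nat \<Rightarrow> nat \<Rightarrow> 'a) \<times> 'm \<Rightarrow>\<^sub>0 int) set monoid" where
  "frobenius_pullback p \<kappa> M = tensor_group (kisin_ring p \<kappa>)
     (with_smult (kisin_ring p \<kappa>) (\<lambda>a s. kisin_frob p \<kappa> a \<otimes>\<^bsub>kisin_ring p \<kappa>\<^esub> s)) M"

definition linearization ::
  "(nat \<Rightarrow> nat \<Rightarrow> 'a, 'm) module \<Rightarrow> ('m \<Rightarrow> 'm) \<Rightarrow> ((nat \<Rightarrow> nat \<Rightarrow> 'a) \<times> 'm \<Rightarrow>\<^sub>0 int) set \<Rightarrow> 'm" where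
  "linearization M \<phi> = tensor_lift M (\<lambda>s x. s \<odot>\<^bsub>M\<^esub> \<phi> x)"

definition breuil_kisin_module ::
  "nat \<Rightarrow> ('a, 'x) ring_scheme \<Rightarrow> (nat \<Rightarrow> nat \<Rightarrow> 'a) \<Rightarrow> nat
     \<Rightarrow> (nat \<Rightarrow> nat \<Rightarrow> 'a, 'm) module \<Rightarrow> ('m \<Rightarrow> 'm) \<Rightarrow> bool" where
  "breuil_kisin_module p \<kappa> E h M \<phi> \<longleftrightarrow>
     module (kisin_ring p \<kappa>) M \<and> finite_free (kisin_ring p \<kappa>) M \<and>
     \<phi> \<in> carrier M \<rightarrow> carrier M \<and>
     (\<forall>x\<in>carrier M. \<forall>y\<in>carrier M. \<phi> (x \<oplus>\<^bsub>M\<^esub> y) = \<phi> x \<oplus>\<^bsub>M\<^esub> \<phi> y) \<and>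
     (\<forall>s\<in>carrier (kisin_ring p \<kappa>). \<forall>x\<in>carrier M. \<phi> (s \<odot>\<^bsub>M\<^esub> x) = kisin_frob p \<kappa> s \<odot>\<^bsub>M\<^esub> \<phi> x) \<and>
     (\<forall>x\<in>carrier M. (E [^]\<^bsub>kisin_ring p \<kappa>\<^esub> h) \<odot>\<^bsub>M\<^esub> x
        \<in> linearization M \<phi> ` carrier (frobenius_pullback p \<kappa> M))"

text \<open>An action on \<open>M\<close>, by endomorphisms commuting with \<open>\<phi>\<close>, of an algebra \<open>R\<close> over the p-adic
  integers.\<close>

definition coefficient_action ::
  "nat \<Rightarrow> ('a, 'x) ring_scheme \<Rightarrow> (nat \<Rightarrow> int, 'r) module
     \<Rightarrow> (nat \<Rightarrow> nat \<Rightarrow> 'a, 'm) module \<Rightarrow> ('m \<Rightarrow> 'm) \<Rightarrow> ('r \<Rightarrow> 'm \<Rightarrow> 'm) \<Rightarrow> bool" where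
  "coefficient_action p \<kappa> R M \<phi> act \<longleftrightarrow>
     module R (with_smult M act) \<and>
     (\<forall>r\<in>carrier R. \<forall>s\<in>carrier (kisin_ring p \<kappa>). \<forall>x\<in>carrier M.
        act r (s \<odot>\<^bsub>M\<^esub> x) = s \<odot>\<^bsub>M\<^esub> act r x) \<and>
     (\<forall>r\<in>carrier R. \<forall>x\<in>carrier M. act r (\<phi> x) = \<phi> (act r x)) \<and>
     (\<forall>z\<in>carrier (padic_ints p). \<forall>r\<in>carrier R. \<forall>x\<in>carrier M.
        act (z \<odot>\<^bsub>R\<^esub> r) x =
          powser_const (witt_ring p \<kappa>) (padic_to_witt p \<kappa> z) \<odot>\<^bsub>M\<^esub> act r x)"

definition coeff_kisin_ring ::
  "nat \<Rightarrow> ('a, 'x) ring_scheme \<Rightarrow> (nat \<Rightarrow> int, 'r) module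
     \<Rightarrow> (nat \<Rightarrow> ('r \<times> (nat \<Rightarrow> 'a) \<Rightarrow>\<^sub>0 int) set) ring" where
  "coeff_kisin_ring p \<kappa> R = powser_ring (tensor_algebra (padic_ints p) R (witt_algebra p \<kappa>))"

text \<open>The action of the tensor product of \<open>R\<close> and \<open>W(\<kappa>)\<close> on \<open>M\<close>, given by
  \<open>(r \<otimes> w) x = r (w x)\<close>.\<close>

definition tensor_act ::
  "nat \<Rightarrow> ('a, 'x) ring_scheme \<Rightarrow> (nat \<Rightarrow> nat \<Rightarrow> 'a, 'm) module \<Rightarrow> ('r \<Rightarrow> 'm \<Rightarrow> 'm)
     \<Rightarrow> ('r \<times> (nat \<Rightarrow> 'a) \<Rightarrow>\<^sub>0 int) set \<Rightarrow> 'm \<Rightarrow> 'm" where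
  "tensor_act p \<kappa> M act t x =
     tensor_lift M (\<lambda>r w. act r (powser_const (witt_ring p \<kappa>) w \<odot>\<^bsub>M\<^esub> x)) t"

text \<open>The power series \<open>\<Sum> a\<^sub>n u\<^sup>n\<close> acts on \<open>M\<close> by sending \<open>x\<close> to the \<open>u\<close>-adic limit of the sums
  \<open>\<Sum>i<n. u\<^sup>i (a\<^sub>i x)\<close>.\<close>

definition coeff_kisin_act ::
  "nat \<Rightarrow> ('a, 'x) ring_scheme \<Rightarrow> (nat \<Rightarrow> nat \<Rightarrow> 'a, 'm) module \<Rightarrow> ('r \<Rightarrow> 'm \<Rightarrow> 'm)
     \<Rightarrow> (nat \<Rightarrow> ('r \<times> (nat \<Rightarrow> 'a) \<Rightarrow>\<^sub>0 int) set) \<Rightarrow> 'm \<Rightarrow> 'm" where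
  "coeff_kisin_act p \<kappa> M act f x =
     (let S = kisin_ring p \<kappa>; u = powser_var (witt_ring p \<kappa>) in
      (THE y. y \<in> carrier M \<and> (\<forall>n. \<exists>z\<in>carrier M. y =
        (\<Oplus>\<^bsub>M\<^esub>i\<in>{..<n}. (u [^]\<^bsub>S\<^esub> i) \<odot>\<^bsub>M\<^esub> tensor_act p \<kappa> M act (f i) x)
          \<oplus>\<^bsub>M\<^esub> (u [^]\<^bsub>S\<^esub> n) \<odot>\<^bsub>M\<^esub> z)))"

definition coeff_kisin_module ::
  "nat \<Rightarrow> ('a, 'x) ring_scheme \<Rightarrow> (nat \<Rightarrow> nat \<Rightarrow> 'a, 'm) module \<Rightarrow> ('r \<Rightarrow> 'm \<Rightarrow> 'm)
     \<Rightarrow> (nat \<Rightarrow> ('r \<times> (nat \<Rightarrow> 'a) \<Rightarrow>\<^sub>0 int) set, 'm) module" where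
  "coeff_kisin_module p \<kappa> M act = with_smult M (coeff_kisin_act p \<kappa> M act)"

end

theory Submission
  imports Defs
begin

text \<open>
  Let \<open>A\<close> be the tensor product of \<open>R\<close> and \<open>W(\<kappa>)\<close>. As \<open>M\<close> is finite free over \<open>W(\<kappa>)[[u]]\<close>, it is
  \<open>u\<close>-adically complete and \<open>u\<close>-torsion free, and \<open>M/uM\<close> is \<open>p\<close>-torsion free and finitely generated
  over \<open>R\<close>: the field \<open>\<kappa>\<close> is finite and its Teichmueller representatives span \<open>W(\<kappa>)\<close> over the \<open>p\<close>-adic
  integers. By the hypothesis on \<open>R\<close>, the module \<open>M/uM\<close> has a finite dual basis of \<open>R\<close>-linear functionals
  \<open>g\<^sub>t\<close>. The order of \<open>\<kappa>\<^sup>*\<close> being prime to \<open>p\<close>,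
  averaging as in Maschke's theorem \<open>m \<mapsto> g\<^sub>t([a]\<^sup>-\<^sup>1 m) \<otimes> [a]\<close> over \<open>a \<in> \<kappa>\<^sup>*\<close> gives \<open>A\<close>-linear functionals \<open>h\<^sub>t\<close>, again with \<open>m \<equiv> \<Sum>\<^sub>t h\<^sub>t(m) t\<close> modulo \<open>uM\<close>. Writing
  \<open>m = \<Sum>\<^sub>t h\<^sub>t(m) t + u D(m)\<close> and iterating, completeness yields \<open>m = \<Sum>\<^sub>t f\<^sub>t(m) t\<close> with
  \<open>f\<^sub>t(m) = \<Sum>\<^sub>n h\<^sub>t(D\<^sup>n m) u\<^sup>n\<close>, and the \<open>f\<^sub>t\<close> are \<open>A[[u]]\<close>-linear: they form a dual basis of \<open>M\<close>.
\<close>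

text \<open>The hypothesis on \<open>R\<close> speaks of \<open>R\<close>-modules only, so the
  functionals that it yields are merely \<open>R\<close>-linear, while linearity over the tensor
  product of \<open>R\<close> and \<open>W\<close> is wanted. Scalars from the p-adic integers cause
  no trouble, since they act through \<open>R\<close>. Hence only Teichmueller representatives
  remain, and the nonzero ones form a finite group, over which one can average. This is why the
  finiteness of the residue field has to be derived from the finite degree of \<open>K\<close>, and
  why Witt vectors are expanded in Teichmueller representatives with p-adic coefficients. The ring
  axioms for \<open>witt_ring p \<kappa>\<close> are read off from the hypothesis that
  \<open>M\<close> is a module, which contains that the power series over it form a commutative ring
  (\<open>cring_of_powser\<close>). What is used of Witt's polynomials are mainly three facts: how
  sums begin, what multiplication by \<open>p\<close> does, and that Teichmueller representatives
  multiply. Once the action of power series satisfies the recursion \<open>pact_rec\<close>, its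
  laws follow without handling limits.\<close>

section \<open>Spans over a subring and integral elements\<close>

context cring
begin

declare Span.simps [simp del]

lemma Span_Nil [simp]: "Span A [] = {\<zero>}"
  by (simp add: Span.simps)

lemma Span_Cons_iff:
  "x \<in> Span A (v # vs) \<longleftrightarrow> (\<exists>a\<in>A. \<exists>s\<in>Span A vs. x = a \<otimes> v \<oplus> s)"
  by (simp add: Span.simps line_extension_mem_iff)

lemma Span_ConsI: "a \<in> A \<Longrightarrow> s \<in> Span A vs \<Longrightarrow> a \<otimes> v \<oplus> s \<in> Span A (v # vs)"
  unfolding Span_Cons_iff by blast

text \<open>The induction principle for spans: a set that contains zero and is closed under sums
  contains the span as soon as it contains the single multiples of the generators. In most uses
  below \<open>H\<close> is the set of elements for which some claim holds.\<close>

lemma Span_least_of_subring: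
  assumes "\<zero> \<in> H" "\<And>x y. x \<in> H \<Longrightarrow> y \<in> H \<Longrightarrow> x \<oplus> y \<in> H"
    and "\<And>a v. a \<in> A \<Longrightarrow> v \<in> set vs \<Longrightarrow> a \<otimes> v \<in> H"
  shows "Span A vs \<subseteq> H"
  using assms(3)
proof (induct vs)
  case Nil
  then show ?case using assms(1) by simp
next
  case (Cons v vs)
  then have "Span A vs \<subseteq> H" by simp
  then show ?case using Cons.prems assms(2) by (fastforce simp only: Span_Cons_iff subset_iff list.set_intros)
qed

context
  fixes A assumes A: "subring A R"
begin

lemma sub_carr: "a \<in> A \<Longrightarrow> a \<in> carrier R"
  using subringE(1)[OF A] by blast

lemma Span_carrier: "set vs \<subseteq> carrier R \<Longrightarrow> Span A vs \<subseteq> carrier R"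
  by (rule Span_least_of_subring) (auto simp: sub_carr)

lemma Span_zero: "set vs \<subseteq> carrier R \<Longrightarrow> \<zero> \<in> Span A vs"
proof (induct vs)
  case (Cons v vs)
  then have "\<zero> \<otimes> v \<oplus> \<zero> \<in> Span A (v # vs)" using subringE(2)[OF A] by (intro Span_ConsI) auto
  with Cons.prems show ?case by simp
qed simp

lemma Span_add:
  assumes "set vs \<subseteq> carrier R" "x \<in> Span A vs" "y \<in> Span A vs"
  shows "x \<oplus> y \<in> Span A vs"
  using assms
proof (induct vs arbitrary: x y)
  case Nil
  then show ?case by simp
next
  case (Cons v vs)
  obtain a s b t where 1: "a \<in> A" "s \<in> Span A vs" "x = a \<otimes> v \<oplus> s"
      "b \<in> A" "t \<in> Span A vs" "y = b \<otimes> v \<oplus> t"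
    using Cons.prems(2,3) unfolding Span_Cons_iff by blast
  have c: "s \<in> carrier R" "t \<in> carrier R" "a \<in> carrier R" "b \<in> carrier R" "v \<in> carrier R"
    using 1 Span_carrier[of vs] Cons.prems(1) sub_carr by auto
  have "x \<oplus> y = (a \<oplus> b) \<otimes> v \<oplus> (s \<oplus> t)" using 1 c by (simp, algebra)
  moreover have "s \<oplus> t \<in> Span A vs" using Cons 1 by simp
  moreover have "a \<oplus> b \<in> A" using 1 subringE(7)[OF A] by blast
  ultimately show ?case unfolding Span_Cons_iff by blast
qed

lemma Span_smult:
  assumes "set vs \<subseteq> carrier R" "a \<in> A" "x \<in> Span A vs"
  shows "a \<otimes> x \<in> Span A vs"
proof -
  have "Span A vs \<subseteq> {x \<in> carrier R. a \<otimes> x \<in> Span A vs}"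
    using assms(1)
  proof (induct vs)
    case Nil
    then show ?case using sub_carr[OF assms(2)] by auto
  next
    case (Cons v vs)
    show ?case
    proof
      fix y assume "y \<in> Span A (v # vs)"
      then obtain b t where 1: "b \<in> A" "t \<in> Span A vs" "y = b \<otimes> v \<oplus> t"
        unfolding Span_Cons_iff by blast
      have c: "t \<in> carrier R" "a \<in> carrier R" "b \<in> carrier R" "v \<in> carrier R"
        using 1 Span_carrier[of vs] Cons.prems(1) sub_carr assms(2) by auto
      have "a \<otimes> y = (a \<otimes> b) \<otimes> v \<oplus> (a \<otimes> t)" using 1 c by (simp, algebra)
      moreover have "a \<otimes> t \<in> Span A vs" using Cons 1 by auto
      moreover have "a \<otimes> b \<in> A" using 1 assms subringE(6)[OF A] by blast
      ultimately show "y \<in> {x \<in> carrier R. a \<otimes> x \<in> Span A (v # vs)}"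
        unfolding Span_Cons_iff using 1 c by blast
    qed
  qed
  then show ?thesis using assms by blast
qed

lemma Span_base:
  assumes "set vs \<subseteq> carrier R" "v \<in> set vs"
  shows "v \<in> Span A vs"
  using assms
proof (induct vs)
  case (Cons w vs)
  have c: "w \<in> carrier R" "v \<in> carrier R" using Cons.prems by auto
  show ?case
  proof (cases "v = w")
    case True
    have "\<one> \<otimes> w \<oplus> \<zero> \<in> Span A (w # vs)"
      using subringE(3)[OF A] Span_zero Cons.prems(1) by (intro Span_ConsI) auto
    then show ?thesis using True c by simp
  next
    case False
    then have "v \<in> Span A vs" using Cons by auto
    moreover have "v = \<zero> \<otimes> w \<oplus> v" using c by simp
    ultimately show ?thesis unfolding Span_Cons_iff using subringE(2)[OF A] by blast
  qed
qed simp

lemma Span_subsetI: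
  assumes "set vs \<subseteq> carrier R" "set us \<subseteq> Span A vs"
  shows "Span A us \<subseteq> Span A vs"
  using assms by (intro Span_least_of_subring) (auto intro: Span_zero Span_add Span_smult)

text \<open>Transitivity of finite generation: the products of two generating lists generate over
  the smaller ring. Applied to powers of \<open>x\<close> and of \<open>y\<close>, it makes the ring
  \<open>A[x][y]\<close> finitely generated over \<open>A\<close>.\<close>

lemma Span_Span:
  assumes "set vs \<subseteq> carrier R" "set us \<subseteq> carrier R"
  shows "Span (Span A vs) us \<subseteq> Span A (concat (map (\<lambda>u. map (\<lambda>v. v \<otimes> u) vs) us))" (is "_ \<subseteq> Span A ?W")
proof (rule Span_least_of_subring)
  have W: "set ?W \<subseteq> carrier R" using assms by auto
  show "\<zero> \<in> Span A ?W" using Span_zero W by blast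
  show "\<And>x y. x \<in> Span A ?W \<Longrightarrow> y \<in> Span A ?W \<Longrightarrow> x \<oplus> y \<in> Span A ?W" using Span_add W by blast
  fix b u assume b: "b \<in> Span A vs" and u: "u \<in> set us"
  have uc: "u \<in> carrier R" using u assms by auto
  have "Span A vs \<subseteq> {b \<in> carrier R. b \<otimes> u \<in> Span A ?W}"
  proof (rule Span_least_of_subring)
    show "\<zero> \<in> {b \<in> carrier R. b \<otimes> u \<in> Span A ?W}" using Span_zero W uc by simp
    show "x \<oplus> y \<in> {b \<in> carrier R. b \<otimes> u \<in> Span A ?W}" if
      "x \<in> {b \<in> carrier R. b \<otimes> u \<in> Span A ?W}" "y \<in> {b \<in> carrier R. b \<otimes> u \<in> Span A ?W}" for x y
      using that Span_add[OF W] uc by (auto simp: l_distr)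
    fix a v assume av: "a \<in> A" "v \<in> set vs"
    have vc: "v \<in> carrier R" using av assms by auto
    have "v \<otimes> u \<in> Span A ?W" by (rule Span_base[OF W]) (use av u in auto)
    from Span_smult[OF W av(1) this] show "a \<otimes> v \<in> {b \<in> carrier R. b \<otimes> u \<in> Span A ?W}"
      using sub_carr[OF av(1)] vc uc by (simp add: m_assoc)
  qed
  then show "b \<otimes> u \<in> Span A ?W" using b by blast
qed

end

text \<open>Descending order is the order in which \<open>eval\<close> reads a list of coefficients,
  so that the elements of \<open>Span A (desc_powers x n)\<close> are the values at \<open>x\<close>
  of the lists of \<open>n\<close> coefficients in \<open>A\<close>.\<close>

definition desc_powers :: "'a \<Rightarrow> nat \<Rightarrow> 'a list" where
  "desc_powers x n = map (\<lambda>i. x [^] i) (rev [0..<n])"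

lemma desc_powers_Suc: "desc_powers x (Suc n) = x [^] n # desc_powers x n"
  by (simp add: desc_powers_def)

lemma desc_powers_0 [simp]: "desc_powers x 0 = []"
  by (simp add: desc_powers_def)

lemma set_desc_powers: "set (desc_powers x n) = (\<lambda>i. x [^] i) ` {..<n}"
  by (auto simp: desc_powers_def)

lemma desc_powers_carrier: "x \<in> carrier R \<Longrightarrow> set (desc_powers x n) \<subseteq> carrier R"
  by (auto simp: set_desc_powers)

text \<open>A monic equation solved for its leading power. In this form integrality is a statement
  about spans and can be produced by a chain argument; \<open>integral_over_iff_monic\<close>
  returns to equations.\<close>

definition integral_over :: "'a set \<Rightarrow> 'a \<Rightarrow> bool" where
  "integral_over A x \<longleftrightarrow> x \<in> carrier R \<and> (\<exists>n. x [^] n \<in> Span A (desc_powers x n))"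

text \<open>The span of the first \<open>n\<close> powers of \<open>y\<close> is the ring
  \<open>A[y]\<close>: multiplication by \<open>y\<close> shifts the powers, and the one power that
  leaves the list, \<open>y [^] n\<close>, folds back by the hypothesis. Closure under products then
  follows by induction over the first factor.\<close>

lemma subring_adjoin_integral:
  assumes A: "subring A R" and y: "y \<in> carrier R" and n: "y [^] n \<in> Span A (desc_powers y n)" and "n > 0"
  shows "subring (Span A (desc_powers y n)) R" "A \<subseteq> Span A (desc_powers y n)" "y \<in> Span A (desc_powers y n)"
proof -
  let ?P = "desc_powers y n" let ?B = "Span A ?P"
  have P: "set ?P \<subseteq> carrier R" by (rule desc_powers_carrier[OF y])
  have Bc: "?B \<subseteq> carrier R" by (rule Span_carrier[OF A P])
  have pw: "y [^] i \<in> ?B" if "i \<le> n" for i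
  proof (cases "i = n")
    case False
    then show ?thesis using that by (intro Span_base[OF A P]) (auto simp: set_desc_powers)
  qed (use n in simp)
  have ym: "y \<otimes> b \<in> ?B" if "b \<in> ?B" for b
  proof -
    have "?B \<subseteq> {b \<in> carrier R. y \<otimes> b \<in> ?B}"
    proof (rule Span_least_of_subring)
      show "\<zero> \<in> {b \<in> carrier R. y \<otimes> b \<in> ?B}" using Span_zero[OF A P] y by simp
      show "x \<oplus> z \<in> {b \<in> carrier R. y \<otimes> b \<in> ?B}" if "x \<in> {b \<in> carrier R. y \<otimes> b \<in> ?B}"
        "z \<in> {b \<in> carrier R. y \<otimes> b \<in> ?B}" for x z
        using that Span_add[OF A P] y by (auto simp: r_distr)
      fix a v assume a: "a \<in> A" and "v \<in> set ?P"
      then obtain i where i: "i < n" "v = y [^] i" by (auto simp: set_desc_powers)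
      have "y \<otimes> v = y [^] Suc i" using i y by (simp add: m_comm)
      then have "y \<otimes> v \<in> ?B" using pw[of "Suc i"] i by (simp del: nat_pow_Suc)
      from Span_smult[OF A P a this] show "a \<otimes> v \<in> {b \<in> carrier R. y \<otimes> b \<in> ?B}"
        using i y sub_carr[OF A a] by (simp add: m_lcomm)
    qed
    then show ?thesis using that by blast
  qed
  have pm: "y [^] (i::nat) \<otimes> b \<in> ?B" if "b \<in> ?B" for b i
  proof (induct i)
    case 0
    then show ?case using that Bc by auto
  next
    case (Suc i)
    then show ?case using ym[OF Suc] y that Bc by (auto simp: m_ac)
  qed
  have mm: "x \<otimes> b \<in> ?B" if "x \<in> ?B" "b \<in> ?B" for x b
  proof -
    have b: "b \<in> carrier R" using that Bc by auto
    have "?B \<subseteq> {x \<in> carrier R. x \<otimes> b \<in> ?B}"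
    proof (rule Span_least_of_subring)
      show "\<zero> \<in> {x \<in> carrier R. x \<otimes> b \<in> ?B}" using Span_zero[OF A P] b by simp
      show "x \<oplus> z \<in> {x \<in> carrier R. x \<otimes> b \<in> ?B}" if "x \<in> {x \<in> carrier R. x \<otimes> b \<in> ?B}"
        "z \<in> {x \<in> carrier R. x \<otimes> b \<in> ?B}" for x z
        using that Span_add[OF A P] b by (auto simp: l_distr)
      fix a v assume a: "a \<in> A" and "v \<in> set ?P"
      then obtain i where i: "i < n" "v = y [^] i" by (auto simp: set_desc_powers)
      from Span_smult[OF A P a pm[OF \<open>b \<in> ?B\<close>, of i]] show "a \<otimes> v \<in> {x \<in> carrier R. x \<otimes> b \<in> ?B}"
        using i y sub_carr[OF A a] b by (simp add: m_assoc)
    qed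
    then show ?thesis using that by blast
  qed
  have one: "\<one> \<in> ?B" using pw[of 0] by simp
  show AB: "A \<subseteq> ?B"
  proof
    fix a assume a: "a \<in> A"
    show "a \<in> ?B" using Span_smult[OF A P a one] sub_carr[OF A a] by simp
  qed
  show "subring ?B R"
  proof (rule subringI[OF Bc one _ mm Span_add[OF A P]])
    fix h assume h: "h \<in> ?B"
    have "\<ominus> \<one> \<in> A" using subringE(3,5)[OF A] by blast
    from Span_smult[OF A P this h] show "\<ominus> h \<in> ?B" using h Bc by (auto simp: l_minus)
  qed
  show "y \<in> ?B" using pw[of 1] y \<open>n > 0\<close> by simp
qed

text \<open>A noetherian argument for a ring with the property \<open>V\<close> that every sequence
  has a term dividing all others, as in a discrete valuation ring: a sequence in a finitely
  generated module has a term that depends on its predecessors. The generators are eliminated one at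
  a time, with the dividing term as pivot.\<close>

lemma Span_ascending_chain:
  assumes A: "subring A R"
    and V: "\<And>a :: nat \<Rightarrow> 'a. (\<And>n. a n \<in> A) \<Longrightarrow> \<exists>m. \<forall>n. \<exists>c\<in>A. a n = c \<otimes> a m"
    and vs: "set vs \<subseteq> carrier R"
    and t: "\<And>n::nat. t n \<in> Span A vs"
  shows "\<exists>n. t n \<in> Span A (map t (rev [0..<n]))"
  using vs t
proof (induct vs arbitrary: t)
  case Nil
  then have "t 0 \<in> Span A (map t (rev [0..<0]))" by simp
  then show ?case by blast
next
  case (Cons v vs)
  have vs: "set vs \<subseteq> carrier R" and v: "v \<in> carrier R" using Cons.prems(1) by auto
  have tc: "t n \<in> carrier R" for n
    using Cons.prems Span_carrier[OF A Cons.prems(1)] by blast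
  have "\<exists>a s. a \<in> A \<and> s \<in> Span A vs \<and> t n = a \<otimes> v \<oplus> s" for n
    using Cons.prems(2)[of n] unfolding Span_Cons_iff by blast
  then obtain a s where a: "\<And>n. a n \<in> A" and s: "\<And>n. s n \<in> Span A vs"
    and ts: "\<And>n. t n = a n \<otimes> v \<oplus> s n" by metis
  obtain m where "\<forall>n. \<exists>c\<in>A. a n = c \<otimes> a m" using V[of a, OF a] by blast
  then obtain c where c: "\<And>n. c n \<in> A" and ac: "\<And>n. a n = c n \<otimes> a m" by metis
  have carr: "a n \<in> carrier R" "c n \<in> carrier R" "s n \<in> carrier R" for n
    using a c s sub_carr[OF A] Span_carrier[OF A vs] by auto
  \<comment> \<open>The pivot \<open>t m\<close> clears the coefficient of \<open>v\<close>, which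
    leaves elements of the span of \<open>vs\<close>. Only terms after \<open>m\<close> are kept, so
    that \<open>t m\<close> counts among the predecessors of \<open>t (Suc m + n)\<close>.\<close>
  define t' where "t' n = t (Suc m + n) \<ominus> c (Suc m + n) \<otimes> t m" for n
  have t'c: "t' n \<in> carrier R" for n by (simp add: t'_def tc carr)
  have m1: "\<ominus> x = (\<ominus> \<one>) \<otimes> x" if "x \<in> carrier R" for x using that by (simp add: l_minus)
  have one': "\<ominus> \<one> \<in> A" using subringE(3,5)[OF A] by blast
  have "t' n \<in> Span A vs" for n
  proof -
    have "t' n = s (Suc m + n) \<oplus> (\<ominus> \<one>) \<otimes> (c (Suc m + n) \<otimes> s m)"
      unfolding t'_def ts ac[of "Suc m + n"] using carr[of m] carr[of "Suc m + n"] v by algebra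
    then show ?thesis using s c one' Span_smult[OF A vs] Span_add[OF A vs] by simp
  qed
  from Cons.hyps[of t', OF vs this] obtain n where n: "t' n \<in> Span A (map t' (rev [0..<n]))" by blast
  let ?T = "map t (rev [0..<Suc m + n])"
  have T: "set ?T \<subseteq> carrier R" using tc by auto
  have tT: "t i \<in> Span A ?T" if "i < Suc m + n" for i
    by (rule Span_base[OF A T]) (unfold set_map set_rev set_upt, rule imageI, use that in simp)
  have "Span A (map t' (rev [0..<n])) \<subseteq> Span A ?T"
  proof (rule Span_subsetI[OF A T], rule subsetI)
    fix x assume "x \<in> set (map t' (rev [0..<n]))"
    then obtain i where i: "i < n" and x: "x = t' i" by auto
    have "t' i = t (Suc m + i) \<oplus> (\<ominus> \<one>) \<otimes> (c (Suc m + i) \<otimes> t m)"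
      unfolding t'_def using carr tc by algebra
    then show "x \<in> Span A ?T" using x tT[of "Suc m + i"] tT[of m] i c one' Span_smult[OF A T] Span_add[OF A T]
      by simp
  qed
  then have "t' n \<in> Span A ?T" using n by blast
  moreover have "t (Suc m + n) = t' n \<oplus> c (Suc m + n) \<otimes> t m"
    unfolding t'_def using carr tc by algebra
  ultimately have "t (Suc m + n) \<in> Span A ?T"
    using tT[of m] c Span_smult[OF A T] Span_add[OF A T] by simp
  then show ?case by blast
qed

text \<open>Sums and products of \<open>x\<close> and \<open>y\<close> lie in
  \<open>A[x][y]\<close>, which is contained in a finitely generated \<open>A\<close>-module. For
  \<open>z\<close> in it, \<open>Span_ascending_chain\<close> applied to the powers of
  \<open>z\<close> yields a power that depends on the lower ones, and this is integrality. The
  argument takes the place of the usual determinant.\<close>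

lemma integral_subring:
  assumes A: "subring A R" and "\<one> \<noteq> \<zero>"
    and V: "\<And>a :: nat \<Rightarrow> 'a. (\<And>n. a n \<in> A) \<Longrightarrow> \<exists>m. \<forall>n. \<exists>c\<in>A. a n = c \<otimes> a m"
  shows "subring {x. integral_over A x} R" "A \<subseteq> {x. integral_over A x}"
proof -
  have common: "\<exists>L. subring L R \<and> x \<in> L \<and> y \<in> L \<and> (\<forall>z\<in>L. integral_over A z)"
    if xy: "integral_over A x" "integral_over A y" for x y
  proof -
    have x: "x \<in> carrier R" and y: "y \<in> carrier R" using xy by (auto simp: integral_over_def)
    obtain n where n: "x [^] n \<in> Span A (desc_powers x n)" using xy(1) integral_over_def by blast
    have n0: "n > 0" using n \<open>\<one> \<noteq> \<zero>\<close> by (cases n) auto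
    let ?B = "Span A (desc_powers x n)"
    note B = subring_adjoin_integral[OF A x n n0]
    obtain m where m: "y [^] m \<in> Span A (desc_powers y m)" using xy(2) integral_over_def by blast
    have m0: "m > 0" using m \<open>\<one> \<noteq> \<zero>\<close> by (cases m) auto
    have mB: "y [^] m \<in> Span ?B (desc_powers y m)"
    proof -
      have "Span A (desc_powers y m) \<subseteq> Span ?B (desc_powers y m)"
        using Span_zero[OF B(1)] Span_add[OF B(1)] Span_smult[OF B(1)] Span_base[OF B(1)]
          B(2) desc_powers_carrier[OF y] by (intro Span_least_of_subring) blast+
      then show ?thesis using m by blast
    qed
    let ?L = "Span ?B (desc_powers y m)"
    note L = subring_adjoin_integral[OF B(1) y mB m0]
    let ?W = "concat (map (\<lambda>u. map (\<lambda>v. v \<otimes> u) (desc_powers x n)) (desc_powers y m))"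
    have W: "?L \<subseteq> Span A ?W"
      by (rule Span_Span[OF A desc_powers_carrier[OF x] desc_powers_carrier[OF y]])
    have Wc: "set ?W \<subseteq> carrier R" using desc_powers_carrier[OF x] desc_powers_carrier[OF y] by fastforce
    have "integral_over A z" if z: "z \<in> ?L" for z
    proof -
      have zc: "z \<in> carrier R" using L(1) z subringE(1) by blast
      have "z [^] (k::nat) \<in> ?L" for k
        by (induct k) (use L(1) z subringE(3,6)[OF L(1)] in auto)
      then have "\<And>k::nat. z [^] k \<in> Span A ?W" using W by blast
      from Span_ascending_chain[of A "?W" "\<lambda>k. z [^] k", OF A V Wc this] show ?thesis
        using zc unfolding integral_over_def desc_powers_def by blast
    qed
    then show ?thesis using L B by blast
  qed
  show AA: "A \<subseteq> {x. integral_over A x}"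
  proof
    fix a assume a: "a \<in> A"
    have "a \<in> Span A [\<one>]" unfolding Span_Cons_iff using a sub_carr[OF A] by force
    then have "a [^] (1::nat) \<in> Span A (desc_powers a 1)" using sub_carr[OF A a] by (simp add: desc_powers_def)
    then show "a \<in> {x. integral_over A x}" unfolding integral_over_def using sub_carr[OF A a] by blast
  qed
  show "subring {x. integral_over A x} R"
  proof (rule subringI)
    show "{x. integral_over A x} \<subseteq> carrier R" by (auto simp: integral_over_def)
    show "\<one> \<in> {x. integral_over A x}" using AA subringE(3)[OF A] by blast
    show "\<ominus> h \<in> {x. integral_over A x}" if "h \<in> {x. integral_over A x}" for h
      using common[of h h] that subringE(5) by (metis mem_Collect_eq)
    show "h \<otimes> h' \<in> {x. integral_over A x}" "h \<oplus> h' \<in> {x. integral_over A x}"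
      if "h \<in> {x. integral_over A x}" "h' \<in> {x. integral_over A x}" for h h'
      using common[of h h'] that subringE(6,7) by (metis mem_Collect_eq)+
  qed
qed

lemma eval_in_Span:
  assumes "set f \<subseteq> A"
  shows "eval f x \<in> Span A (desc_powers x (length f))"
  using assms
proof (induct f)
  case (Cons a f)
  then show ?case by (auto simp: desc_powers_Suc intro!: Span_ConsI)
qed simp

lemma Span_eq_eval:
  assumes "s \<in> Span A (desc_powers x n)"
  shows "\<exists>f. length f = n \<and> set f \<subseteq> A \<and> s = eval f x"
  using assms
proof (induct n arbitrary: s)
  case (Suc n)
  then obtain a t where "a \<in> A" "t \<in> Span A (desc_powers x n)" "s = a \<otimes> x [^] n \<oplus> t"
    unfolding desc_powers_Suc Span_Cons_iff by blast
  moreover obtain f where "length f = n" "set f \<subseteq> A" "t = eval f x" using Suc.hyps calculation(2) by blast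
  ultimately have "length (a # f) = Suc n \<and> set (a # f) \<subseteq> A \<and> s = eval (a # f) x" by simp
  then show ?case by blast
qed auto

text \<open>Connects spans with the equations in the definition of \<open>ring_of_integers\<close>.
  Moving the leading power to the other side costs the sign \<open>\<ominus> \<one>\<close>, which
  belongs to \<open>A\<close>.\<close>

lemma integral_over_iff_monic:
  assumes A: "subring A R" and "\<one> \<noteq> \<zero>" and x: "x \<in> carrier R"
  shows "integral_over A x \<longleftrightarrow>
    (\<exists>f \<in> carrier (univ_poly R A). f \<noteq> [] \<and> lead_coeff f = \<one> \<and> eval f x = \<zero>)"
proof
  assume "integral_over A x"
  then obtain n where n: "x [^] n \<in> Span A (desc_powers x n)" by (auto simp: integral_over_def)
  have "\<ominus> \<one> \<otimes> x [^] n \<in> Span A (desc_powers x n)"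
    using Span_smult[OF A desc_powers_carrier[OF x] _ n] subringE(3,5)[OF A] by blast
  then obtain f where f: "length f = n" "set f \<subseteq> A" "\<ominus> \<one> \<otimes> x [^] n = eval f x" using Span_eq_eval by blast
  have "\<one> # f \<in> carrier (univ_poly R A)"
    using f(2) subringE(3)[OF A] \<open>\<one> \<noteq> \<zero>\<close> by (simp add: univ_poly_carrier[symmetric] polynomial_def)
  moreover have "eval (\<one> # f) x = \<zero>" using f x by (simp add: l_minus r_neg f(3)[symmetric])
  ultimately show "\<exists>f \<in> carrier (univ_poly R A). f \<noteq> [] \<and> lead_coeff f = \<one> \<and> eval f x = \<zero>" by force
next
  assume "\<exists>f \<in> carrier (univ_poly R A). f \<noteq> [] \<and> lead_coeff f = \<one> \<and> eval f x = \<zero>"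
  then obtain g where g: "\<one> # g \<in> carrier (univ_poly R A)" "eval (\<one> # g) x = \<zero>"
    by (metis list.collapse)
  have gA: "set g \<subseteq> A" using g(1) by (auto simp: univ_poly_carrier[symmetric] polynomial_def)
  have s: "eval g x \<in> Span A (desc_powers x (length g))" by (rule eval_in_Span[OF gA])
  have sc: "eval g x \<in> carrier R" using s Span_carrier[OF A desc_powers_carrier[OF x]] by blast
  have "x [^] length g \<oplus> eval g x = \<zero>" using g(2) x by simp
  then have "x [^] length g = \<ominus> \<one> \<otimes> eval g x"
    using sc x by (simp add: l_minus sum_zero_eq_neg)
  moreover have "\<ominus> \<one> \<otimes> eval g x \<in> Span A (desc_powers x (length g))"
    using Span_smult[OF A desc_powers_carrier[OF x] _ s] subringE(3,5)[OF A] by blast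
  ultimately show "integral_over A x" unfolding integral_over_def using x by metis
qed

end

section \<open>The ring of integers and its residue field\<close>

lemma padic_ints_mod:
  assumes "z \<in> carrier (padic_ints p)" "n \<le> m"
  shows "z m mod int p ^ n = z n"
  using assms(2)
proof (induct m rule: dec_induct)
  case base
  then show ?case using assms(1) by (simp add: padic_ints_def)
next
  case (step m)
  have "z (Suc m) mod int p ^ n = (z (Suc m) mod int p ^ m) mod int p ^ n"
    using step by (simp add: mod_mod_cancel le_imp_power_dvd)
  then show ?case using step assms(1) by (simp add: padic_ints_def)
qed

lemma padic_intsI:
  assumes "p > 0" "\<And>n. f (Suc n) mod int p ^ n = f n mod int p ^ n"
  shows "(\<lambda>n. f n mod int p ^ n) \<in> carrier (padic_ints p)"
proof -
  have "f (Suc n) mod int p ^ Suc n mod int p ^ n = f n mod int p ^ n" for n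
    using assms(2)[of n] by (subst mod_mod_cancel) auto
  then show ?thesis using assms(1) by (simp add: padic_ints_def del: power_Suc)
qed

lemma padic_ints_cring:
  assumes p: "p > 0"
  shows "cring (padic_ints p)"
proof -
  have Z: "z (Suc n) mod int p ^ n = z n mod int p ^ n" if "z \<in> carrier (padic_ints p)" for z n
    using padic_ints_mod[OF that, of n n] padic_ints_mod[OF that, of n "Suc n"] by simp
  have Z2: "z n mod int p ^ n = z n" if "z \<in> carrier (padic_ints p)" for z n
    using padic_ints_mod[OF that, of n n] by simp
  have carr: "(\<lambda>n. (x n + y n) mod int p ^ n) \<in> carrier (padic_ints p)"
    "(\<lambda>n. (x n * y n) mod int p ^ n) \<in> carrier (padic_ints p)"
    "(\<lambda>n. (- x n) mod int p ^ n) \<in> carrier (padic_ints p)"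
    if "x \<in> carrier (padic_ints p)" "y \<in> carrier (padic_ints p)" for x y
    using Z[OF that(1)] Z[OF that(2)]
    by (auto intro!: padic_intsI[OF p] mod_add_cong mod_mult_cong mod_minus_cong)
  have one: "(\<lambda>n. 1 mod int p ^ n) \<in> carrier (padic_ints p)" and zero: "(\<lambda>n. 0) \<in> carrier (padic_ints p)"
    using padic_intsI[OF p, of "\<lambda>_. 1"] padic_intsI[OF p, of "\<lambda>_. 0"] by auto
  have ops: "monoid.mult (padic_ints p) = (\<lambda>x y n. (x n * y n) mod int p ^ n)"
     "\<one>\<^bsub>padic_ints p\<^esub> = (\<lambda>n. 1 mod int p ^ n)" "\<zero>\<^bsub>padic_ints p\<^esub> = (\<lambda>n. 0)"
     "ring.add (padic_ints p) = (\<lambda>x y n. (x n + y n) mod int p ^ n)"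
    by (auto simp: padic_ints_def)
  show ?thesis
  proof (rule cringI)
    show "abelian_group (padic_ints p)"
    proof (rule abelian_groupI)
      show "\<exists>y\<in>carrier (padic_ints p). y \<oplus>\<^bsub>padic_ints p\<^esub> x = \<zero>\<^bsub>padic_ints p\<^esub>" if x: "x \<in> carrier (padic_ints p)" for x
        by (rule bexI[OF _ carr(3)[OF x x]]) (simp add: ops mod_simps)
    qed (auto simp: ops carr zero Z2 mod_simps ac_simps)
    show "comm_monoid (padic_ints p)"
      by (rule comm_monoidI) (auto simp: ops carr one Z2 mod_simps ac_simps)
  qed (auto simp: ops mod_simps algebra_simps)
qed


text \<open>The hypotheses say that \<open>z\<close> has valuation exactly \<open>v\<close> and
  \<open>w\<close> valuation at least \<open>v\<close>. After cancelling \<open>p ^ v\<close> the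
  cofactor of \<open>z\<close> is prime to \<open>p\<close>, so the quotient can be computed modulo
  each power of \<open>p\<close> by Bezout, and its uniqueness there makes the results
  coherent.\<close>

lemma padic_ints_one_step:
  assumes "normalization_semidom_class.prime p" "z \<in> carrier (padic_ints p)" "w \<in> carrier (padic_ints p)"
    and v: "z v = 0" "z (Suc v) \<noteq> 0" "w v = 0"
  shows "\<exists>c\<in>carrier (padic_ints p). w = c \<otimes>\<^bsub>padic_ints p\<^esub> z"
proof -
  have p: "p > 0" using assms(1) by (simp add: prime_gt_0_nat)
  \<comment> \<open>Division by \<open>p ^ v\<close> costs \<open>v\<close> digits, so the residues
    modulo \<open>p ^ n\<close> of the cofactors are read off at \<open>n + v\<close>.\<close>
  define a where "a n = z (n + v) div int p ^ v" for n
  define b where "b n = w (n + v) div int p ^ v" for n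
  have za: "z (n + v) = int p ^ v * a n" and wb: "w (n + v) = int p ^ v * b n" for n
    using padic_ints_mod[OF assms(2), of v "n + v"] padic_ints_mod[OF assms(3), of v "n + v"] v
    by (auto simp: a_def b_def)
  have cop: "coprime (a n) (int p ^ m)" if "n > 0" for n m
  proof -
    have "\<not> int p dvd a n"
    proof
      assume "int p dvd a n"
      then have "int p ^ Suc v dvd z (n + v)" unfolding za by (auto simp: mult.commute)
      moreover have "z (n + v) mod int p ^ Suc v = z (Suc v)"
        using padic_ints_mod[OF assms(2), of "Suc v" "n + v"] that by simp
      ultimately show False using v by (simp del: power_Suc)
    qed
    moreover have "normalization_semidom_class.prime (int p)" using assms(1) by simp
    ultimately have "coprime (int p) (a n)" by (rule prime_imp_coprime[rotated])
    then show ?thesis by (simp add: coprime_commute)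
  qed
  \<comment> \<open>Solved at \<open>Suc n\<close>, because \<open>a n\<close> is known to be prime
    to \<open>p\<close> for positive index only.\<close>
  have "\<exists>x. (x * a (Suc n)) mod int p ^ Suc n = b (Suc n) mod int p ^ Suc n" for n
  proof -
    obtain u u' where h: "u * a (Suc n) + u' * int p ^ Suc n = 1"
      using bezout_int[of "a (Suc n)" "int p ^ Suc n"] cop[of "Suc n" "Suc n"] by (auto simp del: power_Suc)
    have "(b (Suc n) * u) * a (Suc n) - b (Suc n)
        = b (Suc n) * (u * a (Suc n)) - b (Suc n) * (u * a (Suc n) + u' * int p ^ Suc n)"
      unfolding h by (simp add: mult.assoc)
    also have "\<dots> = int p ^ Suc n * (- b (Suc n) * u')" by (simp add: algebra_simps)
    finally show ?thesis by (metis dvd_triv_left mod_eq_dvd_iff)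
  qed
  then obtain x where x: "\<And>n. (x n * a (Suc n)) mod int p ^ Suc n = b (Suc n) mod int p ^ Suc n" by metis
  \<comment> \<open>The solution \<open>x n\<close> is right modulo \<open>p ^ Suc n\<close>;
    reducing it modulo \<open>p ^ n\<close> gives away one digit and restores the indexing of
    \<open>padic_ints\<close>.\<close>
  define c where "c = (\<lambda>n. x n mod int p ^ n)"
  have key: "int p ^ (Suc n + v) dvd x n * z (Suc n + v) - w (Suc n + v)" for n
  proof -
    have "int p ^ Suc n dvd x n * a (Suc n) - b (Suc n)"
      using x[of n] by (simp add: mod_eq_dvd_iff)
    then have "int p ^ v * int p ^ Suc n dvd int p ^ v * (x n * a (Suc n) - b (Suc n))"
      by (rule mult_dvd_mono[OF dvd_refl])
    also have "int p ^ v * (x n * a (Suc n) - b (Suc n)) = x n * z (Suc n + v) - w (Suc n + v)"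
      unfolding za wb by (simp add: algebra_simps)
    finally show ?thesis by (simp add: power_add algebra_simps)
  qed
  have "c \<in> carrier (padic_ints p)"
    unfolding c_def
  proof (rule padic_intsI[OF p])
    fix n
    have zz: "int p ^ (Suc n + v) dvd y (Suc (Suc n) + v) - y (Suc n + v)" if "y \<in> carrier (padic_ints p)" for y
      using padic_ints_mod[OF that, of "Suc n + v" "Suc (Suc n) + v"] padic_ints_mod[OF that, of "Suc n + v" "Suc n + v"]
      by (simp add: mod_eq_dvd_iff[symmetric] del: power_Suc)
    have "int p ^ (Suc n + v) dvd x (Suc n) * z (Suc (Suc n) + v) - w (Suc (Suc n) + v)"
      using key[of "Suc n"] by (rule dvd_trans[rotated]) (simp add: le_imp_power_dvd del: power_Suc)
    \<comment> \<open>The congruences for \<open>n\<close> and \<open>Suc n\<close> are subtracted,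
      \<open>z\<close> and \<open>w\<close> being coherent. The factor \<open>a (Suc n)\<close>,
      prime to \<open>p\<close>, then cancels.\<close>
    then have "int p ^ (Suc n + v) dvd
        (x (Suc n) * z (Suc (Suc n) + v) - w (Suc (Suc n) + v)) - x (Suc n) * (z (Suc (Suc n) + v) - z (Suc n + v))
        + (w (Suc (Suc n) + v) - w (Suc n + v)) - (x n * z (Suc n + v) - w (Suc n + v))"
      using key[of n] zz[OF assms(2)] zz[OF assms(3)] by (meson dvd_add dvd_diff dvd_mult)
    also have "\<dots> = (x (Suc n) - x n) * z (Suc n + v)" by (simp add: algebra_simps)
    also have "\<dots> = int p ^ v * ((x (Suc n) - x n) * a (Suc n))" unfolding za by simp
    finally have "int p ^ v * int p ^ Suc n dvd int p ^ v * ((x (Suc n) - x n) * a (Suc n))"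
      by (simp add: power_add algebra_simps)
    then have "int p ^ Suc n dvd (x (Suc n) - x n) * a (Suc n)" using p by (simp del: power_Suc)
    then have "int p ^ Suc n dvd x (Suc n) - x n"
      using cop[of "Suc n" "Suc n"] by (metis coprime_commute coprime_dvd_mult_left_iff zero_less_Suc)
    then have "int p ^ n dvd x (Suc n) - x n" by (metis dvd_trans le_imp_power_dvd lessI less_imp_le)
    then show "x (Suc n) mod int p ^ n = x n mod int p ^ n" by (simp add: mod_eq_dvd_iff)
  qed
  moreover have "w n = (c n * z n) mod int p ^ n" for n
  proof -
    have "int p ^ n dvd x n * z (Suc n + v) - w (Suc n + v)"
      using key[of n] by (rule dvd_trans[rotated]) (simp add: le_imp_power_dvd del: power_Suc)
    then have "(x n * z (Suc n + v)) mod int p ^ n = w (Suc n + v) mod int p ^ n"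
      by (simp add: mod_eq_dvd_iff)
    also have "\<dots> = w n" by (rule padic_ints_mod[OF assms(3)]) simp
    finally have "(x n mod int p ^ n * (z (Suc n + v) mod int p ^ n)) mod int p ^ n = w n" by (simp add: mod_mult_eq)
    moreover have "z (Suc n + v) mod int p ^ n = z n" by (rule padic_ints_mod[OF assms(2)]) simp
    ultimately show ?thesis by (simp add: c_def)
  qed
  ultimately show ?thesis by (intro bexI[of _ c]) (auto simp: padic_ints_def)
qed

lemma padic_ints_0: "z \<in> carrier (padic_ints p) \<Longrightarrow> z 0 = 0"
  by (drule padic_ints_mod[of z p 0 0]) auto

text \<open>A pivot is an entry of minimal valuation.\<close>

lemma padic_ints_pivot:
  fixes a :: "nat \<Rightarrow> nat \<Rightarrow> int"
  assumes "normalization_semidom_class.prime p" "\<And>n. a n \<in> carrier (padic_ints p)"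
  shows "\<exists>m. \<forall>n. \<exists>c\<in>carrier (padic_ints p). a n = c \<otimes>\<^bsub>padic_ints p\<^esub> a m"
proof (cases "\<exists>v n. a n (Suc v) \<noteq> 0")
  case False
  interpret cring "padic_ints p" using padic_ints_cring assms(1) prime_gt_0_nat by blast
  have "a n i = 0" for n i using False padic_ints_0[OF assms(2)] by (cases i) auto
  then have "a n = \<zero>\<^bsub>padic_ints p\<^esub>" for n by (auto simp: padic_ints_def)
  then have "a n = \<one>\<^bsub>padic_ints p\<^esub> \<otimes>\<^bsub>padic_ints p\<^esub> a 0" for n by simp
  then show ?thesis by blast
next
  case True
  define v where "v = (LEAST v. \<exists>n. a n (Suc v) \<noteq> 0)"
  obtain m where m: "a m (Suc v) \<noteq> 0" using LeastI_ex[OF True] unfolding v_def by blast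
  have "a n v = 0" for n
  proof (cases v)
    case 0
    then show ?thesis using padic_ints_0[OF assms(2)] by simp
  next
    case (Suc u)
    then show ?thesis using not_less_Least[of u "\<lambda>v. \<exists>n. a n (Suc v) \<noteq> 0"] unfolding v_def[symmetric] by auto
  qed
  then show ?thesis using padic_ints_one_step[OF assms(1,2,2) _ m] by blast
qed

lemma padic_ints_nat:
  assumes "p > 0"
  shows "[k] \<cdot>\<^bsub>padic_ints p\<^esub> \<one>\<^bsub>padic_ints p\<^esub> = (\<lambda>n. int k mod int p ^ n)"
proof -
  interpret cring "padic_ints p" using padic_ints_cring assms by blast
  show ?thesis
    by (induct k) (auto simp: add.nat_pow_Suc simp del: add_pow_def, auto simp: padic_ints_def mod_simps add.commute)
qed

text \<open>The residue \<open>z 1\<close> decides: if it is 0 then \<open>z\<close> is divisible by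
  \<open>p\<close>, which has valuation 1; otherwise \<open>z\<close> has valuation 0 and divides 1.
  Subtracting \<open>z 1\<close>, a natural number below \<open>p\<close>, reduces the first claim
  to the divisible case.\<close>

lemma padic_ints_unit_or_multiple:
  assumes "normalization_semidom_class.prime p" and z: "z \<in> carrier (padic_ints p)"
  shows "\<exists>k<p. \<exists>y\<in>carrier (padic_ints p). z = [k] \<cdot>\<^bsub>padic_ints p\<^esub> \<one>\<^bsub>padic_ints p\<^esub> \<oplus>\<^bsub>padic_ints p\<^esub>
      y \<otimes>\<^bsub>padic_ints p\<^esub> ([p] \<cdot>\<^bsub>padic_ints p\<^esub> \<one>\<^bsub>padic_ints p\<^esub>)"
    and "(\<exists>y\<in>carrier (padic_ints p). z = y \<otimes>\<^bsub>padic_ints p\<^esub> ([p] \<cdot>\<^bsub>padic_ints p\<^esub> \<one>\<^bsub>padic_ints p\<^esub>)) \<or>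
      (\<exists>y\<in>carrier (padic_ints p). y \<otimes>\<^bsub>padic_ints p\<^esub> z = \<one>\<^bsub>padic_ints p\<^esub>)"
proof -
  have p: "p > 0" "p > 1" using assms(1) prime_gt_0_nat prime_gt_1_nat by auto
  interpret Z: cring "padic_ints p" using padic_ints_cring p by blast
  let ?P = "[p] \<cdot>\<^bsub>padic_ints p\<^esub> \<one>\<^bsub>padic_ints p\<^esub>"
  have Pc: "?P \<in> carrier (padic_ints p)" by simp
  have P: "?P 1 = 0" "?P (Suc 1) \<noteq> 0"
    unfolding padic_ints_nat[OF p(1)] using p by auto
  have mult: "\<exists>y\<in>carrier (padic_ints p). w = y \<otimes>\<^bsub>padic_ints p\<^esub> ?P" if "w \<in> carrier (padic_ints p)" "w 1 = 0" for w
    using padic_ints_one_step[OF assms(1) Pc that(1) P that(2)] .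
  show "(\<exists>y\<in>carrier (padic_ints p). z = y \<otimes>\<^bsub>padic_ints p\<^esub> ?P) \<or>
      (\<exists>y\<in>carrier (padic_ints p). y \<otimes>\<^bsub>padic_ints p\<^esub> z = \<one>\<^bsub>padic_ints p\<^esub>)"
  proof (cases "z 1 = 0")
    case False
    then show ?thesis
      using padic_ints_one_step[OF assms(1) z Z.one_closed padic_ints_0[OF z] _ padic_ints_0[OF Z.one_closed]] by force
  qed (use mult z in blast)
  define w where "w = (\<lambda>n. (z n - z 1) mod int p ^ n)"
  have wc: "w \<in> carrier (padic_ints p)" unfolding w_def
    using padic_ints_mod[OF z, of n n for n] padic_ints_mod[OF z, of n "Suc n" for n]
    by (intro padic_intsI[OF p(1)] mod_diff_cong) auto
  obtain y where y: "y \<in> carrier (padic_ints p)" "w = y \<otimes>\<^bsub>padic_ints p\<^esub> ?P" using mult[OF wc] by (auto simp: w_def)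
  have z1: "0 \<le> z 1" "z 1 < int p" using z by (auto simp: padic_ints_def dest!: spec[of _ 1])
  have "z = [nat (z 1)] \<cdot>\<^bsub>padic_ints p\<^esub> \<one>\<^bsub>padic_ints p\<^esub> \<oplus>\<^bsub>padic_ints p\<^esub> w"
    unfolding padic_ints_nat[OF p(1)] using z1 padic_ints_mod[OF z, of n n for n]
    by (auto simp: padic_ints_def w_def mod_simps)
  then show "\<exists>k<p. \<exists>y\<in>carrier (padic_ints p). z = [k] \<cdot>\<^bsub>padic_ints p\<^esub> \<one>\<^bsub>padic_ints p\<^esub> \<oplus>\<^bsub>padic_ints p\<^esub>
      y \<otimes>\<^bsub>padic_ints p\<^esub> ?P" using y z1 by (intro exI[of _ "nat (z 1)"]) auto
qed

section \<open>Fields of fractions inside a field\<close>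

text \<open>This form avoids inverses: closure under the ring operations becomes a matter of
  multiplying denominators.\<close>

lemma (in field) fractions_in_iff:
  assumes "subring A R"
  shows "x \<in> fractions_in R A \<longleftrightarrow> x \<in> carrier R \<and> (\<exists>b\<in>A. b \<noteq> \<zero> \<and> x \<otimes> b \<in> A)"
proof
  assume "x \<in> fractions_in R A"
  then obtain a b where ab: "x = a \<otimes> inv b" "a \<in> A" "b \<in> A" "b \<noteq> \<zero>" unfolding fractions_in_def by blast
  have c: "a \<in> carrier R" "b \<in> Units R" "b \<in> carrier R" using ab subringE(1)[OF assms] field_Units by auto
  then have "x \<otimes> b = a" using ab by (simp add: m_assoc)
  then show "x \<in> carrier R \<and> (\<exists>b\<in>A. b \<noteq> \<zero> \<and> x \<otimes> b \<in> A)" using ab c by auto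
next
  assume "x \<in> carrier R \<and> (\<exists>b\<in>A. b \<noteq> \<zero> \<and> x \<otimes> b \<in> A)"
  then obtain b where b: "x \<in> carrier R" "b \<in> A" "b \<noteq> \<zero>" "x \<otimes> b \<in> A" by blast
  then have "b \<in> Units R" "b \<in> carrier R" using subringE(1)[OF assms] field_Units by auto
  then have "x = (x \<otimes> b) \<otimes> inv b" using b by (simp add: m_assoc)
  then show "x \<in> fractions_in R A" unfolding fractions_in_def using b by blast
qed

lemma (in field) fractions_in_subfield:
  assumes A: "subring A R"
  shows "subfield (fractions_in R A) R"
proof (rule subfieldI')
  note iff = fractions_in_iff[OF A]
  have Ac: "a \<in> A \<Longrightarrow> a \<in> carrier R" for a using subringE(1)[OF A] by blast
  show "subring (fractions_in R A) R"
  proof (rule subringI)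
    show "fractions_in R A \<subseteq> carrier R" using iff by blast
    show "\<one> \<in> fractions_in R A" unfolding iff using subringE(3)[OF A] by force
    show "\<ominus> h \<in> fractions_in R A" if h: "h \<in> fractions_in R A" for h
    proof -
      obtain b where b: "h \<in> carrier R" "b \<in> A" "b \<noteq> \<zero>" "h \<otimes> b \<in> A" using h iff by blast
      then have "\<ominus> h \<otimes> b \<in> A" using subringE(5)[OF A] Ac by (simp add: l_minus)
      then show ?thesis unfolding iff using b by blast
    qed
    fix h k assume "h \<in> fractions_in R A" "k \<in> fractions_in R A"
    then obtain b c where b: "h \<in> carrier R" "b \<in> A" "b \<noteq> \<zero>" "h \<otimes> b \<in> A"
      and c: "k \<in> carrier R" "c \<in> A" "c \<noteq> \<zero>" "k \<otimes> c \<in> A" using iff by metis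
    have bc: "b \<otimes> c \<in> A" "b \<otimes> c \<noteq> \<zero>" using b c subringE(6)[OF A] Ac integral_iff by auto
    have "(h \<otimes> k) \<otimes> (b \<otimes> c) = (h \<otimes> b) \<otimes> (k \<otimes> c)" using b c Ac[OF b(2)] Ac[OF c(2)] by algebra
    then have "(h \<otimes> k) \<otimes> (b \<otimes> c) \<in> A" using b c subringE(6)[OF A] by simp
    then show "h \<otimes> k \<in> fractions_in R A" unfolding iff using bc b c by blast
    have "(h \<oplus> k) \<otimes> (b \<otimes> c) = (h \<otimes> b) \<otimes> c \<oplus> (k \<otimes> c) \<otimes> b" using b c Ac[OF b(2)] Ac[OF c(2)] by algebra
    then have "(h \<oplus> k) \<otimes> (b \<otimes> c) \<in> A" using b c subringE(6,7)[OF A] by simp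
    then show "h \<oplus> k \<in> fractions_in R A" unfolding iff using bc b c by blast
  qed
  fix k assume "k \<in> fractions_in R A - {\<zero>}"
  then obtain b where b: "k \<in> carrier R" "k \<noteq> \<zero>" "b \<in> A" "b \<noteq> \<zero>" "k \<otimes> b \<in> A" using iff by blast
  have u: "k \<in> Units R" using b field_Units by auto
  have "inv k \<otimes> (k \<otimes> b) = b" using u b Ac[OF b(3)] by (simp add: m_assoc[symmetric])
  moreover have "k \<otimes> b \<noteq> \<zero>" using b Ac integral_iff by auto
  ultimately show "inv k \<in> fractions_in R A" unfolding iff using b u by (metis Units_inv_closed)
qed

section \<open>The ring of integers as an integral closure\<close>

locale padic_extension = field K for p and K :: "'k ring" (structure) and \<iota> and \<pi> +
  assumes prime_p: "normalization_semidom_class.prime p"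
    and ext: "finite_extension_of_Qp p K \<iota>"
    and unif: "uniformizer p K \<iota> \<pi>"
begin

abbreviation "A \<equiv> \<iota> ` carrier (padic_ints p)"
abbreviation "OK \<equiv> ring_of_integers p K \<iota>"
abbreviation "P \<equiv> [p] \<cdot>\<^bsub>K\<^esub> \<one>"
abbreviation "I \<equiv> PIdl\<^bsub>OK\<^esub> \<pi>"

lemma p_pos: "p > 0" "p > 1"
  using prime_p prime_gt_0_nat prime_gt_1_nat by auto

sublocale Z: cring "padic_ints p"
  by (rule padic_ints_cring[OF p_pos(1)])

lemma hom: "\<iota> \<in> ring_hom (padic_ints p) K" and inj: "inj_on \<iota> (carrier (padic_ints p))"
  using ext by (auto simp: finite_extension_of_Qp_def)

sublocale h: ring_hom_cring "padic_ints p" K \<iota>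
  by unfold_locales (rule hom)

lemma subring_A: "subring A K"
  using ring_hom_ring.img_is_subring[OF ring_hom_ringI2[OF Z.ring_axioms ring_axioms hom] Z.carrier_is_subring] .

lemma A_closed: "a \<in> A \<Longrightarrow> a \<in> carrier K"
  using subringE(1)[OF subring_A] by blast

lemma hom_nat: "\<iota> ([(k::nat)] \<cdot>\<^bsub>padic_ints p\<^esub> \<one>\<^bsub>padic_ints p\<^esub>) = [k] \<cdot>\<^bsub>K\<^esub> \<one>"
proof (induct k)
  case (Suc k)
  then show ?case by (simp add: Z.add.nat_pow_Suc add.nat_pow_Suc)
qed simp

text \<open>Supplies the property \<open>V\<close> of \<open>Span_ascending_chain\<close> for the
  copy of the p-adic integers in \<open>K\<close>.\<close>

lemma pivot:
  assumes "\<And>n::nat. a n \<in> A"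
  shows "\<exists>m. \<forall>n. \<exists>c\<in>A. a n = c \<otimes> a m"
proof -
  have "\<forall>n. \<exists>z\<in>carrier (padic_ints p). a n = \<iota> z" using assms by blast
  then obtain z where z: "\<And>n. z n \<in> carrier (padic_ints p)" "\<And>n. a n = \<iota> (z n)" by metis
  obtain m where m: "\<forall>n. \<exists>c\<in>carrier (padic_ints p). z n = c \<otimes>\<^bsub>padic_ints p\<^esub> z m"
    using padic_ints_pivot[OF prime_p, of z] z(1) by blast
  have "\<exists>c\<in>A. a n = c \<otimes> a m" for n
  proof -
    obtain c where "c \<in> carrier (padic_ints p)" "z n = c \<otimes>\<^bsub>padic_ints p\<^esub> z m" using m by blast
    then show ?thesis unfolding z(2) using z(1) by auto
  qed
  then show ?thesis by blast
qed

lemma A_decomp: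
  assumes "a \<in> A"
  shows "\<exists>k<p. \<exists>y\<in>A. a = [k] \<cdot>\<^bsub>K\<^esub> \<one> \<oplus> y \<otimes> P" "(\<exists>y\<in>A. a = y \<otimes> P) \<or> (\<exists>y\<in>A. y \<otimes> a = \<one>)"
proof -
  obtain z where z: "z \<in> carrier (padic_ints p)" "a = \<iota> z" using assms by blast
  obtain k y where "k < p" "y \<in> carrier (padic_ints p)"
    "z = [k] \<cdot>\<^bsub>padic_ints p\<^esub> \<one>\<^bsub>padic_ints p\<^esub> \<oplus>\<^bsub>padic_ints p\<^esub> y \<otimes>\<^bsub>padic_ints p\<^esub> ([p] \<cdot>\<^bsub>padic_ints p\<^esub> \<one>\<^bsub>padic_ints p\<^esub>)"
    using padic_ints_unit_or_multiple(1)[OF prime_p z(1)] by blast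
  then show "\<exists>k<p. \<exists>y\<in>A. a = [k] \<cdot>\<^bsub>K\<^esub> \<one> \<oplus> y \<otimes> P" unfolding z(2) by (auto simp: hom_nat)
  show "(\<exists>y\<in>A. a = y \<otimes> P) \<or> (\<exists>y\<in>A. y \<otimes> a = \<one>)"
    using padic_ints_unit_or_multiple(2)[OF prime_p z(1)]
  proof (elim disjE bexE)
    fix y assume y: "y \<in> carrier (padic_ints p)" "z = y \<otimes>\<^bsub>padic_ints p\<^esub> ([p] \<cdot>\<^bsub>padic_ints p\<^esub> \<one>\<^bsub>padic_ints p\<^esub>)"
    then have "a = \<iota> y \<otimes> P" unfolding z(2) by (simp add: hom_nat)
    then show ?thesis using y by blast
  next
    fix y assume y: "y \<in> carrier (padic_ints p)" "y \<otimes>\<^bsub>padic_ints p\<^esub> z = \<one>\<^bsub>padic_ints p\<^esub>"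
    then have "\<iota> y \<otimes> a = \<one>" unfolding z(2) using z h.hom_mult h.hom_one by metis
    then show ?thesis using y by blast
  qed
qed

text \<open>As \<iota> is injective, the question can be decided in the p-adic integers, where a
  multiple of \<open>p\<close> has residue 0 modulo \<open>p\<close>.\<close>

lemma one_not_multiple_P: "y \<in> A \<Longrightarrow> y \<otimes> P \<noteq> \<one>"
proof
  assume y: "y \<in> A" "y \<otimes> P = \<one>"
  then obtain z where z: "z \<in> carrier (padic_ints p)" "y = \<iota> z" by blast
  let ?q = "[p] \<cdot>\<^bsub>padic_ints p\<^esub> \<one>\<^bsub>padic_ints p\<^esub>"
  have "\<iota> (z \<otimes>\<^bsub>padic_ints p\<^esub> ?q) = \<iota> \<one>\<^bsub>padic_ints p\<^esub>" using y z by (simp add: hom_nat)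
  then have "z \<otimes>\<^bsub>padic_ints p\<^esub> ?q = \<one>\<^bsub>padic_ints p\<^esub>" using inj z by (simp add: inj_on_def)
  then have "(z \<otimes>\<^bsub>padic_ints p\<^esub> ?q) 1 = \<one>\<^bsub>padic_ints p\<^esub> 1" by simp
  then show False unfolding padic_ints_nat[OF p_pos(1)] using p_pos by (simp add: padic_ints_def)
qed

lemma carrier_OK: "carrier OK = {x. integral_over A x}"
proof -
  have "x \<in> carrier OK \<longleftrightarrow> integral_over A x" for x
    using integral_over_iff_monic[OF subring_A one_not_zero, of x]
    by (cases "x \<in> carrier K") (auto simp: ring_of_integers_def integral_over_def)
  then show ?thesis by blast
qed

lemma subring_OK: "subring (carrier OK) K" and A_OK: "A \<subseteq> carrier OK"
  unfolding carrier_OK using integral_subring[OF subring_A one_not_zero pivot] by auto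

lemma OK_eq: "OK = K\<lparr>carrier := carrier OK\<rparr>"
  by (simp add: ring_of_integers_def)

lemma OK_simps [simp]:
  "monoid.mult OK = monoid.mult K" "one OK = one K" "ring.add OK = ring.add K" "ring.zero OK = ring.zero K"
  by (auto simp: ring_of_integers_def)

sublocale O: cring OK
  using subcring_iff[OF subringE(1)[OF subring_OK]] subcringI[OF subring_OK] subringE(1)[OF subring_OK] m_comm
  by (subst OK_eq) auto

lemma OK_closed: "x \<in> carrier OK \<Longrightarrow> x \<in> carrier K"
  using subringE(1)[OF subring_OK] by blast

lemma OK_sub: "a \<in> carrier OK \<Longrightarrow> b \<in> carrier OK \<Longrightarrow> a \<otimes> b \<in> carrier OK"
   "a \<in> carrier OK \<Longrightarrow> b \<in> carrier OK \<Longrightarrow> a \<oplus> b \<in> carrier OK"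
   "a \<in> carrier OK \<Longrightarrow> \<ominus> a \<in> carrier OK" "\<zero> \<in> carrier OK" "\<one> \<in> carrier OK"
  using subringE[OF subring_OK] by auto

lemma pi_OK: "\<pi> \<in> carrier OK" and I_eq: "I = carrier OK - Units OK"
  using unif by (auto simp: uniformizer_def)

lemma ideal_I: "ideal I OK"
  by (rule O.cgenideal_ideal[OF pi_OK])

lemma one_not_I: "\<one> \<notin> I"
  unfolding I_eq using O.Units_one_closed by simp

lemma I_sub: "a \<in> I \<Longrightarrow> b \<in> carrier OK \<Longrightarrow> b \<otimes> a \<in> I" "a \<in> I \<Longrightarrow> b \<in> carrier OK \<Longrightarrow> a \<otimes> b \<in> I"
   "a \<in> I \<Longrightarrow> b \<in> I \<Longrightarrow> a \<oplus> b \<in> I" "a \<in> I \<Longrightarrow> \<ominus> a \<in> I" "\<zero> \<in> I" "a \<in> I \<Longrightarrow> a \<in> carrier OK"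
proof -
  interpret J: ideal I OK by (rule ideal_I)
  show l: "a \<in> I \<Longrightarrow> b \<in> carrier OK \<Longrightarrow> b \<otimes> a \<in> I" for a b using J.I_l_closed[of a b] by simp
  show "a \<in> I \<Longrightarrow> b \<in> carrier OK \<Longrightarrow> a \<otimes> b \<in> I" using J.I_r_closed[of a b] by simp
  show "a \<in> I \<Longrightarrow> b \<in> I \<Longrightarrow> a \<oplus> b \<in> I" using J.a_closed[of a b] by simp
  show "\<zero> \<in> I" using J.zero_closed by simp
  show c: "a \<in> I \<Longrightarrow> a \<in> carrier OK" for a using J.a_subset by blast
  show "\<ominus> a \<in> I" if a: "a \<in> I"
    using l[OF a OK_sub(3)[OF OK_sub(5)]] OK_closed[OF c[OF a]] by (simp add: l_minus)
qed

text \<open>If \<open>p\<close> were a unit of the ring of integers, its inverse \<open>y\<close>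
  would be integral. Multiplying the integral equation of \<open>y\<close> by the
  \<open>n\<close>-th power of \<open>p\<close> turns the leading term into 1 and all others into
  multiples of \<open>p\<close> by elements of \<open>A\<close>, against
  \<open>one_not_multiple_P\<close>.\<close>

lemma P_I: "P \<in> I"
proof (rule ccontr)
  have PA: "P \<in> A" using hom_nat[of p] Z.add.nat_pow_closed[OF Z.one_closed] by (metis imageI)
  have Pc: "P \<in> carrier K" by simp
  assume "P \<notin> I"
  then have "P \<in> Units OK" using A_OK PA I_eq by blast
  then obtain y where y: "y \<in> carrier OK" "y \<otimes> P = \<one>" unfolding Units_def by auto
  have yc: "y \<in> carrier K" using y OK_closed by blast
  obtain n where n: "y [^] n \<in> Span A (desc_powers y n)"
    using y by (auto simp: carrier_OK integral_over_def)
  have yP: "y [^] k \<otimes> P [^] k = \<one>" for k :: nat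
    using y yc by (metis Pc nat_pow_distrib nat_pow_one m_comm)
  have PA': "P [^] (k::nat) \<in> A" for k
    by (induct k) (use PA subringE(3,6)[OF subring_A] in auto)
  \<comment> \<open>A combination of powers of \<open>y\<close> with exponents below
    \<open>k\<close> keeps at least one factor \<open>P\<close> after multiplication by the
    \<open>k\<close>-th power of \<open>P\<close>, because \<open>y\<close> and \<open>P\<close>
    cancel.\<close>
  have "\<exists>c\<in>A. s \<otimes> P [^] k = c \<otimes> P" if "s \<in> Span A (desc_powers y k)" for s and k :: nat
    using that
  proof (induct k arbitrary: s)
    case 0
    then have "s \<otimes> P [^] (0::nat) = \<zero> \<otimes> P" by simp
    then show ?case using subringE(2)[OF subring_A] by blast
  next
    case (Suc k)
    obtain a t where at: "a \<in> A" "t \<in> Span A (desc_powers y k)" "s = a \<otimes> y [^] k \<oplus> t"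
      using Suc.prems unfolding desc_powers_Suc Span_Cons_iff by blast
    obtain c where c: "c \<in> A" "t \<otimes> P [^] k = c \<otimes> P" using Suc.hyps[OF at(2)] by blast
    have carr: "a \<in> carrier K" "t \<in> carrier K" "c \<in> carrier K"
      using A_closed[OF at(1)] A_closed[OF c(1)] subsetD[OF Span_carrier[OF subring_A desc_powers_carrier[OF yc]] at(2)]
      by auto
    have gen: "(a \<otimes> Y \<oplus> t) \<otimes> (Q \<otimes> x) = a \<otimes> (Y \<otimes> Q) \<otimes> x \<oplus> (t \<otimes> Q) \<otimes> x"
      if "Y \<in> carrier K" "Q \<in> carrier K" "x \<in> carrier K" for Y Q x
      using carr that by (simp add: l_distr r_distr m_ac)
    have "s \<otimes> P [^] Suc k = a \<otimes> (y [^] k \<otimes> P [^] k) \<otimes> P \<oplus> (t \<otimes> P [^] k) \<otimes> P"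
      unfolding at(3) nat_pow_Suc by (rule gen) (use yc Pc in simp_all)
    also have "\<dots> = (a \<oplus> c \<otimes> P) \<otimes> P"
      unfolding yP c(2) using carr Pc by (simp add: l_distr)
    finally show ?case
      using subringE(7)[OF subring_A at(1) subringE(6)[OF subring_A c(1) PA]] by (rule bexI)
  qed
  then obtain c where "c \<in> A" "y [^] n \<otimes> P [^] n = c \<otimes> P" using n by blast
  then show False using one_not_multiple_P[of c] yP[of n] by simp
qed

abbreviation "\<kappa> \<equiv> residue_field p K \<iota> \<pi>"

text \<open>The ideal \<open>I\<close> consists of all nonunits, so a strictly larger ideal contains
  a unit.\<close>

lemma field_residue: "field \<kappa>"
proof -
  have "maximalideal I OK"
  proof (rule maximalidealI[OF ideal_I])
    show "carrier OK \<noteq> I" using one_not_I OK_sub(5) by auto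
    fix J assume J: "ideal J OK" "I \<subseteq> J" "J \<subseteq> carrier OK"
    show "J = I \<or> J = carrier OK"
    proof (cases "J = I")
      case False
      then obtain u where u: "u \<in> J" "u \<in> Units OK" using J I_eq by blast
      then have "\<one>\<^bsub>OK\<^esub> \<in> J" using ideal.I_l_closed[OF J(1) u(1), of "inv\<^bsub>OK\<^esub> u"] O.Units_l_inv by auto
      then show ?thesis using ideal.one_imp_carrier[OF J(1)] by auto
    qed simp
  qed
  then show ?thesis
    unfolding residue_field_def using maximalideal.quotient_is_field O.cring_axioms by blast
qed

sublocale q: ring_hom_cring OK \<kappa> "(+>\<^bsub>OK\<^esub>) I"
  unfolding residue_field_def by (rule ideal.rcos_ring_hom_cring[OF ideal_I O.cring_axioms])

lemma residue_surj: "carrier \<kappa> = (\<lambda>x. I +>\<^bsub>OK\<^esub> x) ` carrier OK"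
  unfolding residue_field_def FactRing_def A_RCOSETS_def' by auto

lemma residue_eqI:
  assumes "x \<in> carrier OK" "y \<in> carrier OK" "x \<ominus> y \<in> I"
  shows "I +>\<^bsub>OK\<^esub> x = I +>\<^bsub>OK\<^esub> y"
proof -
  interpret J: ideal I OK by (rule ideal_I)
  have d: "x \<ominus> y \<in> carrier OK" using assms(3) I_sub(6) by blast
  have "x = (x \<ominus> y) \<oplus>\<^bsub>OK\<^esub> y" using OK_closed assms by (simp, algebra)
  then have "I +>\<^bsub>OK\<^esub> x = (I +>\<^bsub>OK\<^esub> (x \<ominus> y)) \<oplus>\<^bsub>\<kappa>\<^esub> (I +>\<^bsub>OK\<^esub> y)"
    using q.hom_add[OF d assms(2)] by metis
  also have "I +>\<^bsub>OK\<^esub> (x \<ominus> y) = \<zero>\<^bsub>\<kappa>\<^esub>"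
    unfolding residue_field_def FactRing_def using assms(3) d by (simp add: J.a_rcos_const)
  finally show ?thesis using q.hom_closed[OF assms(2)] by simp
qed

lemma residue_char: "[p] \<cdot>\<^bsub>\<kappa>\<^esub> \<one>\<^bsub>\<kappa>\<^esub> = \<zero>\<^bsub>\<kappa>\<^esub>"
proof -
  have "[k] \<cdot>\<^bsub>\<kappa>\<^esub> \<one>\<^bsub>\<kappa>\<^esub> = I +>\<^bsub>OK\<^esub> ([(k::nat)] \<cdot>\<^bsub>K\<^esub> \<one>) \<and> [k] \<cdot>\<^bsub>K\<^esub> \<one> \<in> carrier OK" for k
  proof (induct k)
    case 0
    then show ?case using q.hom_zero OK_sub(4) by simp
  next
    case (Suc k)
    then show ?case using q.hom_add[of "[k] \<cdot>\<^bsub>K\<^esub> \<one>" \<one>] q.hom_one OK_sub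
      by (simp add: add.nat_pow_Suc q.S.add.nat_pow_Suc)
  qed
  then have "[p] \<cdot>\<^bsub>\<kappa>\<^esub> \<one>\<^bsub>\<kappa>\<^esub> = I +>\<^bsub>OK\<^esub> P" by blast
  also have "\<dots> = I +>\<^bsub>OK\<^esub> \<zero>" using P_I I_sub(6)[OF P_I] OK_sub(4) by (intro residue_eqI) (auto simp: minus_eq)
  also have "\<dots> = \<zero>\<^bsub>\<kappa>\<^esub>" using q.hom_zero by simp
  finally show ?thesis .
qed

section \<open>Finiteness of the residue field\<close>

text \<open>Linear independence of the residue classes of \<open>Us\<close> over the prime field.
  The elements of the prime field are represented by coefficients in \<open>A\<close>, those in
  \<open>I\<close> representing zero.\<close>

definition "res_indep Us \<longleftrightarrow> set Us \<subseteq> carrier OK \<and>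
   (\<forall>Cs. length Cs = length Us \<longrightarrow> set Cs \<subseteq> A \<longrightarrow> combine Cs Us \<in> I \<longrightarrow> set Cs \<subseteq> I)"

lemma common_denominator:
  assumes "set Ks \<subseteq> fractions_in K A"
  shows "\<exists>d\<in>A. d \<noteq> \<zero> \<and> (\<forall>k\<in>set Ks. k \<otimes> d \<in> A)"
  using assms
proof (induct Ks)
  case Nil
  then show ?case using subringE(3)[OF subring_A] one_not_zero by (intro bexI[of _ \<one>]) simp_all
next
  case (Cons k Ks)
  then obtain d where d: "d \<in> A" "d \<noteq> \<zero>" "\<forall>k\<in>set Ks. k \<otimes> d \<in> A" by auto
  obtain b where b: "k \<in> carrier K" "b \<in> A" "b \<noteq> \<zero>" "k \<otimes> b \<in> A"
    using Cons.prems fractions_in_iff[OF subring_A] by auto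
  have "b \<otimes> d \<in> A" using b d subringE(6)[OF subring_A] by blast
  moreover have "b \<otimes> d \<noteq> \<zero>" using b d A_closed integral_iff by auto
  moreover have "k' \<otimes> (b \<otimes> d) \<in> A" if "k' \<in> set (k # Ks)" for k'
  proof (cases "k' = k")
    case True
    then have "k' \<otimes> (b \<otimes> d) = (k \<otimes> b) \<otimes> d" using A_closed b d by (simp add: m_assoc)
    then show ?thesis using b d subringE(6)[OF subring_A] by metis
  next
    case False
    then have "k' \<in> set Ks" using that by auto
    moreover have "k' \<in> carrier K" using that Cons.prems fractions_in_iff[OF subring_A] by auto
    ultimately have "k' \<otimes> (b \<otimes> d) = b \<otimes> (k' \<otimes> d)" using A_closed b d by (simp add: m_lcomm)
    then show ?thesis using \<open>k' \<in> set Ks\<close> b d subringE(6)[OF subring_A] by metis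
  qed
  ultimately show ?case by blast
qed

text \<open>Residual independence lifts to the field of fractions: a nontrivial relation is scaled
  by a common denominator and divided by a coefficient of least valuation. One coefficient becomes
  1, so the relation remains nontrivial modulo \<open>I\<close>.\<close>

lemma res_indep_independent:
  assumes "res_indep Us"
  shows "independent (fractions_in K A) Us"
proof (rule ccontr)
  note F = fractions_in_subfield[OF subring_A]
  have Us: "set Us \<subseteq> carrier K" using assms OK_closed by (auto simp: res_indep_def)
  assume "dependent (fractions_in K A) Us"
  from dependent_imp_non_trivial_combine[OF F Us this] obtain Ks where
    Ks: "length Ks = length Us" "combine Ks Us = \<zero>" "set Ks \<subseteq> fractions_in K A" "set Ks \<noteq> {\<zero>}" .
  have Kc: "k \<in> carrier K" if "k \<in> set Ks" for k using that Ks(3) fractions_in_iff[OF subring_A] by blast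
  obtain d where d: "d \<in> A" "d \<noteq> \<zero>" "\<forall>k\<in>set Ks. k \<otimes> d \<in> A" using common_denominator[OF Ks(3)] by blast
  \<comment> \<open>The coefficients are continued by zero to a sequence, the form in which
    \<open>pivot\<close> selects one that divides all others.\<close>
  define a where "a (n::nat) = (if n < length Ks then Ks ! n \<otimes> d else \<zero>)" for n
  have "a n \<in> A" for n using d subringE(2)[OF subring_A] by (auto simp: a_def)
  from pivot[of a, OF this] obtain m where "\<forall>n. \<exists>c\<in>A. a n = c \<otimes> a m" by blast
  then obtain c where c: "\<And>n. c n \<in> A" "\<And>n. a n = c n \<otimes> a m" by metis
  have dc: "d \<in> carrier K" and cc: "c n \<in> carrier K" for n using d c A_closed by auto
  show False
  proof (cases "Ks = []")
    case True
    then have "combine [] Us = \<zero>" by simp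
    have "Us = []" using Ks(1) True by simp
    then show False using \<open>dependent (fractions_in K A) Us\<close> by simp
  next
    case False
  have "set Ks \<noteq> {}" using False by simp
  moreover have "set Ks \<subseteq> {\<zero>}" if "\<not> (\<exists>k\<in>set Ks. k \<noteq> \<zero>)" using that by blast
  ultimately have "\<exists>k\<in>set Ks. k \<noteq> \<zero>" using Ks(4) by (auto simp: subset_singleton_iff)
  then obtain i where i: "i < length Ks" "Ks ! i \<noteq> \<zero>" by (auto simp: in_set_conv_nth)
  have "a i \<noteq> \<zero>" using i d dc Kc integral_iff by (auto simp: a_def)
  then have am: "a m \<noteq> \<zero>" using c(2)[of i] cc by auto
  then have m: "m < length Ks" "Ks ! m \<noteq> \<zero>" by (auto simp: a_def dc split: if_splits)
  have mc: "Ks ! m \<in> carrier K" using m Kc by auto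
  have eq: "Ks ! n = Ks ! m \<otimes> c n" if n: "n < length Ks" for n
  proof -
    have "Ks ! n \<otimes> d = (Ks ! m \<otimes> c n) \<otimes> d"
      using c(2)[of n] n m mc dc cc by (simp add: a_def m_ac)
    then show ?thesis using m_rcancel[OF d(2) dc] Kc n mc cc by auto
  qed
  let ?C = "map c [0..<length Ks]"
  have CA: "set ?C \<subseteq> A" using c by auto
  have "Ks = map ((\<otimes>) (Ks ! m)) ?C" by (rule nth_equalityI) (use eq in auto)
  then have "Ks ! m \<otimes> combine ?C Us = \<zero>"
    using combine_r_distr[of ?C Us "Ks ! m"] Us CA A_closed mc Ks(2) by auto
  then have "combine ?C Us = \<zero>" using m mc combine_in_carrier[of ?C Us] CA Us A_closed integral_iff by blast
  then have "combine ?C Us \<in> I" using I_sub by simp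
  moreover have "length ?C = length Us" using Ks(1) by simp
  ultimately have "set ?C \<subseteq> I" using assms CA unfolding res_indep_def by blast
  then have "c m \<in> I" using m by auto
  \<comment> \<open>The pivot divides itself with quotient 1, the coefficient that survives modulo
    \<open>I\<close>.\<close>
  moreover have "c m = \<one>"
  proof -
    have "Ks ! m \<otimes> c m = Ks ! m \<otimes> \<one>" using eq[OF m(1)] mc by simp
    then show ?thesis using m_lcancel[OF m(2) mc cc one_closed] by blast
  qed
  ultimately show False using one_not_I by simp
  qed
qed

text \<open>The bound is the degree of \<open>K\<close>, by independence over the field of
  fractions.\<close>

lemma res_indep_bound: "\<exists>n. \<forall>Us. res_indep Us \<longrightarrow> length Us \<le> n"
proof -
  obtain n where "dimension n (fractions_in K A) (carrier K)"
    using ext finite_dimensionE[OF fractions_in_subfield[OF subring_A]]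
    unfolding finite_extension_of_Qp_def finite_dimension_def by blast
  then have "length Us \<le> n" if Us: "res_indep Us" for Us
  proof (rule independent_length_le_dimension[OF fractions_in_subfield[OF subring_A] _ res_indep_independent[OF Us]])
    show "set Us \<subseteq> carrier K" using Us OK_closed by (auto simp: res_indep_def)
  qed
  then show ?thesis by blast
qed

lemma combine_OK: "set Cs \<subseteq> carrier OK \<Longrightarrow> set Us \<subseteq> carrier OK \<Longrightarrow> combine Cs Us \<in> carrier OK"
  by (induct Cs Us rule: combine.induct) (use OK_sub in auto)

text \<open>By \<open>res_indep_bound\<close> there is a longest residually independent list
  \<open>Us\<close>. Every further element depends on it residually, so each residue class is a
  combination of \<open>Us\<close> with coefficients among the multiples of 1 below
  \<open>p\<close>, and there are finitely many such combinations.\<close>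

lemma finite_residue: "finite (carrier \<kappa>)"
proof -
  obtain n where n: "\<And>Us. res_indep Us \<Longrightarrow> length Us \<le> n" using res_indep_bound by blast
  have "res_indep []" by (simp add: res_indep_def)
  moreover have "\<forall>Us. res_indep Us \<longrightarrow> length Us < Suc n" using n by (simp add: less_Suc_eq_le)
  ultimately have "\<exists>Us. res_indep Us \<and> (\<forall>Vs. res_indep Vs \<longrightarrow> length Vs \<le> length Us)"
    by (rule ex_has_greatest_nat[where f = length])
  then obtain Us where Us: "res_indep Us" and max: "\<And>Vs. res_indep Vs \<Longrightarrow> length Vs \<le> length Us"
    by auto
  have UO: "set Us \<subseteq> carrier OK" using Us by (simp add: res_indep_def)
  let ?N = "(\<lambda>k::nat. [k] \<cdot>\<^bsub>K\<^esub> \<one>) ` {..<p}"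
  let ?L = "{Ds. set Ds \<subseteq> ?N \<and> length Ds = length Us}"
  have NA: "[(k::nat)] \<cdot>\<^bsub>K\<^esub> \<one> \<in> A" for k using hom_nat[of k] Z.add.nat_pow_closed[OF Z.one_closed] by (metis imageI)
  have gen: "((j \<oplus> y \<otimes> x) \<otimes> u \<oplus> s) \<ominus> (j \<otimes> u \<oplus> t) = (y \<otimes> u) \<otimes> x \<oplus> (s \<ominus> t)"
    if "j \<in> carrier K" "y \<in> carrier K" "x \<in> carrier K" "u \<in> carrier K" "s \<in> carrier K" "t \<in> carrier K" for j y x u s t
    using that by algebra
  have gen': "(y \<otimes> c) \<otimes> x \<ominus> t = y \<otimes> (c \<otimes> x \<oplus> s) \<oplus> (\<ominus> y \<otimes> s \<ominus> t)"
    if "c \<in> carrier K" "y \<in> carrier K" "x \<in> carrier K" "s \<in> carrier K" "t \<in> carrier K" for y c x s t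
    using that by algebra
  \<comment> \<open>Coefficients in \<open>A\<close> may be replaced by their digits in
    \<open>?N\<close>, since they differ by a multiple of \<open>P\<close>, which lies in
    \<open>I\<close>.\<close>
  have red: "\<exists>Ds. set Ds \<subseteq> ?N \<and> length Ds = length Cs \<and> combine Cs Us \<ominus> combine Ds Us \<in> I"
    if "set Cs \<subseteq> A" for Cs
    using that UO
  proof (induct Cs Us rule: combine.induct)
    case (1 k Ks u Us)
    then have kA: "k \<in> A" "set Ks \<subseteq> A" and uO: "u \<in> carrier OK" "set Us \<subseteq> carrier OK" by auto
    obtain Ds where Ds: "set Ds \<subseteq> ?N" "length Ds = length Ks" "combine Ks Us \<ominus> combine Ds Us \<in> I"
      using "1.hyps"[OF kA(2) uO(2)] by blast
    obtain j y where j: "j < p" "y \<in> A" "k = [j] \<cdot>\<^bsub>K\<^esub> \<one> \<oplus> y \<otimes> P" using A_decomp(1)[OF kA(1)] by blast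
    have DA: "set Ds \<subseteq> A" using Ds(1) NA by blast
    have c: "y \<in> carrier K" "u \<in> carrier K" "[j] \<cdot>\<^bsub>K\<^esub> \<one> \<in> carrier K" "P \<in> carrier K"
      using A_closed[OF j(2)] OK_closed[OF uO(1)] by auto
    have c': "combine Ks Us \<in> carrier K" "combine Ds Us \<in> carrier K"
      using OK_closed[OF combine_OK[OF _ uO(2)]] kA(2) DA A_OK by blast+
    have "combine (k # Ks) (u # Us) \<ominus> combine ([j] \<cdot>\<^bsub>K\<^esub> \<one> # Ds) (u # Us)
       = (y \<otimes> u) \<otimes> P \<oplus> (combine Ks Us \<ominus> combine Ds Us)"
      unfolding combine.simps j(3) using gen[OF c(3,1,4,2) c'] .
    moreover have "y \<otimes> u \<in> carrier OK" using subsetD[OF A_OK j(2)] uO(1) by (rule OK_sub(1))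
    ultimately have "combine (k # Ks) (u # Us) \<ominus> combine ([j] \<cdot>\<^bsub>K\<^esub> \<one> # Ds) (u # Us) \<in> I"
      using I_sub(3)[OF I_sub(1)[OF P_I] Ds(3)] by metis
    moreover have "set ([j] \<cdot>\<^bsub>K\<^esub> \<one> # Ds) \<subseteq> ?N" using Ds(1) j(1) by simp
    moreover have "length ([j] \<cdot>\<^bsub>K\<^esub> \<one> # Ds) = length (k # Ks)" using Ds(2) by simp
    ultimately show ?case by blast
  next
    case ("2_1" Us)
    show ?case using I_sub(5) by (intro exI[of _ "[]"]) (simp add: minus_eq)
  next
    case ("2_2" Ks)
    let ?D = "replicate (length Ks) ([(0::nat)] \<cdot>\<^bsub>K\<^esub> \<one>)"
    have "[(0::nat)] \<cdot>\<^bsub>K\<^esub> \<one> \<in> ?N" using p_pos by blast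
    then have "set ?D \<subseteq> ?N" unfolding set_replicate_conv_if by simp
    moreover have "combine ?D [] = \<zero>" by (rule combine.simps(3))
    ultimately show ?case using I_sub(5) by (intro exI[of _ ?D]) (simp add: minus_eq)
  qed
  have "carrier \<kappa> \<subseteq> (\<lambda>Ds. I +>\<^bsub>OK\<^esub> combine Ds Us) ` ?L"
  proof
    fix xb assume "xb \<in> carrier \<kappa>"
    then obtain x where x: "x \<in> carrier OK" "xb = I +>\<^bsub>OK\<^esub> x" using residue_surj by auto
    have "\<not> res_indep (x # Us)" using max[of "x # Us"] by auto
    then obtain Cs' where "length Cs' = Suc (length Us)" "set Cs' \<subseteq> A" "combine Cs' (x # Us) \<in> I" "\<not> set Cs' \<subseteq> I"
      using x UO by (auto simp: res_indep_def)
    then obtain c Cs where C: "length Cs = length Us" "c \<in> A" "set Cs \<subseteq> A" "c \<otimes> x \<oplus> combine Cs Us \<in> I"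
        "\<not> set (c # Cs) \<subseteq> I"
      by (cases Cs') auto
    have CO: "combine Cs Us \<in> carrier OK" using combine_OK C A_OK UO by blast
    have carr: "c \<in> carrier K" "x \<in> carrier K" "combine Cs Us \<in> carrier K" using A_closed OK_closed C x CO by auto
    \<comment> \<open>Were \<open>c\<close> in \<open>I\<close>, the relation would become one among
      \<open>Us\<close> alone, and all its coefficients would lie in \<open>I\<close>.\<close>
    have "c \<notin> I"
    proof
      assume c: "c \<in> I"
      have "combine Cs Us = (c \<otimes> x \<oplus> combine Cs Us) \<oplus> \<ominus> (c \<otimes> x)" using carr by algebra
      also have "\<dots> \<in> I" by (rule I_sub(3)[OF C(4) I_sub(4)[OF I_sub(2)[OF c x(1)]]])
      finally have "set Cs \<subseteq> I" using Us C by (auto simp: res_indep_def)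
      then show False using C c by auto
    qed
    moreover have "y \<otimes> P \<in> I" if "y \<in> A" for y using that A_OK P_I I_sub by blast
    ultimately obtain y where y: "y \<in> A" "y \<otimes> c = \<one>" using A_decomp(2)[OF C(2)] by blast
    have yc: "y \<in> carrier K" "y \<in> carrier OK" using y A_closed A_OK by auto
    let ?E = "map ((\<otimes>) (\<ominus> y)) Cs"
    have "set ?E \<subseteq> A" using C y subringE(5,6)[OF subring_A] by auto
    from red[OF this] obtain Ds where Ds: "set Ds \<subseteq> ?N" "length Ds = length Us" "combine ?E Us \<ominus> combine Ds Us \<in> I"
      using C by auto
    have E: "combine ?E Us = \<ominus> y \<otimes> combine Cs Us"
    proof (rule combine_r_distr[symmetric])
      show "set Cs \<subseteq> carrier K" using C(3) A_closed by blast
      show "set Us \<subseteq> carrier K" using UO OK_closed by blast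
      show "\<ominus> y \<in> carrier K" using yc(1) by simp
    qed
    have DO: "combine Ds Us \<in> carrier OK" using combine_OK Ds NA A_OK UO by blast
    have "x \<ominus> combine Ds Us = (y \<otimes> c) \<otimes> x \<ominus> combine Ds Us" using y carr by simp
    also have "\<dots> = y \<otimes> (c \<otimes> x \<oplus> combine Cs Us) \<oplus> (combine ?E Us \<ominus> combine Ds Us)"
      unfolding E by (rule gen'[OF carr(1) yc(1) carr(2,3) OK_closed[OF DO]])
    also have "\<dots> \<in> I" by (rule I_sub(3)[OF I_sub(1)[OF C(4) yc(2)] Ds(3)])
    finally have "xb = I +>\<^bsub>OK\<^esub> combine Ds Us" unfolding x(2) using residue_eqI x DO by blast
    then show "xb \<in> (\<lambda>Ds. I +>\<^bsub>OK\<^esub> combine Ds Us) ` ?L" using Ds by blast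
  qed
  moreover have "finite ?L" by (rule finite_lists_length_eq) simp
  ultimately show ?thesis using finite_surj by blast
qed

end

section \<open>Integer combinations and the evaluation of integer polynomials\<close>

text \<open>The additive extension of \<open>g\<close> to the free abelian group. Both
  \<open>tensor_lift\<close> and \<open>xy_eval\<close> are given by this formula, integer
  polynomials being the free abelian group on the monomials.\<close>

definition int_comb :: "('g, 'x) ring_scheme \<Rightarrow> ('a \<Rightarrow> 'g) \<Rightarrow> ('a \<Rightarrow>\<^sub>0 int) \<Rightarrow> 'g" where
  "int_comb G g x = (\<Oplus>\<^bsub>G\<^esub>t\<in>Poly_Mapping.keys x. [Poly_Mapping.lookup x t] \<cdot>\<^bsub>G\<^esub> g t)"

context abelian_group
begin

lemma int_comb_superset:
  assumes "finite T" "Poly_Mapping.keys x \<subseteq> T" "\<And>t. t \<in> T \<Longrightarrow> g t \<in> carrier G"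
  shows "int_comb G g x = (\<Oplus>t\<in>T. [Poly_Mapping.lookup x t] \<cdot>\<^bsub>G\<^esub> g t)"
  unfolding int_comb_def
  by (rule add.finprod_mono_neutral_cong_left)
    (use assms in \<open>auto simp: in_keys_iff add_pow_int_ge[of 0] intro: add.int_pow_closed\<close>)

lemma int_comb_closed:
  assumes "\<And>t. t \<in> Poly_Mapping.keys x \<Longrightarrow> g t \<in> carrier G"
  shows "int_comb G g x \<in> carrier G"
  unfolding int_comb_def using assms by (auto intro!: finsum_closed)

lemma int_comb_zero [simp]: "int_comb G g 0 = \<zero>"
  by (simp add: int_comb_def)

lemma int_comb_add:
  assumes "\<And>t. t \<in> Poly_Mapping.keys x \<union> Poly_Mapping.keys y \<Longrightarrow> g t \<in> carrier G"
  shows "int_comb G g (x + y) = int_comb G g x \<oplus> int_comb G g y"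
proof -
  let ?T = "Poly_Mapping.keys x \<union> Poly_Mapping.keys y"
  have "int_comb G g (x + y) = (\<Oplus>t\<in>?T. [Poly_Mapping.lookup (x + y) t] \<cdot>\<^bsub>G\<^esub> g t)"
    by (rule int_comb_superset) (use assms Poly_Mapping.keys_add[of x y] in auto)
  also have "\<dots> = (\<Oplus>t\<in>?T. [Poly_Mapping.lookup x t] \<cdot>\<^bsub>G\<^esub> g t \<oplus> [Poly_Mapping.lookup y t] \<cdot>\<^bsub>G\<^esub> g t)"
    by (rule finsum_cong) (use assms in \<open>auto simp: lookup_add add.int_pow_mult simp_implies_def\<close>)
  also have "\<dots> = (\<Oplus>t\<in>?T. [Poly_Mapping.lookup x t] \<cdot>\<^bsub>G\<^esub> g t) \<oplus> (\<Oplus>t\<in>?T. [Poly_Mapping.lookup y t] \<cdot>\<^bsub>G\<^esub> g t)"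
    by (rule finsum_addf) (use assms in auto)
  also have "\<dots> = int_comb G g x \<oplus> int_comb G g y"
    using int_comb_superset[of ?T x g] int_comb_superset[of ?T y g] assms by simp
  finally show ?thesis .
qed

lemma int_comb_frag_of: "g t \<in> carrier G \<Longrightarrow> int_comb G g (frag_of t) = g t"
  by (simp add: int_comb_def)

lemma int_comb_diff:
  assumes "\<And>t. t \<in> Poly_Mapping.keys x \<union> Poly_Mapping.keys y \<Longrightarrow> g t \<in> carrier G"
  shows "int_comb G g (x - y) = int_comb G g x \<ominus> int_comb G g y"
proof -
  have "Poly_Mapping.keys (x - y) \<subseteq> Poly_Mapping.keys x \<union> Poly_Mapping.keys y" by (rule keys_diff)
  then have "int_comb G g (x - y + y) = int_comb G g (x - y) \<oplus> int_comb G g y"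
    using assms by (intro int_comb_add) auto
  moreover have "int_comb G g (x - y) \<in> carrier G" "int_comb G g y \<in> carrier G"
    using assms keys_diff[of x y] by (auto intro!: int_comb_closed)
  ultimately show ?thesis by (simp add: minus_eq a_assoc r_neg)
qed

end

text \<open>Turns a type-class ring into a record, so that integer polynomials can be source and
  target of homomorphisms between records.\<close>

definition class_ring :: "'a::comm_ring_1 ring" where
  "class_ring = \<lparr>carrier = UNIV, monoid.mult = (*), one = 1, ring.zero = 0, ring.add = (+)\<rparr>"

lemma class_ring_simps [simp]:
  "carrier class_ring = UNIV" "x \<otimes>\<^bsub>class_ring\<^esub> y = x * y" "\<one>\<^bsub>class_ring\<^esub> = 1"
  "\<zero>\<^bsub>class_ring\<^esub> = 0" "x \<oplus>\<^bsub>class_ring\<^esub> y = x + y"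
  by (auto simp: class_ring_def)

lemma class_ring_cring: "cring class_ring"
proof (rule cringI)
  show "abelian_group (class_ring :: 'a ring)"
    by (rule abelian_groupI) (auto simp: ac_simps intro: exI[of _ "- x" for x] add.left_inverse)
  show "Group.comm_monoid (class_ring :: 'a ring)"
    by (rule Group.comm_monoidI) (auto simp: ac_simps)
qed (auto simp: algebra_simps)

interpretation class_ring: cring class_ring
  by (rule class_ring_cring)

lemma class_ring_pow [simp]: "x [^]\<^bsub>class_ring\<^esub> (n::nat) = x ^ n"
  by (induct n) (auto simp: ac_simps)

definition (in cring) mono_eval :: "('i \<Rightarrow> 'a) \<Rightarrow> ('i \<Rightarrow>\<^sub>0 nat) \<Rightarrow> 'a" where
  "mono_eval v m = (\<Otimes>i\<in>Poly_Mapping.keys m. v i [^] Poly_Mapping.lookup m i)"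

context cring
begin

lemma xy_eval_eq: "xy_eval R v P = int_comb R (mono_eval v) P"
  by (simp add: xy_eval_def int_comb_def mono_eval_def)

context
  fixes v :: "'i \<Rightarrow> 'a" assumes v: "\<And>i. v i \<in> carrier R"
begin

lemma mono_eval_closed: "mono_eval v m \<in> carrier R"
  unfolding mono_eval_def using v by (auto intro!: finprod_closed)

lemma mono_eval_superset:
  assumes "finite T" "Poly_Mapping.keys m \<subseteq> T"
  shows "mono_eval v m = (\<Otimes>i\<in>T. v i [^] Poly_Mapping.lookup m i)"
  unfolding mono_eval_def
  by (rule finprod_mono_neutral_cong_left) (use assms v in \<open>auto simp: in_keys_iff\<close>)

lemma mono_eval_add: "mono_eval v (m + m') = mono_eval v m \<otimes> mono_eval v m'"
proof -
  let ?T = "Poly_Mapping.keys m \<union> Poly_Mapping.keys m'"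
  have "mono_eval v (m + m') = (\<Otimes>i\<in>?T. v i [^] Poly_Mapping.lookup m i \<otimes> v i [^] Poly_Mapping.lookup m' i)"
    unfolding mono_eval_superset[of ?T "m + m'", OF _ Poly_Mapping.keys_add, simplified]
    by (rule finprod_cong) (use v in \<open>auto simp: lookup_add nat_pow_mult simp_implies_def\<close>)
  also have "\<dots> = mono_eval v m \<otimes> mono_eval v m'"
    using mono_eval_superset[of ?T m] mono_eval_superset[of ?T m'] v by (simp add: finprod_multf Pi_def)
  finally show ?thesis .
qed

text \<open>Both sides are additive in each factor, so \<open>frag_induction\<close> reduces the
  claim to monomials, where it is \<open>mono_eval_add\<close>.\<close>

lemma int_comb_mono_mult:
  "int_comb R (mono_eval v) (f * g) = int_comb R (mono_eval v) f \<otimes> int_comb R (mono_eval v) g"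
proof -
  let ?e = "int_comb R (mono_eval v)"
  have c: "?e f \<in> carrier R" for f by (rule int_comb_closed) (rule mono_eval_closed)
  have d: "?e (f - g) = ?e f \<ominus> ?e g" for f g by (rule int_comb_diff) (rule mono_eval_closed)
  have o: "?e (frag_of m) = mono_eval v m" for m by (rule int_comb_frag_of) (rule mono_eval_closed)
  have 1: "?e (frag_of m * g) = ?e (frag_of m) \<otimes> ?e g" for m g
  proof (rule frag_induction[of g UNIV "\<lambda>g. ?e (frag_of m * g) = ?e (frag_of m) \<otimes> ?e g"])
    fix m'
    have "frag_of m * frag_of m' = (frag_of (m + m') :: _ \<Rightarrow>\<^sub>0 int)" by (simp add: mult_single)
    then show "?e (frag_of m * frag_of m') = ?e (frag_of m) \<otimes> ?e (frag_of m')"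
      by (simp add: o mono_eval_add)
  next
    fix a b assume "?e (frag_of m * a) = ?e (frag_of m) \<otimes> ?e a" "?e (frag_of m * b) = ?e (frag_of m) \<otimes> ?e b"
    then show "?e (frag_of m * (a - b)) = ?e (frag_of m) \<otimes> ?e (a - b)"
      using c by (simp add: d right_diff_distrib minus_eq r_distr r_minus)
  qed (use c in auto)
  show ?thesis
  proof (rule frag_induction[of f UNIV "\<lambda>f. ?e (f * g) = ?e f \<otimes> ?e g"])
    fix a b assume "?e (a * g) = ?e a \<otimes> ?e g" "?e (b * g) = ?e b \<otimes> ?e g"
    then show "?e ((a - b) * g) = ?e (a - b) \<otimes> ?e g"
      using c by (simp add: d left_diff_distrib minus_eq l_distr l_minus)
  qed (use c 1 in auto)
qed

end

lemma xy_eval_var: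
  assumes "\<And>i. v i \<in> carrier R"
  shows "xy_eval R v (xy_var i) = v i"
  using assms by (simp add: xy_eval_def xy_var_def)

lemma xy_eval_hom:
  assumes "\<And>i. v i \<in> carrier R"
  shows "xy_eval R v \<in> ring_hom class_ring R"
proof (rule ring_hom_memI)
  note c = mono_eval_closed[of v, OF assms]
  show "xy_eval R v f \<in> carrier R" for f unfolding xy_eval_eq by (rule int_comb_closed) (rule c)
  show "xy_eval R v (f \<otimes>\<^bsub>class_ring\<^esub> g) = xy_eval R v f \<otimes> xy_eval R v g" for f g
    unfolding xy_eval_eq using int_comb_mono_mult[OF assms] by simp
  show "xy_eval R v (f \<oplus>\<^bsub>class_ring\<^esub> g) = xy_eval R v f \<oplus> xy_eval R v g" for f g
    unfolding xy_eval_eq using int_comb_add[of f g "mono_eval v"] c by simp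
  have "(1::xy_poly) = frag_of 0" by (simp add:)
  then show "xy_eval R v \<one>\<^bsub>class_ring\<^esub> = \<one>"
    unfolding xy_eval_eq using int_comb_frag_of[of "mono_eval v" 0] c by (simp add: mono_eval_def)
qed

end

lemma (in ring_hom_cring) hom_nat_pow': "x \<in> carrier R \<Longrightarrow> h (x [^] (n::nat)) = h x [^]\<^bsub>S\<^esub> n"
  by (induct n) auto

lemma (in ring_hom_cring) hom_nat_add_pow:
  "x \<in> carrier R \<Longrightarrow> h ([(n::nat)] \<cdot>\<^bsub>R\<^esub> x) = [n] \<cdot>\<^bsub>S\<^esub> h x"
  by (induct n) (auto simp: R.add.nat_pow_Suc S.add.nat_pow_Suc)

lemma (in ring_hom_cring) hom_int_add_pow:
  "x \<in> carrier R \<Longrightarrow> h ([(k::int)] \<cdot>\<^bsub>R\<^esub> x) = [k] \<cdot>\<^bsub>S\<^esub> h x"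
  by (cases "k \<ge> 0") (auto simp: add_pow_int_ge add_pow_int_lt hom_nat_add_pow)

text \<open>Naturality of evaluation; in \<open>witt_transfer\<close> it carries a substitution of
  polynomials over to an evaluation in \<open>R\<close>.\<close>

lemma (in ring_hom_cring) hom_xy_eval:
  assumes "\<And>i. v i \<in> carrier R"
  shows "h (xy_eval R v P) = xy_eval S (\<lambda>i. h (v i)) P"
proof -
  have c: "(\<Otimes>i\<in>Poly_Mapping.keys m. v i [^] Poly_Mapping.lookup m i) \<in> carrier R" for m :: "nat + nat \<Rightarrow>\<^sub>0 nat"
    using assms R.nat_pow_closed by (auto intro!: R.finprod_closed)
  have "h (xy_eval R v P) = (\<Oplus>\<^bsub>S\<^esub>m\<in>Poly_Mapping.keys P. h ([Poly_Mapping.lookup P m] \<cdot>\<^bsub>R\<^esub>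
     (\<Otimes>i\<in>Poly_Mapping.keys m. v i [^] Poly_Mapping.lookup m i)))"
    unfolding xy_eval_def using c by (subst hom_finsum) (auto simp: comp_def)
  also have "\<dots> = xy_eval S (\<lambda>i. h (v i)) P"
    unfolding xy_eval_def
  proof (rule S.finsum_cong')
    fix m :: "nat + nat \<Rightarrow>\<^sub>0 nat"
    have "h (\<Otimes>i\<in>Poly_Mapping.keys m. v i [^] Poly_Mapping.lookup m i)
        = (\<Otimes>\<^bsub>S\<^esub>i\<in>Poly_Mapping.keys m. h (v i) [^]\<^bsub>S\<^esub> Poly_Mapping.lookup m i)"
      using assms by (subst hom_finprod) (auto simp: comp_def hom_nat_pow' intro!: S.finprod_cong')
    then show "h ([Poly_Mapping.lookup P m] \<cdot>\<^bsub>R\<^esub> (\<Otimes>i\<in>Poly_Mapping.keys m. v i [^] Poly_Mapping.lookup m i))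
        = [Poly_Mapping.lookup P m] \<cdot>\<^bsub>S\<^esub> (\<Otimes>\<^bsub>S\<^esub>i\<in>Poly_Mapping.keys m. h (v i) [^]\<^bsub>S\<^esub> Poly_Mapping.lookup m i)"
      using hom_int_add_pow[OF c] by simp
  qed (use assms in \<open>auto intro!: S.add.int_pow_closed S.finprod_closed\<close>)
  finally show ?thesis .
qed

section \<open>Witt polynomials\<close>

text \<open>When \<open>a ^ p - b ^ p\<close> is factored by \<open>a - b\<close>, the cofactor is
  congruent to \<open>p * b ^ (p - 1)\<close> modulo \<open>a - b\<close>, hence divisible by
  \<open>p\<close>. This gives one more factor \<open>p\<close>; the condition \<open>i > 0\<close>
  ensures that \<open>p\<close> divides \<open>a - b\<close>.\<close>

lemma dvd_power_p_diff:
  fixes a b :: "'a::comm_ring_1"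
  assumes "i > 0" "of_nat p ^ i dvd a - b"
  shows "of_nat p ^ Suc i dvd a ^ p - b ^ p"
proof -
  have pd: "of_nat p dvd a - b" using assms by (meson dvd_power dvd_trans)
  have "of_nat p dvd (\<Sum>j<p. b ^ (p - Suc j) * a ^ j)"
  proof -
    have e: "(\<Sum>j<p. b ^ (p - Suc j) * a ^ j)
        = (\<Sum>j<p. b ^ (p - Suc j) * (a ^ j - b ^ j)) + of_nat p * b ^ (p - 1)"
    proof -
      have "(\<Sum>j<p. b ^ (p - Suc j) * b ^ j) = (\<Sum>j<p. b ^ (p - 1))"
        by (rule sum.cong) (auto simp: power_add[symmetric])
      then show ?thesis by (simp add: right_diff_distrib sum_subtractf)
    qed
    have "of_nat p dvd a ^ j - b ^ j" for j
      by (rule dvd_trans[OF pd]) (simp add: power_diff_sumr2)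
    then have "of_nat p dvd (\<Sum>j<p. b ^ (p - Suc j) * (a ^ j - b ^ j))" by (intro dvd_sum dvd_mult)
    then show ?thesis unfolding e by (rule dvd_add) simp
  qed
  then have "of_nat p ^ i * of_nat p dvd (a - b) * (\<Sum>j<p. b ^ (p - Suc j) * a ^ j)"
    using assms(2) by (rule mult_dvd_mono[rotated])
  then show ?thesis by (simp add: power_diff_sumr2 mult.commute)
qed

lemma dvd_power_p_power_diff:
  fixes a b :: "'a::comm_ring_1"
  assumes "of_nat p dvd a - b"
  shows "of_nat p ^ Suc j dvd a ^ (p ^ j) - b ^ (p ^ j)"
proof (induct j)
  case (Suc j)
  from dvd_power_p_diff[OF _ Suc] show ?case by (simp add: power_mult[symmetric] mult.commute)
qed (use assms in simp)

lemma freshman: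
  fixes a b :: "'a::comm_ring_1"
  assumes "normalization_semidom_class.prime p"
  shows "of_nat p dvd (a + b) ^ p - (a ^ p + b ^ p)"
proof -
  have p: "p > 0" using assms prime_gt_0_nat by blast
  have "(a + b) ^ p = (\<Sum>k\<le>p. of_nat (p choose k) * a ^ k * b ^ (p - k))" by (rule binomial_ring)
  also have "{..p} = insert 0 (insert p {0<..<p})" using p by auto
  also have "(\<Sum>k\<in>insert 0 (insert p {0<..<p}). of_nat (p choose k) * a ^ k * b ^ (p - k))
      = b ^ p + (a ^ p + (\<Sum>k\<in>{0<..<p}. of_nat (p choose k) * a ^ k * b ^ (p - k)))"
    using p by simp
  finally have e: "(a + b) ^ p - (a ^ p + b ^ p) = (\<Sum>k\<in>{0<..<p}. of_nat (p choose k) * a ^ k * b ^ (p - k))" by simp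
  have "of_nat p dvd (of_nat (p choose k) :: 'a)" if "k \<in> {0<..<p}" for k
  proof -
    have "p dvd (p choose k)" using assms that by (intro dvd_choose_prime) auto
    then show ?thesis by (metis dvd_def of_nat_mult)
  qed
  then show ?thesis unfolding e by (intro dvd_sum dvd_mult2) auto
qed

text \<open>The version for differences, under which \<open>frag_induction\<close> closes. Deriving
  it from \<open>freshman\<close> avoids a discussion of the sign of the power of
  \<open>- b\<close>.\<close>

lemma freshman_diff:
  fixes a b :: "'a::comm_ring_1"
  assumes "normalization_semidom_class.prime p"
  shows "of_nat p dvd (a - b) ^ p - (a ^ p - b ^ p)"
proof -
  have "of_nat p dvd (a - b + b) ^ p - ((a - b) ^ p + b ^ p)" by (rule freshman[OF assms])
  then have "of_nat p dvd - ((a - b + b) ^ p - ((a - b) ^ p + b ^ p))" by (simp only: dvd_minus_iff)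
  then show ?thesis by (simp add: algebra_simps)
qed

abbreviation xy_subst :: "(nat + nat \<Rightarrow> xy_poly) \<Rightarrow> xy_poly \<Rightarrow> xy_poly" where
  "xy_subst \<equiv> xy_eval class_ring"

lemma xy_subst_simps:
  "xy_subst v (f + g) = xy_subst v f + xy_subst v g"
  "xy_subst v (f * g) = xy_subst v f * xy_subst v g"
  "xy_subst v 1 = 1" "xy_subst v 0 = 0" "xy_subst v (f - g) = xy_subst v f - xy_subst v g"
  "xy_subst v (f ^ n) = xy_subst v f ^ n" "xy_subst v (of_nat k) = of_nat k"
  "xy_subst v (xy_var i) = v i"
proof -
  have h: "xy_subst v \<in> ring_hom class_ring class_ring" by (rule class_ring.xy_eval_hom) simp
  show a: "xy_subst v (f + g) = xy_subst v f + xy_subst v g" for f g using ring_hom_add[OF h, of f g] by simp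
  show m: "xy_subst v (f * g) = xy_subst v f * xy_subst v g" for f g using ring_hom_mult[OF h, of f g] by simp
  show o: "xy_subst v 1 = 1" using ring_hom_one[OF h] by simp
  show z: "xy_subst v 0 = 0" using a[of 0 0] by simp
  show "xy_subst v (f - g) = xy_subst v f - xy_subst v g" using a[of "f - g" g] by (simp add: algebra_simps)
  show "xy_subst v (f ^ n) = xy_subst v f ^ n" by (induct n) (auto simp: o m)
  show "xy_subst v (of_nat k) = of_nat k" by (induct k) (auto simp: o a z)
  show "xy_subst v (xy_var i) = v i" by (rule class_ring.xy_eval_var) simp
qed

lemma xy_subst_ghost: "xy_subst v (ghost p n a) = ghost p n (\<lambda>i. xy_subst v (a i))"
proof -
  have s: "xy_subst v (sum f {..n}) = (\<Sum>i\<le>n. xy_subst v (f i))" for f :: "nat \<Rightarrow> xy_poly" and n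
    by (induct n) (auto simp: xy_subst_simps)
  show ?thesis unfolding ghost_def by (simp add: s xy_subst_simps)
qed

lemma lookup_of_nat_mult: "Poly_Mapping.lookup (of_nat k * (f :: xy_poly)) m = int k * Poly_Mapping.lookup f m"
  by (induct k) (auto simp: distrib_right lookup_add)

lemma xy_poly_cancel:
  assumes "k > 0" "of_nat k * f = of_nat k * (g :: xy_poly)"
  shows "f = g"
proof (rule poly_mapping_eqI)
  fix m
  have "int k * Poly_Mapping.lookup f m = int k * Poly_Mapping.lookup g m"
    unfolding lookup_of_nat_mult[symmetric] assms(2) ..
  then show "Poly_Mapping.lookup f m = Poly_Mapping.lookup g m" using assms(1) by simp
qed

lemma xy_poly_dvd_cancel:
  assumes "k > 0" "of_nat k * of_nat l dvd of_nat k * (f :: xy_poly)"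
  shows "of_nat l dvd f"
proof -
  obtain g where "of_nat k * f = of_nat k * of_nat l * g" using assms(2) by (rule dvdE)
  then have "of_nat k * f = of_nat k * (of_nat l * g)" by (simp only: mult.assoc)
  then have "f = of_nat l * g" by (rule xy_poly_cancel[OF assms(1)])
  then show ?thesis by (rule dvdI)
qed

section \<open>Ghost components and Dwork's lemma\<close>

lemma ghost_Suc: "ghost p (Suc n) a = (\<Sum>i\<le>n. of_nat p ^ i * (a i ^ p) ^ (p ^ (n - i))) + of_nat p ^ Suc n * a (Suc n)"
  unfolding ghost_def by (simp add: Suc_diff_le power_mult[symmetric])

lemma ghost_0: "ghost p 0 a = a 0"
  by (simp add: ghost_def)

lemma ghost_split: "ghost p n a = (\<Sum>i<n. of_nat p ^ i * a i ^ (p ^ (n - i))) + of_nat p ^ n * a n"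
  unfolding ghost_def by (simp add: lessThan_Suc_atMost[symmetric])

lemma ghost_zero:
  assumes "p > 0" "\<And>i. i \<le> n \<Longrightarrow> a i = 0"
  shows "ghost p n a = 0"
  unfolding ghost_def using assms by (auto simp: power_0_left intro!: sum.neutral)

text \<open>By induction the entries below \<open>n\<close> agree modulo \<open>p\<close>, so their
  contributions agree modulo \<open>p ^ Suc n\<close> by \<open>dvd_power_p_power_diff\<close>. What
  is left is \<open>p ^ n * (a n - b n)\<close>, from which \<open>p ^ n\<close> cancels.\<close>

lemma ghost_dvd_imp_dvd:
  fixes a b :: "nat \<Rightarrow> xy_poly"
  assumes "p > 0" "\<And>k. k \<le> n \<Longrightarrow> of_nat p ^ Suc k dvd ghost p k a - ghost p k b"
  shows "of_nat p dvd a n - b n"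
  using assms(2)
proof (induct n rule: less_induct)
  case (less n)
  have "of_nat p ^ Suc n dvd of_nat p ^ i * a i ^ (p ^ (n - i)) - of_nat p ^ i * b i ^ (p ^ (n - i))" if "i < n" for i
  proof -
    have "of_nat p dvd a i - b i" using less that by simp
    then have "of_nat p ^ i * of_nat p ^ Suc (n - i) dvd of_nat p ^ i * (a i ^ (p ^ (n - i)) - b i ^ (p ^ (n - i)))"
      by (intro mult_dvd_mono dvd_refl dvd_power_p_power_diff)
    then show ?thesis using that by (simp add: power_add[symmetric] right_diff_distrib del: power_Suc)
  qed
  then have "of_nat p ^ Suc n dvd (\<Sum>i<n. of_nat p ^ i * a i ^ (p ^ (n - i))) - (\<Sum>i<n. of_nat p ^ i * b i ^ (p ^ (n - i)))"
    unfolding sum_subtractf[symmetric] by (intro dvd_sum) auto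
  moreover have "of_nat p ^ Suc n dvd ghost p n a - ghost p n b" using less.prems by simp
  ultimately have "of_nat p ^ Suc n dvd ghost p n a - ghost p n b - ((\<Sum>i<n. of_nat p ^ i * a i ^ (p ^ (n - i))) - (\<Sum>i<n. of_nat p ^ i * b i ^ (p ^ (n - i))))"
    by (rule dvd_diff[rotated])
  also have "\<dots> = of_nat p ^ n * (a n - b n)" unfolding ghost_split by (simp add: algebra_simps)
  finally have "of_nat (p ^ n) * of_nat p dvd of_nat (p ^ n) * (a n - b n)"
    by (simp only: of_nat_power power_Suc mult.commute)
  moreover have "p ^ n > 0" using assms(1) by simp
  ultimately show ?case by (rule xy_poly_dvd_cancel[rotated])
qed

text \<open>The ghost components are triangular in the entries, with \<open>p ^ n\<close> in front
  of the last one, and integer polynomials have no torsion.\<close>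

lemma ghost_inj:
  fixes a b :: "nat \<Rightarrow> xy_poly"
  assumes "p > 0" "\<And>k. k \<le> n \<Longrightarrow> ghost p k a = ghost p k b"
  shows "a n = b n"
  using assms(2)
proof (induct n rule: less_induct)
  case (less n)
  have "(\<Sum>i<n. of_nat p ^ i * a i ^ (p ^ (n - i))) = (\<Sum>i<n. of_nat p ^ i * b i ^ (p ^ (n - i)))"
    by (rule sum.cong[OF refl]) (use less in simp)
  moreover have "ghost p n a = ghost p n b" using less.prems by simp
  ultimately have "of_nat p ^ n * a n = of_nat p ^ n * b n" unfolding ghost_split by (simp only: add_left_cancel)
  then have "of_nat (p ^ n) * a n = of_nat (p ^ n) * b n" by (simp only: of_nat_power)
  moreover have "p ^ n > 0" using assms(1) by simp
  ultimately show ?case by (rule xy_poly_cancel[rotated])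
qed

abbreviation xy_frob :: "nat \<Rightarrow> xy_poly \<Rightarrow> xy_poly" where
  "xy_frob p \<equiv> xy_subst (\<lambda>i. xy_var i ^ p)"

text \<open>\<open>xy_frob p\<close> lifts the Frobenius modulo \<open>p\<close>: on monomials it is
  the power exactly, and \<open>freshman_diff\<close> extends the congruence to differences.\<close>

lemma xy_frob_cong:
  assumes p: "normalization_semidom_class.prime p"
  shows "of_nat p dvd xy_frob p f - f ^ p"
proof (rule frag_induction[of f UNIV "\<lambda>f. of_nat p dvd xy_frob p f - f ^ p"])
  show "of_nat p dvd xy_frob p 0 - 0 ^ p" using p prime_gt_0_nat by (simp add: xy_subst_simps power_0_left)
next
  fix a b assume ab: "of_nat p dvd xy_frob p a - a ^ p" "of_nat p dvd xy_frob p b - b ^ p"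
  have "of_nat p dvd (xy_frob p a - a ^ p) - (xy_frob p b - b ^ p) - ((a - b) ^ p - (a ^ p - b ^ p))"
    by (rule dvd_diff[OF dvd_diff[OF ab] freshman_diff[OF p]])
  then show "of_nat p dvd xy_frob p (a - b) - (a - b) ^ p" by (simp add: xy_subst_simps algebra_simps)
next
  fix m :: "nat + nat \<Rightarrow>\<^sub>0 nat"
  have pw: "frag_of m ^ k = (frag_of (\<Sum>i<k. m) :: xy_poly)" for k
    by (induct k) (auto simp: mult_single add.commute)
  let ?v = "\<lambda>i. xy_var i ^ p"
  have c: "class_ring.mono_eval w m = (\<Prod>i\<in>Poly_Mapping.keys m. w i ^ Poly_Mapping.lookup m i)" for w :: "_ \<Rightarrow> xy_poly"
  proof -
    have "finprod class_ring g T = prod g T" for g :: "nat + nat \<Rightarrow> xy_poly" and T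
      by (induct T rule: infinite_finite_induct) (auto simp: class_ring.finprod_insert)
    then show ?thesis by (simp add: class_ring.mono_eval_def)
  qed
  have id: "frag_of m = (\<Prod>i\<in>Poly_Mapping.keys m. xy_var i ^ Poly_Mapping.lookup m i)"
  proof -
    have x: "xy_var i ^ k = frag_of (Poly_Mapping.single i k)" for i k
      by (induct k) (auto simp: xy_var_def mult_single single_add[symmetric])
    have "(\<Prod>i\<in>T. frag_of (g i)) = (frag_of (sum g T) :: xy_poly)" for g :: "nat + nat \<Rightarrow> _" and T
      by (induct T rule: infinite_finite_induct) (auto simp: mult_single)
    then have "(\<Prod>i\<in>Poly_Mapping.keys m. xy_var i ^ Poly_Mapping.lookup m i)
        = frag_of (\<Sum>i\<in>Poly_Mapping.keys m. Poly_Mapping.single i (Poly_Mapping.lookup m i))" by (simp add: x)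
    moreover have "(\<Sum>i\<in>Poly_Mapping.keys m. Poly_Mapping.single i (Poly_Mapping.lookup m i)) = m"
    proof (rule poly_mapping_eqI)
      fix k
      have "Poly_Mapping.lookup (sum g T) k = (\<Sum>i\<in>T. Poly_Mapping.lookup (g i) k)"
        for g :: "nat + nat \<Rightarrow> nat + nat \<Rightarrow>\<^sub>0 nat" and T
        by (induct T rule: infinite_finite_induct) (auto simp: lookup_add)
      then show "Poly_Mapping.lookup (\<Sum>i\<in>Poly_Mapping.keys m. Poly_Mapping.single i (Poly_Mapping.lookup m i)) k
          = Poly_Mapping.lookup m k"
        by (simp add: lookup_single when_def in_keys_iff)
    qed
    ultimately show ?thesis by simp
  qed
  have "xy_frob p (frag_of m) = (\<Prod>i\<in>Poly_Mapping.keys m. (xy_var i ^ p) ^ Poly_Mapping.lookup m i)"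
    unfolding class_ring.xy_eval_eq by (subst class_ring.int_comb_frag_of) (auto simp: c)
  also have "\<dots> = frag_of m ^ p"
    unfolding id prod_power_distrib by (simp add: power_mult[symmetric] mult.commute)
  finally show "of_nat p dvd xy_frob p (frag_of m) - frag_of m ^ p" by simp
qed auto

text \<open>Dwork's lemma. The entries are solved for one after the other: entry \<open>n\<close> is
  what the earlier entries leave of \<open>g n\<close>, divided by \<open>p ^ n\<close>. The
  division is possible because \<open>xy_frob\<close> replaces each entry in the ghost expression of
  \<open>g m\<close> by a polynomial congruent to its power, and these powers occur in the next
  ghost component.\<close>

lemma dwork:
  fixes g :: "nat \<Rightarrow> xy_poly"
  assumes p: "normalization_semidom_class.prime p"
    and g: "\<And>n. of_nat p ^ Suc n dvd g (Suc n) - xy_frob p (g n)"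
  shows "\<exists>a. \<forall>n. ghost p n a = g n"
proof -
  let ?P = "\<lambda>f n r. (\<Sum>i<n. of_nat p ^ i * f i ^ (p ^ (n - i))) + of_nat p ^ n * r = g n"
  \<comment> \<open>Entry \<open>n\<close> is constrained by all earlier entries, so the sequence is
    chosen along the well-order.\<close>
  have "\<exists>a. \<forall>n. ?P a n (a n)"
  proof (rule dependent_wellorder_choice)
    fix r and f f' :: "nat \<Rightarrow> xy_poly" and n assume "\<And>i. i < n \<Longrightarrow> f i = f' i"
    then have "(\<Sum>i<n. of_nat p ^ i * f i ^ (p ^ (n - i))) = (\<Sum>i<n. of_nat p ^ i * f' i ^ (p ^ (n - i)))"
      by (intro sum.cong) auto
    then show "?P f n r = ?P f' n r" by simp
  next
    fix n :: nat and f assume f: "\<And>i. i < n \<Longrightarrow> ?P f i (f i)"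
    show "\<exists>r. ?P f n r"
    proof (cases n)
      case 0
      then show ?thesis by simp
    next
      case (Suc m)
      have gm: "ghost p m f = g m" unfolding ghost_split using f[of m] Suc by simp
      \<comment> \<open>The factor \<open>p ^ i\<close> and the exponent \<open>p ^ (m - i)\<close>
        together raise the congruence modulo \<open>p\<close> to one modulo
        \<open>p ^ Suc m\<close>.\<close>
      have "of_nat p ^ Suc m dvd of_nat p ^ i * xy_frob p (f i) ^ (p ^ (m - i)) - of_nat p ^ i * (f i ^ p) ^ (p ^ (m - i))"
        if "i \<le> m" for i
      proof -
        have "of_nat p ^ i * of_nat p ^ Suc (m - i) dvd
            of_nat p ^ i * (xy_frob p (f i) ^ (p ^ (m - i)) - (f i ^ p) ^ (p ^ (m - i)))"
          by (intro mult_dvd_mono dvd_refl dvd_power_p_power_diff xy_frob_cong[OF p])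
        then show ?thesis using that by (simp add: power_add[symmetric] right_diff_distrib del: power_Suc)
      qed
      then have "of_nat p ^ Suc m dvd (\<Sum>i\<le>m. of_nat p ^ i * xy_frob p (f i) ^ (p ^ (m - i)))
          - (\<Sum>i\<le>m. of_nat p ^ i * (f i ^ p) ^ (p ^ (m - i)))"
        unfolding sum_subtractf[symmetric] by (intro dvd_sum) auto
      moreover have "(\<Sum>i\<le>m. of_nat p ^ i * xy_frob p (f i) ^ (p ^ (m - i))) = xy_frob p (g m)"
        unfolding gm[symmetric] xy_subst_ghost by (simp add: ghost_def)
      ultimately have "of_nat p ^ Suc m dvd (g (Suc m) - xy_frob p (g m))
          + (xy_frob p (g m) - (\<Sum>i\<le>m. of_nat p ^ i * (f i ^ p) ^ (p ^ (m - i))))"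
        by (intro dvd_add[OF g]) simp
      then have "of_nat p ^ Suc m dvd g (Suc m) - (\<Sum>i\<le>m. of_nat p ^ i * (f i ^ p) ^ (p ^ (m - i)))" by simp
      moreover have "(\<Sum>i\<le>m. of_nat p ^ i * (f i ^ p) ^ (p ^ (m - i))) = (\<Sum>i<Suc m. of_nat p ^ i * f i ^ (p ^ (Suc m - i)))"
        unfolding lessThan_Suc_atMost by (rule sum.cong) (auto simp: power_mult[symmetric] Suc_diff_le)
      ultimately have "of_nat p ^ Suc m dvd g (Suc m) - (\<Sum>i<Suc m. of_nat p ^ i * f i ^ (p ^ (Suc m - i)))"
        by (simp only:)
      then obtain r where "g (Suc m) - (\<Sum>i<Suc m. of_nat p ^ i * f i ^ (p ^ (Suc m - i))) = of_nat p ^ Suc m * r"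
        by (rule dvdE)
      then have "g (Suc m) = of_nat p ^ Suc m * r + (\<Sum>i<Suc m. of_nat p ^ i * f i ^ (p ^ (Suc m - i)))"
        by (simp only: diff_eq_eq)
      then have "?P f n r" unfolding Suc by (simp only: add.commute)
      then show ?thesis by blast
    qed
  qed
  then show ?thesis unfolding ghost_split by blast
qed

text \<open>On variables \<open>xy_frob\<close> takes powers exactly, so the recursion that Dwork's
  lemma asks for up to a congruence has an explicit error term here.\<close>

lemma xy_frob_ghost_var:
  "ghost p (Suc n) (\<lambda>i. xy_var (s i)) = xy_frob p (ghost p n (\<lambda>i. xy_var (s i))) + of_nat p ^ Suc n * xy_var (s (Suc n))"
  unfolding ghost_Suc xy_subst_ghost xy_subst_simps by (simp add: ghost_def)

text \<open>Sums and products of the ghost components of the variables satisfy Dwork's congruence by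
  \<open>xy_frob_ghost_var\<close>. Existence by \<open>dwork\<close> and uniqueness by
  \<open>ghost_inj\<close> make the definite descriptions denote.\<close>

lemma witt_polys:
  assumes p: "normalization_semidom_class.prime p"
  shows "ghost p n (witt_add_poly p) = ghost p n (\<lambda>i. xy_var (Inl i)) + ghost p n (\<lambda>i. xy_var (Inr i))"
    and "ghost p n (witt_mult_poly p) = ghost p n (\<lambda>i. xy_var (Inl i)) * ghost p n (\<lambda>i. xy_var (Inr i))"
proof -
  have p0: "p > 0" using p prime_gt_0_nat by blast
  have uniq: "\<exists>!a. \<forall>n. ghost p n a = g n" if E: "\<exists>a. \<forall>n. ghost p n a = g n" for g :: "nat \<Rightarrow> xy_poly"
  proof -
    obtain a where a: "\<forall>n. ghost p n a = g n" using E by blast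
    show ?thesis
    proof (rule ex1I, rule a)
      fix b assume b: "\<forall>n. ghost p n b = g n"
      show "b = a"
      proof
        fix n
        show "b n = a n" by (rule ghost_inj[OF p0]) (simp only: a[rule_format] b[rule_format])
      qed
    qed
  qed
  let ?X = "\<lambda>n. ghost p n (\<lambda>i. xy_var (Inl i))" and ?Y = "\<lambda>n. ghost p n (\<lambda>i. xy_var (Inr i))"
  have "\<exists>a. \<forall>n. ghost p n a = ?X n + ?Y n"
  proof (rule dwork[OF p])
    fix n
    have "?X (Suc n) + ?Y (Suc n) - xy_frob p (?X n + ?Y n) = of_nat p ^ Suc n * (xy_var (Inl (Suc n)) + xy_var (Inr (Suc n)))"
      unfolding xy_frob_ghost_var xy_subst_simps by (simp only: distrib_left add_diff_eq) (simp only: algebra_simps add_diff_cancel)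
    then show "of_nat p ^ Suc n dvd ?X (Suc n) + ?Y (Suc n) - xy_frob p (?X n + ?Y n)" by (rule dvdI)
  qed
  from theI'[OF uniq[OF this]]
  show "ghost p n (witt_add_poly p) = ?X n + ?Y n" unfolding witt_add_poly_def by blast
  have "\<exists>a. \<forall>n. ghost p n a = ?X n * ?Y n"
  proof (rule dwork[OF p])
    fix n
    have "(x + q * a) * (y + q * b) - x * y = q * (x * b + a * y + a * q * b)" for x y a b q :: xy_poly
      by (simp add: algebra_simps)
    then have "q dvd (x + q * a) * (y + q * b) - x * y" for x y a b q :: xy_poly by (rule dvdI)
    then show "of_nat p ^ Suc n dvd ?X (Suc n) * ?Y (Suc n) - xy_frob p (?X n * ?Y n)"
      unfolding xy_frob_ghost_var xy_subst_simps .
  qed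
  from theI'[OF uniq[OF this]]
  show "ghost p n (witt_mult_poly p) = ?X n * ?Y n" unfolding witt_mult_poly_def by blast
qed

text \<open>Identities between Witt vectors over any ring may be checked on ghost components of
  universal lifts, because the ghost map is injective on polynomials with integer coefficients.\<close>

lemma witt_transfer:
  fixes a b c :: "nat \<Rightarrow> xy_poly"
  assumes p: "normalization_semidom_class.prime p" and "cring R" and e: "e \<in> ring_hom class_ring R"
  shows "(\<And>n. ghost p n c = ghost p n a + ghost p n b) \<Longrightarrow>
      (\<lambda>n. e (a n)) \<oplus>\<^bsub>witt_ring p R\<^esub> (\<lambda>n. e (b n)) = (\<lambda>n. e (c n))"
    and "(\<And>n. ghost p n c = ghost p n a * ghost p n b) \<Longrightarrow>
      (\<lambda>n. e (a n)) \<otimes>\<^bsub>witt_ring p R\<^esub> (\<lambda>n. e (b n)) = (\<lambda>n. e (c n))"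
proof -
  interpret R: cring R by fact
  interpret e: ring_hom_cring class_ring R e by unfold_locales (rule e)
  have p0: "p > 0" using p prime_gt_0_nat by blast
  have s: "case_sum (\<lambda>n. e (a n)) (\<lambda>n. e (b n)) = (\<lambda>i. e (case_sum a b i))" by (auto split: sum.split)
  have *: "e (c n) = xy_eval R (\<lambda>i. e (case_sum a b i)) (S n)" if "\<And>n. ghost p n c = ghost p n (\<lambda>i. xy_subst (case_sum a b) (S i))" for S n
  proof -
    have "c n = xy_subst (case_sum a b) (S n)" by (rule ghost_inj[OF p0]) (rule that)
    then show ?thesis using e.hom_xy_eval[of "case_sum a b" "S n"] by simp
  qed
  show "(\<lambda>n. e (a n)) \<oplus>\<^bsub>witt_ring p R\<^esub> (\<lambda>n. e (b n)) = (\<lambda>n. e (c n))" if "\<And>n. ghost p n c = ghost p n a + ghost p n b"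
    using *[of "witt_add_poly p"] unfolding xy_subst_ghost[symmetric] witt_polys[OF p]
    by (simp add: witt_ring_def s that xy_subst_simps xy_subst_ghost)
  show "(\<lambda>n. e (a n)) \<otimes>\<^bsub>witt_ring p R\<^esub> (\<lambda>n. e (b n)) = (\<lambda>n. e (c n))" if "\<And>n. ghost p n c = ghost p n a * ghost p n b"
    using *[of "witt_mult_poly p"] unfolding xy_subst_ghost[symmetric] witt_polys[OF p]
    by (simp add: witt_ring_def s that xy_subst_simps xy_subst_ghost)
qed

text \<open>Over integer polynomials a sum is obtained by substitution into the addition
  polynomials; later arguments only look at its ghost components.\<close>

lemma witt_ghost_add_ex:
  fixes a b :: "nat \<Rightarrow> xy_poly"
  assumes p: "normalization_semidom_class.prime p"
  shows "\<exists>c :: nat \<Rightarrow> xy_poly. \<forall>n. ghost p n c = ghost p n a + ghost p n b"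
proof -
  have "ghost p n (\<lambda>i. xy_subst (case_sum a b) (witt_add_poly p i)) = ghost p n a + ghost p n b" for n
    unfolding xy_subst_ghost[symmetric] witt_polys[OF p] by (simp add: xy_subst_simps xy_subst_ghost)
  then show ?thesis by blast
qed

section \<open>Operations on Witt vectors\<close>

lemma witt_ring_simps:
  "carrier (witt_ring p R) = UNIV \<rightarrow> carrier R"
  "\<one>\<^bsub>witt_ring p R\<^esub> = (\<lambda>n. if n = 0 then \<one>\<^bsub>R\<^esub> else \<zero>\<^bsub>R\<^esub>)"
  "\<zero>\<^bsub>witt_ring p R\<^esub> = (\<lambda>n. \<zero>\<^bsub>R\<^esub>)"
  by (auto simp: witt_ring_def)

definition teich :: "('a, 'x) ring_scheme \<Rightarrow> 'a \<Rightarrow> nat \<Rightarrow> 'a" where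
  "teich R a = (\<lambda>n. if n = 0 then a else \<zero>\<^bsub>R\<^esub>)"

context
  fixes p :: nat and R :: "('a, 'x) ring_scheme" (structure) and x y
  assumes p: "normalization_semidom_class.prime p" and R: "cring R"
    and x: "x \<in> carrier (witt_ring p R)" and y: "y \<in> carrier (witt_ring p R)"
begin

private abbreviation "e \<equiv> xy_eval R (case_sum x y)"
private abbreviation "XX \<equiv> \<lambda>i. xy_var (Inl i)"
private abbreviation "YY \<equiv> \<lambda>i. xy_var (Inr i)"

interpretation cring R by (rule R)

private lemma xy_carr: "case_sum x y i \<in> carrier R"
  using x y by (auto simp: witt_ring_simps split: sum.split)

private lemma e_hom: "e \<in> ring_hom class_ring R"
  by (rule xy_eval_hom) (rule xy_carr)

interpretation e: ring_hom_cring class_ring R e by unfold_locales (rule e_hom)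

private lemma e_var: "e (xy_var (Inl i)) = x i" "e (xy_var (Inr i)) = y i"
  using xy_eval_var[of "case_sum x y", OF xy_carr] by auto

private lemma e_ops: "e (f + g) = e f \<oplus> e g" "e (f * g) = e f \<otimes> e g" "e 0 = \<zero>" "e 1 = \<one>"
  using e.hom_add[of f g] e.hom_mult[of f g] e.hom_zero e.hom_one by auto

private lemma p0: "p > 0" using p prime_gt_0_nat by blast

lemma witt_add_eq: "x \<oplus>\<^bsub>witt_ring p R\<^esub> y = (\<lambda>n. e (witt_add_poly p n))"
  by (simp add: witt_ring_def)

lemma witt_mult_eq: "x \<otimes>\<^bsub>witt_ring p R\<^esub> y = (\<lambda>n. e (witt_mult_poly p n))"
  by (simp add: witt_ring_def)

lemma witt_closed:
  "x \<oplus>\<^bsub>witt_ring p R\<^esub> y \<in> carrier (witt_ring p R)" "x \<otimes>\<^bsub>witt_ring p R\<^esub> y \<in> carrier (witt_ring p R)"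
  unfolding witt_add_eq witt_mult_eq witt_ring_simps using e.hom_closed by auto

text \<open>A vector whose first \<open>m\<close> entries vanish has vanishing ghost components
  below \<open>m\<close>, and its \<open>m\<close>-th one is \<open>p ^ m\<close> times its entry.
  Hence adding it leaves the lower entries alone and is plain addition at place
  \<open>m\<close>.\<close>

lemma witt_add_shift:
  assumes m: "\<And>j. j < m \<Longrightarrow> y j = \<zero>"
  shows "i < m \<Longrightarrow> (x \<oplus>\<^bsub>witt_ring p R\<^esub> y) i = x i" "(x \<oplus>\<^bsub>witt_ring p R\<^esub> y) m = x m \<oplus> y m"
proof -
  \<comment> \<open>The universal vector with \<open>m\<close> leading zeros, which specializes to
    \<open>y\<close>.\<close>
  let ?b = "\<lambda>j. if j < m then 0 else xy_var (Inr j)"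
  obtain c where c: "\<And>n. ghost p n c = ghost p n XX + ghost p n ?b" using witt_ghost_add_ex[OF p] by metis
  have b: "(\<lambda>n. e (?b n)) = y" using m by (auto simp: e_ops e_var)
  have s: "x \<oplus>\<^bsub>witt_ring p R\<^esub> y = (\<lambda>n. e (c n))"
    using witt_transfer(1)[OF p R e_hom, of c XX ?b, OF c] unfolding b e_var .
  have 1: "c i = XX i" if "i < m" for i
  proof (rule ghost_inj[OF p0])
    fix k assume "k \<le> i"
    then show "ghost p k c = ghost p k XX" using c[of k] that by (simp add: ghost_zero[OF p0, of k ?b])
  qed
  then show "i < m \<Longrightarrow> (x \<oplus>\<^bsub>witt_ring p R\<^esub> y) i = x i" unfolding s by (simp add: e_var)
  have z: "(0::xy_poly) ^ (p ^ k) = 0" for k using p0 by (simp add: power_0_left)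
  have sc: "(\<Sum>i<m. of_nat p ^ i * c i ^ (p ^ (m - i))) = (\<Sum>i<m. of_nat p ^ i * XX i ^ (p ^ (m - i)))"
    by (rule sum.cong[OF refl]) (use 1 in simp)
  have sb: "(\<Sum>i<m. of_nat p ^ i * ?b i ^ (p ^ (m - i))) = 0"
    by (rule sum.neutral) (simp add: z)
  have "(\<Sum>i<m. of_nat p ^ i * XX i ^ (p ^ (m - i))) + of_nat p ^ m * c m
      = (\<Sum>i<m. of_nat p ^ i * XX i ^ (p ^ (m - i))) + of_nat p ^ m * XX m + (0 + of_nat p ^ m * ?b m)"
    using c[of m] unfolding ghost_split sc sb .
  then have "of_nat p ^ m * c m = of_nat p ^ m * XX m + of_nat p ^ m * xy_var (Inr m)"
    by (simp only: add.assoc add_left_cancel add_0_left less_irrefl if_False)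
  then have "of_nat (p ^ m) * c m = of_nat (p ^ m) * (xy_var (Inl m) + xy_var (Inr m))"
    by (simp only: of_nat_power distrib_left)
  moreover have "p ^ m > 0" using p0 by simp
  ultimately have "c m = xy_var (Inl m) + xy_var (Inr m)" by (rule xy_poly_cancel[rotated])
  then show "(x \<oplus>\<^bsub>witt_ring p R\<^esub> y) m = x m \<oplus> y m" unfolding s by (simp add: e_ops e_var)
qed

text \<open>In characteristic \<open>p\<close>, multiplication by \<open>p\<close> is Frobenius
  followed by a shift. Universally, \<open>p\<close> times the vector of variables and the shifted
  vector of powers have ghost components that differ by \<open>p ^ Suc n\<close> times a variable,
  so their entries are congruent modulo \<open>p\<close> by
  \<open>ghost_dvd_imp_dvd\<close>.\<close>

lemma witt_p_times:
  assumes char: "[p] \<cdot>\<^bsub>R\<^esub> \<one> = \<zero>"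
  shows "[p] \<cdot>\<^bsub>witt_ring p R\<^esub> x = (\<lambda>n. if n = 0 then \<zero> else x (n - 1) [^] p)"
proof -
  \<comment> \<open>The multiples of \<open>x\<close> unfold to iterated sums. A universal lift
    \<open>c\<close> is carried along with its ghost components, since no ring laws for
    \<open>witt_ring p R\<close> are at hand.\<close>
  have "\<exists>c. (\<lambda>n. e (c n)) = [k] \<cdot>\<^bsub>witt_ring p R\<^esub> x \<and> (\<forall>n. ghost p n c = of_nat k * ghost p n XX)" for k
  proof (induct k)
    case 0
    have "(\<lambda>n. e (0::xy_poly)) = [(0::nat)] \<cdot>\<^bsub>witt_ring p R\<^esub> x"
      by (simp add: add_pow_def nat_pow_def e_ops witt_ring_simps)
    moreover have "ghost p n (\<lambda>_. 0::xy_poly) = of_nat 0 * ghost p n XX" for n by (simp add: ghost_zero[OF p0])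
    ultimately show ?case by (intro exI[of _ "\<lambda>_. 0"]) simp
  next
    case (Suc k)
    then obtain c where c: "(\<lambda>n. e (c n)) = [k] \<cdot>\<^bsub>witt_ring p R\<^esub> x" "\<And>n. ghost p n c = of_nat k * ghost p n XX" by blast
    obtain d where d: "\<And>n. ghost p n d = ghost p n c + ghost p n XX" using witt_ghost_add_ex[OF p] by metis
    have "(\<lambda>n. e (d n)) = ([k] \<cdot>\<^bsub>witt_ring p R\<^esub> x) \<oplus>\<^bsub>witt_ring p R\<^esub> x"
      using witt_transfer(1)[OF p R e_hom, of d c XX, OF d] unfolding c e_var by simp
    also have "\<dots> = [Suc k] \<cdot>\<^bsub>witt_ring p R\<^esub> x" by (simp add: add_pow_def nat_pow_def)
    finally have "(\<lambda>n. e (d n)) = [Suc k] \<cdot>\<^bsub>witt_ring p R\<^esub> x" .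
    moreover have "ghost p n d = of_nat (Suc k) * ghost p n XX" for n
      unfolding d c(2) of_nat_Suc distrib_right mult_1 by (rule add.commute)
    ultimately show ?case by blast
  qed
  then obtain c where c: "(\<lambda>n. e (c n)) = [p] \<cdot>\<^bsub>witt_ring p R\<^esub> x" "\<And>n. ghost p n c = of_nat p * ghost p n XX" by blast
  let ?V = "\<lambda>n. if n = 0 then 0 else xy_var (Inl (n - 1)) ^ p"
  have V: "of_nat p * ghost p n XX - ghost p n ?V = of_nat p ^ Suc n * XX n" for n
  proof (cases n)
    case 0
    then show ?thesis by (simp add: ghost_0)
  next
    case (Suc k)
    have "ghost p (Suc k) ?V = (\<Sum>i\<le>Suc k. of_nat p ^ i * ?V i ^ (p ^ (Suc k - i)))" by (simp add: ghost_def)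
    also have "\<dots> = (\<Sum>i\<le>k. of_nat p ^ Suc i * (XX i ^ p) ^ (p ^ (k - i)))"
      unfolding sum.atMost_Suc_shift using p0 by (simp add: power_0_left)
    also have "\<dots> = of_nat p * (\<Sum>i\<le>k. of_nat p ^ i * (XX i ^ p) ^ (p ^ (k - i)))"
      by (simp add: sum_distrib_left mult.assoc)
    finally show ?thesis unfolding Suc ghost_Suc by (simp only: distrib_left add_diff_cancel_left') (simp add: mult.assoc)
  qed
  have "e (c n) = e (?V n)" for n
  proof -
    have "of_nat p dvd c n - ?V n"
      by (rule ghost_dvd_imp_dvd[OF p0]) (simp only: c V dvd_triv_left)
    then obtain f where "c n - ?V n = of_nat p * f" by (rule dvdE)
    then have "c n = ?V n + of_nat p * f" by (simp only: diff_eq_eq add.commute)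
    moreover have "e (of_nat p) = \<zero>"
    proof -
      have "e (of_nat k) = [k] \<cdot>\<^bsub>R\<^esub> \<one>" for k
        by (induct k) (auto simp: e_ops add.nat_pow_Suc a_comm)
      then show ?thesis using char by simp
    qed
    ultimately show ?thesis using e.hom_closed by (simp add: e_ops)
  qed
  then show ?thesis unfolding c(1)[symmetric]
    using e.hom_nat_pow'[of "XX i" p for i] by (auto simp: e_ops e_var)
qed

text \<open>The ghost components of a Teichmueller vector are the powers \<open>f ^ (p ^ n)\<close>,
  and powers are multiplicative. The factors appear as first entries of the Witt vectors
  \<open>x\<close> and \<open>y\<close> fixed in this context.\<close>

lemma witt_teich_mult:
  "teich R (x 0) \<otimes>\<^bsub>witt_ring p R\<^esub> teich R (y 0) = teich R (x 0 \<otimes> y 0)"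
proof -
  let ?t = "\<lambda>f n. if n = 0 then f else 0 :: xy_poly"
  have g: "ghost p n (?t f) = f ^ (p ^ n)" for f n
  proof -
    have "ghost p n (?t f) = (\<Sum>i\<in>{0}. of_nat p ^ i * ?t f i ^ (p ^ (n - i)))"
      unfolding ghost_def by (rule sum.mono_neutral_right) (use p0 in \<open>auto simp: power_0_left\<close>)
    then show ?thesis by simp
  qed
  have t: "(\<lambda>n. e (?t f n)) = teich R (e f)" for f by (auto simp: teich_def e_ops)
  have "(\<lambda>n. e (?t (XX 0) n)) \<otimes>\<^bsub>witt_ring p R\<^esub> (\<lambda>n. e (?t (YY 0) n)) = (\<lambda>n. e (?t (XX 0 * YY 0) n))"
    by (rule witt_transfer(2)[OF p R e_hom]) (simp only: g power_mult_distrib)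
  then show ?thesis unfolding t by (simp add: e_ops e_var)
qed

end

section \<open>Witt vectors of a finite field\<close>

text \<open>The ring laws for Witt vectors enter as the assumption \<open>cring_W\<close>; in the
  application they come from \<open>cring_of_powser\<close>.\<close>

locale finite_witt = k: field k for p and k :: "('a, 'x) ring_scheme" +
  assumes prime_p: "normalization_semidom_class.prime p"
    and char_p: "[p] \<cdot>\<^bsub>k\<^esub> \<one>\<^bsub>k\<^esub> = \<zero>\<^bsub>k\<^esub>"
    and finite_k: "finite (carrier k)"
    and cring_W: "cring (witt_ring p k)"
begin

abbreviation "W \<equiv> witt_ring p k"

sublocale W: cring W by (rule cring_W)

lemma p_pos: "p > 0" using prime_p prime_gt_0_nat by blast

lemma W_nth: "w \<in> carrier W \<Longrightarrow> w n \<in> carrier k"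
  by (auto simp: witt_ring_simps)

lemma W_I: "(\<And>n. w n \<in> carrier k) \<Longrightarrow> w \<in> carrier W"
  by (auto simp: witt_ring_simps)

text \<open>Both \<open>p\<close> and the order of the additive group annihilate 1; were they
  coprime, a Bezout combination would make 1 vanish.\<close>

lemma p_dvd_card: "p dvd card (carrier k)"
proof (rule ccontr)
  assume "\<not> p dvd card (carrier k)"
  then have "coprime p (card (carrier k))" using prime_p by (simp add: prime_imp_coprime)
  then obtain x y where xy: "int p * x + int (card (carrier k)) * y = 1"
    using bezout_int[of "int p" "int (card (carrier k))"] by (auto simp: mult.commute)
  have q: "[(card (carrier k))] \<cdot>\<^bsub>k\<^esub> \<one>\<^bsub>k\<^esub> = \<zero>\<^bsub>k\<^esub>"
    using k.add.pow_order_eq_1[of "\<one>\<^bsub>k\<^esub>"] by (simp add: order_def)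
  have "[(int p * x)] \<cdot>\<^bsub>k\<^esub> \<one>\<^bsub>k\<^esub> = \<zero>\<^bsub>k\<^esub>"
    using k.add.int_pow_pow[of "\<one>\<^bsub>k\<^esub>" x "int p"] char_p by (simp add: mult.commute add_pow_int_ge)
  moreover have "[(int (card (carrier k)) * y)] \<cdot>\<^bsub>k\<^esub> \<one>\<^bsub>k\<^esub> = \<zero>\<^bsub>k\<^esub>"
    using k.add.int_pow_pow[of "\<one>\<^bsub>k\<^esub>" y "int (card (carrier k))"] q by (simp add: mult.commute add_pow_int_ge)
  ultimately have "[(1::int)] \<cdot>\<^bsub>k\<^esub> \<one>\<^bsub>k\<^esub> = \<zero>\<^bsub>k\<^esub>"
    unfolding xy[symmetric] by (subst k.add.int_pow_mult) auto
  then show False using k.one_not_zero by (simp add: add_pow_int_ge)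
qed

lemma pow_p_zero_iff: "x \<in> carrier k \<Longrightarrow> x [^]\<^bsub>k\<^esub> p = \<zero>\<^bsub>k\<^esub> \<Longrightarrow> x = \<zero>\<^bsub>k\<^esub>"
proof -
  assume x: "x \<in> carrier k"
  have "x [^]\<^bsub>k\<^esub> n = \<zero>\<^bsub>k\<^esub> \<Longrightarrow> x = \<zero>\<^bsub>k\<^esub>" for n :: nat
    by (induct n) (use x k.integral_iff k.one_not_zero in auto)
  then show "x [^]\<^bsub>k\<^esub> p = \<zero>\<^bsub>k\<^esub> \<Longrightarrow> x = \<zero>\<^bsub>k\<^esub>" .
qed

text \<open>The order of the unit group is one less than that of the field, hence prime to
  \<open>p\<close>, so raising to the power \<open>p\<close> is invertible on units.\<close>

lemma pow_p_surj:
  assumes y: "y \<in> carrier k"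
  shows "\<exists>x\<in>carrier k. x [^]\<^bsub>k\<^esub> p = y"
proof (cases "y = \<zero>\<^bsub>k\<^esub>")
  case True
  then show ?thesis using p_pos by (intro bexI[of _ "\<zero>\<^bsub>k\<^esub>"]) (auto simp: k.nat_pow_zero)
next
  case False
  let ?n = "card (Units k)"
  have yU: "y \<in> Units k" using y False k.field_Units by auto
  have yn: "y [^]\<^bsub>k\<^esub> ?n = \<one>\<^bsub>k\<^esub>" by (rule k.units_power_order_eq_one[OF k.finite_ring_finite_units[OF finite_k] yU])
  have fin: "finite (Units k)" using finite_k k.finite_ring_finite_units by blast
  have n: "card (carrier k) = Suc ?n"
    using card.remove[OF finite_k k.zero_closed] unfolding k.field_Units .
  have "coprime p ?n"
  proof (rule prime_imp_coprime[OF prime_p])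
    show "\<not> p dvd ?n"
    proof
      assume "p dvd ?n"
      moreover have "p dvd Suc ?n" using p_dvd_card unfolding n .
      ultimately have "p dvd Suc ?n - ?n" by (rule dvd_diff_nat[rotated])
      then have "p dvd 1" by simp
      then show False using prime_p by simp
    qed
  qed
  \<comment> \<open>\<open>a\<close> inverts \<open>p\<close> modulo the order of the unit group, so
    \<open>y [^] a\<close> will be the root.\<close>
  then obtain a b where ab: "p * a = ?n * b + 1"
  proof -
    have "p \<noteq> 0" using p_pos by simp
    then obtain a b where "p * a = ?n * b + gcd p ?n" using bezout_nat by blast
    then show ?thesis using \<open>coprime p ?n\<close> that by (simp only: coprime_imp_gcd_eq_1)
  qed
  have "(y [^]\<^bsub>k\<^esub> a) [^]\<^bsub>k\<^esub> p = y [^]\<^bsub>k\<^esub> (?n * b + 1)"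
    using y ab by (simp add: k.nat_pow_pow mult.commute)
  also have "\<dots> = (y [^]\<^bsub>k\<^esub> ?n) [^]\<^bsub>k\<^esub> b \<otimes>\<^bsub>k\<^esub> y"
    using y by (simp add: k.nat_pow_pow)
  also have "\<dots> = y" using y by (simp add: yn)
  finally show ?thesis using y by blast
qed

lemma p_times: "w \<in> carrier W \<Longrightarrow> [p] \<cdot>\<^bsub>W\<^esub> w = (\<lambda>n. if n = 0 then \<zero>\<^bsub>k\<^esub> else w (n - 1) [^]\<^bsub>k\<^esub> p)"
  by (rule witt_p_times[OF prime_p k.cring_axioms _ _ char_p])

lemma p_torsion_free: "w \<in> carrier W \<Longrightarrow> [p] \<cdot>\<^bsub>W\<^esub> w = \<zero>\<^bsub>W\<^esub> \<Longrightarrow> w = \<zero>\<^bsub>W\<^esub>"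
proof -
  assume w: "w \<in> carrier W" "[p] \<cdot>\<^bsub>W\<^esub> w = \<zero>\<^bsub>W\<^esub>"
  have "w n [^]\<^bsub>k\<^esub> p = \<zero>\<^bsub>k\<^esub>" for n
    using fun_cong[OF w(2), of "Suc n"] p_times[OF w(1)] by (simp add: witt_ring_simps)
  then show "w = \<zero>\<^bsub>W\<^esub>" using pow_p_zero_iff W_nth[OF w(1)] by (auto simp: witt_ring_simps)
qed

text \<open>By \<open>p_times\<close>, multiplication by \<open>p\<close> prepends a zero and raises
  the entries to the power \<open>p\<close>. Conversely a vector starting with a zero is divided by
  \<open>p\<close> by taking \<open>p\<close>-th roots, which exist by
  \<open>pow_p_surj\<close>.\<close>

lemma p_multiple_iff:
  assumes "w \<in> carrier W"
  shows "(\<exists>v\<in>carrier W. w = [(p ^ n)] \<cdot>\<^bsub>W\<^esub> v) \<longleftrightarrow> (\<forall>i<n. w i = \<zero>\<^bsub>k\<^esub>)"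
  using assms
proof (induct n arbitrary: w)
  case 0
  then show ?case by auto
next
  case (Suc n)
  have pp: "[(p ^ Suc n)] \<cdot>\<^bsub>W\<^esub> v = [p] \<cdot>\<^bsub>W\<^esub> ([(p ^ n)] \<cdot>\<^bsub>W\<^esub> v)" if "v \<in> carrier W" for v
    using that by (simp add: W.add.nat_pow_pow mult.commute)
  show ?case
  proof
    assume "\<exists>v\<in>carrier W. w = [(p ^ Suc n)] \<cdot>\<^bsub>W\<^esub> v"
    then obtain v where v: "v \<in> carrier W" "w = [p] \<cdot>\<^bsub>W\<^esub> ([(p ^ n)] \<cdot>\<^bsub>W\<^esub> v)" using pp by auto
    let ?x = "[(p ^ n)] \<cdot>\<^bsub>W\<^esub> v"
    have x: "?x \<in> carrier W" using v by simp
    then have "\<forall>i<n. ?x i = \<zero>\<^bsub>k\<^esub>" using Suc.hyps v(1) by blast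
    then show "\<forall>i<Suc n. w i = \<zero>\<^bsub>k\<^esub>"
      unfolding v(2) p_times[OF x] using p_pos by (auto simp: k.nat_pow_zero)
  next
    assume z: "\<forall>i<Suc n. w i = \<zero>\<^bsub>k\<^esub>"
    have "\<forall>i. \<exists>x\<in>carrier k. x [^]\<^bsub>k\<^esub> p = w (Suc i)" using pow_p_surj W_nth[OF Suc.prems] by blast
    then obtain v where v: "\<And>i. v i \<in> carrier k" "\<And>i. v i [^]\<^bsub>k\<^esub> p = w (Suc i)" by metis
    have vW: "v \<in> carrier W" using v by (intro W_I)
    have w: "w = [p] \<cdot>\<^bsub>W\<^esub> v"
    proof
      fix i show "w i = ([p] \<cdot>\<^bsub>W\<^esub> v) i" using z v by (cases i) (auto simp: p_times[OF vW])
    qed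
    have "\<forall>i<n. v i = \<zero>\<^bsub>k\<^esub>" using z v pow_p_zero_iff by auto
    then obtain v' where "v' \<in> carrier W" "v = [(p ^ n)] \<cdot>\<^bsub>W\<^esub> v'" using Suc.hyps[OF vW] by blast
    then show "\<exists>v\<in>carrier W. w = [(p ^ Suc n)] \<cdot>\<^bsub>W\<^esub> v" using w pp by auto
  qed
qed

section \<open>p-adic approximation of Witt vectors\<close>

definition agree :: "nat \<Rightarrow> (nat \<Rightarrow> 'a) \<Rightarrow> (nat \<Rightarrow> 'a) \<Rightarrow> bool" where
  "agree n w v \<longleftrightarrow> (\<forall>i<n. w i = v i)"

text \<open>Agreement in the first \<open>n\<close> entries is congruence modulo
  \<open>p ^ n\<close>. From agreement to congruence, the difference is shown to vanish entry by
  entry: at its first entry not yet known to vanish, \<open>witt_add_shift\<close> gives plain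
  addition.\<close>

lemma agree_iff:
  assumes w: "w \<in> carrier W" and v: "v \<in> carrier W"
  shows "agree n w v \<longleftrightarrow> (\<exists>t\<in>carrier W. w = v \<oplus>\<^bsub>W\<^esub> [(p ^ n)] \<cdot>\<^bsub>W\<^esub> t)"
proof
  assume "\<exists>t\<in>carrier W. w = v \<oplus>\<^bsub>W\<^esub> [(p ^ n)] \<cdot>\<^bsub>W\<^esub> t"
  then obtain t where t: "t \<in> carrier W" "w = v \<oplus>\<^bsub>W\<^esub> [(p ^ n)] \<cdot>\<^bsub>W\<^esub> t" by blast
  have c: "[(p ^ n)] \<cdot>\<^bsub>W\<^esub> t \<in> carrier W" using t by simp
  have "\<forall>i<n. ([(p ^ n)] \<cdot>\<^bsub>W\<^esub> t) i = \<zero>\<^bsub>k\<^esub>" using p_multiple_iff[OF c] t(1) by blast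
  then show "agree n w v"
    unfolding agree_def t(2) using witt_add_shift(1)[OF prime_p k.cring_axioms v c, of n] by blast
next
  assume a: "agree n w v"
  define d where "d = w \<ominus>\<^bsub>W\<^esub> v"
  have d: "d \<in> carrier W" "w = v \<oplus>\<^bsub>W\<^esub> d"
    using w v by (auto simp: d_def W.minus_eq W.a_comm[of v] W.a_assoc W.l_neg)
  have "i < n \<Longrightarrow> d i = \<zero>\<^bsub>k\<^esub>" for i
  proof (induct i rule: less_induct)
    case (less i)
    have "w i = v i \<oplus>\<^bsub>k\<^esub> d i"
      unfolding d(2) by (rule witt_add_shift(2)[OF prime_p k.cring_axioms v d(1)], rule less.hyps) (use less.prems in simp_all)
    moreover have "w i = v i" using a less.prems by (simp add: agree_def)
    ultimately have "v i \<oplus>\<^bsub>k\<^esub> d i = v i \<oplus>\<^bsub>k\<^esub> \<zero>\<^bsub>k\<^esub>" using W_nth[OF v, of i] by simp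
    then show ?case by (rule k.add.l_cancel[OF _ W_nth[OF d(1)] k.zero_closed W_nth[OF v]])
  qed
  then obtain t where "t \<in> carrier W" "d = [(p ^ n)] \<cdot>\<^bsub>W\<^esub> t" using p_multiple_iff[OF d(1)] by blast
  then show "\<exists>t\<in>carrier W. w = v \<oplus>\<^bsub>W\<^esub> [(p ^ n)] \<cdot>\<^bsub>W\<^esub> t" using d by blast
qed

lemma agree_refl: "agree n w w" and agree_sym: "agree n w v \<Longrightarrow> agree n v w"
  and agree_trans: "agree n w v \<Longrightarrow> agree n v x \<Longrightarrow> agree n w x"
  and agree_mono: "m \<le> n \<Longrightarrow> agree n w v \<Longrightarrow> agree m w v"
  by (auto simp: agree_def)

lemma agree_eqI: "(\<And>n. agree n w v) \<Longrightarrow> w = v"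
  by (rule ext) (meson agree_def lessI)

lemma agree_add:
  assumes c: "w \<in> carrier W" "w' \<in> carrier W" "v \<in> carrier W" "v' \<in> carrier W"
    and "agree n w w'" "agree n v v'"
  shows "agree n (w \<oplus>\<^bsub>W\<^esub> v) (w' \<oplus>\<^bsub>W\<^esub> v')"
proof -
  obtain s t where st: "s \<in> carrier W" "w = w' \<oplus>\<^bsub>W\<^esub> [(p ^ n)] \<cdot>\<^bsub>W\<^esub> s" "t \<in> carrier W" "v = v' \<oplus>\<^bsub>W\<^esub> [(p ^ n)] \<cdot>\<^bsub>W\<^esub> t"
    using iffD1[OF agree_iff[OF c(1,2)] assms(5)] iffD1[OF agree_iff[OF c(3,4)] assms(6)] by blast
  have "w \<oplus>\<^bsub>W\<^esub> v = (w' \<oplus>\<^bsub>W\<^esub> v') \<oplus>\<^bsub>W\<^esub> ([(p ^ n)] \<cdot>\<^bsub>W\<^esub> s \<oplus>\<^bsub>W\<^esub> [(p ^ n)] \<cdot>\<^bsub>W\<^esub> t)"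
    unfolding st(2,4) using c st(1,3) by (simp add: W.a_ac)
  also have "[(p ^ n)] \<cdot>\<^bsub>W\<^esub> s \<oplus>\<^bsub>W\<^esub> [(p ^ n)] \<cdot>\<^bsub>W\<^esub> t = [(p ^ n)] \<cdot>\<^bsub>W\<^esub> (s \<oplus>\<^bsub>W\<^esub> t)"
    using st by (simp add: W.add.nat_pow_distrib)
  finally show ?thesis using c st(1,3)
    by (intro iffD2[OF agree_iff] bexI[of _ "s \<oplus>\<^bsub>W\<^esub> t"]) (simp_all add: st(2,4))
qed

lemma agree_mult_right:
  assumes c: "w \<in> carrier W" "w' \<in> carrier W" "v \<in> carrier W" and "agree n w w'"
  shows "agree n (w \<otimes>\<^bsub>W\<^esub> v) (w' \<otimes>\<^bsub>W\<^esub> v)"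
proof -
  obtain s where s: "s \<in> carrier W" "w = w' \<oplus>\<^bsub>W\<^esub> [(p ^ n)] \<cdot>\<^bsub>W\<^esub> s"
    using iffD1[OF agree_iff[OF c(1,2)] assms(4)] by blast
  have "w \<otimes>\<^bsub>W\<^esub> v = w' \<otimes>\<^bsub>W\<^esub> v \<oplus>\<^bsub>W\<^esub> [(p ^ n)] \<cdot>\<^bsub>W\<^esub> (s \<otimes>\<^bsub>W\<^esub> v)"
    unfolding s(2) using c s(1) by (simp add: W.l_distr W.add_pow_ldistr)
  then show ?thesis using c s(1)
    by (intro iffD2[OF agree_iff] bexI[of _ "s \<otimes>\<^bsub>W\<^esub> v"]) (simp_all add: s(2))
qed

lemma agree_finsum:
  assumes "finite I" "\<And>i. i \<in> I \<Longrightarrow> f i \<in> carrier W" "\<And>i. i \<in> I \<Longrightarrow> g i \<in> carrier W"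
    and "\<And>i. i \<in> I \<Longrightarrow> agree n (f i) (g i)"
  shows "agree n (\<Oplus>\<^bsub>W\<^esub>i\<in>I. f i) (\<Oplus>\<^bsub>W\<^esub>i\<in>I. g i)"
  using assms by (induct I rule: finite_induct) (auto simp: agree_refl Pi_def intro!: agree_add)

definition nat_W :: "nat \<Rightarrow> nat \<Rightarrow> 'a" where
  "nat_W m = [m] \<cdot>\<^bsub>W\<^esub> \<one>\<^bsub>W\<^esub>"

lemma nat_W_closed: "nat_W m \<in> carrier W"
  by (simp add: nat_W_def)

lemma nat_W_cong:
  assumes "m mod p ^ n = m' mod p ^ n"
  shows "agree n (nat_W m) (nat_W m')"
proof -
  have *: "agree n (nat_W m) (nat_W (m mod p ^ n))" for m
  proof -
    have "nat_W m = nat_W (m mod p ^ n + p ^ n * (m div p ^ n))" by simp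
    also have "\<dots> = nat_W (m mod p ^ n) \<oplus>\<^bsub>W\<^esub> [(p ^ n)] \<cdot>\<^bsub>W\<^esub> (nat_W (m div p ^ n))"
      unfolding nat_W_def by (simp only: W.add.nat_pow_mult W.add.nat_pow_pow W.one_closed mult.commute)
    finally show ?thesis by (intro iffD2[OF agree_iff[OF nat_W_closed nat_W_closed]] bexI[OF _ nat_W_closed])
  qed
  show ?thesis by (rule agree_trans[OF *[of m, unfolded assms] agree_sym[OF *[of m']]])
qed

text \<open>Shows that the definite description \<open>padic_to_witt\<close> denotes: the residues
  \<open>z n\<close> give Witt vectors that agree in more and more entries, and the limit is taken
  entrywise.\<close>

lemma padic_to_witt:
  assumes z: "z \<in> carrier (padic_ints p)"
  shows "padic_to_witt p k z \<in> carrier W" "agree n (padic_to_witt p k z) (nat_W (nat (z n)))"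
proof -
  have z0: "z n \<ge> 0" for n using z by (simp add: padic_ints_def)
  have zn: "[(z n)] \<cdot>\<^bsub>W\<^esub> \<one>\<^bsub>W\<^esub> = nat_W (nat (z n))" for n using z0 by (simp add: nat_W_def add_pow_int_ge)
  have compat: "agree n (nat_W (nat (z m))) (nat_W (nat (z n)))" if "n \<le> m" for n m
  proof (rule nat_W_cong)
    have "z m mod int p ^ n = z n mod int p ^ n"
      using padic_ints_mod[OF z that] padic_ints_mod[OF z order_refl, of n] by simp
    then have "int (nat (z m) mod p ^ n) = int (nat (z n) mod p ^ n)" using z0 by (simp add: zmod_int)
    then show "nat (z m) mod p ^ n = nat (z n) mod p ^ n" by (rule of_nat_eq_iff[THEN iffD1])
  qed
  \<comment> \<open>Entry \<open>i\<close> is stable from the residue modulo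
    \<open>p ^ Suc i\<close> on.\<close>
  define w where "w = (\<lambda>i. nat_W (nat (z (Suc i))) i)"
  have wW: "w \<in> carrier W" unfolding w_def by (rule W_I) (rule W_nth[OF nat_W_closed])
  have wa: "agree n w (nat_W (nat (z n)))" for n
    unfolding agree_def w_def
  proof (intro allI impI)
    fix i assume "i < n"
    then have "agree (Suc i) (nat_W (nat (z n))) (nat_W (nat (z (Suc i))))" by (intro compat) simp
    then show "nat_W (nat (z (Suc i))) i = nat_W (nat (z n)) i" by (simp add: agree_def)
  qed
  have spec: "(\<forall>n. \<exists>v\<in>carrier W. x = [(z n)] \<cdot>\<^bsub>W\<^esub> \<one>\<^bsub>W\<^esub> \<oplus>\<^bsub>W\<^esub> [(p ^ n)] \<cdot>\<^bsub>W\<^esub> v) \<longleftrightarrow> (\<forall>n. agree n x (nat_W (nat (z n))))"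
    if "x \<in> carrier W" for x
    unfolding zn using agree_iff[OF that nat_W_closed] by blast
  have "padic_to_witt p k z = w"
    unfolding padic_to_witt_def
  proof (rule the_equality)
    show "w \<in> carrier W \<and> (\<forall>n. \<exists>v\<in>carrier W. w = [(z n)] \<cdot>\<^bsub>W\<^esub> \<one>\<^bsub>W\<^esub> \<oplus>\<^bsub>W\<^esub> [(p ^ n)] \<cdot>\<^bsub>W\<^esub> v)"
      using spec[OF wW] wa wW by blast
    fix x assume "x \<in> carrier W \<and> (\<forall>n. \<exists>v\<in>carrier W. x = [(z n)] \<cdot>\<^bsub>W\<^esub> \<one>\<^bsub>W\<^esub> \<oplus>\<^bsub>W\<^esub> [(p ^ n)] \<cdot>\<^bsub>W\<^esub> v)"
    then have "\<forall>n. agree n x (nat_W (nat (z n)))" using spec by blast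
    then show "x = w" using wa agree_trans agree_sym by (intro agree_eqI) blast
  qed
  then show "padic_to_witt p k z \<in> carrier W" "agree n (padic_to_witt p k z) (nat_W (nat (z n)))"
    using wW wa by auto
qed

abbreviation "tch \<equiv> teich k"

lemma tch_closed: "a \<in> carrier k \<Longrightarrow> tch a \<in> carrier W"
  by (rule W_I) (simp add: teich_def)

lemma tch_mult:
  assumes "a \<in> carrier k" "b \<in> carrier k"
  shows "tch a \<otimes>\<^bsub>W\<^esub> tch b = tch (a \<otimes>\<^bsub>k\<^esub> b)"
  using witt_teich_mult[OF prime_p k.cring_axioms tch_closed[OF assms(1)] tch_closed[OF assms(2)]]
  by (simp add: teich_def)

lemma tch_one: "tch \<one>\<^bsub>k\<^esub> = \<one>\<^bsub>W\<^esub>" and tch_zero: "tch \<zero>\<^bsub>k\<^esub> = \<zero>\<^bsub>W\<^esub>"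
  by (auto simp: teich_def witt_ring_simps)

text \<open>Splitting off the Teichmueller representative of the first entry again and again writes
  \<open>w\<close> as the sum of \<open>p ^ i\<close> times the representative of
  \<open>d i\<close>. The field being finite, terms are collected by the value \<open>a\<close> of
  \<open>d i\<close>; the coefficient of \<open>tch a\<close> is the p-adic integer with digit 1
  exactly where \<open>d i = a\<close>.\<close>

lemma witt_expansion:
  assumes w: "w \<in> carrier W"
  shows "\<exists>z. (\<forall>a\<in>carrier k. z a \<in> carrier (padic_ints p)) \<and>
    w = (\<Oplus>\<^bsub>W\<^esub>a\<in>carrier k. padic_to_witt p k (z a) \<otimes>\<^bsub>W\<^esub> tch a)"
proof -
  have "\<exists>t. t \<in> carrier W \<and> v = tch (v 0) \<oplus>\<^bsub>W\<^esub> [p] \<cdot>\<^bsub>W\<^esub> t" if v: "v \<in> carrier W" for v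
  proof -
    have "agree 1 v (tch (v 0))" by (simp add: agree_def teich_def)
    then show ?thesis using agree_iff[OF v tch_closed[OF W_nth[OF v]]] by auto
  qed
  then obtain nxt where nxt: "\<And>v. v \<in> carrier W \<Longrightarrow> nxt v \<in> carrier W"
    "\<And>v. v \<in> carrier W \<Longrightarrow> v = tch (v 0) \<oplus>\<^bsub>W\<^esub> [p] \<cdot>\<^bsub>W\<^esub> nxt v" by metis
  define v where "v i = (nxt ^^ i) w" for i
  have vW: "v i \<in> carrier W" for i by (induct i) (auto simp: v_def w nxt)
  define d where "d i = v i 0" for i
  have dk: "d i \<in> carrier k" for i unfolding d_def by (rule W_nth[OF vW])
  have vS: "v i = tch (d i) \<oplus>\<^bsub>W\<^esub> [p] \<cdot>\<^bsub>W\<^esub> v (Suc i)" for i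
    using nxt(2)[OF vW[of i]] by (simp add: v_def d_def)
  \<comment> \<open>The digits are 0 and 1, so the partial sums are already reduced modulo
    \<open>p ^ n\<close>, as \<open>p \<ge> 2\<close>.\<close>
  define z where "z a = (\<lambda>n. \<Sum>i<n. if d i = a then int p ^ i else 0)" for a
  have z0: "z a n \<ge> 0" for a n unfolding z_def by (rule sum_nonneg) auto
  have zlt: "z a n < int p ^ n" for a n
  proof (induct n)
    case (Suc n)
    have "z a (Suc n) \<le> z a n + int p ^ n" by (simp add: z_def)
    also have "\<dots> < int p ^ n + int p ^ n" using Suc by simp
    also have "\<dots> = 2 * int p ^ n" by simp
    also have "\<dots> \<le> int p * int p ^ n" using prime_ge_2_nat[OF prime_p] by (intro mult_right_mono) auto
    finally show ?case by simp
  qed (simp add: z_def)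
  have zZ: "z a \<in> carrier (padic_ints p)" for a
  proof -
    have "z a (Suc n) mod int p ^ n = z a n" for n
    proof -
      have "z a (Suc n) mod int p ^ n = z a n mod int p ^ n" by (simp add: z_def)
      then show ?thesis using z0[of a n] zlt[of a n] by simp
    qed
    then show ?thesis using z0 zlt by (simp add: padic_ints_def)
  qed
  define s where "s n = (\<Oplus>\<^bsub>W\<^esub>a\<in>carrier k. nat_W (nat (z a n)) \<otimes>\<^bsub>W\<^esub> tch a)" for n
  have sW: "s n \<in> carrier W" for n
    unfolding s_def using tch_closed nat_W_closed by (auto intro!: W.finsum_closed)
  \<comment> \<open>The remainder after \<open>n\<close> steps is \<open>p ^ n\<close> times the
    \<open>n\<close>-th iterate, so \<open>s n\<close> approximates \<open>w\<close> modulo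
    \<open>p ^ n\<close>.\<close>
  have ws: "w = s n \<oplus>\<^bsub>W\<^esub> [(p ^ n)] \<cdot>\<^bsub>W\<^esub> v n" for n
  proof (induct n)
    case 0
    have "s 0 = (\<Oplus>\<^bsub>W\<^esub>a\<in>carrier k. \<zero>\<^bsub>W\<^esub>)"
      unfolding s_def by (rule W.finsum_cong') (auto simp: z_def nat_W_def tch_closed)
    then show ?case using w by (simp add: v_def)
  next
    case (Suc n)
    have t: "[(p ^ n)] \<cdot>\<^bsub>W\<^esub> tch (d n) \<in> carrier W" using tch_closed[OF dk] by simp
    have "s (Suc n) = (\<Oplus>\<^bsub>W\<^esub>a\<in>carrier k. nat_W (nat (z a n)) \<otimes>\<^bsub>W\<^esub> tch a \<oplus>\<^bsub>W\<^esub>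
        (if d n = a then [(p ^ n)] \<cdot>\<^bsub>W\<^esub> tch a else \<zero>\<^bsub>W\<^esub>))"
      unfolding s_def
    proof (rule W.finsum_cong')
      fix a assume a: "a \<in> carrier k"
      show "nat_W (nat (z a (Suc n))) \<otimes>\<^bsub>W\<^esub> tch a = nat_W (nat (z a n)) \<otimes>\<^bsub>W\<^esub> tch a \<oplus>\<^bsub>W\<^esub>
        (if d n = a then [(p ^ n)] \<cdot>\<^bsub>W\<^esub> tch a else \<zero>\<^bsub>W\<^esub>)"
      proof (cases "d n = a")
        case True
        have "z a (Suc n) = z a n + int (p ^ n)" using True by (simp add: z_def)
        then have "nat (z a (Suc n)) = nat (z a n) + p ^ n"
          by (simp only: nat_add_distrib[OF z0 of_nat_0_le_iff] nat_int)
        then have "nat_W (nat (z a (Suc n))) = nat_W (nat (z a n)) \<oplus>\<^bsub>W\<^esub> nat_W (p ^ n)"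
          by (simp only: nat_W_def W.add.nat_pow_mult W.one_closed)
        moreover have "nat_W (p ^ n) \<otimes>\<^bsub>W\<^esub> tch a = [(p ^ n)] \<cdot>\<^bsub>W\<^esub> tch a"
          using tch_closed[OF a] by (simp add: nat_W_def W.add_pow_ldistr)
        ultimately show ?thesis using True tch_closed[OF a] nat_W_closed by (simp add: W.l_distr)
      next
        case False
        then have "z a (Suc n) = z a n" by (simp add: z_def)
        then show ?thesis using False tch_closed[OF a] nat_W_closed by simp
      qed
    qed (use tch_closed nat_W_closed in auto)
    also have "\<dots> = s n \<oplus>\<^bsub>W\<^esub> (\<Oplus>\<^bsub>W\<^esub>a\<in>carrier k. if d n = a then [(p ^ n)] \<cdot>\<^bsub>W\<^esub> tch a else \<zero>\<^bsub>W\<^esub>)"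
      unfolding s_def by (rule W.finsum_addf) (use tch_closed nat_W_closed in auto)
    also have "(\<Oplus>\<^bsub>W\<^esub>a\<in>carrier k. if d n = a then [(p ^ n)] \<cdot>\<^bsub>W\<^esub> tch a else \<zero>\<^bsub>W\<^esub>) = [(p ^ n)] \<cdot>\<^bsub>W\<^esub> tch (d n)"
      by (rule W.finsum_singleton) (use dk finite_k tch_closed in auto)
    finally have sS: "s (Suc n) = s n \<oplus>\<^bsub>W\<^esub> [(p ^ n)] \<cdot>\<^bsub>W\<^esub> tch (d n)" .
    have "w = s n \<oplus>\<^bsub>W\<^esub> [(p ^ n)] \<cdot>\<^bsub>W\<^esub> (tch (d n) \<oplus>\<^bsub>W\<^esub> [p] \<cdot>\<^bsub>W\<^esub> v (Suc n))"
      using Suc vS[of n] by simp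
    also have "[(p ^ n)] \<cdot>\<^bsub>W\<^esub> (tch (d n) \<oplus>\<^bsub>W\<^esub> [p] \<cdot>\<^bsub>W\<^esub> v (Suc n)) =
        [(p ^ n)] \<cdot>\<^bsub>W\<^esub> tch (d n) \<oplus>\<^bsub>W\<^esub> [(p ^ Suc n)] \<cdot>\<^bsub>W\<^esub> v (Suc n)"
      using tch_closed[OF dk] vW by (simp add: W.add.nat_pow_distrib W.add.nat_pow_pow mult.commute)
    finally show ?case unfolding sS using sW t vW by (simp add: W.a_assoc)
  qed
  have "w = (\<Oplus>\<^bsub>W\<^esub>a\<in>carrier k. padic_to_witt p k (z a) \<otimes>\<^bsub>W\<^esub> tch a)" (is "w = ?r")
  proof (rule agree_eqI)
    fix n
    have "agree n w (s n)" using agree_iff[OF w sW] ws vW by blast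
    moreover have "agree n ?r (s n)"
      unfolding s_def
      by (rule agree_finsum[OF finite_k])
        (use padic_to_witt[OF zZ] tch_closed nat_W_closed in \<open>auto intro!: agree_mult_right\<close>)
    ultimately show "agree n w ?r" using agree_trans agree_sym by blast
  qed
  then show ?thesis using zZ by (intro exI[of _ z] conjI ballI)
qed

text \<open>The order of the group of Teichmueller representatives is prime to \<open>p\<close>, hence invertible.\<close>

lemma card_units_invertible:
  "\<exists>c\<in>carrier W. c \<otimes>\<^bsub>W\<^esub> nat_W (card (carrier k - {\<zero>\<^bsub>k\<^esub>})) = \<one>\<^bsub>W\<^esub>"
proof -
  let ?m = "card (carrier k - {\<zero>\<^bsub>k\<^esub>})"
  have m: "card (carrier k) = Suc ?m"
    by (rule card.remove[OF finite_k k.zero_closed])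
  have pm: "\<not> p dvd ?m"
  proof
    assume "p dvd ?m"
    moreover have "p dvd Suc ?m" using p_dvd_card unfolding m .
    ultimately have "p dvd Suc ?m - ?m" by (rule dvd_diff_nat[rotated])
    then have "p dvd 1" by simp
    then show False using prime_p by simp
  qed
  interpret Z: cring "padic_ints p" by (rule padic_ints_cring[OF p_pos])
  let ?z = "[(?m)] \<cdot>\<^bsub>padic_ints p\<^esub> \<one>\<^bsub>padic_ints p\<^esub>"
  have zn: "?z = (\<lambda>n. int ?m mod int p ^ n)" by (rule padic_ints_nat[OF p_pos])
  have "?z (Suc 0) \<noteq> 0"
  proof
    assume "?z (Suc 0) = 0"
    then have "int p dvd int ?m" unfolding zn by auto
    then show False using pm by (simp only: of_nat_dvd_iff)
  qed
  moreover have zc: "?z \<in> carrier (padic_ints p)" by (rule Z.add.nat_pow_closed[OF Z.one_closed])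
  ultimately obtain y where y: "y \<in> carrier (padic_ints p)" "\<one>\<^bsub>padic_ints p\<^esub> = y \<otimes>\<^bsub>padic_ints p\<^esub> ?z"
    using padic_ints_one_step[OF prime_p zc Z.one_closed padic_ints_0[OF zc] _ padic_ints_0[OF Z.one_closed]] by blast
  have yn: "(y n * int ?m) mod int p ^ n = 1 mod int p ^ n" for n
    using fun_cong[OF y(2), of n] unfolding zn by (simp add: padic_ints_def mod_simps)
  have y0: "y n \<ge> 0" for n using y(1) by (simp add: padic_ints_def)
  have "padic_to_witt p k y \<otimes>\<^bsub>W\<^esub> nat_W ?m = \<one>\<^bsub>W\<^esub>"
  proof (rule agree_eqI)
    fix n
    have "agree n (padic_to_witt p k y \<otimes>\<^bsub>W\<^esub> nat_W ?m) (nat_W (nat (y n)) \<otimes>\<^bsub>W\<^esub> nat_W ?m)"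
      using padic_to_witt[OF y(1)] nat_W_closed by (intro agree_mult_right) auto
    also have "nat_W (nat (y n)) \<otimes>\<^bsub>W\<^esub> nat_W ?m = nat_W (nat (y n) * ?m)"
      unfolding nat_W_def by (simp add: W.add_pow_ldistr W.add.nat_pow_pow mult.commute)
    finally have 1: "agree n (padic_to_witt p k y \<otimes>\<^bsub>W\<^esub> nat_W ?m) (nat_W (nat (y n) * ?m))" .
    have 2: "agree n (nat_W (nat (y n) * ?m)) (nat_W 1)"
    proof (rule nat_W_cong)
      have "int ((nat (y n) * ?m) mod p ^ n) = (y n * int ?m) mod int p ^ n"
        by (simp only: zmod_int of_nat_mult of_nat_power nat_0_le[OF y0])
      also have "\<dots> = int (1 mod p ^ n)" unfolding yn by (simp only: zmod_int of_nat_1 of_nat_power)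
      finally have "int ((nat (y n) * ?m) mod p ^ n) = int (1 mod p ^ n)" .
      then show "(nat (y n) * ?m) mod p ^ n = 1 mod p ^ n" by (rule of_nat_eq_iff[THEN iffD1])
    qed
    have "nat_W 1 = \<one>\<^bsub>W\<^esub>" by (simp add: nat_W_def)
    then show "agree n (padic_to_witt p k y \<otimes>\<^bsub>W\<^esub> nat_W ?m) \<one>\<^bsub>W\<^esub>" using agree_trans[OF 1 2] by simp
  qed
  then show ?thesis using padic_to_witt(1)[OF y(1)] by blast
qed

end

section \<open>Tensor products\<close>

lemma (in abelian_group) eq_of_minus_zero:
  assumes "x \<in> carrier G" "y \<in> carrier G" "x \<ominus> y = \<zero>"
  shows "x = y"
proof -
  have "x = (x \<ominus> y) \<oplus> y" using assms(1,2) by (simp add: minus_eq a_assoc l_neg)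
  then show ?thesis using assms by simp
qed

lemma frag_extend_add_fun:
  "frag_extend (\<lambda>x. f x + g x) c = frag_extend f c + frag_extend g c"
  by (simp add: frag_extend_def frag_cmul_distrib2 sum.distrib)

lemma frag_extend_diff_fun:
  "frag_extend (\<lambda>x. f x - g x) c = frag_extend f c - frag_extend g c"
  using frag_extend_add_fun[of "\<lambda>x. f x - g x" g c] by (simp add: algebra_simps)

lemma pair_mult_diff:
  "pair_mult A B (x - x') y = pair_mult A B x y - pair_mult A B x' y"
  "pair_mult A B x (y - y') = pair_mult A B x y - pair_mult A B x y'"
  by (simp_all add: pair_mult_def frag_extend_diff case_prod_unfold frag_extend_diff_fun)

lemma pair_mult_0 [simp]: "pair_mult A B 0 y = 0" "pair_mult A B x 0 = 0"
  using pair_mult_diff(1)[of A B 0 0 y] pair_mult_diff(2)[of A B x 0 0] by auto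

lemma pair_mult_add:
  "pair_mult A B (x + x') y = pair_mult A B x y + pair_mult A B x' y"
  "pair_mult A B x (y + y') = pair_mult A B x y + pair_mult A B x y'"
proof -
  show "pair_mult A B (x + x') y = pair_mult A B x y + pair_mult A B x' y"
    using pair_mult_diff(1)[of A B "x + x'" x' y] by (simp add: eq_diff_eq)
  show "pair_mult A B x (y + y') = pair_mult A B x y + pair_mult A B x y'"
    using pair_mult_diff(2)[of A B x "y + y'" y'] by (simp add: eq_diff_eq)
qed

lemma pair_mult_frag_of:
  "pair_mult A B (frag_of (a, b)) (frag_of (a', b')) = frag_of (a \<otimes>\<^bsub>A\<^esub> a', b \<otimes>\<^bsub>B\<^esub> b')"
  by (simp add: pair_mult_def frag_extend_of)

declare carrier_free_Abelian_group_iff [simp del]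

section \<open>The tensor product of two algebras as a ring\<close>

text \<open>The associativity laws for scalars are what makes a product with a balancing relation
  again a balancing relation, in \<open>pm_N\<close>.\<close>

locale tensor_setup =
  A?: cring A + B?: cring B
  for k :: "('k, 'x) ring_scheme" and A :: "('k, 'a) module" and B :: "('k, 'b) module" +
  assumes A_smult_closed: "c \<in> carrier k \<Longrightarrow> a \<in> carrier A \<Longrightarrow> c \<odot>\<^bsub>A\<^esub> a \<in> carrier A"
    and A_smult_assoc: "c \<in> carrier k \<Longrightarrow> a \<in> carrier A \<Longrightarrow> a' \<in> carrier A \<Longrightarrow>
      (c \<odot>\<^bsub>A\<^esub> a) \<otimes>\<^bsub>A\<^esub> a' = c \<odot>\<^bsub>A\<^esub> (a \<otimes>\<^bsub>A\<^esub> a')"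
    and B_smult_closed: "c \<in> carrier k \<Longrightarrow> b \<in> carrier B \<Longrightarrow> c \<odot>\<^bsub>B\<^esub> b \<in> carrier B"
    and B_smult_assoc: "c \<in> carrier k \<Longrightarrow> b \<in> carrier B \<Longrightarrow> b' \<in> carrier B \<Longrightarrow>
      (c \<odot>\<^bsub>B\<^esub> b) \<otimes>\<^bsub>B\<^esub> b' = c \<odot>\<^bsub>B\<^esub> (b \<otimes>\<^bsub>B\<^esub> b')"
begin

abbreviation "G \<equiv> free_Abelian_group (carrier A \<times> carrier B)"
abbreviation "N \<equiv> tensor_rels k A B"
abbreviation "cls \<equiv> tensor_class k A B"
abbreviation "TA \<equiv> tensor_algebra k A B"
abbreviation "pm \<equiv> pair_mult A B"

sublocale G: comm_group G
  by (rule abelian_free_Abelian_group)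

lemma G_simps: "carrier G = {c. Poly_Mapping.keys c \<subseteq> carrier A \<times> carrier B}"
  "x \<otimes>\<^bsub>G\<^esub> y = x + y" "\<one>\<^bsub>G\<^esub> = 0"
  by (auto simp: free_Abelian_group_def)

lemma G_inv: "x \<in> carrier G \<Longrightarrow> inv\<^bsub>G\<^esub> x = - x"
  by (simp add: inv_free_Abelian_group G_simps)

lemma G_frag_of: "a \<in> carrier A \<Longrightarrow> b \<in> carrier B \<Longrightarrow> frag_of (a, b) \<in> carrier G"
  by (simp add: G_simps)

lemma G_add: "x \<in> carrier G \<Longrightarrow> y \<in> carrier G \<Longrightarrow> x + y \<in> carrier G"
  using G.m_closed[of x y] by (simp add: G_simps(2))

lemma G_uminus: "x \<in> carrier G \<Longrightarrow> - x \<in> carrier G"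
  using G.inv_closed[of x] by (simp add: G_inv)

lemma G_diff: "x \<in> carrier G \<Longrightarrow> y \<in> carrier G \<Longrightarrow> x - y \<in> carrier G"
  using G_add[of x "- y"] G_uminus[of y] by simp

lemma G_zero: "0 \<in> carrier G" by (simp add: G_simps)

text \<open>Stated with differences, which also cover negatives and sums. The identities for
  \<open>pm\<close> below are checked on pure tensors by this rule.\<close>

lemma G_induct [consumes 1, case_names zero of diff]:
  assumes "x \<in> carrier G" and "P 0" and "\<And>a b. a \<in> carrier A \<Longrightarrow> b \<in> carrier B \<Longrightarrow> P (frag_of (a, b))"
    and "\<And>x y. P x \<Longrightarrow> P y \<Longrightarrow> P (x - y)"
  shows "P x"
  using assms by (intro frag_induction[of x "carrier A \<times> carrier B" P]) (auto simp: G_simps)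

definition "gens = {frag_of (a \<oplus>\<^bsub>A\<^esub> a', b) - frag_of (a, b) - frag_of (a', b) | a a' b.
         a \<in> carrier A \<and> a' \<in> carrier A \<and> b \<in> carrier B} \<union>
      {frag_of (a, b \<oplus>\<^bsub>B\<^esub> b') - frag_of (a, b) - frag_of (a, b') | a b b'.
         a \<in> carrier A \<and> b \<in> carrier B \<and> b' \<in> carrier B} \<union>
      {frag_of (c \<odot>\<^bsub>A\<^esub> a, b) - frag_of (a, c \<odot>\<^bsub>B\<^esub> b) | c a b.
         c \<in> carrier k \<and> a \<in> carrier A \<and> b \<in> carrier B}"

lemma N_def: "N = generate G gens"
  by (simp add: tensor_rels_def gens_def)

lemma gens_cases [consumes 1, case_names left right balanced]:
  assumes "g \<in> gens"
  obtains a a' b where "a \<in> carrier A" "a' \<in> carrier A" "b \<in> carrier B" "g = frag_of (a \<oplus>\<^bsub>A\<^esub> a', b) - frag_of (a, b) - frag_of (a', b)"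
  | a b b' where "a \<in> carrier A" "b \<in> carrier B" "b' \<in> carrier B" "g = frag_of (a, b \<oplus>\<^bsub>B\<^esub> b') - frag_of (a, b) - frag_of (a, b')"
  | c a b where "c \<in> carrier k" "a \<in> carrier A" "b \<in> carrier B" "g = frag_of (c \<odot>\<^bsub>A\<^esub> a, b) - frag_of (a, c \<odot>\<^bsub>B\<^esub> b)"
  using assms unfolding gens_def
  by (elim UnE CollectE exE conjE)
    ((rule that(1), assumption+) | (rule that(2), assumption+) | (rule that(3), assumption+))+

lemma gens_in:
  "a \<in> carrier A \<Longrightarrow> a' \<in> carrier A \<Longrightarrow> b \<in> carrier B \<Longrightarrow> frag_of (a \<oplus>\<^bsub>A\<^esub> a', b) - frag_of (a, b) - frag_of (a', b) \<in> gens"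
  "a \<in> carrier A \<Longrightarrow> b \<in> carrier B \<Longrightarrow> b' \<in> carrier B \<Longrightarrow> frag_of (a, b \<oplus>\<^bsub>B\<^esub> b') - frag_of (a, b) - frag_of (a, b') \<in> gens"
  "c \<in> carrier k \<Longrightarrow> a \<in> carrier A \<Longrightarrow> b \<in> carrier B \<Longrightarrow> frag_of (c \<odot>\<^bsub>A\<^esub> a, b) - frag_of (a, c \<odot>\<^bsub>B\<^esub> b) \<in> gens"
  unfolding gens_def by blast+

lemma gens_carrier: "gens \<subseteq> carrier G"
proof
  fix g assume "g \<in> gens"
  then show "g \<in> carrier G"
  proof (cases rule: gens_cases)
    case (left a a' b)
    show ?thesis unfolding left(4) by (intro G_diff G_frag_of A.a_closed left(1-3))
  next
    case (right a b b')
    show ?thesis unfolding right(4) by (intro G_diff G_frag_of B.a_closed right(1-3))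
  next
    case (balanced c a b)
    show ?thesis unfolding balanced(4) by (intro G_diff G_frag_of A_smult_closed B_smult_closed balanced(1-3))
  qed
qed

lemma N_subgroup: "subgroup N G"
  unfolding N_def by (rule G.generate_is_subgroup[OF gens_carrier])

lemma N_normal: "N \<lhd> G"
  by (rule G.subgroup_imp_normal[OF N_subgroup])

lemma N_ops: "x \<in> N \<Longrightarrow> x \<in> carrier G" "0 \<in> N" "x \<in> N \<Longrightarrow> y \<in> N \<Longrightarrow> x + y \<in> N" "x \<in> N \<Longrightarrow> - x \<in> N"
    "x \<in> N \<Longrightarrow> y \<in> N \<Longrightarrow> x - y \<in> N"
proof -
  show c: "x \<in> N \<Longrightarrow> x \<in> carrier G" for x using subgroup.subset[OF N_subgroup] by blast
  show "0 \<in> N" using subgroup.one_closed[OF N_subgroup] by (simp add: G_simps)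
  show a: "x \<in> N \<Longrightarrow> y \<in> N \<Longrightarrow> x + y \<in> N" for x y using subgroup.m_closed[OF N_subgroup, of x y] by (simp add: G_simps(2))
  show m: "x \<in> N \<Longrightarrow> - x \<in> N" for x using subgroup.m_inv_closed[OF N_subgroup, of x] c by (simp add: G_inv)
  show "x \<in> N \<Longrightarrow> y \<in> N \<Longrightarrow> x - y \<in> N" using a[of x "- y"] m[of y] by simp
qed

lemma gens_N: "g \<in> gens \<Longrightarrow> g \<in> N"
  unfolding N_def by (rule generate.incl)

lemma N_induct [consumes 1, case_names gens zero diff]:
  assumes "x \<in> N" and "\<And>g. g \<in> gens \<Longrightarrow> P g" and "P 0"
    and "\<And>x y. x \<in> carrier G \<Longrightarrow> y \<in> carrier G \<Longrightarrow> P x \<Longrightarrow> P y \<Longrightarrow> P (x - y)"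
  shows "P x"
proof -
  have "x \<in> carrier G \<and> P x"
    using assms(1) unfolding N_def
  proof induct
    case one
    then show ?case using assms(3) by (simp add: G_simps)
  next
    case (incl h)
    then show ?case using assms(2) gens_carrier by blast
  next
    case (inv h)
    then have h: "h \<in> carrier G" using gens_carrier by blast
    have "P (0 - h)" by (rule assms(4)[OF G_zero h assms(3) assms(2)[OF inv]])
    then show ?case using h G_uminus by (simp add: G_inv)
  next
    case (eng h1 h2)
    have c: "h1 \<in> carrier G" "h2 \<in> carrier G" and P: "P h1" "P h2" using eng(2,4) by simp_all
    have "P (0 - h2)" by (rule assms(4)[OF G_zero c(2) assms(3) P(2)])
    then have "P (h1 - (0 - h2))" by (rule assms(4)[OF c(1) G_diff[OF G_zero c(2)] P(1)])
    then show ?case using G_add[OF c] by (simp only: G_simps(2) diff_0 diff_minus_eq_add)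
  qed
  then show ?thesis ..
qed

lemma cls_def': "cls x = N #>\<^bsub>G\<^esub> x"
  by (simp add: tensor_class_def)

lemma in_cls: "x' \<in> cls x \<longleftrightarrow> x' - x \<in> N"
proof
  assume "x' \<in> cls x"
  then obtain n where "n \<in> N" "x' = n \<otimes>\<^bsub>G\<^esub> x" unfolding cls_def' r_coset_def by blast
  then show "x' - x \<in> N" by (simp only: G_simps(2) add_diff_cancel)
next
  assume "x' - x \<in> N"
  moreover have "x' = (x' - x) \<otimes>\<^bsub>G\<^esub> x" by (simp only: G_simps(2) diff_add_cancel)
  ultimately show "x' \<in> cls x" unfolding cls_def' r_coset_def by blast
qed

lemma cls_eq_iff:
  assumes "x \<in> carrier G" "y \<in> carrier G"
  shows "cls x = cls y \<longleftrightarrow> x - y \<in> N"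
proof -
  have "x - y \<in> N \<longleftrightarrow> x \<in> cls y" by (simp add: in_cls)
  moreover have "cls x = cls y \<longleftrightarrow> x \<in> cls y"
    unfolding cls_def'
    using G.repr_independence[OF _ assms(2) N_subgroup, of x] G.rcos_self[OF assms(1) N_subgroup] by auto
  ultimately show ?thesis by blast
qed

lemma in_cls_carrier: "x' \<in> cls x \<Longrightarrow> x \<in> carrier G \<Longrightarrow> x' \<in> carrier G"
  using G_add[OF N_ops(1)[of "x' - x"], of x] by (simp add: in_cls)

lemma TA_carrier: "carrier TA = cls ` carrier G"
  by (auto simp: tensor_algebra_def tensor_group_def FactGroup_def RCOSETS_def cls_def')

lemma TA_carrierE:
  assumes "t \<in> carrier TA"
  obtains x where "x \<in> carrier G" "t = cls x"
  using assms unfolding TA_carrier by blast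

lemma cls_carrier: "x \<in> carrier G \<Longrightarrow> cls x \<in> carrier TA"
  unfolding TA_carrier by blast

lemma TA_add: "x \<in> carrier G \<Longrightarrow> y \<in> carrier G \<Longrightarrow> cls x \<oplus>\<^bsub>TA\<^esub> cls y = cls (x + y)"
  using normal.rcos_sum[OF N_normal, of x y]
  by (simp add: tensor_algebra_def tensor_group_def FactGroup_def cls_def' G_simps(2))

lemma TA_zero: "\<zero>\<^bsub>TA\<^esub> = cls 0"
  using G.coset_mult_one[OF subgroup.subset[OF N_subgroup]]
  by (simp add: tensor_algebra_def tensor_group_def FactGroup_def cls_def' G_simps(3))

lemma pm_closed: "x \<in> carrier G \<Longrightarrow> y \<in> carrier G \<Longrightarrow> pm x y \<in> carrier G"
proof (induct rule: G_induct)
  case (of a b)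
  show ?case using of(3)
    by (induct rule: G_induct) (auto simp: pair_mult_frag_of pair_mult_diff of G_zero intro: G_diff G_frag_of)
qed (auto simp: pair_mult_diff G_zero intro: G_diff)

lemma pm_comm: "x \<in> carrier G \<Longrightarrow> y \<in> carrier G \<Longrightarrow> pm x y = pm y x"
proof (induct rule: G_induct)
  case (of a b)
  show ?case using of(3)
    by (induct rule: G_induct) (auto simp: pair_mult_frag_of pair_mult_diff of A.m_comm B.m_comm)
qed (auto simp: pair_mult_diff)

lemma pm_assoc:
  assumes "x \<in> carrier G" "y \<in> carrier G" "z \<in> carrier G"
  shows "pm (pm x y) z = pm x (pm y z)"
  using assms(1)
proof (induct rule: G_induct)
  case (of a b)
  note ab = of
  show ?case using assms(2)
  proof (induct rule: G_induct)
    case (of a' b')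
    note ab' = of
    show ?case using assms(3)
      by (induct rule: G_induct) (auto simp: pair_mult_frag_of pair_mult_diff ab ab' A.m_assoc B.m_assoc)
  qed (auto simp: pair_mult_diff)
qed (auto simp: pair_mult_diff)

lemma pm_one: "y \<in> carrier G \<Longrightarrow> pm (frag_of (\<one>\<^bsub>A\<^esub>, \<one>\<^bsub>B\<^esub>)) y = y"
  by (induct rule: G_induct) (auto simp: pair_mult_frag_of pair_mult_diff)

text \<open>The relations form an ideal: a generating relation times a pure tensor is again a
  generating relation of the same kind, and additivity in both arguments reduces to this
  case.\<close>

lemma pm_N: "x \<in> N \<Longrightarrow> y \<in> carrier G \<Longrightarrow> pm x y \<in> N"
proof (induct rule: N_induct)
  case (gens g)
  show ?case using gens(2)
  proof (induct rule: G_induct)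
    case (of a b)
    note ab = of
    show ?case using gens(1)
    proof (cases rule: gens_cases)
      case (left x x' y)
      then show ?thesis using ab
        by (auto simp: pair_mult_frag_of pair_mult_diff A.l_distr intro!: gens_N gens_in)
    next
      case (right x y y')
      then show ?thesis using ab
        by (auto simp: pair_mult_frag_of pair_mult_diff B.l_distr intro!: gens_N gens_in)
    next
      case (balanced c x y)
      then show ?thesis using ab
        by (auto simp: pair_mult_frag_of pair_mult_diff A_smult_assoc B_smult_assoc intro!: gens_N gens_in)
    qed
  qed (auto simp: pair_mult_diff N_ops)
qed (auto simp: pair_mult_diff N_ops)

text \<open>The union over representatives in \<open>tensor_algebra\<close> collapses to a single
  class, because the relations form an ideal.\<close>

lemma TA_mult:
  assumes x: "x \<in> carrier G" and y: "y \<in> carrier G"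
  shows "cls x \<otimes>\<^bsub>TA\<^esub> cls y = cls (pm x y)"
proof -
  have "cls (pm x' y') = cls (pm x y)" if "x' \<in> cls x" "y' \<in> cls y" for x' y'
  proof -
    note c = in_cls_carrier[OF that(1) x] in_cls_carrier[OF that(2) y]
    \<comment> \<open>The difference is split as in the product rule; commutativity puts the
      relation in first place in both terms, as \<open>pm_N\<close> expects.\<close>
    have "pm x' y' - pm x y = pm (x' - x) y' + pm (y' - y) x"
      using pm_comm[OF x c(2)] pm_comm[OF x y] by (simp add: pair_mult_diff)
    moreover have "pm (x' - x) y' \<in> N" "pm (y' - y) x \<in> N"
      using that c x by (auto intro: pm_N simp: in_cls)
    ultimately show ?thesis using cls_eq_iff pm_closed c x y N_ops(3) by simp
  qed
  moreover have "x \<in> cls x" "y \<in> cls y" using N_ops by (auto simp: in_cls)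
  moreover have "cls x \<otimes>\<^bsub>TA\<^esub> cls y = (\<Union>x'\<in>cls x. \<Union>y'\<in>cls y. cls (pm x' y'))"
    by (simp add: tensor_algebra_def)
  moreover have "(\<Union>x'\<in>cls x. \<Union>y'\<in>cls y. cls (pm x' y')) = (\<Union>x'\<in>cls x. \<Union>y'\<in>cls y. cls (pm x y))"
    by (intro SUP_cong refl) (rule calculation(1))
  ultimately show ?thesis by blast
qed

lemma TA_one: "\<one>\<^bsub>TA\<^esub> = cls (frag_of (\<one>\<^bsub>A\<^esub>, \<one>\<^bsub>B\<^esub>))"
  by (simp add: tensor_algebra_def)

lemma TA_cring: "cring TA"
proof (rule cringI)
  show "abelian_group TA"
  proof (rule abelian_groupI)
    fix s assume "s \<in> carrier TA"
    then obtain x where x: "x \<in> carrier G" "s = cls x" by (rule TA_carrierE)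
    show "\<zero>\<^bsub>TA\<^esub> \<oplus>\<^bsub>TA\<^esub> s = s" using x G_zero by (simp add: TA_zero TA_add)
    show "\<exists>y\<in>carrier TA. y \<oplus>\<^bsub>TA\<^esub> s = \<zero>\<^bsub>TA\<^esub>"
      by (rule bexI[of _ "cls (- x)"]) (use x G_uminus in \<open>auto simp: TA_add TA_zero intro: cls_carrier\<close>)
  qed (auto elim!: TA_carrierE simp: TA_add G_add TA_zero G_zero ac_simps intro!: cls_carrier)
  show "Group.comm_monoid TA"
  proof (rule Group.comm_monoidI)
    fix s t assume "s \<in> carrier TA" "t \<in> carrier TA"
    then obtain x y where "x \<in> carrier G" "s = cls x" "y \<in> carrier G" "t = cls y" by (metis TA_carrierE)
    then show "s \<otimes>\<^bsub>TA\<^esub> t = t \<otimes>\<^bsub>TA\<^esub> s" by (simp add: TA_mult pm_comm)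
  qed (auto elim!: TA_carrierE simp: TA_mult pm_closed TA_one pm_one pm_assoc intro!: cls_carrier)
qed (auto elim!: TA_carrierE simp: TA_mult TA_add G_add pm_closed pair_mult_add)

sublocale TA: cring TA by (rule TA_cring)

definition tns :: "'a \<Rightarrow> 'b \<Rightarrow> ('a \<times> 'b \<Rightarrow>\<^sub>0 int) set" where
  "tns a b = cls (frag_of (a, b))"

lemma tns_closed: "a \<in> carrier A \<Longrightarrow> b \<in> carrier B \<Longrightarrow> tns a b \<in> carrier TA"
  unfolding tns_def by (intro cls_carrier G_frag_of)

lemma TA_minus: "x \<in> carrier G \<Longrightarrow> y \<in> carrier G \<Longrightarrow> cls x \<ominus>\<^bsub>TA\<^esub> cls y = cls (x - y)"
proof -
  assume xy: "x \<in> carrier G" "y \<in> carrier G"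
  have "\<ominus>\<^bsub>TA\<^esub> cls y = cls (- y)"
    using xy G_uminus by (intro TA.minus_equality) (auto simp: TA_add TA_zero intro!: cls_carrier)
  then show ?thesis using xy G_uminus by (simp add: TA.minus_eq TA_add)
qed

lemma TA_induct [consumes 1, case_names zero of diff]:
  assumes "t \<in> carrier TA" and "P \<zero>\<^bsub>TA\<^esub>" and "\<And>a b. a \<in> carrier A \<Longrightarrow> b \<in> carrier B \<Longrightarrow> P (tns a b)"
    and "\<And>s t. s \<in> carrier TA \<Longrightarrow> t \<in> carrier TA \<Longrightarrow> P s \<Longrightarrow> P t \<Longrightarrow> P (s \<ominus>\<^bsub>TA\<^esub> t)"
  shows "P t"
proof -
  obtain x where x: "x \<in> carrier G" "t = cls x" using assms(1) by (rule TA_carrierE)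
  have "x \<in> carrier G \<and> P (cls x)" using x(1)
  proof (induct rule: G_induct)
    case (diff x y)
    then show ?case using assms(4)[of "cls x" "cls y"] by (simp add: TA_minus cls_carrier G_diff)
  qed (use assms(2,3) in \<open>auto simp: TA_zero tns_def G_zero G_frag_of\<close>)
  then show ?thesis using x by simp
qed

lemma tns_add_left: "a \<in> carrier A \<Longrightarrow> a' \<in> carrier A \<Longrightarrow> b \<in> carrier B \<Longrightarrow> tns (a \<oplus>\<^bsub>A\<^esub> a') b = tns a b \<oplus>\<^bsub>TA\<^esub> tns a' b"
  unfolding tns_def
  using gens_N[OF gens_in(1)[of a a' b]] by (simp add: TA_add G_frag_of cls_eq_iff G_add diff_diff_eq)

lemma tns_add_right: "a \<in> carrier A \<Longrightarrow> b \<in> carrier B \<Longrightarrow> b' \<in> carrier B \<Longrightarrow> tns a (b \<oplus>\<^bsub>B\<^esub> b') = tns a b \<oplus>\<^bsub>TA\<^esub> tns a b'"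
  unfolding tns_def
  using gens_N[OF gens_in(2)[of a b b']] by (simp add: TA_add G_frag_of cls_eq_iff G_add diff_diff_eq)

lemma tns_balanced: "c \<in> carrier k \<Longrightarrow> a \<in> carrier A \<Longrightarrow> b \<in> carrier B \<Longrightarrow> tns (c \<odot>\<^bsub>A\<^esub> a) b = tns a (c \<odot>\<^bsub>B\<^esub> b)"
  unfolding tns_def
  using gens_N[OF gens_in(3)[of c a b]] by (simp add: G_frag_of cls_eq_iff A_smult_closed B_smult_closed)

lemma tns_mult:
  "a \<in> carrier A \<Longrightarrow> b \<in> carrier B \<Longrightarrow> a' \<in> carrier A \<Longrightarrow> b' \<in> carrier B \<Longrightarrow>
    tns a b \<otimes>\<^bsub>TA\<^esub> tns a' b' = tns (a \<otimes>\<^bsub>A\<^esub> a') (b \<otimes>\<^bsub>B\<^esub> b')"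
  by (simp add: tns_def TA_mult G_frag_of pair_mult_frag_of)

lemma tns_one: "\<one>\<^bsub>TA\<^esub> = tns \<one>\<^bsub>A\<^esub> \<one>\<^bsub>B\<^esub>"
  by (simp add: TA_one tns_def)

lemma tns_zero_right: "a \<in> carrier A \<Longrightarrow> tns a \<zero>\<^bsub>B\<^esub> = \<zero>\<^bsub>TA\<^esub>"
proof -
  assume a: "a \<in> carrier A"
  have "tns a \<zero>\<^bsub>B\<^esub> \<oplus>\<^bsub>TA\<^esub> tns a \<zero>\<^bsub>B\<^esub> = tns a \<zero>\<^bsub>B\<^esub>"
    using tns_add_right[OF a B.zero_closed B.zero_closed] by simp
  then show ?thesis using tns_closed[OF a B.zero_closed] TA.add.r_cancel_one' by metis
qed

lemma tns_zero_left: "b \<in> carrier B \<Longrightarrow> tns \<zero>\<^bsub>A\<^esub> b = \<zero>\<^bsub>TA\<^esub>"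
proof -
  assume a: "b \<in> carrier B"
  have "tns \<zero>\<^bsub>A\<^esub> b \<oplus>\<^bsub>TA\<^esub> tns \<zero>\<^bsub>A\<^esub> b = tns \<zero>\<^bsub>A\<^esub> b"
    using tns_add_left[OF A.zero_closed A.zero_closed a] by simp
  then show ?thesis using tns_closed[OF A.zero_closed a] TA.add.r_cancel_one' by metis
qed

section \<open>The universal property of the tensor product\<close>

context
  fixes M :: "('g, 'y) ring_scheme" and f
  assumes M: "abelian_group M"
    and f_closed: "\<And>a b. a \<in> carrier A \<Longrightarrow> b \<in> carrier B \<Longrightarrow> f a b \<in> carrier M"
    and f_left: "\<And>a a' b. a \<in> carrier A \<Longrightarrow> a' \<in> carrier A \<Longrightarrow> b \<in> carrier B \<Longrightarrow> f (a \<oplus>\<^bsub>A\<^esub> a') b = f a b \<oplus>\<^bsub>M\<^esub> f a' b"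
    and f_right: "\<And>a b b'. a \<in> carrier A \<Longrightarrow> b \<in> carrier B \<Longrightarrow> b' \<in> carrier B \<Longrightarrow> f a (b \<oplus>\<^bsub>B\<^esub> b') = f a b \<oplus>\<^bsub>M\<^esub> f a b'"
    and f_balanced: "\<And>c a b. c \<in> carrier k \<Longrightarrow> a \<in> carrier A \<Longrightarrow> b \<in> carrier B \<Longrightarrow> f (c \<odot>\<^bsub>A\<^esub> a) b = f a (c \<odot>\<^bsub>B\<^esub> b)"
begin

interpretation M: abelian_group M by (rule M)

private abbreviation "L \<equiv> int_comb M (\<lambda>t. f (fst t) (snd t))"

private lemma L_closed: "x \<in> carrier G \<Longrightarrow> L x \<in> carrier M"
  by (rule M.int_comb_closed) (auto simp: G_simps intro!: f_closed)

private lemma L_diff: "x \<in> carrier G \<Longrightarrow> y \<in> carrier G \<Longrightarrow> L (x - y) = L x \<ominus>\<^bsub>M\<^esub> L y"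
  by (rule M.int_comb_diff) (auto simp: G_simps intro!: f_closed)

private lemma L_frag_of: "a \<in> carrier A \<Longrightarrow> b \<in> carrier B \<Longrightarrow> L (frag_of (a, b)) = f a b"
  by (subst M.int_comb_frag_of) (auto simp: f_closed)

private lemma L_N: "x \<in> N \<Longrightarrow> L x = \<zero>\<^bsub>M\<^esub>"
proof (induct rule: N_induct)
  case (gens g)
  then show ?case
  proof (cases rule: gens_cases)
    case (left a a' b)
    have "L g = f (a \<oplus>\<^bsub>A\<^esub> a') b \<ominus>\<^bsub>M\<^esub> f a b \<ominus>\<^bsub>M\<^esub> f a' b"
      using left by (simp add: L_diff G_diff G_frag_of L_frag_of)
    then show ?thesis using left f_closed
      by (simp add: f_left M.minus_eq M.a_assoc M.a_lcomm[of "f a' b"] M.r_neg)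
  next
    case (right a b b')
    have "L g = f a (b \<oplus>\<^bsub>B\<^esub> b') \<ominus>\<^bsub>M\<^esub> f a b \<ominus>\<^bsub>M\<^esub> f a b'"
      using right by (simp add: L_diff G_diff G_frag_of L_frag_of)
    then show ?thesis using right f_closed
      by (simp add: f_right M.minus_eq M.a_assoc M.a_lcomm[of "f a b'"] M.r_neg)
  next
    case (balanced c a b)
    have "L g = f (c \<odot>\<^bsub>A\<^esub> a) b \<ominus>\<^bsub>M\<^esub> f a (c \<odot>\<^bsub>B\<^esub> b)"
      using balanced by (simp add: L_diff G_frag_of L_frag_of A_smult_closed B_smult_closed)
    then show ?thesis using balanced f_closed B_smult_closed by (simp add: f_balanced M.minus_eq M.r_neg)
  qed
next
  case (diff x y)
  then show ?case by (simp add: L_diff M.minus_eq)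
qed simp

text \<open>The definite description \<open>tensor_lift\<close> denotes, because the additive
  extension \<open>L\<close> vanishes on all relations and is therefore constant on classes.\<close>

private lemma lift_cls: "x \<in> carrier G \<Longrightarrow> tensor_lift M f (cls x) = L x"
proof -
  assume x: "x \<in> carrier G"
  have "L x' = L x" if x': "x' \<in> cls x" for x'
  proof -
    have d: "x' - x \<in> N" using x' in_cls by blast
    have "L x' \<ominus>\<^bsub>M\<^esub> L x = \<zero>\<^bsub>M\<^esub>"
      using L_N[OF d] L_diff[OF in_cls_carrier[OF x' x] x] by simp
    then show ?thesis
      by (rule M.eq_of_minus_zero[OF L_closed[OF in_cls_carrier[OF x' x]] L_closed[OF x]])
  qed
  note const = this
  have "x \<in> cls x" unfolding in_cls using N_ops(2) by simp
  have "(THE y. \<forall>z\<in>cls x. y = L z) = L x"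
  proof (rule the_equality)
    show "\<forall>z\<in>cls x. L x = L z" by (rule ballI) (rule const[symmetric])
    show "y = L x" if "\<forall>z\<in>cls x. y = L z" for y by (rule bspec[OF that \<open>x \<in> cls x\<close>])
  qed
  then show ?thesis unfolding tensor_lift_def int_comb_def .
qed

lemma tensor_lift_closed: "t \<in> carrier TA \<Longrightarrow> tensor_lift M f t \<in> carrier M"
  by (erule TA_carrierE) (simp add: lift_cls L_closed)

lemma tensor_lift_minus:
  "s \<in> carrier TA \<Longrightarrow> t \<in> carrier TA \<Longrightarrow> tensor_lift M f (s \<ominus>\<^bsub>TA\<^esub> t) = tensor_lift M f s \<ominus>\<^bsub>M\<^esub> tensor_lift M f t"
  by (elim TA_carrierE) (simp add: TA_minus lift_cls G_diff L_diff)

lemma tensor_lift_add: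
  "s \<in> carrier TA \<Longrightarrow> t \<in> carrier TA \<Longrightarrow> tensor_lift M f (s \<oplus>\<^bsub>TA\<^esub> t) = tensor_lift M f s \<oplus>\<^bsub>M\<^esub> tensor_lift M f t"
  by (elim TA_carrierE, simp add: TA_add lift_cls G_add, rule M.int_comb_add) (auto simp: G_simps intro!: f_closed)

lemma tensor_lift_zero: "tensor_lift M f \<zero>\<^bsub>TA\<^esub> = \<zero>\<^bsub>M\<^esub>"
  by (simp add: TA_zero lift_cls G_zero)

lemma tensor_lift_tns:
  "a \<in> carrier A \<Longrightarrow> b \<in> carrier B \<Longrightarrow> tensor_lift M f (tns a b) = f a b"
  by (simp add: tns_def lift_cls G_frag_of L_frag_of)

end

end

section \<open>Power series and complete modules\<close>

text \<open>Division of a series by the variable after removal of its constant term. The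
  decomposition of \<open>f\<close> into \<open>f 0\<close> and \<open>coeff_shift f\<close> drives
  the proofs about products of series and about their action.\<close>

definition coeff_shift :: "(nat \<Rightarrow> 'a) \<Rightarrow> nat \<Rightarrow> 'a" where
  "coeff_shift f = (\<lambda>n. f (Suc n))"

lemma coeff_shift_apply: "coeff_shift f n = f (Suc n)"
  by (simp add: coeff_shift_def)

lemma powser_ring_simps:
  "carrier (powser_ring R) = UNIV \<rightarrow> carrier R"
  "f \<otimes>\<^bsub>powser_ring R\<^esub> g = (\<lambda>n. \<Oplus>\<^bsub>R\<^esub>i\<in>{..n}. f i \<otimes>\<^bsub>R\<^esub> g (n - i))"
  "\<one>\<^bsub>powser_ring R\<^esub> = (\<lambda>n. if n = 0 then \<one>\<^bsub>R\<^esub> else \<zero>\<^bsub>R\<^esub>)"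
  "\<zero>\<^bsub>powser_ring R\<^esub> = (\<lambda>n. \<zero>\<^bsub>R\<^esub>)"
  "f \<oplus>\<^bsub>powser_ring R\<^esub> g = (\<lambda>n. f n \<oplus>\<^bsub>R\<^esub> g n)"
  by (auto simp: powser_ring_def)

section \<open>Rings of power series\<close>

context cring
begin

abbreviation "PS \<equiv> powser_ring R"

lemma powser_nth: "f \<in> carrier PS \<Longrightarrow> f n \<in> carrier R"
  by (auto simp: powser_ring_simps)

lemma powserI: "(\<And>n. f n \<in> carrier R) \<Longrightarrow> f \<in> carrier PS"
  by (auto simp: powser_ring_simps)

lemma coeff_shift_closed: "f \<in> carrier PS \<Longrightarrow> coeff_shift f \<in> carrier PS"
  by (auto simp: powser_ring_simps coeff_shift_def)

lemma powser_mult_closed: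
  "f \<in> carrier PS \<Longrightarrow> g \<in> carrier PS \<Longrightarrow> f \<otimes>\<^bsub>PS\<^esub> g \<in> carrier PS"
  by (auto simp: powser_ring_simps intro!: finsum_closed)

lemma powser_mult_0:
  "f \<in> carrier PS \<Longrightarrow> g \<in> carrier PS \<Longrightarrow> (f \<otimes>\<^bsub>PS\<^esub> g) 0 = f 0 \<otimes> g 0"
  using powser_nth[of f 0] powser_nth[of g 0] by (simp add: powser_ring_simps(2))

lemma powser_mult_Suc:
  assumes f: "f \<in> carrier PS" and g: "g \<in> carrier PS"
  shows "(f \<otimes>\<^bsub>PS\<^esub> g) (Suc n) = f 0 \<otimes> g (Suc n) \<oplus> (coeff_shift f \<otimes>\<^bsub>PS\<^esub> g) n"
proof -
  have "(f \<otimes>\<^bsub>PS\<^esub> g) (Suc n) = (\<Oplus>i\<in>{..n}. f (Suc i) \<otimes> g (Suc n - Suc i)) \<oplus> f 0 \<otimes> g (Suc n - 0)"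
    unfolding powser_ring_simps(2)
    by (rule finsum_Suc2) (use powser_nth[OF f] powser_nth[OF g] in auto)
  moreover have "(\<Oplus>i\<in>{..n}. f (Suc i) \<otimes> g (n - i)) \<in> carrier R"
    using powser_nth[OF f] powser_nth[OF g] by (auto intro!: finsum_closed)
  ultimately show ?thesis
    using powser_nth[OF f] powser_nth[OF g] by (simp add: powser_ring_simps(2) coeff_shift_def a_comm)
qed

lemma powser_mult_comm:
  assumes f: "f \<in> carrier PS" and g: "g \<in> carrier PS"
  shows "f \<otimes>\<^bsub>PS\<^esub> g = g \<otimes>\<^bsub>PS\<^esub> f"
proof
  fix n :: nat
  have "i \<in> (\<lambda>i. n - i) ` {..n}" if "i \<le> n" for i
    using that by (intro image_eqI[of _ _ "n - i"]) auto
  then have im: "(\<lambda>i. n - i) ` {..n} = {..n}" by auto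
  have "(g \<otimes>\<^bsub>PS\<^esub> f) n = (\<Oplus>i\<in>(\<lambda>i. n - i) ` {..n}. g i \<otimes> f (n - i))"
    unfolding im powser_ring_simps(2) ..
  also have "\<dots> = (\<Oplus>i\<in>{..n}. g (n - i) \<otimes> f (n - (n - i)))"
    by (rule finsum_reindex) (use powser_nth[OF f] powser_nth[OF g] in \<open>auto simp: inj_on_def\<close>)
  also have "\<dots> = (f \<otimes>\<^bsub>PS\<^esub> g) n"
    unfolding powser_ring_simps(2)
    by (rule finsum_cong') (use powser_nth[OF f] powser_nth[OF g] in \<open>auto simp: m_comm\<close>)
  finally show "(f \<otimes>\<^bsub>PS\<^esub> g) n = (g \<otimes>\<^bsub>PS\<^esub> f) n" by simp
qed

lemma powser_l_distr:
  assumes f: "f \<in> carrier PS" and g: "g \<in> carrier PS" and k: "k \<in> carrier PS"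
  shows "(f \<oplus>\<^bsub>PS\<^esub> g) \<otimes>\<^bsub>PS\<^esub> k = (f \<otimes>\<^bsub>PS\<^esub> k) \<oplus>\<^bsub>PS\<^esub> (g \<otimes>\<^bsub>PS\<^esub> k)"
proof
  fix n
  have "((f \<oplus>\<^bsub>PS\<^esub> g) \<otimes>\<^bsub>PS\<^esub> k) n = (\<Oplus>i\<in>{..n}. f i \<otimes> k (n - i) \<oplus> g i \<otimes> k (n - i))"
    unfolding powser_ring_simps
    by (rule finsum_cong') (use powser_nth[OF f] powser_nth[OF g] powser_nth[OF k] in \<open>auto simp: l_distr\<close>)
  also have "\<dots> = ((f \<otimes>\<^bsub>PS\<^esub> k) \<oplus>\<^bsub>PS\<^esub> (g \<otimes>\<^bsub>PS\<^esub> k)) n"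
    unfolding powser_ring_simps
    by (rule finsum_addf) (use powser_nth[OF f] powser_nth[OF g] powser_nth[OF k] in auto)
  finally show "((f \<oplus>\<^bsub>PS\<^esub> g) \<otimes>\<^bsub>PS\<^esub> k) n = ((f \<otimes>\<^bsub>PS\<^esub> k) \<oplus>\<^bsub>PS\<^esub> (g \<otimes>\<^bsub>PS\<^esub> k)) n" .
qed

lemma powser_const_mult:
  assumes a: "a \<in> carrier R" and f: "f \<in> carrier PS" and g: "g \<in> carrier PS"
  shows "((\<lambda>n. a \<otimes> f n) \<otimes>\<^bsub>PS\<^esub> g) n = a \<otimes> (f \<otimes>\<^bsub>PS\<^esub> g) n"
  unfolding powser_ring_simps
  using powser_nth[OF f] powser_nth[OF g] a
  by (subst finsum_rdistr) (auto simp: m_assoc intro!: finsum_cong')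

lemma coeff_shift_mult:
  assumes f: "f \<in> carrier PS" and g: "g \<in> carrier PS"
  shows "coeff_shift (f \<otimes>\<^bsub>PS\<^esub> g) = (\<lambda>n. f 0 \<otimes> coeff_shift g n) \<oplus>\<^bsub>PS\<^esub> (coeff_shift f \<otimes>\<^bsub>PS\<^esub> g)"
  by (rule ext) (simp only: coeff_shift_apply powser_mult_Suc[OF f g] powser_ring_simps(5))

text \<open>Splitting off the constant term of the first factor reduces coefficient
  \<open>Suc n\<close> to coefficient \<open>n\<close> for the shifted series. The induction runs
  over all \<open>f\<close> at once, which spares the rearrangement of double sums.\<close>

lemma powser_assoc:
  assumes "f \<in> carrier PS" and g: "g \<in> carrier PS" and k: "k \<in> carrier PS"
  shows "((f \<otimes>\<^bsub>PS\<^esub> g) \<otimes>\<^bsub>PS\<^esub> k) n = (f \<otimes>\<^bsub>PS\<^esub> (g \<otimes>\<^bsub>PS\<^esub> k)) n"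
  using assms(1)
proof (induct n arbitrary: f)
  case 0
  then show ?case
    using powser_mult_closed g k powser_nth[of _ 0] by (simp add: powser_mult_0 m_assoc)
next
  case (Suc n)
  note f = Suc.prems
  note cl = powser_mult_closed coeff_shift_closed
  have fg: "f \<otimes>\<^bsub>PS\<^esub> g \<in> carrier PS" and gk: "g \<otimes>\<^bsub>PS\<^esub> k \<in> carrier PS" using f g k by (auto intro: cl)
  have c1: "(\<lambda>n. f 0 \<otimes> coeff_shift g n) \<in> carrier PS"
    using powser_nth[OF f] powser_nth[OF coeff_shift_closed[OF g]] by (intro powserI) auto
  have c2: "coeff_shift f \<otimes>\<^bsub>PS\<^esub> g \<in> carrier PS" using f g by (intro cl)
  have e: "(x \<otimes> y) \<otimes> z \<oplus> (x \<otimes> s \<oplus> t) = x \<otimes> (y \<otimes> z \<oplus> s) \<oplus> t"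
    if "x \<in> carrier R" "y \<in> carrier R" "z \<in> carrier R" "s \<in> carrier R" "t \<in> carrier R" for x y z s t
    using that by algebra
  have "((f \<otimes>\<^bsub>PS\<^esub> g) \<otimes>\<^bsub>PS\<^esub> k) (Suc n)
      = (f 0 \<otimes> g 0) \<otimes> k (Suc n) \<oplus> (f 0 \<otimes> (coeff_shift g \<otimes>\<^bsub>PS\<^esub> k) n \<oplus> ((coeff_shift f \<otimes>\<^bsub>PS\<^esub> g) \<otimes>\<^bsub>PS\<^esub> k) n)"
    unfolding powser_mult_Suc[OF fg k] powser_mult_0[OF f g] coeff_shift_mult[OF f g] powser_l_distr[OF c1 c2 k]
    unfolding powser_ring_simps(5) powser_const_mult[OF powser_nth[OF f] coeff_shift_closed[OF g] k] ..
  also have "((coeff_shift f \<otimes>\<^bsub>PS\<^esub> g) \<otimes>\<^bsub>PS\<^esub> k) n = (coeff_shift f \<otimes>\<^bsub>PS\<^esub> (g \<otimes>\<^bsub>PS\<^esub> k)) n"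
    by (rule Suc.hyps[OF coeff_shift_closed[OF f]])
  also have "(f 0 \<otimes> g 0) \<otimes> k (Suc n) \<oplus> (f 0 \<otimes> (coeff_shift g \<otimes>\<^bsub>PS\<^esub> k) n \<oplus> (coeff_shift f \<otimes>\<^bsub>PS\<^esub> (g \<otimes>\<^bsub>PS\<^esub> k)) n)
     = (f \<otimes>\<^bsub>PS\<^esub> (g \<otimes>\<^bsub>PS\<^esub> k)) (Suc n)"
    unfolding powser_mult_Suc[OF f gk] powser_mult_Suc[OF g k]
    by (rule e) (use f g k gk in \<open>auto intro!: powser_nth cl\<close>)
  finally show ?case .
qed

lemma powser_one_mult:
  assumes f: "f \<in> carrier PS"
  shows "(\<one>\<^bsub>PS\<^esub> \<otimes>\<^bsub>PS\<^esub> f) n = f n"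
proof -
  have o: "\<one>\<^bsub>PS\<^esub> \<in> carrier PS" by (auto simp: powser_ring_simps)
  have z: "coeff_shift \<one>\<^bsub>PS\<^esub> = (\<lambda>_. \<zero>)" by (auto simp: coeff_shift_def powser_ring_simps)
  have "((\<lambda>_. \<zero>) \<otimes>\<^bsub>PS\<^esub> f) n = \<zero>" for n
    unfolding powser_ring_simps(2) using powser_nth[OF f] by simp
  then show ?thesis
    using powser_nth[OF f]
    by (cases n; simp only: powser_mult_0[OF o f] powser_mult_Suc[OF o f] z; simp add: powser_ring_simps(3))
qed

lemma powser_cring: "cring PS"
proof (rule cringI)
  show "abelian_group PS"
  proof (rule abelian_groupI)
    show "\<exists>y\<in>carrier PS. y \<oplus>\<^bsub>PS\<^esub> x = \<zero>\<^bsub>PS\<^esub>" if "x \<in> carrier PS" for x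
      by (rule bexI[of _ "\<lambda>n. \<ominus> x n"]) (use powser_nth[OF that] in \<open>auto simp: powser_ring_simps l_neg\<close>)
  qed (auto simp: powser_ring_simps a_ac Pi_def)
  show "Group.comm_monoid PS"
  proof (rule Group.comm_monoidI)
    show "\<one>\<^bsub>PS\<^esub> \<in> carrier PS" by (auto simp: powser_ring_simps)
  qed (auto intro: powser_mult_closed powser_mult_comm ext[OF powser_assoc] ext[OF powser_one_mult])
qed (rule powser_l_distr)

end

text \<open>The ring laws of \<open>R\<close> are read off from coefficient 0 of the laws for
  series. An element is represented by the sequence with all entries equal to it rather than by a
  constant series, because sums of such sequences are again of this kind before any law for zero is
  available.\<close>

lemma cring_of_powser:
  assumes c: "cring (powser_ring R)"
    and cl: "\<And>x y. x \<in> carrier R \<Longrightarrow> y \<in> carrier R \<Longrightarrow> x \<oplus>\<^bsub>R\<^esub> y \<in> carrier R"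
      "\<And>x y. x \<in> carrier R \<Longrightarrow> y \<in> carrier R \<Longrightarrow> x \<otimes>\<^bsub>R\<^esub> y \<in> carrier R"
      "\<zero>\<^bsub>R\<^esub> \<in> carrier R" "\<one>\<^bsub>R\<^esub> \<in> carrier R"
  shows "cring R"
proof -
  let ?P = "powser_ring R" and ?c = "\<lambda>a (n::nat). a"
  interpret P: cring ?P by fact
  have m: "?c a \<in> carrier ?P" if "a \<in> carrier R" for a using that by (simp add: powser_ring_simps)
  have add: "?c a \<oplus>\<^bsub>?P\<^esub> ?c b = ?c (a \<oplus>\<^bsub>R\<^esub> b)" for a b by (simp add: powser_ring_simps)
  have zero: "\<zero>\<^bsub>?P\<^esub> = ?c \<zero>\<^bsub>R\<^esub>" by (simp add: powser_ring_simps)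
  have ab: "abelian_group R"
  proof (rule abelian_groupI)
    fix x y z assume xyz: "x \<in> carrier R" "y \<in> carrier R" "z \<in> carrier R"
    show "x \<oplus>\<^bsub>R\<^esub> y \<oplus>\<^bsub>R\<^esub> z = x \<oplus>\<^bsub>R\<^esub> (y \<oplus>\<^bsub>R\<^esub> z)"
      using P.a_assoc[OF m m m, OF xyz] unfolding add by (rule fun_cong)
    show "x \<oplus>\<^bsub>R\<^esub> y = y \<oplus>\<^bsub>R\<^esub> x"
      using P.a_comm[OF m m, OF xyz(1,2)] unfolding add by (rule fun_cong)
  next
    fix x assume x: "x \<in> carrier R"
    show "\<zero>\<^bsub>R\<^esub> \<oplus>\<^bsub>R\<^esub> x = x"
      using P.l_zero[OF m, OF x] unfolding zero add by (rule fun_cong)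
    have "\<exists>y\<in>carrier ?P. y \<oplus>\<^bsub>?P\<^esub> ?c x = \<zero>\<^bsub>?P\<^esub>"
      using P.l_neg[OF m[OF x]] P.a_inv_closed[OF m[OF x]] by blast
    then obtain y where "y \<in> carrier ?P" "y \<oplus>\<^bsub>?P\<^esub> ?c x = \<zero>\<^bsub>?P\<^esub>" by blast
    then have "y 0 \<in> carrier R" "y 0 \<oplus>\<^bsub>R\<^esub> x = \<zero>\<^bsub>R\<^esub>" by (auto simp: powser_ring_simps dest: fun_cong[of _ _ 0])
    then show "\<exists>y\<in>carrier R. y \<oplus>\<^bsub>R\<^esub> x = \<zero>\<^bsub>R\<^esub>" by blast
  qed (use cl in auto)
  interpret R: abelian_group R by (rule ab)
  \<comment> \<open>From here on \<open>R\<close> is known to be an additive group, so the sum over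
    the single index 0 can be evaluated.\<close>
  have mult: "(f \<otimes>\<^bsub>?P\<^esub> g) 0 = f 0 \<otimes>\<^bsub>R\<^esub> g 0" if "f \<in> carrier ?P" "g \<in> carrier ?P" for f g
  proof -
    have "f 0 \<otimes>\<^bsub>R\<^esub> g 0 \<in> carrier R" using that cl(2) by (auto simp: powser_ring_simps)
    then show ?thesis using R.finsum_insert[of "{}" 0 "\<lambda>i. f i \<otimes>\<^bsub>R\<^esub> g (0 - i)"] by (simp add: powser_ring_simps)
  qed
  have m0: "(f \<otimes>\<^bsub>?P\<^esub> g) \<in> carrier ?P" if "f \<in> carrier ?P" "g \<in> carrier ?P" for f g using that by simp
  show ?thesis
  proof (rule cringI[OF ab])
    show "Group.comm_monoid R"
    proof (rule Group.comm_monoidI)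
      fix x y z assume xyz: "x \<in> carrier R" "y \<in> carrier R" "z \<in> carrier R"
      have "((?c x \<otimes>\<^bsub>?P\<^esub> ?c y) \<otimes>\<^bsub>?P\<^esub> ?c z) 0 = (?c x \<otimes>\<^bsub>?P\<^esub> (?c y \<otimes>\<^bsub>?P\<^esub> ?c z)) 0"
        using P.m_assoc[OF m m m, OF xyz] by (rule fun_cong)
      then show "x \<otimes>\<^bsub>R\<^esub> y \<otimes>\<^bsub>R\<^esub> z = x \<otimes>\<^bsub>R\<^esub> (y \<otimes>\<^bsub>R\<^esub> z)"
        using m[OF xyz(1)] m[OF xyz(2)] m[OF xyz(3)] m0 by (simp add: mult)
      have "(?c x \<otimes>\<^bsub>?P\<^esub> ?c y) 0 = (?c y \<otimes>\<^bsub>?P\<^esub> ?c x) 0"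
        using P.m_comm[OF m m, OF xyz(1,2)] by (rule fun_cong)
      then show "x \<otimes>\<^bsub>R\<^esub> y = y \<otimes>\<^bsub>R\<^esub> x" using m[OF xyz(1)] m[OF xyz(2)] by (simp add: mult)
    next
      fix x assume x: "x \<in> carrier R"
      have "(\<one>\<^bsub>?P\<^esub> \<otimes>\<^bsub>?P\<^esub> ?c x) 0 = x" using P.l_one[OF m[OF x]] by (rule fun_cong)
      then show "\<one>\<^bsub>R\<^esub> \<otimes>\<^bsub>R\<^esub> x = x"
        unfolding mult[OF P.one_closed m[OF x]] by (simp add: powser_ring_simps)
    qed (use cl in auto)
    fix x y z assume xyz: "x \<in> carrier R" "y \<in> carrier R" "z \<in> carrier R"
    have "((?c x \<oplus>\<^bsub>?P\<^esub> ?c y) \<otimes>\<^bsub>?P\<^esub> ?c z) 0 = ((?c x \<otimes>\<^bsub>?P\<^esub> ?c z) \<oplus>\<^bsub>?P\<^esub> (?c y \<otimes>\<^bsub>?P\<^esub> ?c z)) 0"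
      using P.l_distr[OF m m m, OF xyz] by (rule fun_cong)
    then show "(x \<oplus>\<^bsub>R\<^esub> y) \<otimes>\<^bsub>R\<^esub> z = x \<otimes>\<^bsub>R\<^esub> z \<oplus>\<^bsub>R\<^esub> y \<otimes>\<^bsub>R\<^esub> z"
      using mult[OF m[OF xyz(1)] m[OF xyz(3)]] mult[OF m[OF xyz(2)] m[OF xyz(3)]] mult[OF m[OF cl(1)[OF xyz(1,2)]] m[OF xyz(3)]]
      unfolding add by (simp add: powser_ring_simps(5))
  qed
qed

section \<open>Complete modules and the action of power series\<close>

lemma with_smult_simps [simp]:
  "carrier (with_smult M a) = carrier M" "ring.add (with_smult M a) = ring.add M"
  "\<zero>\<^bsub>with_smult M a\<^esub> = \<zero>\<^bsub>M\<^esub>" "smult (with_smult M a) = a"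
  "monoid.mult (with_smult M a) = monoid.mult M" "one (with_smult M a) = one M"
  by (auto simp: with_smult_def)

lemma with_smult_derived [simp]:
  "finsum (with_smult M a) = finsum M" "a_inv (with_smult M a) = a_inv M"
  "add_pow (with_smult M a) n = add_pow M (n::nat)"
  "add_pow (with_smult M a) k = add_pow M (k::int)"
  by (auto simp: fun_eq_iff finsum_def finprod_def a_inv_def m_inv_def add_pow_def nat_pow_def int_pow_def Let_def)

lemma abelian_group_with_smult:
  assumes "abelian_group M"
  shows "abelian_group (with_smult M a)"
proof -
  interpret abelian_group M by fact
  show ?thesis
  proof (rule abelian_groupI)
    show "\<exists>y\<in>carrier (with_smult M a). y \<oplus>\<^bsub>with_smult M a\<^esub> x = \<zero>\<^bsub>with_smult M a\<^esub>"
      if "x \<in> carrier (with_smult M a)" for x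
      using that by (intro bexI[of _ "\<ominus>\<^bsub>M\<^esub> x"]) (auto simp: l_neg)
  qed (auto simp: a_ac)
qed

text \<open>\<open>u\<close> plays the role of multiplication by the variable, but is given as an
  endomorphism, the scalars being only the coefficients of the series. Completeness is stated as the
  existence of exactly those limits that define the action of a power series.\<close>

locale complete_module = module A M for A :: "('a, 'x) ring_scheme" and M :: "('a, 'm) module" (structure) +
  fixes u :: "'m \<Rightarrow> 'm"
  assumes u_closed: "x \<in> carrier M \<Longrightarrow> u x \<in> carrier M"
    and u_add: "x \<in> carrier M \<Longrightarrow> y \<in> carrier M \<Longrightarrow> u (x \<oplus>\<^bsub>M\<^esub> y) = u x \<oplus>\<^bsub>M\<^esub> u y"
    and u_smult: "a \<in> carrier A \<Longrightarrow> x \<in> carrier M \<Longrightarrow> u (a \<odot>\<^bsub>M\<^esub> x) = a \<odot>\<^bsub>M\<^esub> u x"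
    and u_inj: "x \<in> carrier M \<Longrightarrow> y \<in> carrier M \<Longrightarrow> u x = u y \<Longrightarrow> x = y"
    and separated: "x \<in> carrier M \<Longrightarrow> (\<And>n. \<exists>z\<in>carrier M. x = (u ^^ n) z) \<Longrightarrow> x = \<zero>\<^bsub>M\<^esub>"
    and complete: "(\<And>k::nat. m k \<in> carrier M) \<Longrightarrow>
      \<exists>y\<in>carrier M. \<forall>n. \<exists>z\<in>carrier M. y = (\<Oplus>\<^bsub>M\<^esub>i\<in>{..<n}. (u ^^ i) (m i)) \<oplus>\<^bsub>M\<^esub> (u ^^ n) z"
begin

lemma u_pow_closed: "x \<in> carrier M \<Longrightarrow> (u ^^ n) x \<in> carrier M"
  by (induct n) (auto intro: u_closed)

lemma u_zero: "u \<zero>\<^bsub>M\<^esub> = \<zero>\<^bsub>M\<^esub>"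
  using u_add[of "\<zero>\<^bsub>M\<^esub>" "\<zero>\<^bsub>M\<^esub>"] u_closed[of "\<zero>\<^bsub>M\<^esub>"] by simp

lemma u_minus: "x \<in> carrier M \<Longrightarrow> y \<in> carrier M \<Longrightarrow> u (x \<ominus>\<^bsub>M\<^esub> y) = u x \<ominus>\<^bsub>M\<^esub> u y"
proof -
  assume c: "x \<in> carrier M" "y \<in> carrier M"
  have "u (x \<ominus>\<^bsub>M\<^esub> y) \<oplus>\<^bsub>M\<^esub> u y = u x"
    using c by (simp add: u_add[symmetric] M.minus_eq M.a_assoc M.l_neg)
  then show ?thesis using c u_closed by (metis M.minus_closed M.add.inv_solve_right' M.minus_eq)
qed

lemma u_pow_minus: "x \<in> carrier M \<Longrightarrow> y \<in> carrier M \<Longrightarrow> (u ^^ n) (x \<ominus>\<^bsub>M\<^esub> y) = (u ^^ n) x \<ominus>\<^bsub>M\<^esub> (u ^^ n) y"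
  by (induct n) (auto simp: u_minus u_pow_closed)

lemma u_finsum: "finite I \<Longrightarrow> (\<And>i. i \<in> I \<Longrightarrow> g i \<in> carrier M) \<Longrightarrow> u (\<Oplus>\<^bsub>M\<^esub>i\<in>I. g i) = (\<Oplus>\<^bsub>M\<^esub>i\<in>I. u (g i))"
  by (induct I rule: finite_induct) (auto simp: u_zero u_add u_closed Pi_def)

lemma add_minus_add:
  assumes "m \<in> carrier M" "a \<in> carrier M" "b \<in> carrier M"
  shows "(m \<oplus>\<^bsub>M\<^esub> a) \<ominus>\<^bsub>M\<^esub> (m \<oplus>\<^bsub>M\<^esub> b) = a \<ominus>\<^bsub>M\<^esub> b"
proof -
  have "(m \<oplus>\<^bsub>M\<^esub> a) \<ominus>\<^bsub>M\<^esub> (m \<oplus>\<^bsub>M\<^esub> b) = m \<oplus>\<^bsub>M\<^esub> (a \<oplus>\<^bsub>M\<^esub> (\<ominus>\<^bsub>M\<^esub> m \<oplus>\<^bsub>M\<^esub> \<ominus>\<^bsub>M\<^esub> b))"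
    using assms by (simp add: M.minus_eq M.minus_add M.a_assoc)
  also have "\<dots> = (m \<oplus>\<^bsub>M\<^esub> \<ominus>\<^bsub>M\<^esub> m) \<oplus>\<^bsub>M\<^esub> (a \<oplus>\<^bsub>M\<^esub> \<ominus>\<^bsub>M\<^esub> b)"
    using assms by (simp only: M.a_ac M.a_inv_closed M.a_closed)
  finally show ?thesis using assms by (simp add: M.r_neg M.minus_eq)
qed

text \<open>Elements of a separated module are equal if they agree modulo \<open>u\<close> and the quotients of their
  remainders by \<open>u\<close> are again related; this replaces all manipulations of infinite sums.\<close>

lemma coinduct_eq:
  assumes S: "\<And>a b. S a b \<Longrightarrow> a \<in> carrier M \<and> b \<in> carrier M \<and>
      (\<exists>m\<in>carrier M. \<exists>a' b'. S a' b' \<and> a = m \<oplus>\<^bsub>M\<^esub> u a' \<and> b = m \<oplus>\<^bsub>M\<^esub> u b')"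
    and "S a b"
  shows "a = b"
proof -
  have "\<exists>z\<in>carrier M. a \<ominus>\<^bsub>M\<^esub> b = (u ^^ n) z" for n
    using \<open>S a b\<close>
  proof (induct n arbitrary: a b)
    case 0
    then show ?case using S[OF 0] by auto
  next
    case (Suc n)
    obtain m a' b' where m: "m \<in> carrier M" "S a' b'" "a = m \<oplus>\<^bsub>M\<^esub> u a'" "b = m \<oplus>\<^bsub>M\<^esub> u b'"
      using S[OF Suc.prems] by blast
    have c: "a' \<in> carrier M" "b' \<in> carrier M" using S[OF m(2)] by auto
    obtain z where z: "z \<in> carrier M" "a' \<ominus>\<^bsub>M\<^esub> b' = (u ^^ n) z" using Suc.hyps[OF m(2)] by blast
    have "a \<ominus>\<^bsub>M\<^esub> b = u (a' \<ominus>\<^bsub>M\<^esub> b')"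
      unfolding m using m(1) c u_closed by (simp add: u_minus add_minus_add)
    then show ?case using z by auto
  qed
  then have "a \<ominus>\<^bsub>M\<^esub> b = \<zero>\<^bsub>M\<^esub>" using S[OF assms(2)] by (intro separated) auto
  then show ?thesis using S[OF assms(2)] by (metis M.eq_of_minus_zero)
qed

text \<open>The limit of \<open>coeff_kisin_act\<close>, with iterates of \<open>u\<close> in place
  of powers of the variable.\<close>

definition pact_spec where
  "pact_spec f x y \<longleftrightarrow> y \<in> carrier M \<and> (\<forall>n. \<exists>z\<in>carrier M.
     y = (\<Oplus>\<^bsub>M\<^esub>i\<in>{..<n}. (u ^^ i) (f i \<odot>\<^bsub>M\<^esub> x)) \<oplus>\<^bsub>M\<^esub> (u ^^ n) z)"

definition pact :: "(nat \<Rightarrow> 'a) \<Rightarrow> 'm \<Rightarrow> 'm" where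
  "pact f x = (THE y. pact_spec f x y)"

abbreviation "AS \<equiv> powser_ring A"

text \<open>Existence is the completeness axiom; two limits differ by a multiple of every power of
  \<open>u\<close> and are equal by separatedness.\<close>

lemma pact_spec_ex1:
  assumes f: "f \<in> carrier AS" and x: "x \<in> carrier M"
  shows "\<exists>!y. pact_spec f x y"
proof -
  have c: "f i \<odot>\<^bsub>M\<^esub> x \<in> carrier M" for i using R.powser_nth[OF f] x by simp
  obtain y where "pact_spec f x y" using complete[of "\<lambda>i. f i \<odot>\<^bsub>M\<^esub> x", OF c] unfolding pact_spec_def by blast
  moreover have "y = y'" if y: "pact_spec f x y" "pact_spec f x y'" for y y'
  proof -
    have yc: "y \<in> carrier M" "y' \<in> carrier M" using y by (auto simp: pact_spec_def)
    have "y \<ominus>\<^bsub>M\<^esub> y' = \<zero>\<^bsub>M\<^esub>"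
    proof (rule separated)
      fix n
      let ?s = "\<Oplus>\<^bsub>M\<^esub>i\<in>{..<n}. (u ^^ i) (f i \<odot>\<^bsub>M\<^esub> x)"
      have "\<exists>z\<in>carrier M. y = ?s \<oplus>\<^bsub>M\<^esub> (u ^^ n) z" "\<exists>z\<in>carrier M. y' = ?s \<oplus>\<^bsub>M\<^esub> (u ^^ n) z"
        using y unfolding pact_spec_def by simp_all
      then obtain z z' where z: "z \<in> carrier M" "y = ?s \<oplus>\<^bsub>M\<^esub> (u ^^ n) z" "z' \<in> carrier M" "y' = ?s \<oplus>\<^bsub>M\<^esub> (u ^^ n) z'"
        by (elim bexE)
      have s: "?s \<in> carrier M" using c u_pow_closed by (auto intro!: M.finsum_closed)
      have "y \<ominus>\<^bsub>M\<^esub> y' = (u ^^ n) (z \<ominus>\<^bsub>M\<^esub> z')"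
        unfolding z(2,4) using add_minus_add[OF s] z(1,3) by (simp add: u_pow_minus u_pow_closed)
      then show "\<exists>z\<in>carrier M. y \<ominus>\<^bsub>M\<^esub> y' = (u ^^ n) z" using z(1,3) by auto
    qed (use yc in auto)
    then show ?thesis using yc by (metis M.eq_of_minus_zero)
  qed
  ultimately show ?thesis by blast
qed

lemma pact_spec_pact:
  assumes "f \<in> carrier AS" "x \<in> carrier M"
  shows "pact_spec f x (pact f x)"
  unfolding pact_def by (rule theI'[OF pact_spec_ex1[OF assms]])

lemma pact_closed:
  assumes "f \<in> carrier AS" "x \<in> carrier M"
  shows "pact f x \<in> carrier M"
  using pact_spec_pact[OF assms] by (simp add: pact_spec_def)

text \<open>The laws of the action are derived from this recursion by \<open>coinduct_eq\<close>.
  The right side has the defining property of the limit, because removing the first summand of a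
  partial sum leaves \<open>u\<close> applied to a partial sum for the shifted series.\<close>

lemma pact_rec:
  assumes f: "f \<in> carrier AS" and x: "x \<in> carrier M"
  shows "pact f x = f 0 \<odot>\<^bsub>M\<^esub> x \<oplus>\<^bsub>M\<^esub> u (pact (coeff_shift f) x)"
proof -
  note sf = R.coeff_shift_closed[OF f]
  have c: "f i \<odot>\<^bsub>M\<^esub> x \<in> carrier M" for i using R.powser_nth[OF f] x by simp
  let ?y = "pact (coeff_shift f) x" and ?w = "f 0 \<odot>\<^bsub>M\<^esub> x \<oplus>\<^bsub>M\<^esub> u (pact (coeff_shift f) x)"
  have y: "pact_spec (coeff_shift f) x ?y" by (rule pact_spec_pact[OF sf x])
  have yc: "?y \<in> carrier M" using y by (simp add: pact_spec_def)
  have fs: "(\<Oplus>\<^bsub>M\<^esub>i\<in>{..<Suc n}. g i) = g 0 \<oplus>\<^bsub>M\<^esub> (\<Oplus>\<^bsub>M\<^esub>i\<in>{..<n}. g (Suc i))"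
    if g: "\<And>i. g i \<in> carrier M" for g and n
  proof (induct n)
    case (Suc n)
    have "(\<Oplus>\<^bsub>M\<^esub>i\<in>{..<Suc (Suc n)}. g i) = g (Suc n) \<oplus>\<^bsub>M\<^esub> (\<Oplus>\<^bsub>M\<^esub>i\<in>{..<Suc n}. g i)"
      unfolding lessThan_Suc[of "Suc n"] by (rule M.finsum_insert) (use g in auto)
    also have "\<dots> = g (Suc n) \<oplus>\<^bsub>M\<^esub> (g 0 \<oplus>\<^bsub>M\<^esub> (\<Oplus>\<^bsub>M\<^esub>i\<in>{..<n}. g (Suc i)))" unfolding Suc ..
    also have "\<dots> = g 0 \<oplus>\<^bsub>M\<^esub> (g (Suc n) \<oplus>\<^bsub>M\<^esub> (\<Oplus>\<^bsub>M\<^esub>i\<in>{..<n}. g (Suc i)))"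
      using g by (intro M.a_lcomm) (auto intro!: M.finsum_closed)
    also have "g (Suc n) \<oplus>\<^bsub>M\<^esub> (\<Oplus>\<^bsub>M\<^esub>i\<in>{..<n}. g (Suc i)) = (\<Oplus>\<^bsub>M\<^esub>i\<in>{..<Suc n}. g (Suc i))"
      unfolding lessThan_Suc by (rule M.finsum_insert[symmetric]) (use g in auto)
    finally show ?case .
  qed (use g in \<open>simp add: lessThan_Suc\<close>)
  have "pact_spec f x ?w"
    unfolding pact_spec_def
  proof (intro conjI allI)
    show wc: "?w \<in> carrier M" using c yc u_closed by simp
    fix n
    show "\<exists>z\<in>carrier M. ?w = (\<Oplus>\<^bsub>M\<^esub>i\<in>{..<n}. (u ^^ i) (f i \<odot>\<^bsub>M\<^esub> x)) \<oplus>\<^bsub>M\<^esub> (u ^^ n) z"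
    proof (cases n)
      case 0
      then show ?thesis using wc by auto
    next
      case (Suc k)
      let ?s = "\<Oplus>\<^bsub>M\<^esub>i\<in>{..<k}. (u ^^ i) (coeff_shift f i \<odot>\<^bsub>M\<^esub> x)"
      obtain z where z: "z \<in> carrier M" "?y = ?s \<oplus>\<^bsub>M\<^esub> (u ^^ k) z"
        using y unfolding pact_spec_def by blast
      have sc: "?s \<in> carrier M" using c u_pow_closed by (auto simp: coeff_shift_def intro!: M.finsum_closed)
      have us: "u ?s = (\<Oplus>\<^bsub>M\<^esub>i\<in>{..<k}. (u ^^ Suc i) (f (Suc i) \<odot>\<^bsub>M\<^esub> x))"
        using c u_pow_closed by (subst u_finsum) (auto simp: coeff_shift_def)
      have "u ?y = u ?s \<oplus>\<^bsub>M\<^esub> (u ^^ Suc k) z" using z sc u_pow_closed by (simp add: u_add)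
      then have "?w = f 0 \<odot>\<^bsub>M\<^esub> x \<oplus>\<^bsub>M\<^esub> ((\<Oplus>\<^bsub>M\<^esub>i\<in>{..<k}. (u ^^ Suc i) (f (Suc i) \<odot>\<^bsub>M\<^esub> x)) \<oplus>\<^bsub>M\<^esub> (u ^^ Suc k) z)"
        unfolding us by simp
      also have "\<dots> = (f 0 \<odot>\<^bsub>M\<^esub> x \<oplus>\<^bsub>M\<^esub> (\<Oplus>\<^bsub>M\<^esub>i\<in>{..<k}. (u ^^ Suc i) (f (Suc i) \<odot>\<^bsub>M\<^esub> x))) \<oplus>\<^bsub>M\<^esub> (u ^^ Suc k) z"
        using c u_pow_closed z(1) by (intro M.a_assoc[symmetric]) (auto intro!: M.finsum_closed u_closed)
      also have "f 0 \<odot>\<^bsub>M\<^esub> x \<oplus>\<^bsub>M\<^esub> (\<Oplus>\<^bsub>M\<^esub>i\<in>{..<k}. (u ^^ Suc i) (f (Suc i) \<odot>\<^bsub>M\<^esub> x)) = (\<Oplus>\<^bsub>M\<^esub>i\<in>{..<n}. (u ^^ i) (f i \<odot>\<^bsub>M\<^esub> x))"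
        unfolding Suc using fs[of "\<lambda>i. (u ^^ i) (f i \<odot>\<^bsub>M\<^esub> x)" k] c u_pow_closed by simp
      finally show ?thesis using z Suc by blast
    qed
  qed
  then show ?thesis unfolding pact_def by (rule the1_equality[OF pact_spec_ex1[OF f x]])
qed

lemma add4:
  "a \<in> carrier M \<Longrightarrow> b \<in> carrier M \<Longrightarrow> c \<in> carrier M \<Longrightarrow> d \<in> carrier M \<Longrightarrow>
    (a \<oplus>\<^bsub>M\<^esub> b) \<oplus>\<^bsub>M\<^esub> (c \<oplus>\<^bsub>M\<^esub> d) = (a \<oplus>\<^bsub>M\<^esub> c) \<oplus>\<^bsub>M\<^esub> (b \<oplus>\<^bsub>M\<^esub> d)"
  by (simp only: M.a_ac M.a_closed)

lemma pact_zero: "x \<in> carrier M \<Longrightarrow> pact (\<lambda>_. \<zero>\<^bsub>A\<^esub>) x = \<zero>\<^bsub>M\<^esub>"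
proof (rule coinduct_eq[where S = "\<lambda>a b. \<exists>x\<in>carrier M. a = pact (\<lambda>_. \<zero>\<^bsub>A\<^esub>) x \<and> b = \<zero>\<^bsub>M\<^esub>"])
  have z: "(\<lambda>_. \<zero>\<^bsub>A\<^esub>) \<in> carrier AS" by (rule R.powserI) simp
  fix a b assume "\<exists>x\<in>carrier M. a = pact (\<lambda>_. \<zero>\<^bsub>A\<^esub>) x \<and> b = \<zero>\<^bsub>M\<^esub>"
  then obtain x where x: "x \<in> carrier M" "a = pact (\<lambda>_. \<zero>\<^bsub>A\<^esub>) x" "b = \<zero>\<^bsub>M\<^esub>" by blast
  have "a = \<zero>\<^bsub>M\<^esub> \<oplus>\<^bsub>M\<^esub> u a" "b = \<zero>\<^bsub>M\<^esub> \<oplus>\<^bsub>M\<^esub> u b"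
    using pact_rec[OF z x(1)] x(1) unfolding x by (simp_all add: coeff_shift_def u_zero)
  then show "a \<in> carrier M \<and> b \<in> carrier M \<and> (\<exists>m\<in>carrier M. \<exists>a' b'.
     (\<exists>x\<in>carrier M. a' = pact (\<lambda>_. \<zero>\<^bsub>A\<^esub>) x \<and> b' = \<zero>\<^bsub>M\<^esub>) \<and> a = m \<oplus>\<^bsub>M\<^esub> u a' \<and> b = m \<oplus>\<^bsub>M\<^esub> u b')"
    using pact_closed[OF z x(1)] x by (metis M.zero_closed)
qed auto

text \<open>The relation ranges over all pairs of series, because passing to the remainders replaces
  both series by their shifts.\<close>

lemma pact_add_left:
  assumes "f \<in> carrier AS" "g \<in> carrier AS" "x \<in> carrier M"
  shows "pact (f \<oplus>\<^bsub>AS\<^esub> g) x = pact f x \<oplus>\<^bsub>M\<^esub> pact g x"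
proof -
  interpret AS: cring AS by (rule R.powser_cring)
  let ?S = "\<lambda>a b. \<exists>f\<in>carrier AS. \<exists>g\<in>carrier AS. a = pact (f \<oplus>\<^bsub>AS\<^esub> g) x \<and> b = pact f x \<oplus>\<^bsub>M\<^esub> pact g x"
  show ?thesis
  proof (rule coinduct_eq[where S = ?S])
    fix a b assume "?S a b"
    then obtain f g where fg: "f \<in> carrier AS" "g \<in> carrier AS"
      and ab: "a = pact (f \<oplus>\<^bsub>AS\<^esub> g) x" "b = pact f x \<oplus>\<^bsub>M\<^esub> pact g x" by blast
    note s = R.coeff_shift_closed[OF fg(1)] R.coeff_shift_closed[OF fg(2)]
    have sh: "coeff_shift (f \<oplus>\<^bsub>AS\<^esub> g) = coeff_shift f \<oplus>\<^bsub>AS\<^esub> coeff_shift g"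
      by (simp add: coeff_shift_def powser_ring_simps(5))
    note c = pact_closed[OF s(1) assms(3)] pact_closed[OF s(2) assms(3)] R.powser_nth[OF fg(1), of 0] R.powser_nth[OF fg(2), of 0]
    let ?m = "f 0 \<odot>\<^bsub>M\<^esub> x \<oplus>\<^bsub>M\<^esub> g 0 \<odot>\<^bsub>M\<^esub> x"
    let ?a = "pact (coeff_shift f \<oplus>\<^bsub>AS\<^esub> coeff_shift g) x"
    let ?b = "pact (coeff_shift f) x \<oplus>\<^bsub>M\<^esub> pact (coeff_shift g) x"
    have 1: "a = ?m \<oplus>\<^bsub>M\<^esub> u ?a"
      unfolding ab pact_rec[OF AS.a_closed[OF fg] assms(3)] sh
      using c assms(3) by (simp add: powser_ring_simps(5) smult_l_distr)
    have 2: "b = ?m \<oplus>\<^bsub>M\<^esub> u ?b"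
      unfolding ab pact_rec[OF fg(1) assms(3)] pact_rec[OF fg(2) assms(3)]
      using c assms(3) u_closed by (simp add: u_add add4)
    have "a \<in> carrier M" "b \<in> carrier M" unfolding ab using fg assms(3) pact_closed by auto
    moreover have "?S ?a ?b" using s by blast
    moreover have "?m \<in> carrier M" using c assms(3) by simp
    ultimately show "a \<in> carrier M \<and> b \<in> carrier M \<and> (\<exists>m\<in>carrier M. \<exists>a' b'. ?S a' b' \<and> a = m \<oplus>\<^bsub>M\<^esub> u a' \<and> b = m \<oplus>\<^bsub>M\<^esub> u b')"
      using 1 2 by blast
  qed (use assms in blast)
qed

lemma pact_add_right:
  assumes "f \<in> carrier AS" "x \<in> carrier M" "y \<in> carrier M"
  shows "pact f (x \<oplus>\<^bsub>M\<^esub> y) = pact f x \<oplus>\<^bsub>M\<^esub> pact f y"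
proof -
  let ?S = "\<lambda>a b. \<exists>f\<in>carrier AS. a = pact f (x \<oplus>\<^bsub>M\<^esub> y) \<and> b = pact f x \<oplus>\<^bsub>M\<^esub> pact f y"
  show ?thesis
  proof (rule coinduct_eq[where S = ?S])
    fix a b assume "?S a b"
    then obtain f where f: "f \<in> carrier AS" and ab: "a = pact f (x \<oplus>\<^bsub>M\<^esub> y)" "b = pact f x \<oplus>\<^bsub>M\<^esub> pact f y" by blast
    note s = R.coeff_shift_closed[OF f]
    note c = pact_closed[OF s assms(2)] pact_closed[OF s assms(3)] R.powser_nth[OF f, of 0]
    have xy: "x \<oplus>\<^bsub>M\<^esub> y \<in> carrier M" using assms by simp
    let ?m = "f 0 \<odot>\<^bsub>M\<^esub> x \<oplus>\<^bsub>M\<^esub> f 0 \<odot>\<^bsub>M\<^esub> y"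
    let ?a = "pact (coeff_shift f) (x \<oplus>\<^bsub>M\<^esub> y)"
    let ?b = "pact (coeff_shift f) x \<oplus>\<^bsub>M\<^esub> pact (coeff_shift f) y"
    have 1: "a = ?m \<oplus>\<^bsub>M\<^esub> u ?a"
      unfolding ab pact_rec[OF f xy] using c assms(2,3) by (simp add: smult_r_distr)
    have 2: "b = ?m \<oplus>\<^bsub>M\<^esub> u ?b"
      unfolding ab pact_rec[OF f assms(2)] pact_rec[OF f assms(3)]
      using c assms(2,3) u_closed by (simp add: u_add add4)
    have "a \<in> carrier M" "b \<in> carrier M" unfolding ab using f assms(2,3) pact_closed by auto
    moreover have "?S ?a ?b" using s by blast
    moreover have "?m \<in> carrier M" using c assms by simp
    ultimately show "a \<in> carrier M \<and> b \<in> carrier M \<and> (\<exists>m\<in>carrier M. \<exists>a' b'. ?S a' b' \<and> a = m \<oplus>\<^bsub>M\<^esub> u a' \<and> b = m \<oplus>\<^bsub>M\<^esub> u b')"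
      using 1 2 by blast
  qed (use assms in blast)
qed

lemma pact_const:
  assumes "f \<in> carrier AS" "x \<in> carrier M" "r \<in> carrier A"
  shows "pact (\<lambda>n. r \<otimes>\<^bsub>A\<^esub> f n) x = r \<odot>\<^bsub>M\<^esub> pact f x"
proof -
  let ?S = "\<lambda>a b. \<exists>f\<in>carrier AS. a = pact (\<lambda>n. r \<otimes>\<^bsub>A\<^esub> f n) x \<and> b = r \<odot>\<^bsub>M\<^esub> pact f x"
  show ?thesis
  proof (rule coinduct_eq[where S = ?S])
    fix a b assume "?S a b"
    then obtain f where f: "f \<in> carrier AS" and ab: "a = pact (\<lambda>n. r \<otimes>\<^bsub>A\<^esub> f n) x" "b = r \<odot>\<^bsub>M\<^esub> pact f x" by blast
    note s = R.coeff_shift_closed[OF f]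
    have rf: "(\<lambda>n. r \<otimes>\<^bsub>A\<^esub> f n) \<in> carrier AS" using R.powser_nth[OF f] assms(3) by (intro R.powserI) simp
    note c = pact_closed[OF s assms(2)] R.powser_nth[OF f, of 0]
    let ?m = "r \<odot>\<^bsub>M\<^esub> (f 0 \<odot>\<^bsub>M\<^esub> x)"
    let ?a = "pact (\<lambda>n. r \<otimes>\<^bsub>A\<^esub> coeff_shift f n) x"
    let ?b = "r \<odot>\<^bsub>M\<^esub> pact (coeff_shift f) x"
    have sh: "coeff_shift (\<lambda>n. r \<otimes>\<^bsub>A\<^esub> f n) = (\<lambda>n. r \<otimes>\<^bsub>A\<^esub> coeff_shift f n)" by (simp add: coeff_shift_def)
    have 1: "a = ?m \<oplus>\<^bsub>M\<^esub> u ?a"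
      unfolding ab pact_rec[OF rf assms(2)] sh using c assms(2,3) by (simp add: smult_assoc1)
    have 2: "b = ?m \<oplus>\<^bsub>M\<^esub> u ?b"
      unfolding ab pact_rec[OF f assms(2)] using c assms(2,3) u_closed by (simp add: u_smult smult_r_distr)
    have "a \<in> carrier M" "b \<in> carrier M" unfolding ab using f rf assms(2,3) pact_closed by auto
    moreover have "?S ?a ?b" using s by blast
    moreover have "?m \<in> carrier M" using c assms by simp
    ultimately show "a \<in> carrier M \<and> b \<in> carrier M \<and> (\<exists>m\<in>carrier M. \<exists>a' b'. ?S a' b' \<and> a = m \<oplus>\<^bsub>M\<^esub> u a' \<and> b = m \<oplus>\<^bsub>M\<^esub> u b')"
      using 1 2 by blast
  qed (use assms in blast)
qed

text \<open>The relation carries a common summand \<open>c\<close>, since each step leaves one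
  behind: the shift of the product of \<open>f\<close> and \<open>g\<close> is \<open>f 0\<close>
  times the shift of \<open>g\<close> plus the shift of \<open>f\<close> times \<open>g\<close>, and
  the first part also arises on the other side, from \<open>f 0\<close> acting on
  \<open>pact g x\<close>.\<close>

lemma pact_mult:
  assumes f: "f \<in> carrier AS" and g: "g \<in> carrier AS" and x: "x \<in> carrier M"
  shows "pact (f \<otimes>\<^bsub>AS\<^esub> g) x = pact f (pact g x)"
proof -
  interpret AS: cring AS by (rule R.powser_cring)
  have gx: "pact g x \<in> carrier M" by (rule pact_closed[OF g x])
  note sg = R.coeff_shift_closed[OF g] and sgx = pact_closed[OF R.coeff_shift_closed[OF g] x]
  let ?S = "\<lambda>a b. \<exists>f\<in>carrier AS. \<exists>c\<in>carrier M. a = c \<oplus>\<^bsub>M\<^esub> pact (f \<otimes>\<^bsub>AS\<^esub> g) x \<and> b = c \<oplus>\<^bsub>M\<^esub> pact f (pact g x)"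
  have "\<zero>\<^bsub>M\<^esub> \<oplus>\<^bsub>M\<^esub> pact (f \<otimes>\<^bsub>AS\<^esub> g) x = \<zero>\<^bsub>M\<^esub> \<oplus>\<^bsub>M\<^esub> pact f (pact g x)"
  proof (rule coinduct_eq[where S = ?S])
    fix a b assume "?S a b"
    then obtain f c where f: "f \<in> carrier AS" and c: "c \<in> carrier M"
      and ab: "a = c \<oplus>\<^bsub>M\<^esub> pact (f \<otimes>\<^bsub>AS\<^esub> g) x" "b = c \<oplus>\<^bsub>M\<^esub> pact f (pact g x)" by blast
    note sf = R.coeff_shift_closed[OF f]
    have f0: "f 0 \<in> carrier A" and g0: "g 0 \<in> carrier A" using R.powser_nth f g by auto
    have fsg: "(\<lambda>n. f 0 \<otimes>\<^bsub>A\<^esub> coeff_shift g n) \<in> carrier AS" using R.powser_nth[OF sg] f0 by (intro R.powserI) simp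
    have sfg: "coeff_shift f \<otimes>\<^bsub>AS\<^esub> g \<in> carrier AS" using sf g by simp
    let ?d = "f 0 \<odot>\<^bsub>M\<^esub> pact (coeff_shift g) x"
    let ?m = "c \<oplus>\<^bsub>M\<^esub> f 0 \<odot>\<^bsub>M\<^esub> (g 0 \<odot>\<^bsub>M\<^esub> x)"
    let ?a = "?d \<oplus>\<^bsub>M\<^esub> pact (coeff_shift f \<otimes>\<^bsub>AS\<^esub> g) x"
    let ?b = "?d \<oplus>\<^bsub>M\<^esub> pact (coeff_shift f) (pact g x)"
    have dc: "?d \<in> carrier M" using f0 sgx by simp
    note cl = pact_closed[OF sfg x] pact_closed[OF sf gx]
    have "pact (f \<otimes>\<^bsub>AS\<^esub> g) x = f 0 \<odot>\<^bsub>M\<^esub> (g 0 \<odot>\<^bsub>M\<^esub> x) \<oplus>\<^bsub>M\<^esub> u ?a"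
      unfolding pact_rec[OF AS.m_closed[OF f g] x] R.coeff_shift_mult[OF f g] R.powser_mult_0[OF f g]
        pact_add_left[OF fsg sfg x] pact_const[OF sg x f0] using f0 g0 x by (simp add: smult_assoc1)
    then have 1: "a = ?m \<oplus>\<^bsub>M\<^esub> u ?a" unfolding ab using c f0 g0 x u_closed dc cl by (simp add: M.a_assoc)
    have "pact f (pact g x) = f 0 \<odot>\<^bsub>M\<^esub> (g 0 \<odot>\<^bsub>M\<^esub> x) \<oplus>\<^bsub>M\<^esub> u ?b"
      unfolding pact_rec[OF f gx] using f0 g0 x dc cl u_closed sgx
      by (subst (1) pact_rec[OF g x]) (simp add: smult_r_distr u_add u_smult M.a_assoc)
    then have 2: "b = ?m \<oplus>\<^bsub>M\<^esub> u ?b" unfolding ab using c f0 g0 x u_closed dc cl by (simp add: M.a_assoc)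
    have "a \<in> carrier M" "b \<in> carrier M" unfolding ab using f g x gx c pact_closed by auto
    moreover have "?S ?a ?b" using sf dc by blast
    moreover have "?m \<in> carrier M" using c f0 g0 x by simp
    ultimately show "a \<in> carrier M \<and> b \<in> carrier M \<and> (\<exists>m\<in>carrier M. \<exists>a' b'. ?S a' b' \<and> a = m \<oplus>\<^bsub>M\<^esub> u a' \<and> b = m \<oplus>\<^bsub>M\<^esub> u b')"
      using 1 2 by blast
  qed (use f in \<open>blast intro: M.zero_closed\<close>)
  then show ?thesis using pact_closed f g x gx by simp
qed

lemma pact_one:
  assumes "x \<in> carrier M"
  shows "pact \<one>\<^bsub>AS\<^esub> x = x"
proof -
  interpret AS: cring AS by (rule R.powser_cring)
  have "coeff_shift \<one>\<^bsub>AS\<^esub> = (\<lambda>_. \<zero>\<^bsub>A\<^esub>)" by (auto simp: coeff_shift_def powser_ring_simps)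
  then show ?thesis
    using pact_rec[OF AS.one_closed assms] assms by (simp add: pact_zero u_zero) (simp add: powser_ring_simps)
qed

lemma module_pact: "module AS (with_smult M pact)"
  by (rule moduleI)
    (auto simp: R.powser_cring abelian_group_with_smult M.abelian_group_axioms pact_closed pact_add_left
      pact_add_right pact_mult pact_one)

text \<open>As \<open>u\<close> is injective, the remainder \<open>D m\<close> is determined by
  \<open>m\<close>. Therefore \<open>D\<close> inherits additivity and \<open>A\<close>-linearity
  from \<open>\<sigma>\<close>, and \<open>D (u m) = m\<close> because \<open>\<sigma>\<close>
  vanishes on multiples of \<open>u\<close>. The linearity of the functionals \<open>F\<close> rests
  on these laws and those of \<open>h\<close>.\<close>

theorem projective_of_residual_dual_basis:
  assumes T: "finite T" "T \<subseteq> carrier M"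
    and h_closed: "\<And>x m. x \<in> T \<Longrightarrow> m \<in> carrier M \<Longrightarrow> h x m \<in> carrier A"
    and h_add: "\<And>x m m'. x \<in> T \<Longrightarrow> m \<in> carrier M \<Longrightarrow> m' \<in> carrier M \<Longrightarrow> h x (m \<oplus>\<^bsub>M\<^esub> m') = h x m \<oplus>\<^bsub>A\<^esub> h x m'"
    and h_smult: "\<And>x a m. x \<in> T \<Longrightarrow> a \<in> carrier A \<Longrightarrow> m \<in> carrier M \<Longrightarrow> h x (a \<odot>\<^bsub>M\<^esub> m) = a \<otimes>\<^bsub>A\<^esub> h x m"
    and h_u: "\<And>x m. x \<in> T \<Longrightarrow> m \<in> carrier M \<Longrightarrow> h x (u m) = \<zero>\<^bsub>A\<^esub>"
    and basis: "\<And>m. m \<in> carrier M \<Longrightarrow> \<exists>d\<in>carrier M. m = (\<Oplus>\<^bsub>M\<^esub>x\<in>T. h x m \<odot>\<^bsub>M\<^esub> x) \<oplus>\<^bsub>M\<^esub> u d"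
  shows "projective_module AS (with_smult M pact)"
proof -
  interpret AS: cring AS by (rule R.powser_cring)
  interpret P: module AS "with_smult M pact" by (rule module_pact)
  have Tc: "x \<in> carrier M" if "x \<in> T" for x using that T by blast
  define \<sigma> where "\<sigma> m = (\<Oplus>\<^bsub>M\<^esub>x\<in>T. h x m \<odot>\<^bsub>M\<^esub> x)" for m
  have \<sigma>_closed: "\<sigma> m \<in> carrier M" if "m \<in> carrier M" for m
    unfolding \<sigma>_def using that h_closed Tc by (auto intro!: M.finsum_closed)
  have \<sigma>_add: "\<sigma> (m \<oplus>\<^bsub>M\<^esub> m') = \<sigma> m \<oplus>\<^bsub>M\<^esub> \<sigma> m'" if "m \<in> carrier M" "m' \<in> carrier M" for m m'
  proof -
    have "\<sigma> (m \<oplus>\<^bsub>M\<^esub> m') = (\<Oplus>\<^bsub>M\<^esub>x\<in>T. h x m \<odot>\<^bsub>M\<^esub> x \<oplus>\<^bsub>M\<^esub> h x m' \<odot>\<^bsub>M\<^esub> x)"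
      unfolding \<sigma>_def by (rule M.finsum_cong') (use that h_closed h_add Tc in \<open>auto simp: smult_l_distr\<close>)
    also have "\<dots> = \<sigma> m \<oplus>\<^bsub>M\<^esub> \<sigma> m'"
      unfolding \<sigma>_def by (rule M.finsum_addf) (use that h_closed Tc in auto)
    finally show ?thesis .
  qed
  have \<sigma>_smult: "\<sigma> (a \<odot>\<^bsub>M\<^esub> m) = a \<odot>\<^bsub>M\<^esub> \<sigma> m" if "m \<in> carrier M" "a \<in> carrier A" for m a
  proof -
    have "a \<odot>\<^bsub>M\<^esub> \<sigma> m = (\<Oplus>\<^bsub>M\<^esub>x\<in>T. a \<odot>\<^bsub>M\<^esub> (h x m \<odot>\<^bsub>M\<^esub> x))"
      unfolding \<sigma>_def by (rule finsum_smult_ldistr) (use that h_closed Tc T in auto)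
    also have "\<dots> = \<sigma> (a \<odot>\<^bsub>M\<^esub> m)"
      unfolding \<sigma>_def by (rule M.finsum_cong') (use that h_closed h_smult Tc in \<open>auto simp: smult_assoc1\<close>)
    finally show ?thesis by simp
  qed
  have \<sigma>_u: "\<sigma> (u m) = \<zero>\<^bsub>M\<^esub>" if "m \<in> carrier M" for m
  proof -
    have "\<sigma> (u m) = (\<Oplus>\<^bsub>M\<^esub>x\<in>T. \<zero>\<^bsub>M\<^esub>)"
      unfolding \<sigma>_def by (rule M.finsum_cong') (use that h_u Tc in auto)
    then show ?thesis by simp
  qed
  define D where "D m = (SOME d. d \<in> carrier M \<and> m = \<sigma> m \<oplus>\<^bsub>M\<^esub> u d)" for m
  have D: "D m \<in> carrier M" "m = \<sigma> m \<oplus>\<^bsub>M\<^esub> u (D m)" if m: "m \<in> carrier M" for m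
  proof -
    have "\<exists>d. d \<in> carrier M \<and> m = \<sigma> m \<oplus>\<^bsub>M\<^esub> u d" using basis[OF m] unfolding \<sigma>_def by blast
    from someI_ex[OF this] show "D m \<in> carrier M" "m = \<sigma> m \<oplus>\<^bsub>M\<^esub> u (D m)" unfolding D_def by blast+
  qed
  have D_unique: "D m = d" if "m \<in> carrier M" "d \<in> carrier M" "m = \<sigma> m \<oplus>\<^bsub>M\<^esub> u d" for m d
  proof -
    have "\<sigma> m \<oplus>\<^bsub>M\<^esub> u (D m) = \<sigma> m \<oplus>\<^bsub>M\<^esub> u d" using D(2)[OF that(1)] that(3) by simp
    then have "u (D m) = u d" using \<sigma>_closed[OF that(1)] D(1)[OF that(1)] that(2) u_closed by simp
    then show ?thesis using u_inj D(1)[OF that(1)] that(2) by blast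
  qed
  have D_add: "D (m \<oplus>\<^bsub>M\<^esub> m') = D m \<oplus>\<^bsub>M\<^esub> D m'" if m: "m \<in> carrier M" "m' \<in> carrier M" for m m'
  proof (rule D_unique)
    have "m \<oplus>\<^bsub>M\<^esub> m' = (\<sigma> m \<oplus>\<^bsub>M\<^esub> u (D m)) \<oplus>\<^bsub>M\<^esub> (\<sigma> m' \<oplus>\<^bsub>M\<^esub> u (D m'))"
      using D(2)[OF m(1)] D(2)[OF m(2)] by simp
    also have "\<dots> = \<sigma> (m \<oplus>\<^bsub>M\<^esub> m') \<oplus>\<^bsub>M\<^esub> u (D m \<oplus>\<^bsub>M\<^esub> D m')"
      using m D(1) \<sigma>_closed u_closed by (simp add: \<sigma>_add u_add add4)
    finally show "m \<oplus>\<^bsub>M\<^esub> m' = \<sigma> (m \<oplus>\<^bsub>M\<^esub> m') \<oplus>\<^bsub>M\<^esub> u (D m \<oplus>\<^bsub>M\<^esub> D m')" .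
  qed (use m D(1) in auto)
  have D_smult: "D (a \<odot>\<^bsub>M\<^esub> m) = a \<odot>\<^bsub>M\<^esub> D m" if m: "m \<in> carrier M" "a \<in> carrier A" for m a
  proof (rule D_unique)
    have "a \<odot>\<^bsub>M\<^esub> m = a \<odot>\<^bsub>M\<^esub> (\<sigma> m \<oplus>\<^bsub>M\<^esub> u (D m))" using D(2)[OF m(1)] by simp
    also have "\<dots> = \<sigma> (a \<odot>\<^bsub>M\<^esub> m) \<oplus>\<^bsub>M\<^esub> u (a \<odot>\<^bsub>M\<^esub> D m)"
      using m D(1) \<sigma>_closed u_closed by (simp add: \<sigma>_smult u_smult smult_r_distr)
    finally show "a \<odot>\<^bsub>M\<^esub> m = \<sigma> (a \<odot>\<^bsub>M\<^esub> m) \<oplus>\<^bsub>M\<^esub> u (a \<odot>\<^bsub>M\<^esub> D m)" .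
  qed (use m D(1) in auto)
  have D_u: "D (u m) = m" if m: "m \<in> carrier M" for m
    by (rule D_unique) (use m u_closed \<sigma>_u in auto)
  have Dp_closed: "(D ^^ k) m \<in> carrier M" if "m \<in> carrier M" for k m
    by (induct k) (use that D(1) in auto)
  have Dp_add: "(D ^^ k) (m \<oplus>\<^bsub>M\<^esub> m') = (D ^^ k) m \<oplus>\<^bsub>M\<^esub> (D ^^ k) m'" if "m \<in> carrier M" "m' \<in> carrier M" for k m m'
    by (induct k) (use that Dp_closed D_add in auto)
  have Dp_smult: "(D ^^ k) (a \<odot>\<^bsub>M\<^esub> m) = a \<odot>\<^bsub>M\<^esub> (D ^^ k) m" if "m \<in> carrier M" "a \<in> carrier A" for k m a
    by (induct k) (use that Dp_closed D_smult in auto)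
  define F where "F x m = (\<lambda>k. h x ((D ^^ k) m))" for x m
  have F_closed: "F x m \<in> carrier AS" if "x \<in> T" "m \<in> carrier M" for x m
    unfolding F_def using that h_closed Dp_closed by (intro R.powserI) auto
  have F_shift: "coeff_shift (F x m) = F x (D m)" for x m
    by (rule ext) (simp only: coeff_shift_apply F_def funpow_Suc_right comp_apply)
  have F_add: "F x (m \<oplus>\<^bsub>M\<^esub> m') = F x m \<oplus>\<^bsub>AS\<^esub> F x m'" if "x \<in> T" "m \<in> carrier M" "m' \<in> carrier M" for x m m'
    unfolding F_def using that h_add Dp_closed Dp_add by (simp add: powser_ring_simps(5))
  \<comment> \<open>Induction on the coefficient for all \<open>g\<close> at once: applying
    \<open>D\<close> strips \<open>u\<close> from the recursion of \<open>pact g m\<close>, and the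
    result matches the recursion \<open>powser_mult_Suc\<close> for products.\<close>
  have F_pact: "F x (pact g m) k = (g \<otimes>\<^bsub>AS\<^esub> F x m) k" if x: "x \<in> T" and m: "m \<in> carrier M" and g: "g \<in> carrier AS" for x m g k
    using g
  proof (induct k arbitrary: g)
    case 0
    note g = 0
    note c = pact_closed[OF R.coeff_shift_closed[OF g] m] R.powser_nth[OF g, of 0]
    have "F x (pact g m) 0 = h x (g 0 \<odot>\<^bsub>M\<^esub> m \<oplus>\<^bsub>M\<^esub> u (pact (coeff_shift g) m))" by (simp add: F_def pact_rec[OF g m, symmetric])
    also have "\<dots> = g 0 \<otimes>\<^bsub>A\<^esub> h x m" using x m c u_closed h_closed[OF x m] by (simp add: h_add h_smult h_u)
    finally show ?case using R.powser_mult_0[OF g F_closed[OF x m]] by (simp add: F_def)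
  next
    case (Suc k)
    note g = Suc.prems
    note c = pact_closed[OF R.coeff_shift_closed[OF g] m] R.powser_nth[OF g, of 0]
    have Dp: "D (pact g m) = g 0 \<odot>\<^bsub>M\<^esub> D m \<oplus>\<^bsub>M\<^esub> pact (coeff_shift g) m"
      unfolding pact_rec[OF g m] using c m u_closed by (simp add: D_add D_smult D_u)
    have "F x (pact g m) (Suc k) = F x (g 0 \<odot>\<^bsub>M\<^esub> D m \<oplus>\<^bsub>M\<^esub> pact (coeff_shift g) m) k"
      by (simp only: F_def funpow_Suc_right comp_apply Dp)
    also have "\<dots> = g 0 \<otimes>\<^bsub>A\<^esub> F x (D m) k \<oplus>\<^bsub>A\<^esub> F x (pact (coeff_shift g) m) k"
      unfolding F_def using c m D(1)[OF m] x Dp_closed by (simp add: Dp_add Dp_smult h_add h_smult)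
    also have "\<dots> = g 0 \<otimes>\<^bsub>A\<^esub> F x m (Suc k) \<oplus>\<^bsub>A\<^esub> (coeff_shift g \<otimes>\<^bsub>AS\<^esub> F x m) k"
      unfolding Suc.hyps[OF R.coeff_shift_closed[OF g]] F_shift[symmetric] coeff_shift_apply ..
    finally show ?case unfolding R.powser_mult_Suc[OF g F_closed[OF x m]] .
  qed
  let ?FM = "free_module AS T"
  let ?s = "\<lambda>m. \<lambda>x\<in>T. F x m"
  let ?q = "\<lambda>f. \<Oplus>\<^bsub>M\<^esub>x\<in>T. pact (f x) x"
  have FM: "carrier ?FM = T \<rightarrow>\<^sub>E carrier AS" using T(1) by (auto simp: free_module_def)
  have FMa: "f \<oplus>\<^bsub>?FM\<^esub> g = (\<lambda>x\<in>T. f x \<oplus>\<^bsub>AS\<^esub> g x)" "a \<odot>\<^bsub>?FM\<^esub> f = (\<lambda>x\<in>T. a \<otimes>\<^bsub>AS\<^esub> f x)" for f g a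
    by (auto simp: free_module_def)
  have "?s \<in> linear_maps AS (with_smult M pact) ?FM"
    unfolding linear_maps_def
  proof (intro CollectI conjI ballI)
    show "?s \<in> carrier (with_smult M pact) \<rightarrow> carrier ?FM"
      unfolding FM by (auto intro: F_closed)
    show "?s (m \<oplus>\<^bsub>with_smult M pact\<^esub> m') = ?s m \<oplus>\<^bsub>?FM\<^esub> ?s m'"
      if "m \<in> carrier (with_smult M pact)" "m' \<in> carrier (with_smult M pact)" for m m'
      unfolding FMa by (rule restrict_ext) (use that F_add in auto)
    show "?s (a \<odot>\<^bsub>with_smult M pact\<^esub> m) = a \<odot>\<^bsub>?FM\<^esub> ?s m"
      if "a \<in> carrier AS" "m \<in> carrier (with_smult M pact)" for a m
      unfolding FMa by (rule restrict_ext) (use that F_pact in \<open>auto intro!: ext\<close>)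
  qed
  moreover have "?q \<in> linear_maps AS ?FM (with_smult M pact)"
    unfolding linear_maps_def
  proof (intro CollectI conjI ballI)
    show "?q \<in> carrier ?FM \<rightarrow> carrier (with_smult M pact)"
      unfolding FM using Tc pact_closed by (auto intro!: M.finsum_closed)
    show "?q (f \<oplus>\<^bsub>?FM\<^esub> g) = ?q f \<oplus>\<^bsub>with_smult M pact\<^esub> ?q g" if "f \<in> carrier ?FM" "g \<in> carrier ?FM" for f g
    proof -
      have fg: "f x \<in> carrier AS" "g x \<in> carrier AS" if "x \<in> T" for x
        using that \<open>f \<in> carrier ?FM\<close> \<open>g \<in> carrier ?FM\<close> unfolding FM by auto
      have "?q (f \<oplus>\<^bsub>?FM\<^esub> g) = (\<Oplus>\<^bsub>M\<^esub>x\<in>T. pact (f x) x \<oplus>\<^bsub>M\<^esub> pact (g x) x)"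
        unfolding FMa by (rule M.finsum_cong') (use fg Tc pact_closed in \<open>auto simp: pact_add_left\<close>)
      also have "\<dots> = ?q f \<oplus>\<^bsub>M\<^esub> ?q g" by (rule M.finsum_addf) (use fg Tc pact_closed in auto)
      finally show ?thesis by simp
    qed
    show "?q (a \<odot>\<^bsub>?FM\<^esub> f) = a \<odot>\<^bsub>with_smult M pact\<^esub> ?q f" if "a \<in> carrier AS" "f \<in> carrier ?FM" for a f
    proof -
      have fg: "f x \<in> carrier AS" if "x \<in> T" for x
        using that \<open>f \<in> carrier ?FM\<close> unfolding FM by auto
      have "a \<odot>\<^bsub>with_smult M pact\<^esub> ?q f = (\<Oplus>\<^bsub>M\<^esub>x\<in>T. pact a (pact (f x) x))"
        using P.finsum_smult_ldistr[OF T(1) that(1), of "\<lambda>x. pact (f x) x"] fg Tc pact_closed by auto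
      also have "\<dots> = ?q (a \<odot>\<^bsub>?FM\<^esub> f)"
        unfolding FMa by (rule M.finsum_cong') (use fg Tc pact_closed that(1) in \<open>auto simp: pact_mult\<close>)
      finally show ?thesis by simp
    qed
  qed
  moreover have "?q (?s m) = m" if m: "m \<in> carrier (with_smult M pact)" for m
  proof -
    have mc: "m \<in> carrier M" using m by simp
    have q: "?q (?s m) = (\<Oplus>\<^bsub>M\<^esub>x\<in>T. pact (F x m) x)" if "m \<in> carrier M" for m
      by (rule M.finsum_cong') (use that F_closed Tc pact_closed in auto)
    \<comment> \<open>\<open>b\<close> and the sum attached to it share the part
      \<open>\<sigma> b\<close>, and their remainders are again related, with \<open>D b\<close> in
      place of \<open>b\<close>.\<close>
    let ?S = "\<lambda>a b. b \<in> carrier M \<and> a = (\<Oplus>\<^bsub>M\<^esub>x\<in>T. pact (F x b) x)"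
    have "(\<Oplus>\<^bsub>M\<^esub>x\<in>T. pact (F x m) x) = m"
    proof (rule coinduct_eq[where S = ?S])
      fix a b assume "?S a b"
      then have b: "b \<in> carrier M" and a: "a = (\<Oplus>\<^bsub>M\<^esub>x\<in>T. pact (F x b) x)" by auto
      have cl: "pact (F x b) x \<in> carrier M" "pact (F x (D b)) x \<in> carrier M" "h x b \<odot>\<^bsub>M\<^esub> x \<in> carrier M" if "x \<in> T" for x
        using that F_closed Tc b D(1) h_closed by (auto intro!: pact_closed)
      have "a = (\<Oplus>\<^bsub>M\<^esub>x\<in>T. h x b \<odot>\<^bsub>M\<^esub> x \<oplus>\<^bsub>M\<^esub> u (pact (F x (D b)) x))"
        unfolding a
      proof (rule M.finsum_cong')
        fix x assume x: "x \<in> T"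
        show "pact (F x b) x = h x b \<odot>\<^bsub>M\<^esub> x \<oplus>\<^bsub>M\<^esub> u (pact (F x (D b)) x)"
          unfolding pact_rec[OF F_closed[OF x b] Tc[OF x]] F_shift by (simp add: F_def)
      qed (use cl u_closed in auto)
      also have "\<dots> = \<sigma> b \<oplus>\<^bsub>M\<^esub> (\<Oplus>\<^bsub>M\<^esub>x\<in>T. u (pact (F x (D b)) x))"
        unfolding \<sigma>_def by (rule M.finsum_addf) (use cl u_closed in auto)
      also have "(\<Oplus>\<^bsub>M\<^esub>x\<in>T. u (pact (F x (D b)) x)) = u (\<Oplus>\<^bsub>M\<^esub>x\<in>T. pact (F x (D b)) x)"
        by (rule u_finsum[symmetric]) (use T cl in auto)
      finally have "a = \<sigma> b \<oplus>\<^bsub>M\<^esub> u (\<Oplus>\<^bsub>M\<^esub>x\<in>T. pact (F x (D b)) x)" .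
      moreover have "a \<in> carrier M" unfolding a using cl by (auto intro!: M.finsum_closed)
      ultimately show "a \<in> carrier M \<and> b \<in> carrier M \<and> (\<exists>m\<in>carrier M. \<exists>a' b'. ?S a' b' \<and> a = m \<oplus>\<^bsub>M\<^esub> u a' \<and> b = m \<oplus>\<^bsub>M\<^esub> u b')"
        using b D[OF b] \<sigma>_closed[OF b] by blast
    qed (use mc in auto)
    then show ?thesis using q[OF mc] by simp
  qed
  ultimately show ?thesis unfolding projective_module_def using module_pact by blast
qed

end

section \<open>Functionals on finitely generated modules without torsion\<close>

lemma (in module) submodule_ops:
  assumes "submodule H R M"
  shows "x \<in> H \<Longrightarrow> x \<in> carrier M" "\<zero>\<^bsub>M\<^esub> \<in> H" "x \<in> H \<Longrightarrow> y \<in> H \<Longrightarrow> x \<oplus>\<^bsub>M\<^esub> y \<in> H"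
    "x \<in> H \<Longrightarrow> \<ominus>\<^bsub>M\<^esub> x \<in> H" "a \<in> carrier R \<Longrightarrow> x \<in> H \<Longrightarrow> a \<odot>\<^bsub>M\<^esub> x \<in> H"
    "x \<in> H \<Longrightarrow> y \<in> H \<Longrightarrow> x \<ominus>\<^bsub>M\<^esub> y \<in> H"
proof -
  show c: "x \<in> H \<Longrightarrow> x \<in> carrier M" for x using submoduleE(1)[OF assms] by blast
  show s: "a \<in> carrier R \<Longrightarrow> x \<in> H \<Longrightarrow> a \<odot>\<^bsub>M\<^esub> x \<in> H" for a x by (rule submoduleE(4)[OF assms])
  show p: "x \<in> H \<Longrightarrow> y \<in> H \<Longrightarrow> x \<oplus>\<^bsub>M\<^esub> y \<in> H" for x y by (rule submoduleE(5)[OF assms])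
  show m: "x \<in> H \<Longrightarrow> \<ominus>\<^bsub>M\<^esub> x \<in> H" for x by (rule submoduleE(3)[OF assms])
  show "\<zero>\<^bsub>M\<^esub> \<in> H"
  proof -
    obtain x where x: "x \<in> H" using submoduleE(2)[OF assms] by blast
    show ?thesis using s[OF R.zero_closed x] smult_l_null[OF c[OF x]] by simp
  qed
  show "x \<in> H \<Longrightarrow> y \<in> H \<Longrightarrow> x \<ominus>\<^bsub>M\<^esub> y \<in> H" unfolding M.minus_eq by (intro p m)
qed

lemma (in module) submoduleI':
  assumes "H \<subseteq> carrier M" "\<zero>\<^bsub>M\<^esub> \<in> H" "\<And>x y. x \<in> H \<Longrightarrow> y \<in> H \<Longrightarrow> x \<oplus>\<^bsub>M\<^esub> y \<in> H"
    "\<And>a x. a \<in> carrier R \<Longrightarrow> x \<in> H \<Longrightarrow> a \<odot>\<^bsub>M\<^esub> x \<in> H"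
  shows "submodule H R M"
proof (rule submoduleI[OF assms(1,2) _ assms(3,4)])
  fix x assume x: "x \<in> H"
  have "\<ominus>\<^bsub>M\<^esub> x = (\<ominus>\<^bsub>R\<^esub> \<one>\<^bsub>R\<^esub>) \<odot>\<^bsub>M\<^esub> x" using x assms(1) by (auto simp: smult_l_minus)
  then show "\<ominus>\<^bsub>M\<^esub> x \<in> H" using assms(4)[OF _ x] by simp
qed

section \<open>The quotient by a submodule and its functionals\<close>

text \<open>The generators are numbered, so that coordinates are tuples of type
  \<open>nat \<Rightarrow> 'r\<close> whatever the type of the module. Generation modulo
  \<open>U\<close> is stated through submodules, as in \<open>finitely_generated\<close>.\<close>

locale residual_setup = module R P for R :: "('r, 'x) ring_scheme" and P :: "('r, 'm) module" (structure) +
  fixes U and n and x :: "nat \<Rightarrow> 'm"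
  assumes U: "submodule U R P"
    and x_closed: "i < n \<Longrightarrow> x i \<in> carrier P"
    and gen: "submodule H R P \<Longrightarrow> x ` {..<n} \<union> U \<subseteq> H \<Longrightarrow> H = carrier P"
begin

lemmas U_ops = submodule_ops[OF U]

abbreviation "tuples \<equiv> {..<n} \<rightarrow>\<^sub>E carrier R"

definition comb :: "(nat \<Rightarrow> 'r) \<Rightarrow> 'm" where
  "comb c = (\<Oplus>\<^bsub>P\<^esub>i\<in>{..<n}. c i \<odot>\<^bsub>P\<^esub> x i)"

lemma comb_closed: "(\<And>i. i < n \<Longrightarrow> c i \<in> carrier R) \<Longrightarrow> comb c \<in> carrier P"
  unfolding comb_def using x_closed by (auto intro!: M.finsum_closed)

lemma comb_cong: "(\<And>i. i < n \<Longrightarrow> c i = d i) \<Longrightarrow> (\<And>i. i < n \<Longrightarrow> d i \<in> carrier R) \<Longrightarrow> comb c = comb d"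
  unfolding comb_def using x_closed by (intro M.finsum_cong') auto

lemma comb_add:
  assumes "\<And>i. i < n \<Longrightarrow> c i \<in> carrier R" "\<And>i. i < n \<Longrightarrow> d i \<in> carrier R"
  shows "comb (\<lambda>i. c i \<oplus>\<^bsub>R\<^esub> d i) = comb c \<oplus>\<^bsub>P\<^esub> comb d"
proof -
  have "comb (\<lambda>i. c i \<oplus>\<^bsub>R\<^esub> d i) = (\<Oplus>\<^bsub>P\<^esub>i\<in>{..<n}. c i \<odot>\<^bsub>P\<^esub> x i \<oplus>\<^bsub>P\<^esub> d i \<odot>\<^bsub>P\<^esub> x i)"
    unfolding comb_def by (rule M.finsum_cong') (use assms x_closed in \<open>auto simp: smult_l_distr\<close>)
  also have "\<dots> = comb c \<oplus>\<^bsub>P\<^esub> comb d"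
    unfolding comb_def by (rule M.finsum_addf) (use assms x_closed in auto)
  finally show ?thesis .
qed

lemma comb_smult:
  assumes "\<And>i. i < n \<Longrightarrow> c i \<in> carrier R" "a \<in> carrier R"
  shows "comb (\<lambda>i. a \<otimes>\<^bsub>R\<^esub> c i) = a \<odot>\<^bsub>P\<^esub> comb c"
proof -
  have "a \<odot>\<^bsub>P\<^esub> comb c = (\<Oplus>\<^bsub>P\<^esub>i\<in>{..<n}. a \<odot>\<^bsub>P\<^esub> (c i \<odot>\<^bsub>P\<^esub> x i))"
    unfolding comb_def by (rule finsum_smult_ldistr) (use assms x_closed in auto)
  also have "\<dots> = comb (\<lambda>i. a \<otimes>\<^bsub>R\<^esub> c i)"
    unfolding comb_def by (rule M.finsum_cong') (use assms x_closed in \<open>auto simp: smult_assoc1\<close>)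
  finally show ?thesis by simp
qed

lemma comb_zero: "comb (\<lambda>_. \<zero>\<^bsub>R\<^esub>) = \<zero>\<^bsub>P\<^esub>"
  unfolding comb_def using x_closed by (subst M.finsum_cong'[of _ _ "\<lambda>_. \<zero>\<^bsub>P\<^esub>"]) auto

text \<open>The residue class of \<open>m\<close> is encoded by the set of its coordinate tuples, so that the quotient
  by \<open>U\<close> lives on a type that depends only on \<open>R\<close>.\<close>

definition cl :: "'m \<Rightarrow> (nat \<Rightarrow> 'r) set" where
  "cl m = {c \<in> tuples. comb c \<ominus>\<^bsub>P\<^esub> m \<in> U}"

lemma comb_tuple_closed: "c \<in> tuples \<Longrightarrow> comb c \<in> carrier P"
  by (rule comb_closed) auto

lemma minus_zero_right: "a \<in> carrier P \<Longrightarrow> a \<ominus>\<^bsub>P\<^esub> \<zero>\<^bsub>P\<^esub> = a"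
  by (simp add: M.minus_eq M.add.inv_one)

lemma diff_trans:
  assumes "a \<in> carrier P" "b \<in> carrier P" "c \<in> carrier P" "a \<ominus>\<^bsub>P\<^esub> b \<in> U" "b \<ominus>\<^bsub>P\<^esub> c \<in> U"
  shows "a \<ominus>\<^bsub>P\<^esub> c \<in> U"
proof -
  have "a \<ominus>\<^bsub>P\<^esub> c = (a \<ominus>\<^bsub>P\<^esub> b) \<oplus>\<^bsub>P\<^esub> (b \<ominus>\<^bsub>P\<^esub> c)"
    using assms(1-3) by (simp add: M.minus_eq M.a_assoc M.r_neg1)
  then show ?thesis using U_ops(3)[OF assms(4,5)] by simp
qed

lemma diff_sym:
  assumes "a \<in> carrier P" "b \<in> carrier P" "a \<ominus>\<^bsub>P\<^esub> b \<in> U"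
  shows "b \<ominus>\<^bsub>P\<^esub> a \<in> U"
proof -
  have "b \<ominus>\<^bsub>P\<^esub> a = \<ominus>\<^bsub>P\<^esub> (a \<ominus>\<^bsub>P\<^esub> b)"
    using assms(1,2) by (simp add: M.minus_eq M.minus_add M.a_comm)
  then show ?thesis using U_ops(4)[OF assms(3)] by simp
qed

lemma diff_add:
  assumes "a \<in> carrier P" "b \<in> carrier P" "a' \<in> carrier P" "b' \<in> carrier P" "a \<ominus>\<^bsub>P\<^esub> a' \<in> U" "b \<ominus>\<^bsub>P\<^esub> b' \<in> U"
  shows "(a \<oplus>\<^bsub>P\<^esub> b) \<ominus>\<^bsub>P\<^esub> (a' \<oplus>\<^bsub>P\<^esub> b') \<in> U"
proof -
  have "(a \<oplus>\<^bsub>P\<^esub> b) \<ominus>\<^bsub>P\<^esub> (a' \<oplus>\<^bsub>P\<^esub> b') = (a \<ominus>\<^bsub>P\<^esub> a') \<oplus>\<^bsub>P\<^esub> (b \<ominus>\<^bsub>P\<^esub> b')"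
    using assms(1-4) by (simp add: M.minus_eq M.minus_add M.a_ac)
  then show ?thesis using U_ops(3)[OF assms(5,6)] by simp
qed

lemma diff_smult:
  assumes "a \<in> carrier P" "b \<in> carrier P" "r \<in> carrier R" "a \<ominus>\<^bsub>P\<^esub> b \<in> U"
  shows "r \<odot>\<^bsub>P\<^esub> a \<ominus>\<^bsub>P\<^esub> r \<odot>\<^bsub>P\<^esub> b \<in> U"
proof -
  have "r \<odot>\<^bsub>P\<^esub> a \<ominus>\<^bsub>P\<^esub> r \<odot>\<^bsub>P\<^esub> b = r \<odot>\<^bsub>P\<^esub> (a \<ominus>\<^bsub>P\<^esub> b)"
    using assms(1-3) by (simp add: M.minus_eq smult_r_distr smult_r_minus)
  then show ?thesis using U_ops(5)[OF assms(3,4)] by simp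
qed

lemma diff_self: "a \<in> carrier P \<Longrightarrow> a \<ominus>\<^bsub>P\<^esub> a \<in> U"
  using U_ops(2) by (simp add: M.minus_eq M.r_neg)

text \<open>The elements that have coordinates modulo \<open>U\<close> form a submodule containing
  the generators and \<open>U\<close>.\<close>

lemma cl_nonempty:
  assumes "m \<in> carrier P"
  shows "\<exists>c\<in>tuples. comb c \<ominus>\<^bsub>P\<^esub> m \<in> U"
proof -
  let ?H = "{m \<in> carrier P. \<exists>c\<in>tuples. comb c \<ominus>\<^bsub>P\<^esub> m \<in> U}"
  have restr: "comb (restrict c {..<n}) = comb c" if "\<And>i. i < n \<Longrightarrow> c i \<in> carrier R" for c
    by (rule comb_cong) (use that in auto)
  have "submodule ?H R P"
  proof (rule submoduleI')
    have "comb (\<lambda>i\<in>{..<n}. \<zero>\<^bsub>R\<^esub>) = \<zero>\<^bsub>P\<^esub>" using restr[of "\<lambda>_. \<zero>\<^bsub>R\<^esub>"] comb_zero by simp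
    then show "\<zero>\<^bsub>P\<^esub> \<in> ?H" using diff_self[OF M.zero_closed]
      by (intro CollectI conjI bexI[of _ "\<lambda>i\<in>{..<n}. \<zero>\<^bsub>R\<^esub>"]) auto
    fix a b assume "a \<in> ?H" "b \<in> ?H"
    then obtain c d where c: "a \<in> carrier P" "c \<in> tuples" "comb c \<ominus>\<^bsub>P\<^esub> a \<in> U"
      and d: "b \<in> carrier P" "d \<in> tuples" "comb d \<ominus>\<^bsub>P\<^esub> b \<in> U" by blast
    have cd: "c i \<in> carrier R" "d i \<in> carrier R" if "i < n" for i using that c(2) d(2) by auto
    let ?e = "\<lambda>i\<in>{..<n}. c i \<oplus>\<^bsub>R\<^esub> d i"
    have "comb ?e = comb c \<oplus>\<^bsub>P\<^esub> comb d"
      using restr[of "\<lambda>i. c i \<oplus>\<^bsub>R\<^esub> d i"] cd by (simp add: comb_add)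
    then have "comb ?e \<ominus>\<^bsub>P\<^esub> (a \<oplus>\<^bsub>P\<^esub> b) \<in> U"
      using diff_add[OF comb_tuple_closed[OF c(2)] comb_tuple_closed[OF d(2)] c(1) d(1) c(3) d(3)] by simp
    moreover have "?e \<in> tuples" using cd by auto
    ultimately show "a \<oplus>\<^bsub>P\<^esub> b \<in> ?H" using c(1) d(1) by blast
  next
    fix r a assume r: "r \<in> carrier R" and "a \<in> ?H"
    then obtain c where c: "a \<in> carrier P" "c \<in> tuples" "comb c \<ominus>\<^bsub>P\<^esub> a \<in> U" by blast
    have cd: "c i \<in> carrier R" if "i < n" for i using that c(2) by auto
    let ?e = "\<lambda>i\<in>{..<n}. r \<otimes>\<^bsub>R\<^esub> c i"
    have "comb ?e = r \<odot>\<^bsub>P\<^esub> comb c"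
      using restr[of "\<lambda>i. r \<otimes>\<^bsub>R\<^esub> c i"] cd r by (simp add: comb_smult)
    then have "comb ?e \<ominus>\<^bsub>P\<^esub> r \<odot>\<^bsub>P\<^esub> a \<in> U"
      using diff_smult[OF comb_tuple_closed[OF c(2)] c(1) r c(3)] by simp
    moreover have "?e \<in> tuples" using cd r by auto
    ultimately show "r \<odot>\<^bsub>P\<^esub> a \<in> ?H" using c(1) r by blast
  qed blast
  moreover have "x ` {..<n} \<union> U \<subseteq> ?H"
  proof
    fix m assume "m \<in> x ` {..<n} \<union> U"
    then show "m \<in> ?H"
    proof
      assume "m \<in> x ` {..<n}"
      then obtain j where j: "j < n" "m = x j" by auto
      let ?e = "\<lambda>i\<in>{..<n}. if i = j then \<one>\<^bsub>R\<^esub> else \<zero>\<^bsub>R\<^esub>"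
      have "comb ?e = (\<Oplus>\<^bsub>P\<^esub>i\<in>{..<n}. if j = i then x i else \<zero>\<^bsub>P\<^esub>)"
        unfolding comb_def by (rule M.finsum_cong') (use x_closed in auto)
      also have "\<dots> = x j" by (rule M.finsum_singleton) (use j x_closed in auto)
      finally have "comb ?e \<ominus>\<^bsub>P\<^esub> m \<in> U" using j diff_self x_closed by simp
      moreover have "?e \<in> tuples" by auto
      ultimately show ?thesis using j x_closed by blast
    next
      assume m: "m \<in> U"
      have "comb (\<lambda>i\<in>{..<n}. \<zero>\<^bsub>R\<^esub>) = \<zero>\<^bsub>P\<^esub>" using restr[of "\<lambda>_. \<zero>\<^bsub>R\<^esub>"] comb_zero by simp
      then have "comb (\<lambda>i\<in>{..<n}. \<zero>\<^bsub>R\<^esub>) \<ominus>\<^bsub>P\<^esub> m \<in> U" using U_ops(6)[OF U_ops(2) m] by simp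
      moreover have "(\<lambda>i\<in>{..<n}. \<zero>\<^bsub>R\<^esub>) \<in> tuples" by auto
      ultimately show ?thesis using U_ops(1)[OF m] by blast
    qed
  qed
  ultimately have "?H = carrier P" by (rule gen)
  then show ?thesis using assms by blast
qed

text \<open>A coordinate tuple of \<open>m\<close> exists by \<open>cl_nonempty\<close>; if it also
  belongs to \<open>cl m'\<close>, then its combination is congruent to both elements. So the sets
  of tuples separate residue classes.\<close>

lemma cl_eq_iff:
  assumes m: "m \<in> carrier P" and m': "m' \<in> carrier P"
  shows "cl m = cl m' \<longleftrightarrow> m \<ominus>\<^bsub>P\<^esub> m' \<in> U"
proof
  assume e: "cl m = cl m'"
  obtain c where c: "c \<in> tuples" "comb c \<ominus>\<^bsub>P\<^esub> m \<in> U" using cl_nonempty[OF m] by blast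
  then have "c \<in> cl m" by (simp add: cl_def)
  then have "c \<in> cl m'" using e by simp
  then have "comb c \<ominus>\<^bsub>P\<^esub> m' \<in> U" by (simp add: cl_def)
  then show "m \<ominus>\<^bsub>P\<^esub> m' \<in> U"
    by (rule diff_trans[OF m comb_tuple_closed[OF c(1)] m' diff_sym[OF comb_tuple_closed[OF c(1)] m c(2)]])
next
  assume d: "m \<ominus>\<^bsub>P\<^esub> m' \<in> U"
  note d' = diff_sym[OF m m' d]
  show "cl m = cl m'"
    unfolding cl_def
    using diff_trans[OF comb_tuple_closed m m' _ d] diff_trans[OF comb_tuple_closed m' m _ d'] by blast
qed

lemma cl_comb_ex: "m \<in> carrier P \<Longrightarrow> \<exists>c\<in>tuples. cl m = cl (comb c)"
proof -
  assume m: "m \<in> carrier P"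
  obtain c where c: "c \<in> tuples" "comb c \<ominus>\<^bsub>P\<^esub> m \<in> U" using cl_nonempty[OF m] by blast
  have "cl (comb c) = cl m" using cl_eq_iff[OF comb_tuple_closed[OF c(1)] m] c(2) by simp
  then show ?thesis using c(1) by (intro bexI[of _ c]) simp_all
qed

definition rep :: "(nat \<Rightarrow> 'r) set \<Rightarrow> 'm" where
  "rep Y = (SOME m. m \<in> carrier P \<and> cl m = Y)"

lemma rep: "m \<in> carrier P \<Longrightarrow> rep (cl m) \<in> carrier P \<and> cl (rep (cl m)) = cl m"
  unfolding rep_def by (rule someI[of _ m]) simp

text \<open>The quotient of \<open>P\<close> by \<open>U\<close>, realized on the type over which
  the hypothesis on \<open>R\<close> quantifies. The operations go through chosen representatives;
  \<open>Q_add\<close> and \<open>Q_smult\<close> remove the choice.\<close>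

definition Q :: "('r, (nat \<Rightarrow> 'r) set) module" where
  "Q = \<lparr>carrier = cl ` carrier P, monoid.mult = undefined, one = undefined, ring.zero = cl \<zero>\<^bsub>P\<^esub>,
     ring.add = (\<lambda>Y Z. cl (rep Y \<oplus>\<^bsub>P\<^esub> rep Z)), smult = (\<lambda>r Y. cl (r \<odot>\<^bsub>P\<^esub> rep Y))\<rparr>"

lemma Q_simps: "carrier Q = cl ` carrier P" "\<zero>\<^bsub>Q\<^esub> = cl \<zero>\<^bsub>P\<^esub>"
  by (simp_all add: Q_def)

lemma rep_diff: "m \<in> carrier P \<Longrightarrow> rep (cl m) \<ominus>\<^bsub>P\<^esub> m \<in> U"
  using rep[of m] cl_eq_iff[of "rep (cl m)" m] by simp

lemma Q_add: "m \<in> carrier P \<Longrightarrow> m' \<in> carrier P \<Longrightarrow> cl m \<oplus>\<^bsub>Q\<^esub> cl m' = cl (m \<oplus>\<^bsub>P\<^esub> m')"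
  using rep[of m] rep[of m'] diff_add[OF _ _ _ _ rep_diff[of m] rep_diff[of m']]
  by (simp add: Q_def cl_eq_iff)

lemma Q_smult: "m \<in> carrier P \<Longrightarrow> r \<in> carrier R \<Longrightarrow> r \<odot>\<^bsub>Q\<^esub> cl m = cl (r \<odot>\<^bsub>P\<^esub> m)"
  using rep[of m] diff_smult[OF _ _ _ rep_diff[of m]] by (simp add: Q_def cl_eq_iff)

lemma Q_module: "module R Q"
proof (rule moduleI)
  show "cring R" by (rule R.cring_axioms)
  show "abelian_group Q"
  proof (rule abelian_groupI)
    fix Y assume "Y \<in> carrier Q"
    then obtain m where m: "m \<in> carrier P" "Y = cl m" by (auto simp: Q_simps)
    show "\<zero>\<^bsub>Q\<^esub> \<oplus>\<^bsub>Q\<^esub> Y = Y" using m by (simp add: Q_simps Q_add)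
    show "\<exists>Z\<in>carrier Q. Z \<oplus>\<^bsub>Q\<^esub> Y = \<zero>\<^bsub>Q\<^esub>"
      using m by (intro bexI[of _ "cl (\<ominus>\<^bsub>P\<^esub> m)"]) (auto simp: Q_simps Q_add M.l_neg)
  qed (auto simp: Q_simps Q_add M.a_ac)
qed (auto simp: Q_simps Q_add Q_smult smult_l_distr smult_r_distr smult_assoc1)

text \<open>A submodule of the quotient is pulled back to \<open>P\<close>, where it contains
  \<open>U\<close> and the generators.\<close>

lemma Q_finitely_generated: "finitely_generated R Q"
  unfolding finitely_generated_def
proof (intro exI[of _ "cl ` x ` {..<n}"] conjI allI impI)
  interpret Q: module R Q by (rule Q_module)
  show "cl ` x ` {..<n} \<subseteq> carrier Q" using x_closed by (auto simp: Q_simps)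
  fix H assume H: "submodule H R Q \<and> cl ` x ` {..<n} \<subseteq> H"
  note H_ops = Q.submodule_ops[OF conjunct1[OF H]]
  let ?H = "{m \<in> carrier P. cl m \<in> H}"
  have "submodule ?H R P"
    using H_ops(2,3,5) by (intro submoduleI') (auto simp: Q_simps(2) Q_add[symmetric] Q_smult[symmetric])
  moreover have "x ` {..<n} \<union> U \<subseteq> ?H"
  proof -
    have "cl m = cl \<zero>\<^bsub>P\<^esub>" if "m \<in> U" for m
      using that U_ops(1) by (simp add: cl_eq_iff minus_zero_right)
    then show ?thesis using H x_closed U_ops(1) H_ops(2) by (auto simp: Q_simps(2))
  qed
  ultimately have "?H = carrier P" by (rule gen)
  then show "H = carrier Q" using H_ops(1) by (auto simp: Q_simps(1))
qed simp

lemma Q_torsion_free: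
  assumes "\<And>m. m \<in> carrier P \<Longrightarrow> [(p::nat)] \<cdot>\<^bsub>P\<^esub> m \<in> U \<Longrightarrow> m \<in> U"
  shows "torsion_free_wrt p Q"
  unfolding torsion_free_wrt_def
proof (intro ballI impI)
  interpret Q: module R Q by (rule Q_module)
  fix Y assume "Y \<in> carrier Q" and t: "[p] \<cdot>\<^bsub>Q\<^esub> Y = \<zero>\<^bsub>Q\<^esub>"
  then obtain m where m: "m \<in> carrier P" "Y = cl m" by (auto simp: Q_simps)
  have "[k] \<cdot>\<^bsub>Q\<^esub> cl m = cl ([k] \<cdot>\<^bsub>P\<^esub> m)" for k :: nat
    by (induct k) (use m in \<open>auto simp: Q_simps(2) Q_add Q.M.add.nat_pow_Suc M.add.nat_pow_Suc\<close>)
  then have "cl ([p] \<cdot>\<^bsub>P\<^esub> m) = cl \<zero>\<^bsub>P\<^esub>" using t m by (simp add: Q_simps(2))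
  then have "[p] \<cdot>\<^bsub>P\<^esub> m \<in> U" using m cl_eq_iff[of "[p] \<cdot>\<^bsub>P\<^esub> m" "\<zero>\<^bsub>P\<^esub>"] by (simp add: minus_zero_right)
  then have "m \<in> U" using assms m by blast
  then show "Y = \<zero>\<^bsub>Q\<^esub>" unfolding m(2) Q_simps(2) using m cl_eq_iff[of m "\<zero>\<^bsub>P\<^esub>"] by (simp add: minus_zero_right)
qed

text \<open>A projective module that is finitely generated has a dual basis for any given
  generators: with \<open>c i\<close> the coordinates of the image of the \<open>i\<close>-th unit
  vector under \<open>q\<close>, the value \<open>g j m\<close> is the sum over \<open>i\<close> of
  the products of \<open>s (cl m) i\<close> and \<open>c i j\<close>. The functionals factor through
  the quotient and so vanish on \<open>U\<close>.\<close>

lemma functionals: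
  assumes "projective_module R Q"
  obtains g where "\<And>j m. j < n \<Longrightarrow> m \<in> carrier P \<Longrightarrow> g j m \<in> carrier R"
    "\<And>j m m'. j < n \<Longrightarrow> m \<in> carrier P \<Longrightarrow> m' \<in> carrier P \<Longrightarrow> g j (m \<oplus>\<^bsub>P\<^esub> m') = g j m \<oplus>\<^bsub>R\<^esub> g j m'"
    "\<And>j r m. j < n \<Longrightarrow> r \<in> carrier R \<Longrightarrow> m \<in> carrier P \<Longrightarrow> g j (r \<odot>\<^bsub>P\<^esub> m) = r \<otimes>\<^bsub>R\<^esub> g j m"
    "\<And>j m. j < n \<Longrightarrow> m \<in> U \<Longrightarrow> g j m = \<zero>\<^bsub>R\<^esub>"
    "\<And>m. m \<in> carrier P \<Longrightarrow> comb (\<lambda>j. g j m) \<ominus>\<^bsub>P\<^esub> m \<in> U"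
proof -
  interpret Q: module R Q by (rule Q_module)
  obtain I :: "(nat \<Rightarrow> 'r) set set" and s q where s: "s \<in> linear_maps R Q (free_module R I)"
    and q: "q \<in> linear_maps R (free_module R I) Q" and qs: "\<And>Y. Y \<in> carrier Q \<Longrightarrow> q (s Y) = Y"
    using assms unfolding projective_module_def by (elim conjE exE) (rule that, auto)
  let ?F = "free_module R I"
  have F: "carrier ?F = {f \<in> I \<rightarrow>\<^sub>E carrier R. finite {i \<in> I. f i \<noteq> \<zero>\<^bsub>R\<^esub>}}"
    "f \<oplus>\<^bsub>?F\<^esub> g = (\<lambda>i\<in>I. f i \<oplus>\<^bsub>R\<^esub> g i)" "a \<odot>\<^bsub>?F\<^esub> f = (\<lambda>i\<in>I. a \<otimes>\<^bsub>R\<^esub> f i)" for f g a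
    by (auto simp: free_module_def)
  have q_closed: "f \<in> carrier ?F \<Longrightarrow> q f \<in> carrier Q"
    and q_add: "f \<in> carrier ?F \<Longrightarrow> f' \<in> carrier ?F \<Longrightarrow> q (f \<oplus>\<^bsub>?F\<^esub> f') = q f \<oplus>\<^bsub>Q\<^esub> q f'"
    and q_smult: "a \<in> carrier R \<Longrightarrow> f \<in> carrier ?F \<Longrightarrow> q (a \<odot>\<^bsub>?F\<^esub> f) = a \<odot>\<^bsub>Q\<^esub> q f" for f f' a
    using q by (auto simp: linear_maps_def)
  have s_closed: "Y \<in> carrier Q \<Longrightarrow> s Y \<in> carrier ?F"
    and s_add: "Y \<in> carrier Q \<Longrightarrow> Y' \<in> carrier Q \<Longrightarrow> s (Y \<oplus>\<^bsub>Q\<^esub> Y') = s Y \<oplus>\<^bsub>?F\<^esub> s Y'"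
    and s_smult: "a \<in> carrier R \<Longrightarrow> Y \<in> carrier Q \<Longrightarrow> s (a \<odot>\<^bsub>Q\<^esub> Y) = a \<odot>\<^bsub>?F\<^esub> s Y" for Y Y' a
    using s by (auto simp: linear_maps_def)
  define e where "e i = (\<lambda>j\<in>I. if j = i then \<one>\<^bsub>R\<^esub> else \<zero>\<^bsub>R\<^esub>)" for i
  have eF: "e i \<in> carrier ?F" for i
  proof -
    have "{j \<in> I. e i j \<noteq> \<zero>\<^bsub>R\<^esub>} \<subseteq> {i}" by (auto simp: e_def split: if_splits)
    then have "finite {j \<in> I. e i j \<noteq> \<zero>\<^bsub>R\<^esub>}" by (rule finite_subset) simp
    moreover have "e i \<in> I \<rightarrow>\<^sub>E carrier R" unfolding e_def by auto
    ultimately show ?thesis unfolding F(1) by simp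
  qed
  have "\<exists>c. c \<in> tuples \<and> q (e i) = cl (comb c)" for i
  proof -
    obtain m where m: "m \<in> carrier P" "q (e i) = cl m" using q_closed[OF eF] unfolding Q_simps by blast
    show ?thesis unfolding m(2) using cl_comb_ex[OF m(1)] by blast
  qed
  then obtain c where c: "\<And>i. c i \<in> tuples" "\<And>i. q (e i) = cl (comb (c i))" by metis
  have cR: "j < n \<Longrightarrow> c i j \<in> carrier R" for i j using c(1)[of i] by auto
  have combc: "comb (c i) \<in> carrier P" for i by (rule comb_tuple_closed[OF c(1)])
  \<comment> \<open>\<open>q\<close> is determined by the unit vectors, every element of the free
    module being a finite combination of them.\<close>
  have q_sum: "(\<lambda>j\<in>I. if j \<in> T then f j else \<zero>\<^bsub>R\<^esub>) \<in> carrier ?F \<and>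
      q (\<lambda>j\<in>I. if j \<in> T then f j else \<zero>\<^bsub>R\<^esub>) = cl (\<Oplus>\<^bsub>P\<^esub>i\<in>T. f i \<odot>\<^bsub>P\<^esub> comb (c i))"
    if "finite T" "T \<subseteq> I" "\<And>i. i \<in> T \<Longrightarrow> f i \<in> carrier R" for T f
    using that
  proof (induct T rule: finite_induct)
    case empty
    \<comment> \<open>The value of \<open>q\<close> at zero comes from homogeneity, by scaling an
      arbitrary \<open>e i\<close> with 0.\<close>
    have "\<zero>\<^bsub>R\<^esub> \<odot>\<^bsub>?F\<^esub> e i = (\<lambda>j\<in>I. \<zero>\<^bsub>R\<^esub>)" for i
      unfolding F(3) by (rule restrict_ext) (simp add: e_def)
    then have "q (\<lambda>j\<in>I. \<zero>\<^bsub>R\<^esub>) = \<zero>\<^bsub>R\<^esub> \<odot>\<^bsub>Q\<^esub> q (e undefined)"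
      using q_smult[OF R.zero_closed eF] by metis
    then have "q (\<lambda>j\<in>I. \<zero>\<^bsub>R\<^esub>) = cl \<zero>\<^bsub>P\<^esub>" unfolding c(2) using combc by (simp add: Q_smult)
    moreover have "(\<lambda>j\<in>I. \<zero>\<^bsub>R\<^esub>) \<in> carrier ?F" unfolding F(1) by auto
    ultimately show ?case by (simp only: empty_iff if_False M.finsum_empty)
  next
    case (insert t T)
    let ?r = "\<lambda>j\<in>I. if j \<in> T then f j else \<zero>\<^bsub>R\<^esub>"
    have T: "T \<subseteq> I" "\<And>i. i \<in> T \<Longrightarrow> f i \<in> carrier R" using insert.prems by auto
    note IH = conjunct1[OF insert.hyps(3)[OF T]] conjunct2[OF insert.hyps(3)[OF T]]
    have ft: "f t \<in> carrier R" "t \<in> I" using insert.prems by auto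
    have feF: "f t \<odot>\<^bsub>?F\<^esub> e t \<in> carrier ?F"
    proof -
      have "{j \<in> I. (f t \<odot>\<^bsub>?F\<^esub> e t) j \<noteq> \<zero>\<^bsub>R\<^esub>} \<subseteq> {t}" using ft by (auto simp: e_def F(3) split: if_splits)
      then have "finite {j \<in> I. (f t \<odot>\<^bsub>?F\<^esub> e t) j \<noteq> \<zero>\<^bsub>R\<^esub>}" by (rule finite_subset) simp
      moreover have "f t \<odot>\<^bsub>?F\<^esub> e t \<in> I \<rightarrow>\<^sub>E carrier R" unfolding e_def F(3) using ft by auto
      ultimately show ?thesis unfolding F(1) by simp
    qed
    have dec: "(\<lambda>j\<in>I. if j \<in> insert t T then f j else \<zero>\<^bsub>R\<^esub>) = f t \<odot>\<^bsub>?F\<^esub> e t \<oplus>\<^bsub>?F\<^esub> ?r"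
      unfolding F(2,3) by (rule restrict_ext) (use insert.hyps(2) ft T in \<open>auto simp: e_def\<close>)
    have carr: "(\<lambda>j\<in>I. if j \<in> insert t T then f j else \<zero>\<^bsub>R\<^esub>) \<in> carrier ?F"
    proof -
      let ?w = "\<lambda>j\<in>I. if j \<in> insert t T then f j else \<zero>\<^bsub>R\<^esub>"
      have "{j \<in> I. ?w j \<noteq> \<zero>\<^bsub>R\<^esub>} \<subseteq> insert t T" by auto
      then have "finite {j \<in> I. ?w j \<noteq> \<zero>\<^bsub>R\<^esub>}" by (rule finite_subset) (use insert.hyps(1) in simp)
      moreover have "?w \<in> I \<rightarrow>\<^sub>E carrier R" using insert.prems by auto
      ultimately show ?thesis unfolding F(1) by simp
    qed
    have sc: "(\<Oplus>\<^bsub>P\<^esub>i\<in>T. f i \<odot>\<^bsub>P\<^esub> comb (c i)) \<in> carrier P"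
      using T combc by (auto intro!: M.finsum_closed)
    have "q (f t \<odot>\<^bsub>?F\<^esub> e t \<oplus>\<^bsub>?F\<^esub> ?r) = q (f t \<odot>\<^bsub>?F\<^esub> e t) \<oplus>\<^bsub>Q\<^esub> q ?r"
      by (rule q_add[OF feF IH(1)])
    also have "\<dots> = (f t \<odot>\<^bsub>Q\<^esub> cl (comb (c t))) \<oplus>\<^bsub>Q\<^esub> cl (\<Oplus>\<^bsub>P\<^esub>i\<in>T. f i \<odot>\<^bsub>P\<^esub> comb (c i))"
      by (simp only: q_smult[OF ft(1) eF] c(2) IH(2))
    also have "\<dots> = cl (f t \<odot>\<^bsub>P\<^esub> comb (c t) \<oplus>\<^bsub>P\<^esub> (\<Oplus>\<^bsub>P\<^esub>i\<in>T. f i \<odot>\<^bsub>P\<^esub> comb (c i)))"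
      using ft combc sc by (simp add: Q_smult Q_add)
    finally have qs': "q (f t \<odot>\<^bsub>?F\<^esub> e t \<oplus>\<^bsub>?F\<^esub> ?r)
        = cl (f t \<odot>\<^bsub>P\<^esub> comb (c t) \<oplus>\<^bsub>P\<^esub> (\<Oplus>\<^bsub>P\<^esub>i\<in>T. f i \<odot>\<^bsub>P\<^esub> comb (c i)))" .
    have sum: "f t \<odot>\<^bsub>P\<^esub> comb (c t) \<oplus>\<^bsub>P\<^esub> (\<Oplus>\<^bsub>P\<^esub>i\<in>T. f i \<odot>\<^bsub>P\<^esub> comb (c i)) = (\<Oplus>\<^bsub>P\<^esub>i\<in>insert t T. f i \<odot>\<^bsub>P\<^esub> comb (c i))"
      by (rule M.finsum_insert[symmetric]) (use insert.hyps(1,2) T ft combc in auto)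
    show ?case using carr qs' unfolding sum dec by (rule conjI)
  qed
  define supp where "supp m = {i \<in> I. s (cl m) i \<noteq> \<zero>\<^bsub>R\<^esub>}" for m
  define g where "g j m = (\<Oplus>\<^bsub>R\<^esub>i\<in>supp m. s (cl m) i \<otimes>\<^bsub>R\<^esub> c i j)" for j m
  have clQ: "m \<in> carrier P \<Longrightarrow> cl m \<in> carrier Q" for m by (simp add: Q_simps)
  have sF: "s (cl m) \<in> I \<rightarrow>\<^sub>E carrier R" "finite (supp m)" if "m \<in> carrier P" for m
    using s_closed[OF clQ[OF that]] unfolding F(1) supp_def by auto
  have sR: "i \<in> I \<Longrightarrow> m \<in> carrier P \<Longrightarrow> s (cl m) i \<in> carrier R" for i m using sF(1)[of m] by auto
  have suppI: "supp m \<subseteq> I" for m by (auto simp: supp_def)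
  have g_closed: "g j m \<in> carrier R" if "j < n" "m \<in> carrier P" for j m
    unfolding g_def using that sR cR suppI[of m] by (auto intro!: R.finsum_closed)
  \<comment> \<open>The support varies with \<open>m\<close>, so sums are first extended to a common
    finite index set before they are compared.\<close>
  have g_superset: "g j m = (\<Oplus>\<^bsub>R\<^esub>i\<in>T. s (cl m) i \<otimes>\<^bsub>R\<^esub> c i j)"
    if "finite T" "supp m \<subseteq> T" "T \<subseteq> I" "j < n" "m \<in> carrier P" for j m T
    unfolding g_def
    by (rule R.add.finprod_mono_neutral_cong_left) (use that sR cR in \<open>auto simp: supp_def\<close>)
  have g_add: "g j (m \<oplus>\<^bsub>P\<^esub> m') = g j m \<oplus>\<^bsub>R\<^esub> g j m'" if "j < n" "m \<in> carrier P" "m' \<in> carrier P" for j m m'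
  proof -
    let ?T = "supp m \<union> supp m' \<union> supp (m \<oplus>\<^bsub>P\<^esub> m')"
    have T: "finite ?T" "?T \<subseteq> I" using sF(2) that suppI by auto
    have sm: "s (cl (m \<oplus>\<^bsub>P\<^esub> m')) i = s (cl m) i \<oplus>\<^bsub>R\<^esub> s (cl m') i" if "i \<in> I" for i
      using s_add[OF clQ clQ, of m m'] \<open>m \<in> carrier P\<close> \<open>m' \<in> carrier P\<close> that by (simp add: Q_add F(2))
    have k: "s (cl m) i \<in> carrier R" "s (cl m') i \<in> carrier R" "c i j \<in> carrier R" "i \<in> I" if "i \<in> ?T" for i
      using subsetD[OF T(2) that] sR cR \<open>j < n\<close> \<open>m \<in> carrier P\<close> \<open>m' \<in> carrier P\<close> by auto
    have "g j (m \<oplus>\<^bsub>P\<^esub> m') = (\<Oplus>\<^bsub>R\<^esub>i\<in>?T. s (cl (m \<oplus>\<^bsub>P\<^esub> m')) i \<otimes>\<^bsub>R\<^esub> c i j)"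
      by (rule g_superset) (use T that in auto)
    also have "\<dots> = (\<Oplus>\<^bsub>R\<^esub>i\<in>?T. s (cl m) i \<otimes>\<^bsub>R\<^esub> c i j \<oplus>\<^bsub>R\<^esub> s (cl m') i \<otimes>\<^bsub>R\<^esub> c i j)"
    proof (rule R.finsum_cong'[OF refl])
      show "s (cl (m \<oplus>\<^bsub>P\<^esub> m')) i \<otimes>\<^bsub>R\<^esub> c i j = s (cl m) i \<otimes>\<^bsub>R\<^esub> c i j \<oplus>\<^bsub>R\<^esub> s (cl m') i \<otimes>\<^bsub>R\<^esub> c i j"
        if "i \<in> ?T" for i
        unfolding sm[OF k(4)[OF that]] by (rule R.l_distr[OF k(1-3)[OF that]])
    qed (use k in blast)
    also have "\<dots> = (\<Oplus>\<^bsub>R\<^esub>i\<in>?T. s (cl m) i \<otimes>\<^bsub>R\<^esub> c i j) \<oplus>\<^bsub>R\<^esub> (\<Oplus>\<^bsub>R\<^esub>i\<in>?T. s (cl m') i \<otimes>\<^bsub>R\<^esub> c i j)"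
      by (rule R.finsum_addf) (use k in blast)+
    also have "(\<Oplus>\<^bsub>R\<^esub>i\<in>?T. s (cl m) i \<otimes>\<^bsub>R\<^esub> c i j) = g j m"
      by (rule g_superset[symmetric]) (use T that in auto)
    also have "(\<Oplus>\<^bsub>R\<^esub>i\<in>?T. s (cl m') i \<otimes>\<^bsub>R\<^esub> c i j) = g j m'"
      by (rule g_superset[symmetric]) (use T that in auto)
    finally show ?thesis .
  qed
  have g_smult: "g j (r \<odot>\<^bsub>P\<^esub> m) = r \<otimes>\<^bsub>R\<^esub> g j m" if "j < n" "m \<in> carrier P" "r \<in> carrier R" for j m r
  proof -
    let ?T = "supp m \<union> supp (r \<odot>\<^bsub>P\<^esub> m)"
    have T: "finite ?T" "?T \<subseteq> I" using sF(2) that suppI by auto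
    have sm: "s (cl (r \<odot>\<^bsub>P\<^esub> m)) i = r \<otimes>\<^bsub>R\<^esub> s (cl m) i" if "i \<in> I" for i
      using s_smult[OF \<open>r \<in> carrier R\<close> clQ, of m] \<open>m \<in> carrier P\<close> \<open>r \<in> carrier R\<close> that by (simp add: Q_smult F(3))
    have k: "s (cl m) i \<in> carrier R" "c i j \<in> carrier R" "i \<in> I" if "i \<in> ?T" for i
      using subsetD[OF T(2) that] sR cR \<open>j < n\<close> \<open>m \<in> carrier P\<close> by auto
    have "g j (r \<odot>\<^bsub>P\<^esub> m) = (\<Oplus>\<^bsub>R\<^esub>i\<in>?T. s (cl (r \<odot>\<^bsub>P\<^esub> m)) i \<otimes>\<^bsub>R\<^esub> c i j)"
      by (rule g_superset) (use T that in auto)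
    also have "\<dots> = (\<Oplus>\<^bsub>R\<^esub>i\<in>?T. r \<otimes>\<^bsub>R\<^esub> (s (cl m) i \<otimes>\<^bsub>R\<^esub> c i j))"
    proof (rule R.finsum_cong'[OF refl])
      show "s (cl (r \<odot>\<^bsub>P\<^esub> m)) i \<otimes>\<^bsub>R\<^esub> c i j = r \<otimes>\<^bsub>R\<^esub> (s (cl m) i \<otimes>\<^bsub>R\<^esub> c i j)" if "i \<in> ?T" for i
        unfolding sm[OF k(3)[OF that]] by (rule R.m_assoc[OF \<open>r \<in> carrier R\<close> k(1,2)[OF that]])
    qed (use k \<open>r \<in> carrier R\<close> in blast)
    also have "\<dots> = r \<otimes>\<^bsub>R\<^esub> (\<Oplus>\<^bsub>R\<^esub>i\<in>?T. s (cl m) i \<otimes>\<^bsub>R\<^esub> c i j)"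
      by (rule R.finsum_rdistr[OF T(1) \<open>r \<in> carrier R\<close>, symmetric]) (use k in blast)
    also have "(\<Oplus>\<^bsub>R\<^esub>i\<in>?T. s (cl m) i \<otimes>\<^bsub>R\<^esub> c i j) = g j m"
      by (rule g_superset[symmetric]) (use T that in auto)
    finally show ?thesis .
  qed
  have g_U: "g j m = \<zero>\<^bsub>R\<^esub>" if "j < n" "m \<in> U" for j m
  proof -
    have mc: "m \<in> carrier P" using that(2) U_ops(1) by blast
    have "cl m = cl \<zero>\<^bsub>P\<^esub>" using mc that(2) by (simp add: cl_eq_iff minus_zero_right)
    then have "g j m = g j \<zero>\<^bsub>P\<^esub>" by (simp add: g_def supp_def)
    also have "\<dots> = g j (\<zero>\<^bsub>R\<^esub> \<odot>\<^bsub>P\<^esub> \<zero>\<^bsub>P\<^esub>)" by simp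
    also have "\<dots> = \<zero>\<^bsub>R\<^esub>" using that g_closed by (subst g_smult) auto
    finally show ?thesis .
  qed
  have comb_sum: "comb (\<lambda>j. \<Oplus>\<^bsub>R\<^esub>i\<in>T. f i \<otimes>\<^bsub>R\<^esub> c i j) = (\<Oplus>\<^bsub>P\<^esub>i\<in>T. f i \<odot>\<^bsub>P\<^esub> comb (c i))"
    if "finite T" "\<And>i. i \<in> T \<Longrightarrow> f i \<in> carrier R" for T f
    using that
  proof (induct T rule: finite_induct)
    case empty
    then show ?case by (simp add: comb_zero)
  next
    case (insert t T)
    have fR: "f t \<in> carrier R" "\<And>i. i \<in> T \<Longrightarrow> f i \<in> carrier R" using insert by auto
    have sc: "j < n \<Longrightarrow> (\<Oplus>\<^bsub>R\<^esub>i\<in>T. f i \<otimes>\<^bsub>R\<^esub> c i j) \<in> carrier R" for j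
      using fR cR by (auto intro!: R.finsum_closed)
    have "comb (\<lambda>j. \<Oplus>\<^bsub>R\<^esub>i\<in>insert t T. f i \<otimes>\<^bsub>R\<^esub> c i j) = comb (\<lambda>j. f t \<otimes>\<^bsub>R\<^esub> c t j \<oplus>\<^bsub>R\<^esub> (\<Oplus>\<^bsub>R\<^esub>i\<in>T. f i \<otimes>\<^bsub>R\<^esub> c i j))"
      by (rule comb_cong, rule R.finsum_insert) (use insert.hyps fR cR sc in auto)
    also have "\<dots> = comb (\<lambda>j. f t \<otimes>\<^bsub>R\<^esub> c t j) \<oplus>\<^bsub>P\<^esub> comb (\<lambda>j. \<Oplus>\<^bsub>R\<^esub>i\<in>T. f i \<otimes>\<^bsub>R\<^esub> c i j)"
      by (rule comb_add) (use fR cR sc in auto)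
    also have "\<dots> = f t \<odot>\<^bsub>P\<^esub> comb (c t) \<oplus>\<^bsub>P\<^esub> (\<Oplus>\<^bsub>P\<^esub>i\<in>T. f i \<odot>\<^bsub>P\<^esub> comb (c i))"
      using insert.hyps(3)[OF fR(2)] fR cR by (simp add: comb_smult)
    also have "\<dots> = (\<Oplus>\<^bsub>P\<^esub>i\<in>insert t T. f i \<odot>\<^bsub>P\<^esub> comb (c i))"
      by (rule M.finsum_insert[symmetric]) (use insert.hyps fR combc in auto)
    finally show ?case .
  qed
  have g_comb: "comb (\<lambda>j. g j m) \<ominus>\<^bsub>P\<^esub> m \<in> U" if m: "m \<in> carrier P" for m
  proof -
    have sR': "i \<in> supp m \<Longrightarrow> s (cl m) i \<in> carrier R" for i using sR[OF _ m] suppI by blast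
    have "s (cl m) = (\<lambda>j\<in>I. if j \<in> supp m then s (cl m) j else \<zero>\<^bsub>R\<^esub>)"
      using sF(1)[OF m] by (intro ext) (auto simp: supp_def PiE_def extensional_def)
    then have "q (s (cl m)) = q (\<lambda>j\<in>I. if j \<in> supp m then s (cl m) j else \<zero>\<^bsub>R\<^esub>)" by (rule arg_cong)
    also have "\<dots> = cl (\<Oplus>\<^bsub>P\<^esub>i\<in>supp m. s (cl m) i \<odot>\<^bsub>P\<^esub> comb (c i))"
      by (rule conjunct2[OF q_sum[OF sF(2)[OF m] suppI sR']])
    finally have "cl m = cl (\<Oplus>\<^bsub>P\<^esub>i\<in>supp m. s (cl m) i \<odot>\<^bsub>P\<^esub> comb (c i))"
      unfolding qs[OF clQ[OF m]] .
    also have "(\<Oplus>\<^bsub>P\<^esub>i\<in>supp m. s (cl m) i \<odot>\<^bsub>P\<^esub> comb (c i)) = comb (\<lambda>j. g j m)"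
      unfolding g_def by (rule comb_sum[OF sF(2)[OF m] sR', symmetric])
    finally have "cl (comb (\<lambda>j. g j m)) = cl m" by simp
    moreover have "comb (\<lambda>j. g j m) \<in> carrier P" by (rule comb_closed) (rule g_closed[OF _ m])
    ultimately show ?thesis using cl_eq_iff[OF _ m] by simp
  qed
  show thesis by (rule that[OF g_closed g_add g_smult g_U g_comb])
qed

end

text \<open>The numbering of the generators is undone here, so that the functionals are indexed by
  the elements of \<open>T\<close> themselves.\<close>

theorem residual_dual_basis:
  fixes R :: "('r, 'x) ring_scheme" and P :: "('r, 'm) module"
  assumes HR: "\<And>N :: ('r, (nat \<Rightarrow> 'r) set) module.
       module R N \<Longrightarrow> finitely_generated R N \<Longrightarrow> torsion_free_wrt p N \<Longrightarrow> projective_module R N"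
    and P: "module R P" and U: "submodule U R P"
    and T: "finite T" "T \<subseteq> carrier P"
    and gen: "\<And>H. submodule H R P \<Longrightarrow> T \<union> U \<subseteq> H \<Longrightarrow> H = carrier P"
    and tf: "\<And>m. m \<in> carrier P \<Longrightarrow> [p] \<cdot>\<^bsub>P\<^esub> m \<in> U \<Longrightarrow> m \<in> U"
  obtains g where "\<And>t m. t \<in> T \<Longrightarrow> m \<in> carrier P \<Longrightarrow> g t m \<in> carrier R"
    "\<And>t m m'. t \<in> T \<Longrightarrow> m \<in> carrier P \<Longrightarrow> m' \<in> carrier P \<Longrightarrow> g t (m \<oplus>\<^bsub>P\<^esub> m') = g t m \<oplus>\<^bsub>R\<^esub> g t m'"
    "\<And>t r m. t \<in> T \<Longrightarrow> r \<in> carrier R \<Longrightarrow> m \<in> carrier P \<Longrightarrow> g t (r \<odot>\<^bsub>P\<^esub> m) = r \<otimes>\<^bsub>R\<^esub> g t m"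
    "\<And>t m. t \<in> T \<Longrightarrow> m \<in> U \<Longrightarrow> g t m = \<zero>\<^bsub>R\<^esub>"
    "\<And>m. m \<in> carrier P \<Longrightarrow> (\<Oplus>\<^bsub>P\<^esub>t\<in>T. g t m \<odot>\<^bsub>P\<^esub> t) \<ominus>\<^bsub>P\<^esub> m \<in> U"
proof -
  interpret P: module R P by fact
  obtain x where x: "bij_betw x {0..<card T} T" using ex_bij_betw_nat_finite[OF T(1)] by blast
  let ?n = "card T"
  have im: "x ` {..<?n} = T" and inj: "inj_on x {..<?n}"
    using x by (auto simp: bij_betw_def atLeast0LessThan)
  have xT: "i < ?n \<Longrightarrow> x i \<in> T" for i using im by blast
  interpret residual_setup R P U ?n x
  proof (intro residual_setup.intro residual_setup_axioms.intro P U)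
    show "x i \<in> carrier P" if "i < ?n" for i using xT[OF that] T(2) by blast
    show "H = carrier P" if "submodule H R P" "x ` {..<?n} \<union> U \<subseteq> H" for H
      using gen[OF that(1)] that(2) unfolding im by blast
  qed
  have proj: "projective_module R Q"
  proof (rule HR[OF Q_module Q_finitely_generated Q_torsion_free])
    show "m \<in> U" if "m \<in> carrier P" "[p] \<cdot>\<^bsub>P\<^esub> m \<in> U" for m by (rule tf[OF that])
  qed
  obtain g where g: "\<And>j m. j < ?n \<Longrightarrow> m \<in> carrier P \<Longrightarrow> g j m \<in> carrier R"
    "\<And>j m m'. j < ?n \<Longrightarrow> m \<in> carrier P \<Longrightarrow> m' \<in> carrier P \<Longrightarrow> g j (m \<oplus>\<^bsub>P\<^esub> m') = g j m \<oplus>\<^bsub>R\<^esub> g j m'"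
    "\<And>j r m. j < ?n \<Longrightarrow> r \<in> carrier R \<Longrightarrow> m \<in> carrier P \<Longrightarrow> g j (r \<odot>\<^bsub>P\<^esub> m) = r \<otimes>\<^bsub>R\<^esub> g j m"
    "\<And>j m. j < ?n \<Longrightarrow> m \<in> U \<Longrightarrow> g j m = \<zero>\<^bsub>R\<^esub>"
    "\<And>m. m \<in> carrier P \<Longrightarrow> comb (\<lambda>j. g j m) \<ominus>\<^bsub>P\<^esub> m \<in> U"
    by (rule functionals[OF proj]) (rule that, assumption+)
  define y where "y t = inv_into {..<?n} x t" for t
  have y: "t \<in> T \<Longrightarrow> y t < ?n" "i < ?n \<Longrightarrow> y (x i) = i" for t i
    unfolding y_def using inv_into_into[of t x "{..<?n}"] im inj by (auto simp: inv_into_f_f)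
  have sum: "(\<Oplus>\<^bsub>P\<^esub>t\<in>T. g (y t) m \<odot>\<^bsub>P\<^esub> t) = comb (\<lambda>j. g j m)" if m: "m \<in> carrier P" for m
  proof -
    have "(\<Oplus>\<^bsub>P\<^esub>t\<in>x ` {..<?n}. g (y t) m \<odot>\<^bsub>P\<^esub> t) = (\<Oplus>\<^bsub>P\<^esub>j\<in>{..<?n}. g (y (x j)) m \<odot>\<^bsub>P\<^esub> x j)"
      by (rule P.finsum_reindex) (use inj y g(1) m x_closed in auto)
    also have "\<dots> = comb (\<lambda>j. g j m)"
      unfolding comb_def by (rule P.finsum_cong') (use y g(1) m x_closed in auto)
    finally show ?thesis unfolding im .
  qed
  show thesis by (rule that[of "\<lambda>t. g (y t)"]) (simp_all add: g y(1) sum)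
qed

section \<open>Kisin modules with coefficients\<close>

lemma with_smult_minus [simp]: "a_minus (with_smult M a) = a_minus M"
  by (intro ext) (simp add: a_minus_def)

lemma cring_with_smult:
  assumes "cring W"
  shows "cring (with_smult W a)"
proof -
  interpret W: cring W by fact
  show ?thesis
  proof (rule cringI)
    show "abelian_group (with_smult W a)" by (rule abelian_group_with_smult[OF W.abelian_group_axioms])
    show "Group.comm_monoid (with_smult W a)" by (rule Group.comm_monoidI) (auto simp: W.m_ac)
  qed (auto simp: W.l_distr)
qed

lemma (in abelian_monoid) finsum_swap:
  assumes "finite I" "finite J" "\<And>i j. i \<in> I \<Longrightarrow> j \<in> J \<Longrightarrow> f i j \<in> carrier G"
  shows "(\<Oplus>i\<in>I. \<Oplus>j\<in>J. f i j) = (\<Oplus>j\<in>J. \<Oplus>i\<in>I. f i j)"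
  using assms(1,3)
proof (induct I rule: finite_induct)
  case empty
  then show ?case by simp
next
  case (insert i I)
  have c: "j \<in> J \<Longrightarrow> f i j \<in> carrier G" "j \<in> J \<Longrightarrow> (\<Oplus>i\<in>I. f i j) \<in> carrier G" for j
    using insert.prems by (auto intro!: finsum_closed)
  have "(\<Oplus>i\<in>insert i I. \<Oplus>j\<in>J. f i j) = (\<Oplus>j\<in>J. f i j) \<oplus> (\<Oplus>i\<in>I. \<Oplus>j\<in>J. f i j)"
    by (rule finsum_insert) (use insert in \<open>auto intro!: finsum_closed\<close>)
  also have "(\<Oplus>i\<in>I. \<Oplus>j\<in>J. f i j) = (\<Oplus>j\<in>J. \<Oplus>i\<in>I. f i j)"
    by (rule insert.hyps(3)) (use insert.prems in auto)
  also have "(\<Oplus>j\<in>J. f i j) \<oplus> (\<Oplus>j\<in>J. \<Oplus>i\<in>I. f i j) = (\<Oplus>j\<in>J. f i j \<oplus> (\<Oplus>i\<in>I. f i j))"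
    by (rule finsum_addf[symmetric]) (use c in auto)
  also have "\<dots> = (\<Oplus>j\<in>J. \<Oplus>i\<in>insert i I. f i j)"
    by (rule finsum_cong') (use insert.hyps insert.prems c in \<open>auto intro!: finsum_insert[symmetric]\<close>)
  finally show ?case .
qed

context cring
begin

lemma powser_const_closed: "w \<in> carrier R \<Longrightarrow> powser_const R w \<in> carrier PS"
  by (rule powserI) (simp add: powser_const_def)

lemma powser_var_closed: "powser_var R \<in> carrier PS"
  by (rule powserI) (simp add: powser_var_def)

lemma powser_zero_mult: "f \<in> carrier PS \<Longrightarrow> ((\<lambda>_. \<zero>) \<otimes>\<^bsub>PS\<^esub> f) n = \<zero>"
  unfolding powser_ring_simps(2) using powser_nth[of f] by simp

lemma powser_const_mult_nth:
  assumes w: "w \<in> carrier R" and f: "f \<in> carrier PS"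
  shows "(powser_const R w \<otimes>\<^bsub>PS\<^esub> f) n = w \<otimes> f n"
proof -
  note c = powser_const_closed[OF w]
  have "coeff_shift (powser_const R w) = (\<lambda>_. \<zero>)" by (auto simp: coeff_shift_def powser_const_def)
  then show ?thesis
    using w powser_nth[OF f]
    by (cases n; simp only: powser_mult_0[OF c f] powser_mult_Suc[OF c f] powser_zero_mult[OF f]; simp add: powser_const_def)
qed

lemma powser_var_mult_nth:
  assumes f: "f \<in> carrier PS"
  shows "(powser_var R \<otimes>\<^bsub>PS\<^esub> f) 0 = \<zero>" "(powser_var R \<otimes>\<^bsub>PS\<^esub> f) (Suc n) = f n"
proof -
  note c = powser_var_closed
  have "coeff_shift (powser_var R) = \<one>\<^bsub>PS\<^esub>" by (auto simp: coeff_shift_def powser_var_def powser_ring_simps)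
  then show "(powser_var R \<otimes>\<^bsub>PS\<^esub> f) 0 = \<zero>" "(powser_var R \<otimes>\<^bsub>PS\<^esub> f) (Suc n) = f n"
    using powser_nth[OF f]
    by (simp_all only: powser_mult_0[OF c f] powser_mult_Suc[OF c f] powser_one_mult[OF f]) (simp_all add: powser_var_def)
qed

lemma powser_const_add: "powser_const R (a \<oplus> b) = powser_const R a \<oplus>\<^bsub>PS\<^esub> powser_const R b"
  if "a \<in> carrier R" "b \<in> carrier R"
  using that by (auto simp: powser_const_def powser_ring_simps(5))

lemma powser_const_mult':
  assumes "a \<in> carrier R" "b \<in> carrier R"
  shows "powser_const R (a \<otimes> b) = powser_const R a \<otimes>\<^bsub>PS\<^esub> powser_const R b"
  by (rule ext, simp only: powser_const_mult_nth[OF assms(1) powser_const_closed[OF assms(2)]])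
    (use assms in \<open>simp add: powser_const_def\<close>)

lemma powser_const_one: "powser_const R \<one> = \<one>\<^bsub>PS\<^esub>"
  by (auto simp: powser_const_def powser_ring_simps)

lemma powser_const_zero: "powser_const R \<zero> = \<zero>\<^bsub>PS\<^esub>"
  by (auto simp: powser_const_def powser_ring_simps)

end

section \<open>The commuting actions of the coefficients and of Witt vectors\<close>

locale kisin_action = finite_witt p k for p and k :: "('a, 'x) ring_scheme" +
  fixes R :: "(nat \<Rightarrow> int, 'r) module" and M :: "(nat \<Rightarrow> nat \<Rightarrow> 'a, 'm) module" and act :: "'r \<Rightarrow> 'm \<Rightarrow> 'm"
  assumes R_algebra: "algebra (padic_ints p) R"
    and M_module: "module (powser_ring (witt_ring p k)) M"
    and M_free: "finite_free (powser_ring (witt_ring p k)) M"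
    and act_module: "module R (with_smult M act)"
    and act_S: "r \<in> carrier R \<Longrightarrow> s \<in> carrier (powser_ring (witt_ring p k)) \<Longrightarrow> m \<in> carrier M \<Longrightarrow>
      act r (s \<odot>\<^bsub>M\<^esub> m) = s \<odot>\<^bsub>M\<^esub> act r m"
    and act_Z: "z \<in> carrier (padic_ints p) \<Longrightarrow> r \<in> carrier R \<Longrightarrow> m \<in> carrier M \<Longrightarrow>
      act (z \<odot>\<^bsub>R\<^esub> r) m = powser_const (witt_ring p k) (padic_to_witt p k z) \<odot>\<^bsub>M\<^esub> act r m"
begin

abbreviation "S \<equiv> powser_ring W"
abbreviation "V \<equiv> powser_var W"
abbreviation "wm w m \<equiv> powser_const W w \<odot>\<^bsub>M\<^esub> m"
abbreviation "pw \<equiv> padic_to_witt p k"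
abbreviation "Z \<equiv> padic_ints p"
abbreviation "WA \<equiv> witt_algebra p k"
abbreviation "TW \<equiv> tensor_algebra Z R WA"
abbreviation "tact \<equiv> tensor_act p k M act"
abbreviation "u m \<equiv> V \<odot>\<^bsub>M\<^esub> m"

sublocale Mod: module S M by (rule M_module)
sublocale Act: module R "with_smult M act" by (rule act_module)
sublocale Alg: algebra Z R by (rule R_algebra)

lemma WA_simps:
  "carrier WA = carrier W" "ring.add WA = ring.add W" "\<zero>\<^bsub>WA\<^esub> = \<zero>\<^bsub>W\<^esub>" "monoid.mult WA = monoid.mult W"
  "\<one>\<^bsub>WA\<^esub> = \<one>\<^bsub>W\<^esub>" "z \<odot>\<^bsub>WA\<^esub> w = pw z \<otimes>\<^bsub>W\<^esub> w"
  by (simp_all add: witt_algebra_def)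

sublocale T: tensor_setup Z R WA
proof (intro tensor_setup.intro tensor_setup_axioms.intro)
  show "cring R" by (rule Alg.M_cring)
  show "cring WA" unfolding witt_algebra_def by (rule cring_with_smult[OF cring_W])
qed (auto simp: WA_simps padic_to_witt W.m_assoc Alg.smult_assoc2)

lemma V_closed: "V \<in> carrier S" by (rule W.powser_var_closed)

lemmas const_closed = W.powser_const_closed

lemma wm_closed: "w \<in> carrier W \<Longrightarrow> m \<in> carrier M \<Longrightarrow> wm w m \<in> carrier M"
  using const_closed by simp

lemma wm_add_left: "w \<in> carrier W \<Longrightarrow> v \<in> carrier W \<Longrightarrow> m \<in> carrier M \<Longrightarrow> wm (w \<oplus>\<^bsub>W\<^esub> v) m = wm w m \<oplus>\<^bsub>M\<^esub> wm v m"
  using const_closed by (simp add: W.powser_const_add Mod.smult_l_distr)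

lemma wm_add_right: "w \<in> carrier W \<Longrightarrow> m \<in> carrier M \<Longrightarrow> m' \<in> carrier M \<Longrightarrow> wm w (m \<oplus>\<^bsub>M\<^esub> m') = wm w m \<oplus>\<^bsub>M\<^esub> wm w m'"
  using const_closed by (simp add: Mod.smult_r_distr)

lemma wm_mult: "w \<in> carrier W \<Longrightarrow> v \<in> carrier W \<Longrightarrow> m \<in> carrier M \<Longrightarrow> wm (w \<otimes>\<^bsub>W\<^esub> v) m = wm w (wm v m)"
  using const_closed by (simp add: W.powser_const_mult' Mod.smult_assoc1)

lemma wm_comm: "w \<in> carrier W \<Longrightarrow> v \<in> carrier W \<Longrightarrow> m \<in> carrier M \<Longrightarrow> wm w (wm v m) = wm v (wm w m)"
  by (simp add: wm_mult[symmetric] W.m_comm)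

lemma wm_one: "m \<in> carrier M \<Longrightarrow> wm \<one>\<^bsub>W\<^esub> m = m"
  by (simp add: W.powser_const_one)

lemma wm_zero: "m \<in> carrier M \<Longrightarrow> wm \<zero>\<^bsub>W\<^esub> m = \<zero>\<^bsub>M\<^esub>"
  by (simp add: W.powser_const_zero)

lemma wm_zero_right: "w \<in> carrier W \<Longrightarrow> wm w \<zero>\<^bsub>M\<^esub> = \<zero>\<^bsub>M\<^esub>"
  by (simp add: const_closed)

lemma wm_minus: "w \<in> carrier W \<Longrightarrow> m \<in> carrier M \<Longrightarrow> m' \<in> carrier M \<Longrightarrow> wm w (m \<ominus>\<^bsub>M\<^esub> m') = wm w m \<ominus>\<^bsub>M\<^esub> wm w m'"
  using const_closed by (simp add: Mod.M.minus_eq Mod.smult_r_distr Mod.smult_r_minus)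

lemma act_closed: "r \<in> carrier R \<Longrightarrow> m \<in> carrier M \<Longrightarrow> act r m \<in> carrier M"
  using Act.smult_closed[of r m] by simp

lemma act_add_left: "r \<in> carrier R \<Longrightarrow> r' \<in> carrier R \<Longrightarrow> m \<in> carrier M \<Longrightarrow> act (r \<oplus>\<^bsub>R\<^esub> r') m = act r m \<oplus>\<^bsub>M\<^esub> act r' m"
  using Act.smult_l_distr[of r r' m] by simp

lemma act_add_right: "r \<in> carrier R \<Longrightarrow> m \<in> carrier M \<Longrightarrow> m' \<in> carrier M \<Longrightarrow> act r (m \<oplus>\<^bsub>M\<^esub> m') = act r m \<oplus>\<^bsub>M\<^esub> act r m'"
  using Act.smult_r_distr[of r m m'] by simp

lemma act_mult: "r \<in> carrier R \<Longrightarrow> r' \<in> carrier R \<Longrightarrow> m \<in> carrier M \<Longrightarrow> act (r \<otimes>\<^bsub>R\<^esub> r') m = act r (act r' m)"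
  using Act.smult_assoc1[of r r' m] by simp

lemma act_one: "m \<in> carrier M \<Longrightarrow> act \<one>\<^bsub>R\<^esub> m = m"
  using Act.smult_one[of m] by simp

lemma act_zero_right: "r \<in> carrier R \<Longrightarrow> act r \<zero>\<^bsub>M\<^esub> = \<zero>\<^bsub>M\<^esub>"
  using Act.smult_r_null[of r] by simp

lemma act_minus: "r \<in> carrier R \<Longrightarrow> m \<in> carrier M \<Longrightarrow> m' \<in> carrier M \<Longrightarrow> act r (m \<ominus>\<^bsub>M\<^esub> m') = act r m \<ominus>\<^bsub>M\<^esub> act r m'"
  using Act.smult_r_minus[of r m'] by (simp add: Mod.M.minus_eq act_add_right)

lemma act_wm: "r \<in> carrier R \<Longrightarrow> w \<in> carrier W \<Longrightarrow> m \<in> carrier M \<Longrightarrow> act r (wm w m) = wm w (act r m)"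
  by (rule act_S[OF _ const_closed])

lemma act_Z_one: "z \<in> carrier Z \<Longrightarrow> m \<in> carrier M \<Longrightarrow> act (z \<odot>\<^bsub>R\<^esub> \<one>\<^bsub>R\<^esub>) m = wm (pw z) m"
  using act_Z[of z "\<one>\<^bsub>R\<^esub>" m] by (simp add: act_one)

lemma u_closed: "m \<in> carrier M \<Longrightarrow> u m \<in> carrier M"
  using V_closed by simp

lemma u_add: "m \<in> carrier M \<Longrightarrow> m' \<in> carrier M \<Longrightarrow> u (m \<oplus>\<^bsub>M\<^esub> m') = u m \<oplus>\<^bsub>M\<^esub> u m'"
  using V_closed by (simp add: Mod.smult_r_distr)

lemma u_minus: "m \<in> carrier M \<Longrightarrow> m' \<in> carrier M \<Longrightarrow> u (m \<ominus>\<^bsub>M\<^esub> m') = u m \<ominus>\<^bsub>M\<^esub> u m'"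
  using V_closed by (simp add: Mod.M.minus_eq Mod.smult_r_distr Mod.smult_r_minus)

lemma u_zero: "u \<zero>\<^bsub>M\<^esub> = \<zero>\<^bsub>M\<^esub>"
  using V_closed by simp

lemma u_wm: "w \<in> carrier W \<Longrightarrow> m \<in> carrier M \<Longrightarrow> u (wm w m) = wm w (u m)"
  using V_closed const_closed by (simp add: Mod.smult_assoc1[symmetric] Mod.R.m_comm)

lemma u_act: "r \<in> carrier R \<Longrightarrow> m \<in> carrier M \<Longrightarrow> act r (u m) = u (act r m)"
  by (rule act_S[OF _ V_closed])

text \<open>The side conditions here and in the next four lemmas say that
  \<open>act r (wm w m)\<close> is additive in \<open>r\<close> and in \<open>w\<close> and
  balanced. Balancing is \<open>act_Z\<close>: a p-adic scalar in \<open>R\<close> acts as its image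
  in \<open>W\<close>.\<close>

lemma tact_closed: "t \<in> carrier TW \<Longrightarrow> m \<in> carrier M \<Longrightarrow> tact t m \<in> carrier M"
  unfolding tensor_act_def
  by (rule T.tensor_lift_closed[OF Mod.M.abelian_group_axioms])
    (simp_all add: WA_simps act_closed wm_closed act_add_left act_add_right wm_add_left wm_add_right act_Z wm_mult padic_to_witt act_wm wm_comm)

lemma tact_add_left: "s \<in> carrier TW \<Longrightarrow> t \<in> carrier TW \<Longrightarrow> m \<in> carrier M \<Longrightarrow> tact (s \<oplus>\<^bsub>TW\<^esub> t) m = tact s m \<oplus>\<^bsub>M\<^esub> tact t m"
  unfolding tensor_act_def
  by (rule T.tensor_lift_add[OF Mod.M.abelian_group_axioms])
    (simp_all add: WA_simps act_closed wm_closed act_add_left act_add_right wm_add_left wm_add_right act_Z wm_mult padic_to_witt act_wm wm_comm)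

lemma tact_minus_left: "s \<in> carrier TW \<Longrightarrow> t \<in> carrier TW \<Longrightarrow> m \<in> carrier M \<Longrightarrow> tact (s \<ominus>\<^bsub>TW\<^esub> t) m = tact s m \<ominus>\<^bsub>M\<^esub> tact t m"
  unfolding tensor_act_def
  by (rule T.tensor_lift_minus[OF Mod.M.abelian_group_axioms])
    (simp_all add: WA_simps act_closed wm_closed act_add_left act_add_right wm_add_left wm_add_right act_Z wm_mult padic_to_witt act_wm wm_comm)

lemma tact_zero: "m \<in> carrier M \<Longrightarrow> tact \<zero>\<^bsub>TW\<^esub> m = \<zero>\<^bsub>M\<^esub>"
  unfolding tensor_act_def
  by (rule T.tensor_lift_zero[OF Mod.M.abelian_group_axioms])
    (simp_all add: WA_simps act_closed wm_closed act_add_left act_add_right wm_add_left wm_add_right act_Z wm_mult padic_to_witt act_wm wm_comm)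

lemma tact_tns: "r \<in> carrier R \<Longrightarrow> w \<in> carrier W \<Longrightarrow> m \<in> carrier M \<Longrightarrow> tact (T.tns r w) m = act r (wm w m)"
  unfolding tensor_act_def
  by (rule T.tensor_lift_tns[OF Mod.M.abelian_group_axioms])
    (simp_all add: WA_simps act_closed wm_closed act_add_left act_add_right wm_add_left wm_add_right act_Z wm_mult padic_to_witt act_wm wm_comm)

lemma TW_minus_distr:
  assumes "x \<in> carrier TW" "y \<in> carrier TW" "z \<in> carrier TW"
  shows "x \<otimes>\<^bsub>TW\<^esub> (y \<ominus>\<^bsub>TW\<^esub> z) = x \<otimes>\<^bsub>TW\<^esub> y \<ominus>\<^bsub>TW\<^esub> x \<otimes>\<^bsub>TW\<^esub> z"
    "(y \<ominus>\<^bsub>TW\<^esub> z) \<otimes>\<^bsub>TW\<^esub> x = y \<otimes>\<^bsub>TW\<^esub> x \<ominus>\<^bsub>TW\<^esub> z \<otimes>\<^bsub>TW\<^esub> x"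
  using assms by (simp_all add: T.TA.minus_eq T.TA.r_distr T.TA.l_distr T.TA.r_minus T.TA.l_minus)

lemma W_tns_closed: "r \<in> carrier R \<Longrightarrow> w \<in> carrier W \<Longrightarrow> T.tns r w \<in> carrier TW"
  by (rule T.tns_closed) (simp_all add: WA_simps)

lemma tact_add_right: "t \<in> carrier TW \<Longrightarrow> m \<in> carrier M \<Longrightarrow> m' \<in> carrier M \<Longrightarrow> tact t (m \<oplus>\<^bsub>M\<^esub> m') = tact t m \<oplus>\<^bsub>M\<^esub> tact t m'"
proof (induct rule: T.TA_induct)
  case (of r w)
  then show ?case by (simp add: WA_simps tact_tns wm_add_right act_add_right wm_closed)
next
  case (diff s t)
  note c = tact_closed[OF diff(1)] tact_closed[OF diff(2)]
  show ?case using diff c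
    by (simp add: tact_minus_left Mod.M.minus_eq Mod.M.minus_add Mod.M.a_ac)
qed (simp add: tact_zero)

text \<open>By induction over both tensors the claim reduces to pure tensors, where it holds because
  the actions of \<open>R\<close> and of \<open>W\<close> commute.\<close>

lemma tact_mult: "s \<in> carrier TW \<Longrightarrow> t \<in> carrier TW \<Longrightarrow> m \<in> carrier M \<Longrightarrow> tact (s \<otimes>\<^bsub>TW\<^esub> t) m = tact s (tact t m)"
proof (induct rule: T.TA_induct)
  case zero
  then show ?case by (simp add: tact_zero tact_closed)
next
  case (of r w)
  then have rw: "r \<in> carrier R" "w \<in> carrier W" and m: "m \<in> carrier M" by (simp_all add: WA_simps)
  have *: "tact (T.tns r w \<otimes>\<^bsub>TW\<^esub> t) m = act r (wm w (tact t m))" using of(3)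
  proof (induct rule: T.TA_induct)
    case zero
    then show ?case using rw m by (simp add: W_tns_closed tact_zero wm_zero_right act_zero_right)
  next
    case (of r' w')
    then have rw': "r' \<in> carrier R" "w' \<in> carrier W" by (simp_all add: WA_simps)
    have "T.tns r w \<otimes>\<^bsub>TW\<^esub> T.tns r' w' = T.tns (r \<otimes>\<^bsub>R\<^esub> r') (w \<otimes>\<^bsub>W\<^esub> w')"
      using T.tns_mult[of r w r' w'] rw rw' by (simp add: WA_simps)
    then show ?case using rw rw' m by (simp add: tact_tns wm_mult act_mult wm_closed act_closed act_wm)
  next
    case (diff s t)
    then show ?case using rw m
      by (simp add: W_tns_closed TW_minus_distr tact_minus_left tact_closed wm_minus act_minus wm_closed)
  qed
  then show ?case using rw tact_closed[OF of(3) m] by (simp add: tact_tns)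
next
  case (diff s s')
  then show ?case by (simp add: TW_minus_distr tact_minus_left tact_closed)
qed

lemma tact_one: "m \<in> carrier M \<Longrightarrow> tact \<one>\<^bsub>TW\<^esub> m = m"
  unfolding T.tns_one WA_simps by (simp add: tact_tns wm_one act_one)

lemma tact_module: "module TW (with_smult M tact)"
  by (rule moduleI)
    (simp_all add: T.TA_cring abelian_group_with_smult Mod.M.abelian_group_axioms tact_closed tact_add_left
      tact_add_right tact_mult tact_one)

lemma u_tact: "t \<in> carrier TW \<Longrightarrow> m \<in> carrier M \<Longrightarrow> u (tact t m) = tact t (u m)"
proof (induct rule: T.TA_induct)
  case zero
  then show ?case by (simp add: tact_zero u_closed u_zero)
next
  case (of r w)
  then show ?case by (simp add: WA_simps tact_tns u_closed u_act[symmetric] wm_closed u_wm)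
next
  case (diff s t)
  then show ?case by (simp add: tact_minus_left u_minus tact_closed u_closed)
qed

section \<open>Coordinates in a basis and completeness\<close>

definition "basis = (SOME B. finite B \<and> B \<subseteq> carrier M \<and>
     (\<forall>x\<in>carrier M. \<exists>!c. c \<in> B \<rightarrow>\<^sub>E carrier S \<and> x = (\<Oplus>\<^bsub>M\<^esub>b\<in>B. c b \<odot>\<^bsub>M\<^esub> b)))"

lemma basis: "finite basis" "basis \<subseteq> carrier M"
    "x \<in> carrier M \<Longrightarrow> \<exists>!c. c \<in> basis \<rightarrow>\<^sub>E carrier S \<and> x = (\<Oplus>\<^bsub>M\<^esub>b\<in>basis. c b \<odot>\<^bsub>M\<^esub> b)"
  using someI_ex[OF M_free[unfolded finite_free_def]] unfolding basis_def[symmetric] by blast+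

definition lin :: "('m \<Rightarrow> nat \<Rightarrow> nat \<Rightarrow> 'a) \<Rightarrow> 'm" where
  "lin c = (\<Oplus>\<^bsub>M\<^esub>b\<in>basis. c b \<odot>\<^bsub>M\<^esub> b)"

definition coord :: "'m \<Rightarrow> 'm \<Rightarrow> nat \<Rightarrow> nat \<Rightarrow> 'a" where
  "coord m = (THE c. c \<in> basis \<rightarrow>\<^sub>E carrier S \<and> m = lin c)"

lemma basis_closed: "b \<in> basis \<Longrightarrow> b \<in> carrier M"
  using basis(2) by blast

lemma lin_closed: "(\<And>b. b \<in> basis \<Longrightarrow> c b \<in> carrier S) \<Longrightarrow> lin c \<in> carrier M"
  unfolding lin_def using basis_closed by (auto intro!: Mod.M.finsum_closed)

lemma lin_cong: "(\<And>b. b \<in> basis \<Longrightarrow> c b = d b) \<Longrightarrow> (\<And>b. b \<in> basis \<Longrightarrow> d b \<in> carrier S) \<Longrightarrow> lin c = lin d"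
  unfolding lin_def using basis_closed by (intro Mod.M.finsum_cong') auto

lemma coord:
  assumes "m \<in> carrier M"
  shows "coord m \<in> basis \<rightarrow>\<^sub>E carrier S" "lin (coord m) = m"
  using theI'[OF basis(3)[OF assms]] unfolding coord_def lin_def by auto

lemma coord_closed: "m \<in> carrier M \<Longrightarrow> b \<in> basis \<Longrightarrow> coord m b \<in> carrier S"
  using coord(1) by auto

lemma coord_lin:
  assumes "\<And>b. b \<in> basis \<Longrightarrow> c b \<in> carrier S" "b \<in> basis"
  shows "coord (lin c) b = c b"
proof -
  have l: "lin (restrict c basis) = lin c" by (rule lin_cong) (use assms in auto)
  have "coord (lin c) = restrict c basis"
    unfolding coord_def
  proof (rule the1_equality)
    show "\<exists>!d. d \<in> basis \<rightarrow>\<^sub>E carrier S \<and> lin c = lin d"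
      unfolding lin_def by (rule basis(3)[OF lin_closed[OF assms(1)], unfolded lin_def])
    have "restrict c basis \<in> basis \<rightarrow>\<^sub>E carrier S" using assms(1) by simp
    then show "restrict c basis \<in> basis \<rightarrow>\<^sub>E carrier S \<and> lin c = lin (restrict c basis)" using l by simp
  qed
  then show ?thesis using assms(2) by simp
qed

lemma lin_add:
  assumes "\<And>b. b \<in> basis \<Longrightarrow> c b \<in> carrier S" "\<And>b. b \<in> basis \<Longrightarrow> d b \<in> carrier S"
  shows "lin (\<lambda>b. c b \<oplus>\<^bsub>S\<^esub> d b) = lin c \<oplus>\<^bsub>M\<^esub> lin d"
proof -
  have "lin (\<lambda>b. c b \<oplus>\<^bsub>S\<^esub> d b) = (\<Oplus>\<^bsub>M\<^esub>b\<in>basis. c b \<odot>\<^bsub>M\<^esub> b \<oplus>\<^bsub>M\<^esub> d b \<odot>\<^bsub>M\<^esub> b)"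
    unfolding lin_def by (rule Mod.M.finsum_cong') (use assms basis_closed in \<open>auto simp: Mod.smult_l_distr\<close>)
  also have "\<dots> = lin c \<oplus>\<^bsub>M\<^esub> lin d"
    unfolding lin_def by (rule Mod.M.finsum_addf) (use assms basis_closed in auto)
  finally show ?thesis .
qed

lemma lin_smult:
  assumes "\<And>b. b \<in> basis \<Longrightarrow> c b \<in> carrier S" "s \<in> carrier S"
  shows "lin (\<lambda>b. s \<otimes>\<^bsub>S\<^esub> c b) = s \<odot>\<^bsub>M\<^esub> lin c"
proof -
  have "s \<odot>\<^bsub>M\<^esub> lin c = (\<Oplus>\<^bsub>M\<^esub>b\<in>basis. s \<odot>\<^bsub>M\<^esub> (c b \<odot>\<^bsub>M\<^esub> b))"
    unfolding lin_def by (rule Mod.finsum_smult_ldistr[OF basis(1)]) (use assms basis_closed in auto)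
  also have "\<dots> = lin (\<lambda>b. s \<otimes>\<^bsub>S\<^esub> c b)"
    unfolding lin_def by (rule Mod.M.finsum_cong') (use assms basis_closed in \<open>auto simp: Mod.smult_assoc1\<close>)
  finally show ?thesis by simp
qed

lemma coord_smult:
  assumes "m \<in> carrier M" "s \<in> carrier S" "b \<in> basis"
  shows "coord (s \<odot>\<^bsub>M\<^esub> m) b = s \<otimes>\<^bsub>S\<^esub> coord m b"
proof -
  have "s \<odot>\<^bsub>M\<^esub> m = lin (\<lambda>b. s \<otimes>\<^bsub>S\<^esub> coord m b)"
    using lin_smult[of "coord m" s] coord_closed coord(2) assms by simp
  moreover have "coord (lin (\<lambda>b. s \<otimes>\<^bsub>S\<^esub> coord m b)) b = s \<otimes>\<^bsub>S\<^esub> coord m b"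
    by (rule coord_lin[OF _ assms(3)]) (rule Mod.R.m_closed[OF assms(2) coord_closed[OF assms(1)]])
  ultimately show ?thesis by simp
qed

lemma coord_eqI:
  assumes "m \<in> carrier M" "m' \<in> carrier M" "\<And>b n. b \<in> basis \<Longrightarrow> coord m b n = coord m' b n"
  shows "m = m'"
proof -
  have "lin (coord m) = lin (coord m')"
  proof (rule lin_cong)
    fix b assume b: "b \<in> basis"
    show "coord m b = coord m' b" by (rule ext) (rule assms(3)[OF b])
    show "coord m' b \<in> carrier S" by (rule coord_closed[OF assms(2) b])
  qed
  then show ?thesis using coord(2) assms by simp
qed

text \<open>Multiplication by \<open>u\<close> shifts coordinates. Injectivity, separatedness and
  the description of the image of \<open>u\<close> are read off from this.\<close>

lemma coord_u:
  assumes "m \<in> carrier M" "b \<in> basis"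
  shows "coord (u m) b 0 = \<zero>\<^bsub>W\<^esub>" "coord (u m) b (Suc n) = coord m b n"
  unfolding coord_smult[OF assms(1) V_closed assms(2)]
  using W.powser_var_mult_nth[OF coord_closed[OF assms]] by auto

lemma u_inj:
  assumes m: "m \<in> carrier M" and m': "m' \<in> carrier M" and eq: "u m = u m'"
  shows "m = m'"
proof (rule coord_eqI[OF m m'])
  fix b n assume b: "b \<in> basis"
  show "coord m b n = coord m' b n"
    unfolding coord_u(2)[OF m b, symmetric] coord_u(2)[OF m' b, symmetric] eq ..
qed

lemma u_pow_closed: "m \<in> carrier M \<Longrightarrow> (u ^^ n) m \<in> carrier M"
  by (induct n) (auto intro: u_closed)

lemma coord_u_pow: "m \<in> carrier M \<Longrightarrow> b \<in> basis \<Longrightarrow> i < n \<Longrightarrow> coord ((u ^^ n) m) b i = \<zero>\<^bsub>W\<^esub>"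
proof (induct n arbitrary: i)
  case (Suc n)
  then show ?case using coord_u[OF u_pow_closed[OF Suc.prems(1)] Suc.prems(2)] by (cases i) auto
qed simp

lemma coord_zero: "b \<in> basis \<Longrightarrow> coord \<zero>\<^bsub>M\<^esub> b n = \<zero>\<^bsub>W\<^esub>"
proof -
  assume b: "b \<in> basis"
  have "coord (\<zero>\<^bsub>S\<^esub> \<odot>\<^bsub>M\<^esub> \<zero>\<^bsub>M\<^esub>) b = \<zero>\<^bsub>S\<^esub> \<otimes>\<^bsub>S\<^esub> coord \<zero>\<^bsub>M\<^esub> b" using b by (intro coord_smult) auto
  also have "\<dots> = \<zero>\<^bsub>S\<^esub>" using coord_closed[OF Mod.M.zero_closed b] by (rule Mod.R.l_null)
  finally have "coord \<zero>\<^bsub>M\<^esub> b = \<zero>\<^bsub>S\<^esub>" unfolding Mod.smult_l_null[OF Mod.M.zero_closed] .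
  then show ?thesis unfolding powser_ring_simps(4) by (rule fun_cong)
qed

lemma u_separated:
  assumes x: "x \<in> carrier M" and d: "\<And>n. \<exists>z\<in>carrier M. x = (u ^^ n) z"
  shows "x = \<zero>\<^bsub>M\<^esub>"
proof (rule coord_eqI[OF x Mod.M.zero_closed])
  fix b n assume b: "b \<in> basis"
  obtain z where "z \<in> carrier M" "x = (u ^^ Suc n) z" using d by blast
  then have "coord x b n = \<zero>\<^bsub>W\<^esub>" using coord_u_pow[OF _ b, of z n "Suc n"] by simp
  then show "coord x b n = coord \<zero>\<^bsub>M\<^esub> b n" using coord_zero[OF b] by simp
qed

text \<open>In coordinates the series can be summed coefficientwise, each coefficient being a finite
  sum.\<close>

lemma u_complete:
  assumes m: "\<And>i::nat. m i \<in> carrier M"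
  shows "\<exists>y\<in>carrier M. \<forall>n. \<exists>z\<in>carrier M. y = (\<Oplus>\<^bsub>M\<^esub>i\<in>{..<n}. (u ^^ i) (m i)) \<oplus>\<^bsub>M\<^esub> (u ^^ n) z"
proof -
  \<comment> \<open>All tails are constructed at once: \<open>e l\<close> are the coordinates of the
    series that starts with \<open>m l\<close>, and the remainder after \<open>n\<close> terms is
    the tail \<open>y n\<close>.\<close>
  define e where "e l b = (\<lambda>j. \<Oplus>\<^bsub>W\<^esub>i\<in>{..j}. coord (m (l + i)) b (j - i))" for l b
  have cW: "b \<in> basis \<Longrightarrow> coord (m i) b j \<in> carrier W" for b i j
    using W.powser_nth[OF coord_closed[OF m]] by blast
  have eS: "b \<in> basis \<Longrightarrow> e l b \<in> carrier S" for l b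
    unfolding e_def using cW by (intro W.powserI W.finsum_closed) auto
  have e_rec: "e l b = coord (m l) b \<oplus>\<^bsub>S\<^esub> V \<otimes>\<^bsub>S\<^esub> e (Suc l) b" if b: "b \<in> basis" for l b
  proof
    fix j
    note v = W.powser_var_mult_nth[OF eS[OF b, of "Suc l"]]
    show "e l b j = (coord (m l) b \<oplus>\<^bsub>S\<^esub> V \<otimes>\<^bsub>S\<^esub> e (Suc l) b) j"
    proof (cases j)
      case 0
      have "e l b 0 = coord (m l) b 0" unfolding e_def using cW[OF b] by simp
      then show ?thesis unfolding 0 powser_ring_simps(5) v using cW[OF b] by simp
    next
      case (Suc i)
      have "e l b (Suc i) = (\<Oplus>\<^bsub>W\<^esub>t\<in>{..i}. coord (m (l + Suc t)) b (Suc i - Suc t)) \<oplus>\<^bsub>W\<^esub> coord (m (l + 0)) b (Suc i - 0)"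
        unfolding e_def by (rule W.finsum_Suc2) (use cW[OF b] in auto)
      also have "\<dots> = e (Suc l) b i \<oplus>\<^bsub>W\<^esub> coord (m l) b (Suc i)" by (simp add: e_def)
      also have "\<dots> = coord (m l) b (Suc i) \<oplus>\<^bsub>W\<^esub> e (Suc l) b i"
        by (rule W.a_comm[OF W.powser_nth[OF eS[OF b]] cW[OF b]])
      finally show ?thesis unfolding Suc powser_ring_simps(5) v .
    qed
  qed
  define y where "y l = lin (e l)" for l
  have yM: "y l \<in> carrier M" for l unfolding y_def by (rule lin_closed[OF eS])
  have y_rec: "y l = m l \<oplus>\<^bsub>M\<^esub> u (y (Suc l))" for l
  proof -
    have Ve: "b \<in> basis \<Longrightarrow> V \<otimes>\<^bsub>S\<^esub> e (Suc l) b \<in> carrier S" for b by (rule Mod.R.m_closed[OF V_closed eS])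
    have "y l = lin (\<lambda>b. coord (m l) b \<oplus>\<^bsub>S\<^esub> V \<otimes>\<^bsub>S\<^esub> e (Suc l) b)"
      unfolding y_def by (rule lin_cong[OF e_rec]) (auto intro!: Mod.R.a_closed coord_closed m Ve)
    also have "\<dots> = lin (coord (m l)) \<oplus>\<^bsub>M\<^esub> lin (\<lambda>b. V \<otimes>\<^bsub>S\<^esub> e (Suc l) b)"
      by (rule lin_add[OF coord_closed[OF m] Ve])
    also have "lin (\<lambda>b. V \<otimes>\<^bsub>S\<^esub> e (Suc l) b) = u (y (Suc l))" unfolding y_def by (rule lin_smult[OF eS V_closed])
    finally show ?thesis unfolding coord(2)[OF m] .
  qed
  have up_add: "(u ^^ n) (a \<oplus>\<^bsub>M\<^esub> b) = (u ^^ n) a \<oplus>\<^bsub>M\<^esub> (u ^^ n) b" if "a \<in> carrier M" "b \<in> carrier M" for n a b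
  proof (induct n)
    case (Suc n)
    then show ?case using that u_add[OF u_pow_closed[of a n] u_pow_closed[of b n]] by (simp only: funpow.simps comp_apply)
  qed simp
  have "y 0 = (\<Oplus>\<^bsub>M\<^esub>i\<in>{..<n}. (u ^^ i) (m i)) \<oplus>\<^bsub>M\<^esub> (u ^^ n) (y n)" for n
  proof (induct n)
    case 0
    then show ?case using yM by simp
  next
    case (Suc n)
    let ?s = "\<Oplus>\<^bsub>M\<^esub>i\<in>{..<n}. (u ^^ i) (m i)"
    have sM: "?s \<in> carrier M" using u_pow_closed m by (intro Mod.M.finsum_closed) auto
    have "(u ^^ n) (y n) = (u ^^ n) (m n \<oplus>\<^bsub>M\<^esub> u (y (Suc n)))" using y_rec[of n] by (rule arg_cong)
    also have "\<dots> = (u ^^ n) (m n) \<oplus>\<^bsub>M\<^esub> (u ^^ n) (u (y (Suc n)))"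
      by (rule up_add[OF m u_closed[OF yM]])
    also have "(u ^^ n) (u (y (Suc n))) = (u ^^ Suc n) (y (Suc n))" by (simp only: funpow_Suc_right comp_apply)
    finally have "y 0 = ?s \<oplus>\<^bsub>M\<^esub> ((u ^^ n) (m n) \<oplus>\<^bsub>M\<^esub> (u ^^ Suc n) (y (Suc n)))" using Suc by (simp only:)
    also have "\<dots> = ((u ^^ n) (m n) \<oplus>\<^bsub>M\<^esub> ?s) \<oplus>\<^bsub>M\<^esub> (u ^^ Suc n) (y (Suc n))"
      using sM u_pow_closed[OF m, of n n] u_pow_closed[OF yM, of "Suc n" "Suc n"]
      by (simp only: Mod.M.a_ac Mod.M.a_closed)
    also have "(u ^^ n) (m n) \<oplus>\<^bsub>M\<^esub> ?s = (\<Oplus>\<^bsub>M\<^esub>i\<in>{..<Suc n}. (u ^^ i) (m i))"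
      unfolding lessThan_Suc by (rule Mod.M.finsum_insert[symmetric]) (use u_pow_closed m in auto)
    finally show ?case .
  qed
  then show ?thesis using yM by blast
qed

lemma complete_module: "complete_module TW (with_smult M tact) u"
proof (intro complete_module.intro complete_module_axioms.intro tact_module)
  show "x = \<zero>\<^bsub>with_smult M tact\<^esub>"
    if "x \<in> carrier (with_smult M tact)" "\<And>n. \<exists>z\<in>carrier (with_smult M tact). x = (u ^^ n) z" for x
    using u_separated that by simp
  show "\<exists>y\<in>carrier (with_smult M tact). \<forall>n. \<exists>z\<in>carrier (with_smult M tact).
      y = (\<Oplus>\<^bsub>with_smult M tact\<^esub>i\<in>{..<n}. (u ^^ i) (m i)) \<oplus>\<^bsub>with_smult M tact\<^esub> (u ^^ n) z"
    if "\<And>i::nat. m i \<in> carrier (with_smult M tact)" for m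
    using u_complete[of m] that by simp
  show "x = y" if "x \<in> carrier (with_smult M tact)" "y \<in> carrier (with_smult M tact)" "u x = u y" for x y
    using u_inj that by simp
qed (simp_all add: u_closed u_add u_tact)

text \<open>By \<open>witt_expansion\<close>, additive statements about \<open>W\<close> need
  checking only on p-adic multiples of Teichmueller representatives.\<close>

lemma W_induct:
  assumes "w \<in> carrier W" and zero: "Q \<zero>\<^bsub>W\<^esub>"
    and add: "\<And>w v. w \<in> carrier W \<Longrightarrow> v \<in> carrier W \<Longrightarrow> Q w \<Longrightarrow> Q v \<Longrightarrow> Q (w \<oplus>\<^bsub>W\<^esub> v)"
    and span: "\<And>z a. z \<in> carrier Z \<Longrightarrow> a \<in> carrier k \<Longrightarrow> Q (pw z \<otimes>\<^bsub>W\<^esub> tch a)"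
  shows "Q w"
proof -
  obtain z where z: "\<forall>a\<in>carrier k. z a \<in> carrier Z" "w = (\<Oplus>\<^bsub>W\<^esub>a\<in>carrier k. pw (z a) \<otimes>\<^bsub>W\<^esub> tch a)"
    using witt_expansion[OF assms(1)] by blast
  have cl: "a \<in> carrier k \<Longrightarrow> pw (z a) \<otimes>\<^bsub>W\<^esub> tch a \<in> carrier W" for a
    using z(1) padic_to_witt(1) tch_closed by simp
  have "(\<Oplus>\<^bsub>W\<^esub>a\<in>K. pw (z a) \<otimes>\<^bsub>W\<^esub> tch a) \<in> carrier W \<and> Q (\<Oplus>\<^bsub>W\<^esub>a\<in>K. pw (z a) \<otimes>\<^bsub>W\<^esub> tch a)"
    if "finite K" "K \<subseteq> carrier k" for K
    using that
  proof (induct K rule: finite_induct)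
    case empty
    then show ?case using zero by simp
  next
    case (insert a K)
    have e: "(\<Oplus>\<^bsub>W\<^esub>a\<in>insert a K. pw (z a) \<otimes>\<^bsub>W\<^esub> tch a) = pw (z a) \<otimes>\<^bsub>W\<^esub> tch a \<oplus>\<^bsub>W\<^esub> (\<Oplus>\<^bsub>W\<^esub>a\<in>K. pw (z a) \<otimes>\<^bsub>W\<^esub> tch a)"
      by (rule W.finsum_insert) (use insert cl in auto)
    have "Q (pw (z a) \<otimes>\<^bsub>W\<^esub> tch a)" using span z(1) insert.prems by simp
    then show ?case unfolding e using insert cl add by simp
  qed
  from this[OF finite_k order_refl] show ?thesis unfolding z(2) by blast
qed

section \<open>The reduction modulo u\<close>

definition "U = u ` carrier M"

lemma U_submodule: "submodule U R (with_smult M act)"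
proof (rule Act.submoduleI')
  show "U \<subseteq> carrier (with_smult M act)" using u_closed by (auto simp: U_def)
  show "\<zero>\<^bsub>with_smult M act\<^esub> \<in> U" unfolding U_def using u_zero by (metis imageI with_smult_simps(3) Mod.M.zero_closed)
  show "x \<oplus>\<^bsub>with_smult M act\<^esub> y \<in> U" if "x \<in> U" "y \<in> U" for x y
    using that by (auto simp: U_def u_add[symmetric])
  show "r \<odot>\<^bsub>with_smult M act\<^esub> x \<in> U" if "r \<in> carrier R" "x \<in> U" for r x
    using that act_closed by (auto simp: U_def u_act)
qed

lemma U_iff:
  assumes m: "m \<in> carrier M"
  shows "m \<in> U \<longleftrightarrow> (\<forall>b\<in>basis. coord m b 0 = \<zero>\<^bsub>W\<^esub>)"
proof
  assume "m \<in> U"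
  then show "\<forall>b\<in>basis. coord m b 0 = \<zero>\<^bsub>W\<^esub>" using coord_u(1) by (auto simp: U_def)
next
  assume z: "\<forall>b\<in>basis. coord m b 0 = \<zero>\<^bsub>W\<^esub>"
  let ?z = "lin (\<lambda>b. coeff_shift (coord m b))"
  have sc: "b \<in> basis \<Longrightarrow> coeff_shift (coord m b) \<in> carrier S" for b
    by (rule W.coeff_shift_closed[OF coord_closed[OF m]])
  have zM: "?z \<in> carrier M" by (rule lin_closed[OF sc])
  have "m = u ?z"
  proof (rule coord_eqI[OF m u_closed[OF zM]])
    fix b n assume b: "b \<in> basis"
    show "coord m b n = coord (u ?z) b n"
    proof (cases n)
      case 0
      then show ?thesis using z b coord_u(1)[OF zM b] by simp
    next
      case (Suc i)
      have "coord (u ?z) b (Suc i) = coeff_shift (coord m b) i"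
        unfolding coord_u(2)[OF zM b] by (simp only: coord_lin[OF sc b])
      then show ?thesis unfolding Suc coeff_shift_apply by simp
    qed
  qed
  then show "m \<in> U" unfolding U_def using zM by (rule image_eqI)
qed

lemma nat_times: "m \<in> carrier M \<Longrightarrow> [(n::nat)] \<cdot>\<^bsub>M\<^esub> m = wm (nat_W n) m"
proof (induct n)
  case 0
  then show ?case by (simp add: nat_W_def wm_zero)
next
  case (Suc n)
  have "nat_W (Suc n) = nat_W n \<oplus>\<^bsub>W\<^esub> \<one>\<^bsub>W\<^esub>" by (simp add: nat_W_def W.add.nat_pow_Suc)
  then show ?case using Suc nat_W_closed by (simp add: wm_add_left wm_one Mod.M.add.nat_pow_Suc)
qed

text \<open>Coordinates turn divisibility by \<open>u\<close> into the vanishing of constant terms.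
  These lie in \<open>W\<close>, which has no \<open>p\<close>-torsion.\<close>

lemma U_torsion:
  assumes m: "m \<in> carrier M" and "[p] \<cdot>\<^bsub>M\<^esub> m \<in> U"
  shows "m \<in> U"
proof -
  have "coord m b 0 = \<zero>\<^bsub>W\<^esub>" if b: "b \<in> basis" for b
  proof -
    have c: "coord m b 0 \<in> carrier W" by (rule W.powser_nth[OF coord_closed[OF m b]])
    have "coord (wm (nat_W p) m) b 0 = \<zero>\<^bsub>W\<^esub>"
      using assms(2) U_iff[OF wm_closed[OF nat_W_closed m]] b unfolding nat_times[OF m] by blast
    then have "nat_W p \<otimes>\<^bsub>W\<^esub> coord m b 0 = \<zero>\<^bsub>W\<^esub>"
      unfolding coord_smult[OF m const_closed[OF nat_W_closed] b]
        W.powser_const_mult_nth[OF nat_W_closed coord_closed[OF m b]] .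
    then have "[p] \<cdot>\<^bsub>W\<^esub> coord m b 0 = \<zero>\<^bsub>W\<^esub>" using c by (simp add: nat_W_def W.add_pow_ldistr)
    then show ?thesis by (rule p_torsion_free[OF c])
  qed
  then show ?thesis using U_iff[OF m] by blast
qed

text \<open>Generators of \<open>M\<close> over \<open>R\<close> modulo \<open>u\<close>: the basis
  over the power series, multiplied by the Teichmueller representatives that span \<open>W\<close>
  over the p-adic integers.\<close>

definition "gset = (\<lambda>(a, b). wm (tch a) b) ` (carrier k \<times> basis)"

lemma gset: "finite gset" "gset \<subseteq> carrier M"
  unfolding gset_def using finite_k basis(1) basis_closed tch_closed wm_closed by auto

lemma gset_generates:
  assumes H: "submodule H R (with_smult M act)" and sub: "gset \<union> U \<subseteq> H"
  shows "H = carrier M"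
proof
  note H_ops = Act.submodule_ops[OF H, simplified]
  show "H \<subseteq> carrier M" using H_ops(1) by blast
  show "carrier M \<subseteq> H"
  proof
    fix m assume m: "m \<in> carrier M"
    have wb: "wm w b \<in> H" if w: "w \<in> carrier W" and b: "b \<in> basis" for w b
      using w
    proof (rule W_induct)
      show "wm \<zero>\<^bsub>W\<^esub> b \<in> H" using wm_zero[OF basis_closed[OF b]] H_ops(2) by simp
      show "wm (w \<oplus>\<^bsub>W\<^esub> v) b \<in> H" if "w \<in> carrier W" "v \<in> carrier W" "wm w b \<in> H" "wm v b \<in> H" for w v
        using that H_ops(3) wm_add_left[OF that(1,2) basis_closed[OF b]] by simp
      fix z a assume z: "z \<in> carrier Z" and a: "a \<in> carrier k"
      have "wm (tch a) b \<in> H" using sub a b by (auto simp: gset_def)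
      \<comment> \<open>Multiplication by a p-adic scalar is the action of an element of
        \<open>R\<close>, under which \<open>H\<close> is closed.\<close>
      then have "act (z \<odot>\<^bsub>R\<^esub> \<one>\<^bsub>R\<^esub>) (wm (tch a) b) \<in> H" using z by (intro H_ops(5)) auto
      then show "wm (pw z \<otimes>\<^bsub>W\<^esub> tch a) b \<in> H"
        using act_Z_one[OF z wm_closed[OF tch_closed[OF a] basis_closed[OF b]]]
          wm_mult[OF padic_to_witt(1)[OF z] tch_closed[OF a] basis_closed[OF b]] by simp
    qed
    have cW: "b \<in> basis \<Longrightarrow> coord m b 0 \<in> carrier W" for b by (rule W.powser_nth[OF coord_closed[OF m]])
    \<comment> \<open>\<open>d\<close> collects the constant terms of the coordinates of
      \<open>m\<close>. It lies in \<open>H\<close> by \<open>wb\<close>, and \<open>m\<close>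
      differs from it by a multiple of \<open>u\<close>.\<close>
    define d where "d = lin (\<lambda>b. powser_const W (coord m b 0))"
    have dM: "d \<in> carrier M" unfolding d_def by (rule lin_closed) (rule const_closed[OF cW])
    have "(\<Oplus>\<^bsub>M\<^esub>b\<in>K. wm (coord m b 0) b) \<in> H" if "finite K" "K \<subseteq> basis" for K
      using that
    proof (induct K rule: finite_induct)
      case empty
      then show ?case using H_ops(2) by simp
    next
      case (insert b K)
      have "(\<Oplus>\<^bsub>M\<^esub>b\<in>insert b K. wm (coord m b 0) b) = wm (coord m b 0) b \<oplus>\<^bsub>M\<^esub> (\<Oplus>\<^bsub>M\<^esub>b\<in>K. wm (coord m b 0) b)"
        by (rule Mod.M.finsum_insert) (use insert cW basis_closed wm_closed in auto)
      then show ?case using insert wb cW H_ops(3) by simp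
    qed
    then have dH: "d \<in> H" unfolding d_def lin_def using basis(1) by simp
    have "m \<ominus>\<^bsub>M\<^esub> d \<in> U"
    proof -
      \<comment> \<open>The sign is written as a scalar, so that the difference becomes a value of
        \<open>lin\<close> with explicit coordinates.\<close>
      have md: "m \<ominus>\<^bsub>M\<^esub> d = m \<oplus>\<^bsub>M\<^esub> (\<ominus>\<^bsub>S\<^esub> \<one>\<^bsub>S\<^esub>) \<odot>\<^bsub>M\<^esub> d"
        using dM by (simp add: Mod.M.minus_eq Mod.smult_l_minus)
      let ?c = "\<lambda>b. coord m b \<oplus>\<^bsub>S\<^esub> (\<ominus>\<^bsub>S\<^esub> \<one>\<^bsub>S\<^esub>) \<otimes>\<^bsub>S\<^esub> powser_const W (coord m b 0)"
      have kS: "b \<in> basis \<Longrightarrow> powser_const W (coord m b 0) \<in> carrier S" for b by (rule const_closed[OF cW])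
      have cS: "b \<in> basis \<Longrightarrow> ?c b \<in> carrier S" for b using coord_closed[OF m] kS by simp
      have "m \<ominus>\<^bsub>M\<^esub> d = lin ?c"
        unfolding md unfolding d_def
        using lin_add[of "coord m" "\<lambda>b. (\<ominus>\<^bsub>S\<^esub> \<one>\<^bsub>S\<^esub>) \<otimes>\<^bsub>S\<^esub> powser_const W (coord m b 0)"]
          lin_smult[of "\<lambda>b. powser_const W (coord m b 0)" "\<ominus>\<^bsub>S\<^esub> \<one>\<^bsub>S\<^esub>"] coord_closed[OF m] kS coord(2)[OF m] by simp
      moreover have "?c b 0 = \<zero>\<^bsub>W\<^esub>" if b: "b \<in> basis" for b
      proof -
        have n: "\<ominus>\<^bsub>S\<^esub> \<one>\<^bsub>S\<^esub> = powser_const W (\<ominus>\<^bsub>W\<^esub> \<one>\<^bsub>W\<^esub>)"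
        proof (rule Mod.R.minus_equality)
          show "powser_const W (\<ominus>\<^bsub>W\<^esub> \<one>\<^bsub>W\<^esub>) \<oplus>\<^bsub>S\<^esub> \<one>\<^bsub>S\<^esub> = \<zero>\<^bsub>S\<^esub>"
            using W.powser_const_add[of "\<ominus>\<^bsub>W\<^esub> \<one>\<^bsub>W\<^esub>" "\<one>\<^bsub>W\<^esub>"]
            by (simp add: W.powser_const_one W.powser_const_zero W.l_neg)
        qed (simp_all add: const_closed)
        have "?c b 0 = coord m b 0 \<oplus>\<^bsub>W\<^esub> (\<ominus>\<^bsub>W\<^esub> \<one>\<^bsub>W\<^esub>) \<otimes>\<^bsub>W\<^esub> powser_const W (coord m b 0) 0"
          unfolding powser_ring_simps(5) n by (subst W.powser_const_mult_nth[OF _ kS[OF b]]) simp_all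
        also have "\<dots> = \<zero>\<^bsub>W\<^esub>" using cW[OF b] by (simp add: powser_const_def W.l_minus W.r_neg)
        finally show ?thesis .
      qed
      ultimately show ?thesis
        using U_iff[OF Mod.M.minus_closed[OF m dM]] coord_lin[OF cS] by simp
    qed
    then have "m \<ominus>\<^bsub>M\<^esub> d \<oplus>\<^bsub>M\<^esub> d \<in> H" using sub dH H_ops(3) by blast
    then show "m \<in> H" using m dM by (simp add: Mod.M.minus_eq Mod.M.a_assoc Mod.M.l_neg)
  qed
qed

section \<open>The dual basis by averaging over Teichmueller representatives\<close>

theorem projective:
  assumes HR: "\<And>N :: ('r, (nat \<Rightarrow> 'r) set) module.
       module R N \<Longrightarrow> finitely_generated R N \<Longrightarrow> torsion_free_wrt p N \<Longrightarrow> projective_module R N"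
  shows "projective_module (powser_ring TW) (with_smult M (complete_module.pact (with_smult M tact) u))"
proof -
  interpret C: complete_module TW "with_smult M tact" u by (rule complete_module)
  obtain g where g_closed: "\<And>t m. t \<in> gset \<Longrightarrow> m \<in> carrier M \<Longrightarrow> g t m \<in> carrier R"
    and g_add: "\<And>t m m'. t \<in> gset \<Longrightarrow> m \<in> carrier M \<Longrightarrow> m' \<in> carrier M \<Longrightarrow> g t (m \<oplus>\<^bsub>M\<^esub> m') = g t m \<oplus>\<^bsub>R\<^esub> g t m'"
    and g_smult: "\<And>t r m. t \<in> gset \<Longrightarrow> r \<in> carrier R \<Longrightarrow> m \<in> carrier M \<Longrightarrow> g t (act r m) = r \<otimes>\<^bsub>R\<^esub> g t m"
    and g_U: "\<And>t m. t \<in> gset \<Longrightarrow> m \<in> U \<Longrightarrow> g t m = \<zero>\<^bsub>R\<^esub>"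
    and g_basis: "\<And>m. m \<in> carrier M \<Longrightarrow> (\<Oplus>\<^bsub>M\<^esub>t\<in>gset. act (g t m) t) \<ominus>\<^bsub>M\<^esub> m \<in> U"
  proof (rule residual_dual_basis[OF HR act_module U_submodule gset(1)])
    show "gset \<subseteq> carrier (with_smult M act)" using gset(2) by simp
    show "H = carrier (with_smult M act)" if "submodule H R (with_smult M act)" "gset \<union> U \<subseteq> H" for H
      using gset_generates[OF that] by simp
    show "m \<in> U" if "m \<in> carrier (with_smult M act)" "[p] \<cdot>\<^bsub>with_smult M act\<^esub> m \<in> U" for m
      using U_torsion that by simp
    fix g
    assume g: "\<And>t m. t \<in> gset \<Longrightarrow> m \<in> carrier (with_smult M act) \<Longrightarrow> g t m \<in> carrier R"
      "\<And>t m m'. t \<in> gset \<Longrightarrow> m \<in> carrier (with_smult M act) \<Longrightarrow> m' \<in> carrier (with_smult M act) \<Longrightarrow>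
        g t (m \<oplus>\<^bsub>with_smult M act\<^esub> m') = g t m \<oplus>\<^bsub>R\<^esub> g t m'"
      "\<And>t r m. t \<in> gset \<Longrightarrow> r \<in> carrier R \<Longrightarrow> m \<in> carrier (with_smult M act) \<Longrightarrow>
        g t (r \<odot>\<^bsub>with_smult M act\<^esub> m) = r \<otimes>\<^bsub>R\<^esub> g t m"
      "\<And>t m. t \<in> gset \<Longrightarrow> m \<in> U \<Longrightarrow> g t m = \<zero>\<^bsub>R\<^esub>"
      "\<And>m. m \<in> carrier (with_smult M act) \<Longrightarrow>
        (\<Oplus>\<^bsub>with_smult M act\<^esub>t\<in>gset. g t m \<odot>\<^bsub>with_smult M act\<^esub> t) \<ominus>\<^bsub>with_smult M act\<^esub> m \<in> U"
    show thesis
      by (rule that[OF g(1)[simplified] g(2)[simplified] g(3)[simplified] g(4) g(5)[simplified]])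
  qed
  let ?q = "carrier k - {\<zero>\<^bsub>k\<^esub>}"
  have q: "finite ?q" "a \<in> ?q \<Longrightarrow> a \<in> carrier k" "a \<in> ?q \<Longrightarrow> inv\<^bsub>k\<^esub> a \<in> carrier k"
    "a \<in> ?q \<Longrightarrow> a \<otimes>\<^bsub>k\<^esub> inv\<^bsub>k\<^esub> a = \<one>\<^bsub>k\<^esub>" for a
    using finite_k k.field_Units k.Units_inv_closed[of a] k.Units_r_inv[of a] by auto
  \<comment> \<open>\<open>c\<close> inverts the order of the averaging group; it is the normalizing
    factor of the average.\<close>
  obtain c where c: "c \<in> carrier W" "c \<otimes>\<^bsub>W\<^esub> nat_W (card ?q) = \<one>\<^bsub>W\<^esub>" using card_units_invertible by blast
  define y where "y a m = wm (tch (inv\<^bsub>k\<^esub> a)) m" for a m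
  have y_closed: "a \<in> ?q \<Longrightarrow> m \<in> carrier M \<Longrightarrow> y a m \<in> carrier M" for a m
    unfolding y_def using q wm_closed tch_closed by simp
  have ca: "a \<in> ?q \<Longrightarrow> c \<otimes>\<^bsub>W\<^esub> tch a \<in> carrier W" for a using c q tch_closed by simp
  \<comment> \<open>The average of the twists of \<open>g t\<close>: the inverse of \<open>a\<close>
    acts on the argument through \<open>y a m\<close>, and \<open>tch a\<close> is recorded in the
    second tensor factor together with the normalization \<open>c\<close>.\<close>
  define h where "h t m = (\<Oplus>\<^bsub>TW\<^esub>a\<in>?q. T.tns (g t (y a m)) (c \<otimes>\<^bsub>W\<^esub> tch a))" for t m
  have term_closed: "T.tns (g t (y a m)) (c \<otimes>\<^bsub>W\<^esub> tch a) \<in> carrier TW" if "t \<in> gset" "a \<in> ?q" "m \<in> carrier M" for t a m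
    using that by (intro W_tns_closed g_closed y_closed ca)
  have h_closed: "h t m \<in> carrier TW" if "t \<in> gset" "m \<in> carrier M" for t m
    unfolding h_def using term_closed that by (intro T.TA.finsum_closed) auto
  have h_add: "h t (m \<oplus>\<^bsub>M\<^esub> m') = h t m \<oplus>\<^bsub>TW\<^esub> h t m'" if t: "t \<in> gset" and m: "m \<in> carrier M" "m' \<in> carrier M" for t m m'
  proof -
    have "h t (m \<oplus>\<^bsub>M\<^esub> m') = (\<Oplus>\<^bsub>TW\<^esub>a\<in>?q. T.tns (g t (y a m)) (c \<otimes>\<^bsub>W\<^esub> tch a) \<oplus>\<^bsub>TW\<^esub> T.tns (g t (y a m')) (c \<otimes>\<^bsub>W\<^esub> tch a))"
      unfolding h_def
    proof (rule T.TA.finsum_cong'[OF refl])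
      fix a assume a: "a \<in> ?q"
      have "y a (m \<oplus>\<^bsub>M\<^esub> m') = y a m \<oplus>\<^bsub>M\<^esub> y a m'" unfolding y_def by (rule wm_add_right[OF tch_closed[OF q(3)[OF a]] m])
      then have "g t (y a (m \<oplus>\<^bsub>M\<^esub> m')) = g t (y a m) \<oplus>\<^bsub>R\<^esub> g t (y a m')"
        using g_add[OF t y_closed[OF a m(1)] y_closed[OF a m(2)]] by simp
      then show "T.tns (g t (y a (m \<oplus>\<^bsub>M\<^esub> m'))) (c \<otimes>\<^bsub>W\<^esub> tch a)
          = T.tns (g t (y a m)) (c \<otimes>\<^bsub>W\<^esub> tch a) \<oplus>\<^bsub>TW\<^esub> T.tns (g t (y a m')) (c \<otimes>\<^bsub>W\<^esub> tch a)"
        using T.tns_add_left[OF g_closed[OF t y_closed[OF a m(1)]] g_closed[OF t y_closed[OF a m(2)]], of "c \<otimes>\<^bsub>W\<^esub> tch a"] ca[OF a]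
        by (simp add: WA_simps)
    qed (use term_closed t m in auto)
    also have "\<dots> = h t m \<oplus>\<^bsub>TW\<^esub> h t m'"
      unfolding h_def by (rule T.TA.finsum_addf) (use term_closed t m in auto)
    finally show ?thesis .
  qed
  have h_U: "h t m = \<zero>\<^bsub>TW\<^esub>" if t: "t \<in> gset" and m: "m \<in> U" for t m
  proof -
    obtain n where n: "n \<in> carrier M" "m = u n" using m by (auto simp: U_def)
    have "h t m = (\<Oplus>\<^bsub>TW\<^esub>a\<in>?q. \<zero>\<^bsub>TW\<^esub>)"
      unfolding h_def
    proof (rule T.TA.finsum_cong'[OF refl])
      fix a assume a: "a \<in> ?q"
      have "y a m = u (y a n)" unfolding y_def n(2) using u_wm[OF tch_closed[OF q(3)[OF a]] n(1)] by simp
      then have "y a m \<in> U" unfolding U_def using y_closed[OF a n(1)] by simp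
      then have "g t (y a m) = \<zero>\<^bsub>R\<^esub>" by (rule g_U[OF t])
      then show "T.tns (g t (y a m)) (c \<otimes>\<^bsub>W\<^esub> tch a) = \<zero>\<^bsub>TW\<^esub>"
        using T.tns_zero_left[of "c \<otimes>\<^bsub>W\<^esub> tch a"] ca[OF a] by (simp add: WA_simps)
    qed auto
    then show ?thesis by simp
  qed
  have h_minus: "h t (m \<ominus>\<^bsub>M\<^esub> m') = h t m \<ominus>\<^bsub>TW\<^esub> h t m'" if t: "t \<in> gset" and m: "m \<in> carrier M" "m' \<in> carrier M" for t m m'
  proof -
    have mm: "m \<ominus>\<^bsub>M\<^esub> m' \<in> carrier M" using m by simp
    have "m \<ominus>\<^bsub>M\<^esub> m' \<oplus>\<^bsub>M\<^esub> m' = m" using m by (simp add: Mod.M.minus_eq Mod.M.a_assoc Mod.M.l_neg)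
    then have e: "h t m = h t (m \<ominus>\<^bsub>M\<^esub> m') \<oplus>\<^bsub>TW\<^esub> h t m'" using h_add[OF t mm m(2)] by simp
    show ?thesis unfolding e using h_closed[OF t mm] h_closed[OF t m(2)] by (simp add: T.TA.minus_eq T.TA.a_assoc T.TA.r_neg)
  qed
  have tns_split: "T.tns (r \<otimes>\<^bsub>R\<^esub> r') (w \<otimes>\<^bsub>W\<^esub> w') = T.tns r w \<otimes>\<^bsub>TW\<^esub> T.tns r' w'"
    if "r \<in> carrier R" "r' \<in> carrier R" "w \<in> carrier W" "w' \<in> carrier W" for r r' w w'
    using T.tns_mult[of r w r' w'] that by (simp add: WA_simps)
  have h_act: "h t (act r m) = T.tns r \<one>\<^bsub>W\<^esub> \<otimes>\<^bsub>TW\<^esub> h t m" if t: "t \<in> gset" and m: "m \<in> carrier M" and r: "r \<in> carrier R" for t m r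
  proof -
    have "T.tns r \<one>\<^bsub>W\<^esub> \<otimes>\<^bsub>TW\<^esub> h t m = (\<Oplus>\<^bsub>TW\<^esub>a\<in>?q. T.tns r \<one>\<^bsub>W\<^esub> \<otimes>\<^bsub>TW\<^esub> T.tns (g t (y a m)) (c \<otimes>\<^bsub>W\<^esub> tch a))"
      unfolding h_def by (rule T.TA.finsum_rdistr[OF q(1) W_tns_closed[OF r W.one_closed]]) (use term_closed t m in auto)
    also have "\<dots> = h t (act r m)"
      unfolding h_def
    proof (rule T.TA.finsum_cong'[OF refl])
      fix a assume a: "a \<in> ?q"
      have "y a (act r m) = act r (y a m)" unfolding y_def using act_wm[OF r tch_closed[OF q(3)[OF a]] m] by simp
      then have "g t (y a (act r m)) = r \<otimes>\<^bsub>R\<^esub> g t (y a m)" using g_smult[OF t r y_closed[OF a m]] by simp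
      then show "T.tns r \<one>\<^bsub>W\<^esub> \<otimes>\<^bsub>TW\<^esub> T.tns (g t (y a m)) (c \<otimes>\<^bsub>W\<^esub> tch a) = T.tns (g t (y a (act r m))) (c \<otimes>\<^bsub>W\<^esub> tch a)"
        using tns_split[OF r g_closed[OF t y_closed[OF a m]] W.one_closed ca[OF a]] ca[OF a] by simp
    qed (use term_closed t m r act_closed in auto)
    finally show ?thesis by simp
  qed
  \<comment> \<open>A p-adic scalar acts as an element of \<open>R\<close>, and the balancing
    relation moves it to the second factor.\<close>
  have h_pw: "h t (wm (pw z) m) = T.tns \<one>\<^bsub>R\<^esub> (pw z) \<otimes>\<^bsub>TW\<^esub> h t m" if t: "t \<in> gset" and m: "m \<in> carrier M" and z: "z \<in> carrier Z" for t m z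
  proof -
    have "T.tns (z \<odot>\<^bsub>R\<^esub> \<one>\<^bsub>R\<^esub>) \<one>\<^bsub>W\<^esub> = T.tns \<one>\<^bsub>R\<^esub> (pw z)"
      using T.tns_balanced[of z "\<one>\<^bsub>R\<^esub>" "\<one>\<^bsub>W\<^esub>"] z padic_to_witt(1)[OF z] by (simp add: WA_simps)
    then show ?thesis using h_act[OF t m, of "z \<odot>\<^bsub>R\<^esub> \<one>\<^bsub>R\<^esub>"] z act_Z_one[OF z m] by simp
  qed
  \<comment> \<open>Translating the index of the average by \<open>b\<close> cancels
    \<open>tch b\<close> in the argument and produces it in the second factor, from where it comes
    in front of the sum.\<close>
  have h_tch: "h t (wm (tch b) m) = T.tns \<one>\<^bsub>R\<^esub> (tch b) \<otimes>\<^bsub>TW\<^esub> h t m" if t: "t \<in> gset" and m: "m \<in> carrier M" and b: "b \<in> ?q" for t m b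
  proof -
    have bm: "wm (tch b) m \<in> carrier M" using wm_closed[OF tch_closed[OF q(2)[OF b]] m] .
    have bU: "b \<in> Units k" using b k.field_Units by simp
    have im: "(\<lambda>a. b \<otimes>\<^bsub>k\<^esub> a) ` ?q = ?q"
    proof
      show "(\<lambda>a. b \<otimes>\<^bsub>k\<^esub> a) ` ?q \<subseteq> ?q" using b k.integral_iff by auto
      show "?q \<subseteq> (\<lambda>a. b \<otimes>\<^bsub>k\<^esub> a) ` ?q"
      proof
        fix a assume a: "a \<in> ?q"
        have e: "a = b \<otimes>\<^bsub>k\<^esub> (inv\<^bsub>k\<^esub> b \<otimes>\<^bsub>k\<^esub> a)"
          using q(2-4)[OF b] q(2)[OF a] by (simp add: k.m_assoc[symmetric])
        have "inv\<^bsub>k\<^esub> b \<otimes>\<^bsub>k\<^esub> a \<in> ?q" using q(2,3)[OF b] q(2)[OF a] e a by auto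
        then show "a \<in> (\<lambda>a. b \<otimes>\<^bsub>k\<^esub> a) ` ?q" using e by (rule image_eqI[rotated])
      qed
    qed
    have inj: "inj_on (\<lambda>a. b \<otimes>\<^bsub>k\<^esub> a) ?q" using b k.m_lcancel by (auto simp: inj_on_def)
    have "h t (wm (tch b) m) = (\<Oplus>\<^bsub>TW\<^esub>a\<in>(\<lambda>a. b \<otimes>\<^bsub>k\<^esub> a) ` ?q. T.tns (g t (y a (wm (tch b) m))) (c \<otimes>\<^bsub>W\<^esub> tch a))"
      unfolding im h_def ..
    also have "\<dots> = (\<Oplus>\<^bsub>TW\<^esub>a\<in>?q. T.tns (g t (y (b \<otimes>\<^bsub>k\<^esub> a) (wm (tch b) m))) (c \<otimes>\<^bsub>W\<^esub> tch (b \<otimes>\<^bsub>k\<^esub> a)))"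
      by (rule T.TA.finsum_reindex[OF _ inj]) (use term_closed[OF t _ bm] im in blast)
    also have "\<dots> = (\<Oplus>\<^bsub>TW\<^esub>a\<in>?q. T.tns \<one>\<^bsub>R\<^esub> (tch b) \<otimes>\<^bsub>TW\<^esub> T.tns (g t (y a m)) (c \<otimes>\<^bsub>W\<^esub> tch a))"
    proof (rule T.TA.finsum_cong'[OF refl])
      fix a assume a: "a \<in> ?q"
      have aU: "a \<in> Units k" using a k.field_Units by simp
      have ba: "b \<otimes>\<^bsub>k\<^esub> a \<in> ?q" using im a by blast
      have "inv\<^bsub>k\<^esub> (b \<otimes>\<^bsub>k\<^esub> a) \<otimes>\<^bsub>k\<^esub> b = inv\<^bsub>k\<^esub> a"
      proof (rule k.comm_inv_char[symmetric])
        have "a \<otimes>\<^bsub>k\<^esub> (inv\<^bsub>k\<^esub> (b \<otimes>\<^bsub>k\<^esub> a) \<otimes>\<^bsub>k\<^esub> b) = (b \<otimes>\<^bsub>k\<^esub> a) \<otimes>\<^bsub>k\<^esub> inv\<^bsub>k\<^esub> (b \<otimes>\<^bsub>k\<^esub> a)"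
          using q(2)[OF a] q(2)[OF b] q(3)[OF ba] by (simp add: k.m_ac)
        then show "a \<otimes>\<^bsub>k\<^esub> (inv\<^bsub>k\<^esub> (b \<otimes>\<^bsub>k\<^esub> a) \<otimes>\<^bsub>k\<^esub> b) = \<one>\<^bsub>k\<^esub>" using q(4)[OF ba] by simp
      qed (use q(2)[OF a] q(2)[OF b] q(3)[OF ba] in auto)
      then have "y (b \<otimes>\<^bsub>k\<^esub> a) (wm (tch b) m) = y a m"
        unfolding y_def wm_mult[OF tch_closed[OF q(3)[OF ba]] tch_closed[OF q(2)[OF b]] m, symmetric]
          tch_mult[OF q(3)[OF ba] q(2)[OF b]] by simp
      moreover have "c \<otimes>\<^bsub>W\<^esub> tch (b \<otimes>\<^bsub>k\<^esub> a) = tch b \<otimes>\<^bsub>W\<^esub> (c \<otimes>\<^bsub>W\<^esub> tch a)"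
        using c(1) tch_closed[OF q(2)[OF a]] tch_closed[OF q(2)[OF b]] by (simp add: tch_mult[OF q(2)[OF b] q(2)[OF a], symmetric] W.m_lcomm)
      moreover have "\<one>\<^bsub>R\<^esub> \<otimes>\<^bsub>R\<^esub> g t (y a m) = g t (y a m)" using g_closed[OF t y_closed[OF a m]] by simp
      ultimately show "T.tns (g t (y (b \<otimes>\<^bsub>k\<^esub> a) (wm (tch b) m))) (c \<otimes>\<^bsub>W\<^esub> tch (b \<otimes>\<^bsub>k\<^esub> a))
          = T.tns \<one>\<^bsub>R\<^esub> (tch b) \<otimes>\<^bsub>TW\<^esub> T.tns (g t (y a m)) (c \<otimes>\<^bsub>W\<^esub> tch a)"
        using tns_split[OF Act.R.one_closed g_closed[OF t y_closed[OF a m]] tch_closed[OF q(2)[OF b]] ca[OF a]] by simp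
    qed (use term_closed[OF t _ m] W_tns_closed tch_closed[OF q(2)[OF b]] in auto)
    also have "\<dots> = T.tns \<one>\<^bsub>R\<^esub> (tch b) \<otimes>\<^bsub>TW\<^esub> h t m"
      unfolding h_def
      by (rule T.TA.finsum_rdistr[OF q(1) W_tns_closed[OF Act.R.one_closed tch_closed[OF q(2)[OF b]]], symmetric])
        (use term_closed[OF t _ m] in auto)
    finally show ?thesis .
  qed
  have h_zero: "h t \<zero>\<^bsub>M\<^esub> = \<zero>\<^bsub>TW\<^esub>" if "t \<in> gset" for t
    by (rule h_U[OF that]) (use Act.submodule_ops(2)[OF U_submodule] in simp)
  have h_wm: "\<forall>m\<in>carrier M. h t (wm w m) = T.tns \<one>\<^bsub>R\<^esub> w \<otimes>\<^bsub>TW\<^esub> h t m" if t: "t \<in> gset" and w: "w \<in> carrier W" for t w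
    using w
  proof (rule W_induct)
    have "T.tns \<one>\<^bsub>R\<^esub> \<zero>\<^bsub>W\<^esub> = \<zero>\<^bsub>TW\<^esub>" using T.tns_zero_right[of "\<one>\<^bsub>R\<^esub>"] by (simp add: WA_simps)
    then show zero: "\<forall>m\<in>carrier M. h t (wm \<zero>\<^bsub>W\<^esub> m) = T.tns \<one>\<^bsub>R\<^esub> \<zero>\<^bsub>W\<^esub> \<otimes>\<^bsub>TW\<^esub> h t m"
      using h_closed[OF t] by (simp add: wm_zero h_zero[OF t])
    show "\<forall>m\<in>carrier M. h t (wm (w \<oplus>\<^bsub>W\<^esub> v) m) = T.tns \<one>\<^bsub>R\<^esub> (w \<oplus>\<^bsub>W\<^esub> v) \<otimes>\<^bsub>TW\<^esub> h t m"
      if wv: "w \<in> carrier W" "v \<in> carrier W" "\<forall>m\<in>carrier M. h t (wm w m) = T.tns \<one>\<^bsub>R\<^esub> w \<otimes>\<^bsub>TW\<^esub> h t m"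
        "\<forall>m\<in>carrier M. h t (wm v m) = T.tns \<one>\<^bsub>R\<^esub> v \<otimes>\<^bsub>TW\<^esub> h t m" for w v
    proof
      fix m assume m: "m \<in> carrier M"
      have "T.tns \<one>\<^bsub>R\<^esub> (w \<oplus>\<^bsub>W\<^esub> v) = T.tns \<one>\<^bsub>R\<^esub> w \<oplus>\<^bsub>TW\<^esub> T.tns \<one>\<^bsub>R\<^esub> v"
        using T.tns_add_right[of "\<one>\<^bsub>R\<^esub>" w v] wv by (simp add: WA_simps)
      then show "h t (wm (w \<oplus>\<^bsub>W\<^esub> v) m) = T.tns \<one>\<^bsub>R\<^esub> (w \<oplus>\<^bsub>W\<^esub> v) \<otimes>\<^bsub>TW\<^esub> h t m"
        using wv m t by (simp add: wm_add_left h_add wm_closed T.TA.l_distr W_tns_closed h_closed)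
    qed
    fix z a assume z: "z \<in> carrier Z" and a: "a \<in> carrier k"
    show "\<forall>m\<in>carrier M. h t (wm (pw z \<otimes>\<^bsub>W\<^esub> tch a) m) = T.tns \<one>\<^bsub>R\<^esub> (pw z \<otimes>\<^bsub>W\<^esub> tch a) \<otimes>\<^bsub>TW\<^esub> h t m"
    proof (cases "a = \<zero>\<^bsub>k\<^esub>")
      \<comment> \<open>The residue 0 is outside the averaging group, but its representative is the
        zero of \<open>W\<close>.\<close>
      case True
      then show ?thesis using zero padic_to_witt(1)[OF z] by (simp add: tch_zero)
    next
      case False
      then have aq: "a \<in> ?q" using a by simp
      show ?thesis
      proof
        fix m assume m: "m \<in> carrier M"
        note zW = padic_to_witt(1)[OF z] and aW = tch_closed[OF a]
        have "h t (wm (pw z \<otimes>\<^bsub>W\<^esub> tch a) m) = T.tns \<one>\<^bsub>R\<^esub> (pw z) \<otimes>\<^bsub>TW\<^esub> (T.tns \<one>\<^bsub>R\<^esub> (tch a) \<otimes>\<^bsub>TW\<^esub> h t m)"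
          unfolding wm_mult[OF zW aW m] h_pw[OF t wm_closed[OF aW m] z] h_tch[OF t m aq] ..
        also have "\<dots> = T.tns (\<one>\<^bsub>R\<^esub> \<otimes>\<^bsub>R\<^esub> \<one>\<^bsub>R\<^esub>) (pw z \<otimes>\<^bsub>W\<^esub> tch a) \<otimes>\<^bsub>TW\<^esub> h t m"
          unfolding tns_split[OF Act.R.one_closed Act.R.one_closed zW aW]
          by (rule T.TA.m_assoc[symmetric]) (use W_tns_closed zW aW h_closed t m in auto)
        finally show "h t (wm (pw z \<otimes>\<^bsub>W\<^esub> tch a) m) = T.tns \<one>\<^bsub>R\<^esub> (pw z \<otimes>\<^bsub>W\<^esub> tch a) \<otimes>\<^bsub>TW\<^esub> h t m" by simp
      qed
    qed
  qed
  have h_tact: "h t (tact s m) = s \<otimes>\<^bsub>TW\<^esub> h t m" if t: "t \<in> gset" and m: "m \<in> carrier M" and s: "s \<in> carrier TW" for t m s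
    using s
  proof (induct rule: T.TA_induct)
    case zero
    then show ?case using h_closed[OF t m] m by (simp add: tact_zero h_zero[OF t])
  next
    case (of r w)
    then have rw: "r \<in> carrier R" "w \<in> carrier W" by (simp_all add: WA_simps)
    have "h t (tact (T.tns r w) m) = T.tns r \<one>\<^bsub>W\<^esub> \<otimes>\<^bsub>TW\<^esub> (T.tns \<one>\<^bsub>R\<^esub> w \<otimes>\<^bsub>TW\<^esub> h t m)"
      unfolding tact_tns[OF rw m] h_act[OF t wm_closed[OF rw(2) m] rw(1)] using h_wm[OF t rw(2)] m by simp
    also have "\<dots> = T.tns (r \<otimes>\<^bsub>R\<^esub> \<one>\<^bsub>R\<^esub>) (\<one>\<^bsub>W\<^esub> \<otimes>\<^bsub>W\<^esub> w) \<otimes>\<^bsub>TW\<^esub> h t m"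
      unfolding tns_split[OF rw(1) Act.R.one_closed W.one_closed rw(2)]
      by (rule T.TA.m_assoc[symmetric]) (use W_tns_closed rw h_closed t m in auto)
    finally show ?case using rw by simp
  next
    case (diff s s')
    then show ?case using m t by (simp add: tact_minus_left h_minus tact_closed TW_minus_distr h_closed)
  qed
  have basis': "\<exists>d\<in>carrier M. m = (\<Oplus>\<^bsub>M\<^esub>t\<in>gset. tact (h t m) t) \<oplus>\<^bsub>M\<^esub> u d" if m: "m \<in> carrier M" for m
  proof -
    have tM: "t \<in> gset \<Longrightarrow> t \<in> carrier M" for t using gset(2) by blast
    \<comment> \<open>\<open>F a\<close> is the combination given by the functionals
      \<open>g\<close> at \<open>y a m\<close>, hence congruent to \<open>y a m\<close> modulo
      \<open>u\<close> by \<open>g_basis\<close>.\<close>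
    define F where "F a = (\<Oplus>\<^bsub>M\<^esub>t\<in>gset. act (g t (y a m)) t)" for a
    have gy: "t \<in> gset \<Longrightarrow> a \<in> ?q \<Longrightarrow> g t (y a m) \<in> carrier R" for t a using g_closed y_closed m by blast
    have FM: "F a \<in> carrier M" if "a \<in> ?q" for a
      unfolding F_def using gy that tM act_closed by (intro Mod.M.finsum_closed) auto
    have tact_sum: "tact (\<Oplus>\<^bsub>TW\<^esub>a\<in>K. f a) t = (\<Oplus>\<^bsub>M\<^esub>a\<in>K. tact (f a) t)"
      if "finite K" "\<And>a. a \<in> K \<Longrightarrow> f a \<in> carrier TW" "t \<in> carrier M" for K f t
      using that
    proof (induct K rule: finite_induct)
      case empty
      then show ?case by (simp add: tact_zero)
    next
      case (insert a K)
      have "f a \<in> carrier TW" "f \<in> K \<rightarrow> carrier TW" using insert.prems by auto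
      then have "tact (\<Oplus>\<^bsub>TW\<^esub>a\<in>insert a K. f a) t = tact (f a) t \<oplus>\<^bsub>M\<^esub> tact (\<Oplus>\<^bsub>TW\<^esub>a\<in>K. f a) t"
        using insert.hyps(1,2) insert.prems(2) by (simp add: tact_add_left)
      also have "tact (\<Oplus>\<^bsub>TW\<^esub>a\<in>K. f a) t = (\<Oplus>\<^bsub>M\<^esub>a\<in>K. tact (f a) t)" using insert by simp
      also have "tact (f a) t \<oplus>\<^bsub>M\<^esub> (\<Oplus>\<^bsub>M\<^esub>a\<in>K. tact (f a) t) = (\<Oplus>\<^bsub>M\<^esub>a\<in>insert a K. tact (f a) t)"
        by (rule Mod.M.finsum_insert[symmetric]) (use insert tact_closed in auto)
      finally show ?case .
    qed
    have hterm: "tact (h t m) t = (\<Oplus>\<^bsub>M\<^esub>a\<in>?q. wm (c \<otimes>\<^bsub>W\<^esub> tch a) (act (g t (y a m)) t))" if t: "t \<in> gset" for t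
    proof -
      have "tact (h t m) t = (\<Oplus>\<^bsub>M\<^esub>a\<in>?q. tact (T.tns (g t (y a m)) (c \<otimes>\<^bsub>W\<^esub> tch a)) t)"
        unfolding h_def by (rule tact_sum[OF q(1) term_closed[OF t _ m] tM[OF t]])
      also have "\<dots> = (\<Oplus>\<^bsub>M\<^esub>a\<in>?q. wm (c \<otimes>\<^bsub>W\<^esub> tch a) (act (g t (y a m)) t))"
      proof (rule Mod.M.finsum_cong'[OF refl])
        fix a assume a: "a \<in> ?q"
        show "tact (T.tns (g t (y a m)) (c \<otimes>\<^bsub>W\<^esub> tch a)) t = wm (c \<otimes>\<^bsub>W\<^esub> tch a) (act (g t (y a m)) t)"
          unfolding tact_tns[OF gy[OF t a] ca[OF a] tM[OF t]] by (rule act_wm[OF gy[OF t a] ca[OF a] tM[OF t]])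
      qed (use wm_closed ca act_closed gy t tM in auto)
      finally show ?thesis .
    qed
    \<comment> \<open>Exchanging the sums gives the sum over \<open>a\<close> of \<open>c\<close>
      times \<open>tch a\<close> applied to \<open>F a\<close>. Modulo \<open>u\<close> each term is
      \<open>c\<close> applied to \<open>m\<close>, because \<open>tch a\<close> cancels the inverse
      in \<open>y a m\<close>, and \<open>c\<close> times the number of terms is 1.\<close>
    have "(\<Oplus>\<^bsub>M\<^esub>t\<in>gset. tact (h t m) t) = (\<Oplus>\<^bsub>M\<^esub>t\<in>gset. \<Oplus>\<^bsub>M\<^esub>a\<in>?q. wm (c \<otimes>\<^bsub>W\<^esub> tch a) (act (g t (y a m)) t))"
      by (rule Mod.M.finsum_cong'[OF refl]) (use hterm wm_closed ca act_closed gy tM in \<open>auto intro!: Mod.M.finsum_closed\<close>)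
    also have "\<dots> = (\<Oplus>\<^bsub>M\<^esub>a\<in>?q. \<Oplus>\<^bsub>M\<^esub>t\<in>gset. wm (c \<otimes>\<^bsub>W\<^esub> tch a) (act (g t (y a m)) t))"
      by (rule Mod.M.finsum_swap[OF gset(1) q(1)]) (use wm_closed ca act_closed gy tM in auto)
    also have "\<dots> = (\<Oplus>\<^bsub>M\<^esub>a\<in>?q. wm (c \<otimes>\<^bsub>W\<^esub> tch a) (F a))"
    proof (rule Mod.M.finsum_cong'[OF refl])
      fix a assume a: "a \<in> ?q"
      show "(\<Oplus>\<^bsub>M\<^esub>t\<in>gset. wm (c \<otimes>\<^bsub>W\<^esub> tch a) (act (g t (y a m)) t)) = wm (c \<otimes>\<^bsub>W\<^esub> tch a) (F a)"
        unfolding F_def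
        by (rule Mod.finsum_smult_ldistr[OF gset(1) const_closed[OF ca[OF a]], symmetric]) (use act_closed gy a tM in auto)
    qed (use wm_closed ca FM in auto)
    finally have sum: "(\<Oplus>\<^bsub>M\<^esub>t\<in>gset. tact (h t m) t) = (\<Oplus>\<^bsub>M\<^esub>a\<in>?q. wm (c \<otimes>\<^bsub>W\<^esub> tch a) (F a))" .
    have "\<exists>z\<in>carrier M. F a = y a m \<oplus>\<^bsub>M\<^esub> u z" if a: "a \<in> ?q" for a
    proof -
      note ya = y_closed[OF a m]
      obtain z where z: "z \<in> carrier M" "F a \<ominus>\<^bsub>M\<^esub> y a m = u z" using g_basis[OF ya] unfolding F_def U_def by blast
      have "F a = y a m \<oplus>\<^bsub>M\<^esub> (F a \<ominus>\<^bsub>M\<^esub> y a m)"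
        using FM[OF a] ya by (simp add: Mod.M.minus_eq Mod.M.a_lcomm Mod.M.r_neg)
      then show ?thesis unfolding z(2) using z(1) by blast
    qed
    then obtain z where z: "\<And>a. a \<in> ?q \<Longrightarrow> z a \<in> carrier M" "\<And>a. a \<in> ?q \<Longrightarrow> F a = y a m \<oplus>\<^bsub>M\<^esub> u (z a)" by metis
    let ?Z = "\<Oplus>\<^bsub>M\<^esub>a\<in>?q. wm (c \<otimes>\<^bsub>W\<^esub> tch a) (z a)"
    have czM: "a \<in> ?q \<Longrightarrow> wm (c \<otimes>\<^bsub>W\<^esub> tch a) (z a) \<in> carrier M" for a using wm_closed ca z(1) by blast
    have ZM: "?Z \<in> carrier M" using czM by (intro Mod.M.finsum_closed) auto
    have cm: "wm c m \<in> carrier M" by (rule wm_closed[OF c(1) m])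
    have "(\<Oplus>\<^bsub>M\<^esub>a\<in>?q. wm (c \<otimes>\<^bsub>W\<^esub> tch a) (F a)) = (\<Oplus>\<^bsub>M\<^esub>a\<in>?q. wm c m \<oplus>\<^bsub>M\<^esub> u (wm (c \<otimes>\<^bsub>W\<^esub> tch a) (z a)))"
    proof (rule Mod.M.finsum_cong'[OF refl])
      fix a assume a: "a \<in> ?q"
      note aW = tch_closed[OF q(2)[OF a]] and iW = tch_closed[OF q(3)[OF a]]
      have "wm (c \<otimes>\<^bsub>W\<^esub> tch a) (y a m) = wm c (wm (tch a \<otimes>\<^bsub>W\<^esub> tch (inv\<^bsub>k\<^esub> a)) m)"
        unfolding y_def using wm_mult[OF c(1) aW wm_closed[OF iW m]] wm_mult[OF aW iW m] by simp
      also have "\<dots> = wm c m" unfolding tch_mult[OF q(2)[OF a] q(3)[OF a]] q(4)[OF a] tch_one by (simp only: wm_one[OF m])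
      finally have "wm (c \<otimes>\<^bsub>W\<^esub> tch a) (y a m) = wm c m" .
      then show "wm (c \<otimes>\<^bsub>W\<^esub> tch a) (F a) = wm c m \<oplus>\<^bsub>M\<^esub> u (wm (c \<otimes>\<^bsub>W\<^esub> tch a) (z a))"
        unfolding z(2)[OF a] wm_add_right[OF ca[OF a] y_closed[OF a m] u_closed[OF z(1)[OF a]]] u_wm[OF ca[OF a] z(1)[OF a]] by simp
    qed (use cm czM u_closed in auto)
    also have "\<dots> = (\<Oplus>\<^bsub>M\<^esub>a\<in>?q. wm c m) \<oplus>\<^bsub>M\<^esub> (\<Oplus>\<^bsub>M\<^esub>a\<in>?q. u (wm (c \<otimes>\<^bsub>W\<^esub> tch a) (z a)))"
      by (rule Mod.M.finsum_addf) (use cm czM u_closed in auto)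
    also have "(\<Oplus>\<^bsub>M\<^esub>a\<in>?q. u (wm (c \<otimes>\<^bsub>W\<^esub> tch a) (z a))) = u ?Z"
      by (rule Mod.finsum_smult_ldistr[OF q(1) V_closed, symmetric]) (use czM in auto)
    also have "(\<Oplus>\<^bsub>M\<^esub>a\<in>?q. wm c m) = [card ?q] \<cdot>\<^bsub>M\<^esub> wm c m" by (rule Mod.M.add.finprod_const[OF cm])
    also have "\<dots> = wm (c \<otimes>\<^bsub>W\<^esub> nat_W (card ?q)) m"
      unfolding nat_times[OF cm] wm_comm[OF nat_W_closed c(1) m] wm_mult[OF c(1) nat_W_closed m] ..
    also have "\<dots> = m" unfolding c(2) by (rule wm_one[OF m])
    finally have s: "(\<Oplus>\<^bsub>M\<^esub>t\<in>gset. tact (h t m) t) = m \<oplus>\<^bsub>M\<^esub> u ?Z" unfolding sum .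
    have "u (\<ominus>\<^bsub>M\<^esub> ?Z) = \<ominus>\<^bsub>M\<^esub> u ?Z" by (rule Mod.smult_r_minus[OF V_closed ZM])
    then have "m = (\<Oplus>\<^bsub>M\<^esub>t\<in>gset. tact (h t m) t) \<oplus>\<^bsub>M\<^esub> u (\<ominus>\<^bsub>M\<^esub> ?Z)"
      unfolding s using m u_closed[OF ZM] by (simp add: Mod.M.a_assoc Mod.M.r_neg)
    then show ?thesis using ZM by blast
  qed
  have "projective_module (powser_ring TW) (with_smult (with_smult M tact) C.pact)"
  proof (rule C.projective_of_residual_dual_basis[OF gset(1), of h])
    show "gset \<subseteq> carrier (with_smult M tact)" using gset(2) by simp
    show "h t (u m) = \<zero>\<^bsub>TW\<^esub>" if "t \<in> gset" "m \<in> carrier (with_smult M tact)" for t m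
      using h_U that by (simp add: U_def)
    show "\<exists>d\<in>carrier (with_smult M tact). m = (\<Oplus>\<^bsub>with_smult M tact\<^esub>x\<in>gset. h x m \<odot>\<^bsub>with_smult M tact\<^esub> x) \<oplus>\<^bsub>with_smult M tact\<^esub> u d"
      if "m \<in> carrier (with_smult M tact)" for m
      using basis' that by simp
  qed (simp_all add: h_closed h_add h_tact)
  then show ?thesis by (simp add: with_smult_def)
qed

section \<open>Comparison with the given action and conclusion\<close>

text \<open>On the carrier the iterates of \<open>u\<close> are products with the powers of the
  variable; after this rewriting both definite descriptions read the same.\<close>

lemma coeff_kisin_act_eq:
  assumes f: "f \<in> carrier (powser_ring TW)" and x: "x \<in> carrier M"
  shows "coeff_kisin_act p k M act f x = complete_module.pact (with_smult M tact) u f x"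
proof -
  interpret C: complete_module TW "with_smult M tact" u by (rule complete_module)
  have pw: "(V [^]\<^bsub>S\<^esub> i) \<odot>\<^bsub>M\<^esub> m = (u ^^ i) m" if m: "m \<in> carrier M" for i :: nat and m
  proof (induct i)
    case 0
    then show ?case using m by simp
  next
    case (Suc i)
    note c = Mod.R.nat_pow_closed[OF V_closed, of i]
    have "(V [^]\<^bsub>S\<^esub> Suc i) \<odot>\<^bsub>M\<^esub> m = (V \<otimes>\<^bsub>S\<^esub> V [^]\<^bsub>S\<^esub> i) \<odot>\<^bsub>M\<^esub> m"
      unfolding Mod.R.m_comm[OF V_closed c] by simp
    also have "\<dots> = u ((u ^^ i) m)" unfolding Mod.smult_assoc1[OF V_closed c m] Suc ..
    finally show ?case by simp
  qed
  have fx: "tact (f i) x \<in> carrier M" for i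
    using f x by (intro tact_closed) (auto simp: powser_ring_simps(1) Pi_iff)
  have sum: "(\<Oplus>\<^bsub>M\<^esub>i\<in>{..<n}. (V [^]\<^bsub>S\<^esub> i) \<odot>\<^bsub>M\<^esub> tact (f i) x) = (\<Oplus>\<^bsub>M\<^esub>i\<in>{..<n}. (u ^^ i) (tact (f i) x))" for n :: nat
    by (rule Mod.M.finsum_cong'[OF refl _ pw[OF fx]]) (use u_pow_closed fx in auto)
  have ex: "(\<exists>z\<in>carrier M. y = a \<oplus>\<^bsub>M\<^esub> (V [^]\<^bsub>S\<^esub> n) \<odot>\<^bsub>M\<^esub> z) \<longleftrightarrow> (\<exists>z\<in>carrier M. y = a \<oplus>\<^bsub>M\<^esub> (u ^^ n) z)" for y a and n :: nat
    by (rule bex_cong[OF refl]) (simp only: pw)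
  show ?thesis
    unfolding coeff_kisin_act_def kisin_ring_def Let_def C.pact_def C.pact_spec_def sum ex by simp
qed

end

text \<open>The two actions are only known to agree on carriers, so the module records may differ,
  while projectivity depends on the action on carriers.\<close>

lemma projective_module_smult_cong:
  fixes M :: "('m, 'y) ring_scheme"
  assumes "projective_module A (with_smult M a)"
    and eq: "\<And>f x. f \<in> carrier A \<Longrightarrow> x \<in> carrier M \<Longrightarrow> a' f x = a f x"
  shows "projective_module A (with_smult M a')"
proof -
  obtain I :: "'m set" and s q where mod: "module A (with_smult M a)"
    and s: "s \<in> linear_maps A (with_smult M a) (free_module A I)"
    and q: "q \<in> linear_maps A (free_module A I) (with_smult M a)"
    and qs: "\<forall>x\<in>carrier (with_smult M a). q (s x) = x"
    using assms(1) unfolding projective_module_def by (elim conjE exE) (rule that, assumption+)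
  interpret A: module A "with_smult M a" by (rule mod)
  have ag: "abelian_group (with_smult M a')"
    using A.M.abelian_group_axioms by (simp add: with_smult_def abelian_group_def abelian_monoid_def abelian_group_axioms_def)
  have "module A (with_smult M a')"
    by (rule moduleI[OF A.R.is_cring ag])
      (use A.smult_closed A.smult_l_distr A.smult_r_distr A.smult_assoc1 A.smult_one A.M.a_closed in \<open>simp_all add: eq\<close>)
  moreover have "s \<in> linear_maps A (with_smult M a') (free_module A I)"
    using s by (simp add: linear_maps_def eq)
  moreover have "q \<in> linear_maps A (free_module A I) (with_smult M a')"
    using q by (auto simp add: linear_maps_def eq Pi_iff)
  ultimately show ?thesis using qs unfolding projective_module_def by auto
qed

theorem theorem2p9:
  fixes p h :: nat
    and K :: "'k ring" and \<iota> :: "(nat \<Rightarrow> int) \<Rightarrow> 'k" and \<pi> :: 'k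
    and \<kappa> :: "'k set ring"
    and R :: "(nat \<Rightarrow> int, 'r) module"
    and M :: "(nat \<Rightarrow> nat \<Rightarrow> 'k set, 'm) module"
    and \<phi> :: "'m \<Rightarrow> 'm" and act :: "'r \<Rightarrow> 'm \<Rightarrow> 'm"
  assumes "normalization_semidom_class.prime p"
    and "finite_extension_of_Qp p K \<iota>"
    and "uniformizer p K \<iota> \<pi>"
    and "\<kappa> = residue_field p K \<iota> \<pi>"
    and "algebra (padic_ints p) R"
    and "\<And>N :: ('r, (nat \<Rightarrow> 'r) set) module.
           module R N \<Longrightarrow> finitely_generated R N \<Longrightarrow> torsion_free_wrt p N \<Longrightarrow> projective_module R N"
    and "h > 0"
    and "breuil_kisin_module p \<kappa> (eisenstein_poly p K \<iota> \<pi>) h M \<phi>"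
    and "coefficient_action p \<kappa> R M \<phi> act"
  shows "projective_module (coeff_kisin_ring p \<kappa> R) (coeff_kisin_module p \<kappa> M act)"
proof -
  have K: "field K" using assms(2) by (simp add: finite_extension_of_Qp_def)
  interpret E: padic_extension p K \<iota> \<pi>
    by (intro padic_extension.intro padic_extension_axioms.intro K assms(1-3))
  have kf: "field \<kappa>" and char: "[p] \<cdot>\<^bsub>\<kappa>\<^esub> \<one>\<^bsub>\<kappa>\<^esub> = \<zero>\<^bsub>\<kappa>\<^esub>" and fin: "finite (carrier \<kappa>)"
    using E.field_residue E.residue_char E.finite_residue unfolding assms(4) .
  interpret k: field \<kappa> by (rule kf)
  note bk = assms(8)[unfolded breuil_kisin_module_def kisin_ring_def]
  have mod: "module (powser_ring (witt_ring p \<kappa>)) M" by (rule conjunct1[OF bk])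
  have free: "finite_free (powser_ring (witt_ring p \<kappa>)) M" by (rule conjunct1[OF conjunct2[OF bk]])
  \<comment> \<open>The ring laws of Witt vectors are taken from \<open>M\<close>: its scalars, the
    power series over \<open>witt_ring p \<kappa>\<close>, form a commutative ring.\<close>
  have "cring (witt_ring p \<kappa>)"
  proof (rule cring_of_powser)
    show "cring (powser_ring (witt_ring p \<kappa>))" using mod by (simp add: module_def)
    show "x \<oplus>\<^bsub>witt_ring p \<kappa>\<^esub> y \<in> carrier (witt_ring p \<kappa>)" "x \<otimes>\<^bsub>witt_ring p \<kappa>\<^esub> y \<in> carrier (witt_ring p \<kappa>)"
      if "x \<in> carrier (witt_ring p \<kappa>)" "y \<in> carrier (witt_ring p \<kappa>)" for x y
      by (rule witt_closed[OF assms(1) k.is_cring that])+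
  qed (simp_all add: witt_ring_simps)
  then interpret finite_witt p \<kappa>
    by (intro finite_witt.intro finite_witt_axioms.intro kf assms(1) char fin)
  note ca = assms(9)[unfolded coefficient_action_def kisin_ring_def]
  interpret kisin_action p \<kappa> R M act
  proof (intro kisin_action.intro kisin_action_axioms.intro finite_witt_axioms assms(5) mod free)
    show "module R (with_smult M act)" by (rule conjunct1[OF ca])
    show "act r (s \<odot>\<^bsub>M\<^esub> m) = s \<odot>\<^bsub>M\<^esub> act r m"
      if "r \<in> carrier R" "s \<in> carrier (powser_ring (witt_ring p \<kappa>))" "m \<in> carrier M" for r s m
      by (rule bspec[OF bspec[OF bspec[OF conjunct1[OF conjunct2[OF ca]] that(1)] that(2)] that(3)])
    show "act (z \<odot>\<^bsub>R\<^esub> r) m = powser_const (witt_ring p \<kappa>) (padic_to_witt p \<kappa> z) \<odot>\<^bsub>M\<^esub> act r m"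
      if "z \<in> carrier (padic_ints p)" "r \<in> carrier R" "m \<in> carrier M" for z r m
      by (rule bspec[OF bspec[OF bspec[OF conjunct2[OF conjunct2[OF conjunct2[OF ca]]] that(1)] that(2)] that(3)])
  qed
  show ?thesis
    unfolding coeff_kisin_ring_def coeff_kisin_module_def
    by (rule projective_module_smult_cong[OF projective[OF assms(6)] coeff_kisin_act_eq])
qed

end
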